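(* Let $(\tau_1,\tau_2,\tau_3)=(1,0,0)$ and assume $\chi:=k_3-k_2\neq 0$, i.e. $k_2\neq k_3$. Let $N,\ell$ be positive integers with $\ell\le N$, let $U_0\in H^N(\mathbb{R})\cap L^1(\mathbb{R})$, and let $U$ be a solution of the Cauchy problem (S) (described in the context) with initial datum $U_0$. Then, for any $j\in\{0,\dots,N-\ell\}$, there exists $c_0>0$ such that the following holds. If $\epsilon_0=1$, then $$\|\partial_x^jU(\cdot,t)\|_{L^2(\mathbb{R})}\le c_0(1+t)^{-1/12-j/6}\|U_0\|_{L^1(\mathbb{R})}+c_0(1+t)^{-\ell/2}\|\partial_x^{j+\ell}U_0\|_{L^2(\mathbb{R})},\qquad\forall t\ge 0.$$ If $\epsilon_0=0$, then $$\|\partial_x^jU(\cdot,t)\|_{L^2(\mathbb{R})}\le c_0(1+t)^{-1/8-j/4}\|U_0\|_{L^1(\mathbb{R})}+c_0(1+t)^{-\ell/2}\|\partial_x^{j+\ell}U_0\|_{L^2(\mathbb{R})},\qquad\forall t\ge 0.$$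
   Context: Constants: $k_1,k_2,k_3,k_4,k_5>0$, $\gamma\in\mathbb{R}\setminus\{0\}$, $(\tau_1,\tau_2,\tau_3)\in\{(1,0,0),(0,1,0),(0,0,1)\}$, $\epsilon_0\in\{0,1\}$. Cauchy problem (S): for $x\in\mathbb{R}$, $t>0$, the unknown is $U=(v,u,z,y,\phi,\theta,\sigma,\eta)^T$, with $U(\cdot,0)=U_0$ and $$\begin{cases} v_t-u_x-y-\theta=0,\\ u_t-k_1v_x+\tau_1\gamma\eta_x=0,\\ z_t-y_x=0,\\ y_t-k_2z_x+k_1v+\tau_2\gamma\eta_x=0,\\ \phi_t-\theta_x=0,\\ \theta_t-k_3\phi_x+k_1v+\tau_3\gamma\eta_x=0,\\ \sigma_t-\eta_x=0,\\ \eta_t-k_4\sigma_x+(-1)^{\epsilon_0}k_5\partial_x^{2\epsilon_0}\eta+\gamma(\tau_1u_x+\tau_2y_x+\tau_3\theta_x)=0. \end{cases}$$ So the dissipation term is $-k_5\eta_{xx}$ if $\epsilon_0=1$ and $k_5\eta$ if $\epsilon_0=0$. (It arises from a laminated Timoshenko beam $(\varphi,\psi,w)$ coupled to a temperature variable $q$ by $u=\varphi_t$, $y=\psi_t$, $\theta=w_t$, $\eta=q_t$, $v=\varphi_x+\psi+w$, $z=\psi_x$, $\phi=w_x$, $\sigma=q_x$.) Taking the Fourier transform $\widehat{\cdot}$ in $x$ (so $\partial_x$ becomes multiplication by $i\xi$), (S) becomes for each $\xi\in\mathbb{R}$ a linear constant-coefficient ODE system $\widehat U_t(\xi,t)=A(\xi)\widehat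 U(\xi,t)$ in $\mathbb{C}^8$, and the solution $U$ of (S) is the one given by $\widehat U(\xi,t)=e^{tA(\xi)}\widehat U_0(\xi)$. Norms of vector-valued functions are the usual ones (built from the Euclidean norm on $\mathbb{C}^8$). *)

theory Defs
  imports "HOL-Analysis.Analysis"
begin

section \<open>Function spaces on the real line\<close>

definition L1 :: "(real \<Rightarrow> 'a::euclidean_space) set"
  where "L1 = {f. integrable lborel f}"

definition L1_norm :: "(real \<Rightarrow> 'a::euclidean_space) \<Rightarrow> real"
  where "L1_norm f = (LINT x|lborel. norm (f x))"

definition L2 :: "(real \<Rightarrow> 'a::euclidean_space) set"
  where "L2 = {f. f \<in> borel_measurable lborel \<and> integrable lborel (\<lambda>x. (norm (f x))\<^sup>2)}"

text \<open>Meaningful only on \<^term>\<open>L2\<close>: the Bochner integral of a non-integrable function is 0.\<close>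

definition L2_norm :: "(real \<Rightarrow> 'a::euclidean_space) \<Rightarrow> real"
  where "L2_norm f = sqrt (LINT x|lborel. (norm (f x))\<^sup>2)"

definition locally_integrable :: "(real \<Rightarrow> 'a::euclidean_space) \<Rightarrow> bool"
  where "locally_integrable f \<longleftrightarrow>
    f \<in> borel_measurable lborel \<and> (\<forall>R. set_integrable lborel {-R..R} f)"

definition test_function :: "(real \<Rightarrow> real) \<Rightarrow> bool"
  where "test_function p \<longleftrightarrow>
    (\<forall>n x. (deriv ^^ n) p field_differentiable (at x)) \<and> bounded {x. p x \<noteq> 0}"

definition has_weak_deriv ::
    "nat \<Rightarrow> (real \<Rightarrow> 'a::euclidean_space) \<Rightarrow> (real \<Rightarrow> 'a) \<Rightarrow> bool"
  where "has_weak_deriv k f g \<longleftrightarrow>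
    locally_integrable f \<and> locally_integrable g \<and>
    (\<forall>p. test_function p \<longrightarrow>
      (LINT x|lborel. (deriv ^^ k) p x *\<^sub>R f x) = (-1) ^ k *\<^sub>R (LINT x|lborel. p x *\<^sub>R g x))"

text \<open>The weak derivative is unique only up to null sets; \<^const>\<open>Eps\<close> selects a representative,
  which is immaterial for its norm.\<close>

definition weak_deriv :: "nat \<Rightarrow> (real \<Rightarrow> 'a::euclidean_space) \<Rightarrow> real \<Rightarrow> 'a"
  where "weak_deriv k f = (SOME g. has_weak_deriv k f g)"

definition sobolev_H :: "nat \<Rightarrow> (real \<Rightarrow> 'a::euclidean_space) set"
  where "sobolev_H N = {f. f \<in> L2 \<and> (\<forall>k\<le>N. \<exists>g\<in>L2. has_weak_deriv k f g)}"

section \<open>Fourier transform on \<open>L\<^sup>2\<close>\<close>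

text \<open>\<open>g\<close> is (a representative of) the Fourier--Plancherel transform of \<open>f\<close>: the transforms
  \<open>\<integral>\<^bsub>-R\<^esub>\<^bsup>R\<^esup> exp (- \<i> x \<xi>) f x dx\<close> of the truncations of \<open>f\<close> converge to \<open>g\<close> in \<open>L\<^sup>2\<close>. The convergence is
  stated with the nonnegative integral, so that a divergent integral does not count as 0.
  On \<open>L\<^sup>1 \<inter> L\<^sup>2\<close> this is, almost everywhere, the classical Fourier integral.\<close>

definition has_fourier :: "(real \<Rightarrow> complex^'n) \<Rightarrow> (real \<Rightarrow> complex^'n) \<Rightarrow> bool"
  where "has_fourier f g \<longleftrightarrow> f \<in> L2 \<and> g \<in> L2 \<and>
    ((\<lambda>R. \<integral>\<^sup>+\<xi>. ennreal ((norm (g \<xi> -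
        (LINT x:{-R..R}|lborel. cis (- (x * \<xi>)) *s f x)))\<^sup>2) \<partial>lborel) \<longlongrightarrow> 0) at_top"

section \<open>The laminated beam system\<close>

definition mat_exp :: "complex^'n^'n \<Rightarrow> complex^'n^'n"
  where "mat_exp A = (\<Sum>n. (1 / fact n) *\<^sub>R (((**) A) ^^ n) (mat 1))"

text \<open>The matrix \<open>A(\<xi>)\<close> of the Fourier-transformed system, the unknowns being ordered as
  \<open>(v, u, z, y, \<phi>, \<theta>, \<sigma>, \<eta>)\<close>; \<open>s\<close> below is the symbol \<open>\<i>\<xi>\<close> of the space derivative. The
  system can be read off from the lemma \<open>beam_matrix_mult\<close>.\<close>

definition beam_matrix ::
    "real \<Rightarrow> real \<Rightarrow> real \<Rightarrow> real \<Rightarrow> real \<Rightarrow> real \<Rightarrow> real \<Rightarrow> real \<Rightarrow> real \<Rightarrow> nat \<Rightarrow> real \<Rightarrow> complex^8^8"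
  where "beam_matrix k1 k2 k3 k4 k5 \<gamma> \<tau>1 \<tau>2 \<tau>3 \<epsilon>0 \<xi> =
    (let s = \<i> * complex_of_real \<xi> in
     vector
      [vector [0, s, 0, 1, 0, 1, 0, 0],
       vector [k1 * s, 0, 0, 0, 0, 0, 0, - (\<tau>1 * \<gamma> * s)],
       vector [0, 0, 0, s, 0, 0, 0, 0],
       vector [- k1, 0, k2 * s, 0, 0, 0, 0, - (\<tau>2 * \<gamma> * s)],
       vector [0, 0, 0, 0, 0, s, 0, 0],
       vector [- k1, 0, 0, 0, k3 * s, 0, 0, - (\<tau>3 * \<gamma> * s)],
       vector [0, 0, 0, 0, 0, 0, 0, s],
       vector [0, - (\<gamma> * \<tau>1 * s), 0, - (\<gamma> * \<tau>2 * s), 0, - (\<gamma> * \<tau>3 * s), k4 * s,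
               - ((-1) ^ \<epsilon>0 * k5 * s ^ (2 * \<epsilon>0))]])"

lemma exhaust_8:
  fixes x :: 8
  shows "x = 1 \<or> x = 2 \<or> x = 3 \<or> x = 4 \<or> x = 5 \<or> x = 6 \<or> x = 7 \<or> x = 8"
proof (induct x)
  case (of_int z)
  then have "0 \<le> z" "z < 8" by simp_all
  then have "z = 0 \<or> z = 1 \<or> z = 2 \<or> z = 3 \<or> z = 4 \<or> z = 5 \<or> z = 6 \<or> z = 7"
    by linarith
  then show ?case by auto
qed

lemma UNIV_8: "(UNIV :: 8 set) = {1, 2, 3, 4, 5, 6, 7, 8}"
  using exhaust_8 by auto

lemma sum_8: "sum f (UNIV :: 8 set) = f 1 + f 2 + f 3 + f 4 + f 5 + f 6 + f 7 + f 8"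
  unfolding UNIV_8 by (simp add: ac_simps)

lemma vector_8:
  fixes a b c d e f g h :: "'a::zero"
  shows
  "(vector [a,b,c,d,e,f,g,h] :: 'a^8) $ 1 = a"
  "(vector [a,b,c,d,e,f,g,h] :: 'a^8) $ 2 = b"
  "(vector [a,b,c,d,e,f,g,h] :: 'a^8) $ 3 = c"
  "(vector [a,b,c,d,e,f,g,h] :: 'a^8) $ 4 = d"
  "(vector [a,b,c,d,e,f,g,h] :: 'a^8) $ 5 = e"
  "(vector [a,b,c,d,e,f,g,h] :: 'a^8) $ 6 = f"
  "(vector [a,b,c,d,e,f,g,h] :: 'a^8) $ 7 = g"
  "(vector [a,b,c,d,e,f,g,h] :: 'a^8) $ 8 = h"
  by (simp_all add: vector_def)

lemma beam_matrix_mult: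
  fixes X :: "complex^8" and \<xi> :: real
  defines "s \<equiv> \<i> * complex_of_real \<xi>"
  defines "v \<equiv> X $ 1" and "u \<equiv> X $ 2" and "z \<equiv> X $ 3" and "y \<equiv> X $ 4"
    and "\<phi> \<equiv> X $ 5" and "\<theta> \<equiv> X $ 6" and "\<sigma> \<equiv> X $ 7" and "\<eta> \<equiv> X $ 8"
  assumes "X' = beam_matrix k1 k2 k3 k4 k5 \<gamma> \<tau>1 \<tau>2 \<tau>3 \<epsilon>0 \<xi> *v X"
  shows
    "X' $ 1 - s * u - y - \<theta> = 0"
    "X' $ 2 - k1 * (s * v) + \<tau>1 * \<gamma> * (s * \<eta>) = 0"
    "X' $ 3 - s * y = 0"
    "X' $ 4 - k2 * (s * z) + k1 * v + \<tau>2 * \<gamma> * (s * \<eta>) = 0"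
    "X' $ 5 - s * \<theta> = 0"
    "X' $ 6 - k3 * (s * \<phi>) + k1 * v + \<tau>3 * \<gamma> * (s * \<eta>) = 0"
    "X' $ 7 - s * \<eta> = 0"
    "X' $ 8 - k4 * (s * \<sigma>) + (-1) ^ \<epsilon>0 * k5 * (s ^ (2 * \<epsilon>0) * \<eta>)
       + \<gamma> * (\<tau>1 * (s * u) + \<tau>2 * (s * y) + \<tau>3 * (s * \<theta>)) = 0"
  by (simp_all only: assms beam_matrix_def Let_def matrix_vector_mult_def vec_lambda_beta
      vector_8 sum_8) (simp_all add: ring_distribs)

text \<open>\<open>U x t\<close> solves the Cauchy problem \<open>U\<^sub>t = A(\<partial>\<^sub>x) U\<close>, \<open>U(\<cdot>, 0) = U0\<close>, for the family of
  symbols \<open>A \<xi>\<close>: its Fourier transform in \<open>x\<close> is \<open>exp (t A(\<xi>))\<close> applied to that of \<open>U0\<close>.\<close>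

definition solves_cauchy ::
    "(real \<Rightarrow> complex^'n^'n) \<Rightarrow> (real \<Rightarrow> complex^'n) \<Rightarrow> (real \<Rightarrow> real \<Rightarrow> complex^'n) \<Rightarrow> bool"
  where "solves_cauchy A U0 U \<longleftrightarrow>
    (\<exists>F0. has_fourier U0 F0 \<and>
      (\<forall>t\<ge>0. has_fourier (\<lambda>x. U x t) (\<lambda>\<xi>. mat_exp (t *\<^sub>R A \<xi>) *v F0 \<xi>)))"

end

theory Submission
  imports Defs "HOL-Probability.Probability"
begin

text \<open>
  After a Fourier transform the solution is \<open>exp (t A(\<xi>))\<close> applied to the transformed datum. The
  dissipation acts on \<open>\<eta>\<close> only; for fixed \<open>\<xi>\<close> the couplings pass it on from \<open>\<eta>\<close> to one combination of
  the unknowns after the other, each step being realised by a quadratic multiplier. Adding small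
  multiples of these multipliers to the energy gives a Lyapunov function. Among the combinations are
  \<open>k\<^sub>2 z + k\<^sub>3 \<phi>\<close> and \<open>k\<^sub>2\<^sup>2 z + k\<^sub>3\<^sup>2 \<phi>\<close>, which determine \<open>z\<close> and \<open>\<phi>\<close> because \<open>k\<^sub>2 \<noteq> k\<^sub>3\<close>, and counting the powers of \<open>\<xi>\<close> lost
  on the way yields \<open>|exp (t A(\<xi>)) x|\<^sup>2 \<le> C exp (- c \<rho>(\<xi>) t) |x|\<^sup>2\<close> with \<open>\<rho>(\<xi>) = |\<xi>|\<^bsup>4+2\<epsilon>\<^esup>\<close> for \<open>|\<xi>| \<le> 1\<close> and
  \<open>\<rho>(\<xi>) = \<xi>\<^bsup>-2\<^esup>\<close> for \<open>|\<xi>| > 1\<close>.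

  For low frequencies the transform of the datum is bounded by its \<open>L\<^sup>1\<close> norm and a rescaling of \<open>\<xi>\<close>
  gives the power of \<open>t\<close>; for high frequencies \<open>exp (- c t / \<xi>\<^sup>2)\<close> is at most a multiple of
  \<open>(1 + t)\<^bsup>-l\<^esup> \<xi>\<^bsup>2l\<^esup>\<close>, which costs \<open>l\<close> derivatives. Of Plancherel's theorem only the two inequalities
  between \<open>\<integral>|f|\<^sup>2\<close> and \<open>\<integral>|F|\<^sup>2\<close> are needed; the transform on \<open>L\<^sup>2\<close> is
  characterised by the multiplication formula \<open>\<integral> F q = \<integral> f (ft q)\<close>.\<close>

section \<open>Dissipation along linear flows\<close>

text \<open>What makes the chain delicate is the cross term: passing dissipation from
  \<open>f\<close> to \<open>g\<close> differentiates \<open>g\<close> as well, and that derivative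
  contains unknowns further down the chain. All steps are therefore measured against one fixed total
  \<open>T\<close>, of which each may spend an arbitrarily small share. The weights in
  \<open>T\<close> decide the rate. For |\<xi>| \<ge> 1 the derivative of \<open>Q\<close> contains
  \<xi>^2 v and \<xi>^2 \<eta>, and compensating for this costs the factor \<xi>^(-2). For |\<xi>|
  \<le> 1 the obstacle is the term - 2 k1 v of order zero in the same derivative; used directly it
  would cost two more powers of |\<xi>| in the squares, and modified combinations avoid that. The
  power |\<xi>|^(2\<epsilon>) enters once, because the energy dissipates only that multiple of
  |\<eta>|^2.

  With m = 4 + 2\<epsilon> the square root of (1 + t)^(-(2j+1)/m) has the exponents -1/12 - j/6 and
  -1/8 - j/4. The weak derivatives of \<open>U\<close> at time t are not given; their existence must
  be deduced from the transform, which requires passing from weak derivatives to the Fourier side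
  and back.\<close>

definition flow_solution :: "complex^'n^'n \<Rightarrow> (real \<Rightarrow> complex^'n) \<Rightarrow> bool"
  where "flow_solution A X \<longleftrightarrow> (\<forall>t. (X has_vector_derivative A *v X t) (at t))"

text \<open>Gronwall's argument only looks at trajectories, so the derivative is required just
  there. That \<open>\<Phi>'\<close> is a function of the current state lets inequalities between it
  and other quantities be checked pointwise.\<close>

definition lie_derivative ::
    "complex^'n^'n \<Rightarrow> (complex^'n \<Rightarrow> real) \<Rightarrow> (complex^'n \<Rightarrow> real) \<Rightarrow> bool"
  where "lie_derivative A \<Phi> \<Phi>' \<longleftrightarrow>
    (\<forall>X t. flow_solution A X \<longrightarrow> ((\<lambda>t. \<Phi> (X t)) has_real_derivative \<Phi>' (X t)) (at t))"

lemma lie_derivative_add: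
  "lie_derivative A \<Phi> \<Phi>' \<Longrightarrow> lie_derivative A \<Psi> \<Psi>' \<Longrightarrow>
    lie_derivative A (\<lambda>x. \<Phi> x + \<Psi> x) (\<lambda>x. \<Phi>' x + \<Psi>' x)"
  unfolding lie_derivative_def by (auto intro!: DERIV_add)

lemma lie_derivative_cmult:
  "lie_derivative A \<Phi> \<Phi>' \<Longrightarrow> lie_derivative A (\<lambda>x. c * \<Phi> x) (\<lambda>x. c * \<Phi>' x)"
  unfolding lie_derivative_def by (auto intro!: DERIV_cmult)

lemma lie_derivative_inner:
  fixes f g :: "complex^'n \<Rightarrow> complex"
  assumes f: "linear f" and g: "linear g"
  shows "lie_derivative A (\<lambda>x. g x \<bullet> f x) (\<lambda>x. g x \<bullet> f (A *v x) + g (A *v x) \<bullet> f x)"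
  unfolding lie_derivative_def
proof (intro allI impI)
  fix X t assume X: "flow_solution A X"
  have D: "(X has_vector_derivative A *v X t) (at t)" for t
    using X unfolding flow_solution_def by blast
  have 1: "((\<lambda>t. f (X t)) has_vector_derivative f (A *v X t)) (at t)"
    by (rule bounded_linear.has_vector_derivative[OF _ D])
      (use f linear_conv_bounded_linear in blast)
  have 2: "((\<lambda>t. g (X t)) has_vector_derivative g (A *v X t)) (at t)"
    by (rule bounded_linear.has_vector_derivative[OF _ D])
      (use g linear_conv_bounded_linear in blast)
  show "((\<lambda>t. g (X t) \<bullet> f (X t)) has_real_derivative
      g (X t) \<bullet> f (A *v X t) + g (A *v X t) \<bullet> f (X t)) (at t)"
    unfolding has_real_derivative_iff_has_vector_derivative
    by (rule bounded_bilinear.has_vector_derivative[OF bounded_bilinear_inner 2 1])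
qed

text \<open>\<open>T\<close> is the total still to be absorbed, \<open>N\<close> the dissipation
  that is directly observed, \<open>q\<close> the quantity gained. The constant \<open>K\<close> is
  the same for all frequencies in \<open>S\<close>, although the form may change with \<xi>. It
  serves twice: it keeps the form comparable to |x|^2, and it is the price paid in
  \<open>N\<close>.\<close>

definition dissipates ::
    "(real \<Rightarrow> complex^'n^'n) \<Rightarrow> real set \<Rightarrow> (real \<Rightarrow> complex^'n \<Rightarrow> real) \<Rightarrow>
      (real \<Rightarrow> complex^'n \<Rightarrow> real) \<Rightarrow> (real \<Rightarrow> complex^'n \<Rightarrow> real) \<Rightarrow> real \<Rightarrow>
      (real \<Rightarrow> complex^'n \<Rightarrow> real) \<Rightarrow> (real \<Rightarrow> complex^'n \<Rightarrow> real) \<Rightarrow> real \<Rightarrow> bool"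
  where "dissipates A S T N q \<delta> \<Phi> \<Phi>' K \<longleftrightarrow>
    0 \<le> K \<and> (\<forall>\<xi>\<in>S. lie_derivative (A \<xi>) (\<Phi> \<xi>) (\<Phi>' \<xi>) \<and>
      (\<forall>x. \<bar>\<Phi> \<xi> x\<bar> \<le> K * (norm x)\<^sup>2 \<and> \<Phi>' \<xi> x + q \<xi> x \<le> \<delta> * T \<xi> x + K * N \<xi> x))"

text \<open>The estimates are not iterated with explicit constants: \<open>q\<close> counts as dissipated if some
  quadratic form dissipates it up to the observed quantity \<open>N\<close> and an arbitrarily small multiple of
  the total \<open>T\<close>, which is absorbed only at the very end.\<close>

definition dissipated ::
    "(real \<Rightarrow> complex^'n^'n) \<Rightarrow> real set \<Rightarrow> (real \<Rightarrow> complex^'n \<Rightarrow> real) \<Rightarrow>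
      (real \<Rightarrow> complex^'n \<Rightarrow> real) \<Rightarrow> (real \<Rightarrow> complex^'n \<Rightarrow> real) \<Rightarrow> bool"
  where "dissipated A S T N q \<longleftrightarrow> (\<forall>\<delta>>0. \<exists>\<Phi> \<Phi>' K. dissipates A S T N q \<delta> \<Phi> \<Phi>' K)"

lemma dissipatesD:
  assumes "dissipates A S T N q \<delta> \<Phi> \<Phi>' K"
  shows "0 \<le> K" "\<And>\<xi>. \<xi> \<in> S \<Longrightarrow> lie_derivative (A \<xi>) (\<Phi> \<xi>) (\<Phi>' \<xi>)"
    "\<And>\<xi> x. \<xi> \<in> S \<Longrightarrow> \<bar>\<Phi> \<xi> x\<bar> \<le> K * (norm x)\<^sup>2"
    "\<And>\<xi> x. \<xi> \<in> S \<Longrightarrow> \<Phi>' \<xi> x + q \<xi> x \<le> \<delta> * T \<xi> x + K * N \<xi> x"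
  using assms unfolding dissipates_def by blast+

lemma dissipatedE:
  assumes "dissipated A S T N q" "0 < \<delta>"
  obtains \<Phi> \<Phi>' K where "dissipates A S T N q \<delta> \<Phi> \<Phi>' K"
  using assms unfolding dissipated_def by blast

text \<open>Start of every chain: the zero form already works, with \<open>K = 1\<close>.\<close>

lemma dissipated_observed:
  assumes "\<And>\<xi> x. 0 \<le> T \<xi> x"
  shows "dissipated A S T N N"
  unfolding dissipated_def
proof (intro allI impI)
  fix \<delta> :: real assume "\<delta> > 0"
  then have "dissipates A S T N N \<delta> (\<lambda>_ _. 0) (\<lambda>_ _. 0) 1"
    using assms by (auto simp: dissipates_def lie_derivative_def)
  then show "\<exists>\<Phi> \<Phi>' K. dissipates A S T N N \<delta> \<Phi> \<Phi>' K" by blast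
qed

lemma dissipated_add:
  assumes "dissipated A S T N q" "dissipated A S T N q'"
  shows "dissipated A S T N (\<lambda>\<xi> x. q \<xi> x + q' \<xi> x)"
  unfolding dissipated_def
proof (intro allI impI)
  fix \<delta> :: real assume d: "\<delta> > 0"
  then have d2: "\<delta>/2 > 0" by simp
  obtain \<Phi> \<Phi>' K where "dissipates A S T N q (\<delta>/2) \<Phi> \<Phi>' K"
    using dissipatedE[OF assms(1) d2] .
  note 1 = dissipatesD[OF this]
  obtain \<Psi> \<Psi>' L where "dissipates A S T N q' (\<delta>/2) \<Psi> \<Psi>' L"
    using dissipatedE[OF assms(2) d2] .
  note 2 = dissipatesD[OF this]
  have "dissipates A S T N (\<lambda>\<xi> x. q \<xi> x + q' \<xi> x) \<delta>
    (\<lambda>\<xi> x. \<Phi> \<xi> x + \<Psi> \<xi> x) (\<lambda>\<xi> x. \<Phi>' \<xi> x + \<Psi>' \<xi> x) (K + L)"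
    unfolding dissipates_def
  proof (intro conjI ballI allI)
    fix \<xi> x assume "\<xi> \<in> S"
    then show "\<bar>\<Phi> \<xi> x + \<Psi> \<xi> x\<bar> \<le> (K + L) * (norm x)\<^sup>2"
      using 1(3)[of \<xi> x] 2(3)[of \<xi> x] abs_triangle_ineq[of "\<Phi> \<xi> x" "\<Psi> \<xi> x"]
      by (simp add: distrib_right)
  next
    fix \<xi> x assume "\<xi> \<in> S"
    then have "\<Phi>' \<xi> x + q \<xi> x \<le> \<delta>/2 * T \<xi> x + K * N \<xi> x"
      "\<Psi>' \<xi> x + q' \<xi> x \<le> \<delta>/2 * T \<xi> x + L * N \<xi> x"
      using 1(4) 2(4) by blast+
    then show "\<Phi>' \<xi> x + \<Psi>' \<xi> x + (q \<xi> x + q' \<xi> x) \<le> \<delta> * T \<xi> x + (K + L) * N \<xi> x"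
      by (simp add: distrib_right)
  next
    fix \<xi> assume "\<xi> \<in> S"
    then have "lie_derivative (A \<xi>) (\<Phi> \<xi>) (\<Phi>' \<xi>)" "lie_derivative (A \<xi>) (\<Psi> \<xi>) (\<Psi>' \<xi>)"
      using 1(2) 2(2) by blast+
    then show "lie_derivative (A \<xi>) (\<lambda>x. \<Phi> \<xi> x + \<Psi> \<xi> x) (\<lambda>x. \<Phi>' \<xi> x + \<Psi>' \<xi> x)"
      by (rule lie_derivative_add)
  qed (use 1(1) 2(1) in simp)
  then show "\<exists>\<Phi> \<Phi>' K. dissipates A S T N (\<lambda>\<xi> x. q \<xi> x + q' \<xi> x) \<delta> \<Phi> \<Phi>' K" by blast
qed

lemma dissipated_mono:
  assumes q: "dissipated A S T N q" and M: "0 < M"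
    and le: "\<And>\<xi> x. \<xi> \<in> S \<Longrightarrow> q' \<xi> x \<le> M * q \<xi> x"
  shows "dissipated A S T N q'"
  unfolding dissipated_def
proof (intro allI impI)
  fix \<delta> :: real assume d: "\<delta> > 0"
  \<comment> \<open>Scaling the form by \<open>M\<close> scales the tolerance as well, so it is
    divided beforehand.\<close>
  then have d2: "\<delta>/M > 0" using M by simp
  obtain \<Phi> \<Phi>' K where "dissipates A S T N q (\<delta>/M) \<Phi> \<Phi>' K"
    using dissipatedE[OF q d2] .
  note 1 = dissipatesD[OF this]
  have "dissipates A S T N q' \<delta> (\<lambda>\<xi> x. M * \<Phi> \<xi> x) (\<lambda>\<xi> x. M * \<Phi>' \<xi> x) (M * K)"
    unfolding dissipates_def
  proof (intro conjI ballI allI)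
    fix \<xi> x assume "\<xi> \<in> S"
    then show "\<bar>M * \<Phi> \<xi> x\<bar> \<le> M * K * (norm x)\<^sup>2"
      using 1(3)[of \<xi> x] M by (simp add: abs_mult mult.assoc)
  next
    fix \<xi> x assume S: "\<xi> \<in> S"
    then have "M * (\<Phi>' \<xi> x + q \<xi> x) \<le> M * (\<delta>/M * T \<xi> x + K * N \<xi> x)"
      using 1(4)[OF S, of x] M by simp
    also have "\<dots> = \<delta> * T \<xi> x + M * K * N \<xi> x" using M by (simp add: field_simps)
    finally show "M * \<Phi>' \<xi> x + q' \<xi> x \<le> \<delta> * T \<xi> x + M * K * N \<xi> x"
      using le[OF S, of x] by (simp add: distrib_left)
  next
    fix \<xi> assume "\<xi> \<in> S"
    then have "lie_derivative (A \<xi>) (\<Phi> \<xi>) (\<Phi>' \<xi>)" using 1(2) by blast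
    then show "lie_derivative (A \<xi>) (\<lambda>x. M * \<Phi> \<xi> x) (\<lambda>x. M * \<Phi>' \<xi> x)"
      by (rule lie_derivative_cmult)
  qed (use 1(1) M in simp)
  then show "\<exists>\<Phi> \<Phi>' K. dissipates A S T N q' \<delta> \<Phi> \<Phi>' K" by blast
qed

text \<open>If \<open>f' = b g + h\<close> along the flow, then the multiplier \<open>- \<alpha> (b g \<bullet> f)\<close> passes dissipation on
  from \<open>f\<close> to \<open>g\<close>.\<close>

lemma dissipated_step:
  fixes f g h :: "real \<Rightarrow> complex^'n \<Rightarrow> complex" and b :: "real \<Rightarrow> complex" and \<alpha> :: "real \<Rightarrow> real"
  assumes q: "dissipated A S T N q" and q0: "\<And>\<xi> x. 0 \<le> q \<xi> x"
    and N0: "\<And>\<xi> x. 0 \<le> N \<xi> x"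
    and f: "\<And>\<xi>. linear (f \<xi>)" and g: "\<And>\<xi>. linear (g \<xi>)" and \<alpha>: "\<And>\<xi>. \<xi> \<in> S \<Longrightarrow> 0 \<le> \<alpha> \<xi>"
    and M: "0 < M"
    and deriv: "\<And>\<xi> x. f \<xi> (A \<xi> *v x) = b \<xi> * g \<xi> x + h \<xi> x"
    and bound: "\<And>\<xi> x. \<xi> \<in> S \<Longrightarrow> \<alpha> \<xi> * (norm (b \<xi>) * norm (g \<xi> x) * norm (f \<xi> x)) \<le> M * (norm x)\<^sup>2"
    and rest: "\<And>\<xi> x. \<xi> \<in> S \<Longrightarrow> \<alpha> \<xi> * (norm (h \<xi> x))\<^sup>2 \<le> M * q \<xi> x"
    and a: "\<And>\<xi> x. \<xi> \<in> S \<Longrightarrow> (a \<xi> x)\<^sup>2 \<le> M * q \<xi> x"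
    and y: "\<And>\<xi> x. \<xi> \<in> S \<Longrightarrow> (y \<xi> x)\<^sup>2 \<le> M * (q \<xi> x + T \<xi> x)"
    and cross: "\<And>\<xi> x. \<xi> \<in> S \<Longrightarrow>
      \<alpha> \<xi> * (norm (b \<xi>) * norm (g \<xi> (A \<xi> *v x)) * norm (f \<xi> x)) \<le> a \<xi> x * y \<xi> x"
  shows "dissipated A S T N (\<lambda>\<xi> x. \<alpha> \<xi> * (norm (b \<xi>) * norm (g \<xi> x))\<^sup>2)"
proof -
  \<comment> \<open>Half of the square is spent on the remainder \<open>h\<close> by Young's
    inequality; the factor 2 is restored at the end by monotonicity.\<close>
  have "dissipated A S T N (\<lambda>\<xi> x. \<alpha> \<xi> * (norm (b \<xi>) * norm (g \<xi> x))\<^sup>2 / 2)"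
    unfolding dissipated_def
  proof (intro allI impI)
    fix \<delta> :: real assume d: "\<delta> > 0"
    \<comment> \<open>Weight for the product a y in Young's inequality, chosen so that \<kappa> M T
      is half of the allowed \<delta> T.\<close>
    define \<kappa> where "\<kappa> = \<delta> / (2 * M)"
    have \<kappa>: "\<kappa> > 0" using d M by (simp add: \<kappa>_def)
    \<comment> \<open>The total multiple of \<open>q\<close> that will appear: \<open>M\<close>
      covers the remainder \<open>h\<close>, \<open>M/\<kappa>\<close> the square of
      \<open>a\<close>, and \<open>\<kappa> * M\<close> the share of \<open>q\<close> in the bound
      for \<open>y\<close>. Adding \<open>B\<close> times the given form cancels it, and the
      tolerance \<open>\<delta>/(2*B)\<close> of that form contributes the other half of \<delta>
      T.\<close>
    define B where "B = M + M/\<kappa> + \<kappa> * M"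
    have B: "B > 0" unfolding B_def using M \<kappa> by (simp add: add_pos_pos)
    then have d2: "\<delta>/(2*B) > 0" using d by simp
    obtain \<Phi> \<Phi>' K where "dissipates A S T N q (\<delta>/(2*B)) \<Phi> \<Phi>' K"
      using dissipatedE[OF q d2] .
    note 1 = dissipatesD[OF this]
    define \<Psi> where "\<Psi> = (\<lambda>\<xi> x. - \<alpha> \<xi> * ((b \<xi> * g \<xi> x) \<bullet> f \<xi> x))"
    define \<Psi>' where "\<Psi>' = (\<lambda>\<xi> x. - \<alpha> \<xi> *
      ((b \<xi> * g \<xi> x) \<bullet> f \<xi> (A \<xi> *v x) + (b \<xi> * g \<xi> (A \<xi> *v x)) \<bullet> f \<xi> x))"
    have lie: "lie_derivative (A \<xi>) (\<Psi> \<xi>) (\<Psi>' \<xi>)" for \<xi>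
    proof -
      have "linear (\<lambda>x. b \<xi> * g \<xi> x)"
        by (intro linearI) (simp_all add: linear_add[OF g] linear_scale[OF g] distrib_left)
      from lie_derivative_cmult[OF lie_derivative_inner[OF f this], where c = "- \<alpha> \<xi>"]
      show ?thesis by (simp add: \<Psi>_def \<Psi>'_def)
    qed
    have Psi_le: "\<bar>\<Psi> \<xi> x\<bar> \<le> M * (norm x)\<^sup>2" if "\<xi> \<in> S" for \<xi> x
    proof -
      have "\<bar>\<Psi> \<xi> x\<bar> \<le> \<alpha> \<xi> * (norm (b \<xi> * g \<xi> x) * norm (f \<xi> x))"
        using \<alpha>[OF that] unfolding \<Psi>_def abs_mult
        by (simp add: mult_left_mono Cauchy_Schwarz_ineq2)
      then show ?thesis using bound[OF that, of x] by (simp add: norm_mult)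
    qed
    have main: "\<Psi>' \<xi> x + \<alpha> \<xi> * (norm (b \<xi>) * norm (g \<xi> x))\<^sup>2 / 2 \<le> \<delta>/2 * T \<xi> x + B * q \<xi> x"
      if S: "\<xi> \<in> S" for \<xi> x
    proof -
      let ?G = "b \<xi> * g \<xi> x"
      have e1: "?G \<bullet> f \<xi> (A \<xi> *v x) = (norm ?G)\<^sup>2 + ?G \<bullet> h \<xi> x"
        by (simp add: deriv inner_add_right dot_square_norm)
      have e2: "- (?G \<bullet> h \<xi> x) \<le> (norm ?G)\<^sup>2 / 2 + (norm (h \<xi> x))\<^sup>2 / 2"
      proof -
        have "- (?G \<bullet> h \<xi> x) \<le> norm ?G * norm (h \<xi> x)"
          using Cauchy_Schwarz_ineq2[of ?G "h \<xi> x"] by linarith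
        also have "\<dots> \<le> (norm ?G)\<^sup>2 / 2 + (norm (h \<xi> x))\<^sup>2 / 2"
          using sum_squares_bound[of "norm ?G" "norm (h \<xi> x)"] by simp
        finally show ?thesis .
      qed
      have e3: "- ((b \<xi> * g \<xi> (A \<xi> *v x)) \<bullet> f \<xi> x) \<le> norm (b \<xi>) * norm (g \<xi> (A \<xi> *v x)) * norm (f \<xi> x)"
        using Cauchy_Schwarz_ineq2[of "b \<xi> * g \<xi> (A \<xi> *v x)" "f \<xi> x"] by (simp add: norm_mult)
      have e4: "2 * (a \<xi> x * y \<xi> x) \<le> (a \<xi> x)\<^sup>2 / \<kappa> + \<kappa> * (y \<xi> x)\<^sup>2"
      proof -
        have "0 \<le> (a \<xi> x - \<kappa> * y \<xi> x)\<^sup>2" by simp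
        then have "2 * \<kappa> * (a \<xi> x * y \<xi> x) \<le> (a \<xi> x)\<^sup>2 + \<kappa>\<^sup>2 * (y \<xi> x)\<^sup>2"
          by (simp add: power2_eq_square algebra_simps)
        then show ?thesis using \<kappa> by (simp add: field_simps power2_eq_square)
      qed
      have e5: "(a \<xi> x)\<^sup>2 / \<kappa> \<le> M * q \<xi> x / \<kappa>"
        using a[OF S, of x] \<kappa> by (simp add: divide_right_mono)
      have e6: "\<kappa> * (y \<xi> x)\<^sup>2 \<le> \<kappa> * (M * (q \<xi> x + T \<xi> x))"
        using y[OF S, of x] \<kappa> by (simp add: mult_left_mono)
      have e7: "\<kappa> * (M * (q \<xi> x + T \<xi> x)) = \<kappa> * M * q \<xi> x + \<delta>/2 * T \<xi> x"
        using M by (simp add: \<kappa>_def field_simps)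
      have e8: "\<alpha> \<xi> * (- (?G \<bullet> h \<xi> x)) \<le> \<alpha> \<xi> * ((norm ?G)\<^sup>2 / 2 + (norm (h \<xi> x))\<^sup>2 / 2)"
        using e2 \<alpha>[OF S] by (rule mult_left_mono)
      have e9: "\<alpha> \<xi> * (- ((b \<xi> * g \<xi> (A \<xi> *v x)) \<bullet> f \<xi> x)) \<le> a \<xi> x * y \<xi> x"
        using mult_left_mono[OF e3 \<alpha>[OF S]] cross[OF S, of x] by linarith
      have "0 \<le> \<kappa> * (y \<xi> x)\<^sup>2" using \<kappa> by simp
      with e6 e7 have "\<delta> / 2 * T \<xi> x + \<kappa> * M * q \<xi> x \<ge> 0" by linarith
      moreover have "M * q \<xi> x / \<kappa> \<ge> 0" "M * q \<xi> x \<ge> 0" using M \<kappa> q0 by simp_all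
      moreover have "\<alpha> \<xi> * (norm ?G)\<^sup>2 = \<alpha> \<xi> * (norm (b \<xi>) * norm (g \<xi> x))\<^sup>2"
        by (simp add: norm_mult)
      moreover have "B * q \<xi> x = M * q \<xi> x + M * q \<xi> x / \<kappa> + \<kappa> * M * q \<xi> x"
        by (simp add: B_def field_simps)
      moreover have "\<kappa> * (y \<xi> x)\<^sup>2 \<le> \<kappa> * M * q \<xi> x + \<delta>/2 * T \<xi> x" using e6 e7 by linarith
      moreover have "2 * (a \<xi> x * y \<xi> x) \<le> (a \<xi> x)\<^sup>2 / \<kappa> + \<kappa> * (y \<xi> x)\<^sup>2" by (rule e4)
      moreover have "\<alpha> \<xi> * ((norm ?G)\<^sup>2 / 2 + (norm (h \<xi> x))\<^sup>2 / 2) =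
          \<alpha> \<xi> * (norm ?G)\<^sup>2 / 2 + \<alpha> \<xi> * (norm (h \<xi> x))\<^sup>2 / 2"
        by (simp add: distrib_left)
      moreover have "\<Psi>' \<xi> x = - (\<alpha> \<xi> * (norm ?G)\<^sup>2) + \<alpha> \<xi> * (- (?G \<bullet> h \<xi> x)) +
          \<alpha> \<xi> * (- ((b \<xi> * g \<xi> (A \<xi> *v x)) \<bullet> f \<xi> x))"
        unfolding \<Psi>'_def e1 by (simp add: algebra_simps)
      ultimately show ?thesis
        using e5 e8 e9 rest[OF S, of x] by linarith
    qed
    have "dissipates A S T N (\<lambda>\<xi> x. \<alpha> \<xi> * (norm (b \<xi>) * norm (g \<xi> x))\<^sup>2 / 2) \<delta>
      (\<lambda>\<xi> x. \<Psi> \<xi> x + B * \<Phi> \<xi> x) (\<lambda>\<xi> x. \<Psi>' \<xi> x + B * \<Phi>' \<xi> x) (M + B * K + B * K)"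
      unfolding dissipates_def
    proof (intro conjI ballI allI)
      fix \<xi> assume S: "\<xi> \<in> S"
      show "lie_derivative (A \<xi>) (\<lambda>x. \<Psi> \<xi> x + B * \<Phi> \<xi> x) (\<lambda>x. \<Psi>' \<xi> x + B * \<Phi>' \<xi> x)"
        by (intro lie_derivative_add lie lie_derivative_cmult 1(2) S)
      fix x
      have *: "\<bar>\<Phi> \<xi> x\<bar> \<le> K * (norm x)\<^sup>2" "\<Phi>' \<xi> x + q \<xi> x \<le> \<delta>/(2*B) * T \<xi> x + K * N \<xi> x"
        using 1(3,4) S by blast+
      have "\<bar>B * \<Phi> \<xi> x\<bar> \<le> B * (K * (norm x)\<^sup>2)" using * B by (simp add: abs_mult)
      moreover have "0 \<le> B * (K * (norm x)\<^sup>2)" using 1(1) B by simp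
      ultimately have "\<bar>\<Psi> \<xi> x + B * \<Phi> \<xi> x\<bar> \<le> M * (norm x)\<^sup>2 + B * (K * (norm x)\<^sup>2) + B * (K * (norm x)\<^sup>2)"
        using Psi_le[OF S, of x] by linarith
      then show "\<bar>\<Psi> \<xi> x + B * \<Phi> \<xi> x\<bar> \<le> (M + B * K + B * K) * (norm x)\<^sup>2"
        by (simp add: distrib_right mult.assoc)
      have "B * (\<Phi>' \<xi> x + q \<xi> x) \<le> B * (\<delta>/(2*B) * T \<xi> x + K * N \<xi> x)"
        using *(2) B by simp
      also have "\<dots> = \<delta>/2 * T \<xi> x + B * K * N \<xi> x" using B by (simp add: field_simps)
      finally show "\<Psi>' \<xi> x + B * \<Phi>' \<xi> x + \<alpha> \<xi> * (norm (b \<xi>) * norm (g \<xi> x))\<^sup>2 / 2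
        \<le> \<delta> * T \<xi> x + (M + B * K + B * K) * N \<xi> x"
        using main[OF S, of x] mult_nonneg_nonneg[OF less_imp_le[OF M] N0, of \<xi> x]
          mult_nonneg_nonneg[OF mult_nonneg_nonneg[OF less_imp_le[OF B] 1(1)] N0, of \<xi> x]
        by (simp add: distrib_left distrib_right)
    qed (use 1(1) M B in simp)
    then show "\<exists>\<Phi> \<Phi>' K. dissipates A S T N
      (\<lambda>\<xi> x. \<alpha> \<xi> * (norm (b \<xi>) * norm (g \<xi> x))\<^sup>2 / 2) \<delta> \<Phi> \<Phi>' K" by blast
  qed
  then show ?thesis by (rule dissipated_mono[where M = 2]) auto
qed

text \<open>The cross term with the derivative of \<open>g\<close> must split into a factor
  \<open>a\<close> that is already dissipated and a factor \<open>y\<close> that may also involve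
  the total; Young's inequality then charges \<open>y\<close> to an arbitrarily small multiple of
  \<open>T\<close>. The separate estimates may come with separate constants, and \<open>w\<close> is
  the normalised form of the new quantity, so that repeated use accumulates all gains in one
  sum.\<close>

lemma dissipated_chain:
  fixes f g h :: "real \<Rightarrow> complex^'n \<Rightarrow> complex" and b :: "real \<Rightarrow> complex" and \<alpha> :: "real \<Rightarrow> real"
  assumes q: "dissipated A S T N q" and q0: "\<And>\<xi> x. 0 \<le> q \<xi> x"
    and N0: "\<And>\<xi> x. 0 \<le> N \<xi> x" and T0: "\<And>\<xi> x. 0 \<le> T \<xi> x"
    and f: "\<And>\<xi>. linear (f \<xi>)" and g: "\<And>\<xi>. linear (g \<xi>)" and \<alpha>: "\<And>\<xi>. \<xi> \<in> S \<Longrightarrow> 0 \<le> \<alpha> \<xi>"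
    and M: "0 \<le> M1" "0 \<le> M2" "0 \<le> M3" "0 \<le> M4" "0 \<le> L"
    and deriv: "\<And>\<xi> x. f \<xi> (A \<xi> *v x) = b \<xi> * g \<xi> x + h \<xi> x"
    and bound: "\<And>\<xi> x. \<xi> \<in> S \<Longrightarrow> \<alpha> \<xi> * (norm (b \<xi>) * norm (g \<xi> x) * norm (f \<xi> x)) \<le> M1 * (norm x)\<^sup>2"
    and rest: "\<And>\<xi> x. \<xi> \<in> S \<Longrightarrow> \<alpha> \<xi> * (norm (h \<xi> x))\<^sup>2 \<le> M2 * q \<xi> x"
    and a: "\<And>\<xi> x. \<xi> \<in> S \<Longrightarrow> (a \<xi> x)\<^sup>2 \<le> M3 * q \<xi> x"
    and y: "\<And>\<xi> x. \<xi> \<in> S \<Longrightarrow> (y \<xi> x)\<^sup>2 \<le> M4 * (q \<xi> x + T \<xi> x)"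
    and cross: "\<And>\<xi> x. \<xi> \<in> S \<Longrightarrow>
      \<alpha> \<xi> * (norm (b \<xi>) * norm (g \<xi> (A \<xi> *v x)) * norm (f \<xi> x)) \<le> a \<xi> x * y \<xi> x"
    and w: "\<And>\<xi> x. \<xi> \<in> S \<Longrightarrow> w \<xi> x \<le> L * (\<alpha> \<xi> * (norm (b \<xi>) * norm (g \<xi> x))\<^sup>2)"
  shows "dissipated A S T N (\<lambda>\<xi> x. q \<xi> x + w \<xi> x)"
proof -
  define M where "M = 1 + M1 + M2 + M3 + M4"
  have le: "c * t \<le> M * t" if "c \<in> {M1, M2, M3, M4}" "0 \<le> t" for c t
    using that M by (intro mult_right_mono) (auto simp: M_def)
  have "dissipated A S T N (\<lambda>\<xi> x. \<alpha> \<xi> * (norm (b \<xi>) * norm (g \<xi> x))\<^sup>2)"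
  proof (rule dissipated_step[OF q q0 N0 f g \<alpha> _ deriv, where M = M and a = a and y = y])
    show "0 < M" using M by (simp add: M_def)
  next
    fix \<xi> x assume S: "\<xi> \<in> S"
    show "\<alpha> \<xi> * (cmod (b \<xi>) * cmod (g \<xi> x) * cmod (f \<xi> x)) \<le> M * (norm x)\<^sup>2"
      using bound[OF S, of x] le[of M1 "(norm x)\<^sup>2"] by simp
    show "\<alpha> \<xi> * (cmod (h \<xi> x))\<^sup>2 \<le> M * q \<xi> x"
      using rest[OF S, of x] le[of M2 "q \<xi> x"] q0[of \<xi> x] by simp
    show "(a \<xi> x)\<^sup>2 \<le> M * q \<xi> x"
      using a[OF S, of x] le[of M3 "q \<xi> x"] q0[of \<xi> x] by simp
    show "(y \<xi> x)\<^sup>2 \<le> M * (q \<xi> x + T \<xi> x)"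
      using y[OF S, of x] le[of M4 "q \<xi> x + T \<xi> x"] q0[of \<xi> x] T0[of \<xi> x] by simp
  qed (use cross in simp_all)
  then have "dissipated A S T N w"
  proof (rule dissipated_mono[where M = "L + 1"])
    fix \<xi> x assume S: "\<xi> \<in> S"
    show "w \<xi> x \<le> (L + 1) * (\<alpha> \<xi> * (norm (b \<xi>) * norm (g \<xi> x))\<^sup>2)"
      using w[OF S, of x] \<alpha>[OF S] by (simp add: distrib_right add_increasing2)
  qed (use M in simp)
  with q show ?thesis by (rule dissipated_add)
qed

text \<open>With tolerance 1/2, half of \<open>T\<close> survives on the left. Since
  \<open>H\<close> loses only a multiple of m N and not of N, the dissipating form is added to
  \<open>H\<close> with the factor \<open>m\<close>; hence the rate is the product of
  \<open>m\<close> and \<open>\<rho>\<close>.\<close>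

lemma dissipated_decay:
  fixes A :: "real \<Rightarrow> complex^'n^'n"
  assumes dis: "dissipated A S T N T"
    and H: "\<And>\<xi>. \<xi> \<in> S \<Longrightarrow> lie_derivative (A \<xi>) H (H' \<xi>)"
    and H12: "0 < c1" "\<And>x. c1 * (norm x)\<^sup>2 \<le> H x" "\<And>x. H x \<le> c2 * (norm x)\<^sup>2"
    and c3: "0 < c3" "\<And>\<xi> x. \<xi> \<in> S \<Longrightarrow> H' \<xi> x \<le> - c3 * m \<xi> * N \<xi> x"
    and N: "\<And>\<xi> x. 0 \<le> N \<xi> x" and m: "\<And>\<xi>. \<xi> \<in> S \<Longrightarrow> 0 \<le> m \<xi>" "\<And>\<xi>. \<xi> \<in> S \<Longrightarrow> m \<xi> \<le> 1"
    and \<rho>: "\<And>\<xi> x. \<xi> \<in> S \<Longrightarrow> \<rho> \<xi> * (norm x)\<^sup>2 \<le> T \<xi> x" "\<And>\<xi>. \<xi> \<in> S \<Longrightarrow> 0 \<le> \<rho> \<xi>"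
  shows "\<exists>C>0. \<exists>c>0. \<forall>\<xi>\<in>S. \<forall>X. flow_solution (A \<xi>) X \<longrightarrow> (\<forall>t\<ge>0.
    (norm (X t))\<^sup>2 \<le> C * exp (- (c * m \<xi> * \<rho> \<xi> * t)) * (norm (X 0))\<^sup>2)"
proof -
  obtain \<Phi> \<Phi>' K where "dissipates A S T N T (1/2) \<Phi> \<Phi>' K"
    using dissipatedE[OF dis, of "1/2"] by auto
  note \<Phi> = dissipatesD[OF this]
  have K: "0 \<le> K" by (rule \<Phi>(1))
  \<comment> \<open>The minimum serves two purposes: the perturbation stays below half of the lower
    bound of \<open>H\<close>, and the multiple of \<open>N\<close> that it produces is paid for by
    the dissipation of \<open>H\<close>.\<close>
  define \<kappa> where "\<kappa> = min (c1 / 2) c3 / (K + 1)"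
  have \<kappa>: "0 < \<kappa>" using H12 c3 K by (simp add: \<kappa>_def)
  have "\<kappa> * (K + 1) = min (c1/2) c3" using K by (simp add: \<kappa>_def)
  then have \<kappa>K: "\<kappa> * K \<le> c1 / 2" "\<kappa> * K \<le> c3" using \<kappa> by (simp_all add: distrib_left)
  have c12: "c1 \<le> c2"
  proof -
    have "c1 * (norm (1::complex^'n))\<^sup>2 \<le> c2 * (norm (1::complex^'n))\<^sup>2"
      by (rule order_trans[OF H12(2) H12(3)])
    then show ?thesis by simp
  qed
  define D where "D = c1 + c2"
  have D: "0 < D" using H12(1) c12 by (simp add: D_def)
  \<comment> \<open>Half of the gain \<kappa> m T remains, and the perturbed functional is at most D
    |x|^2; the rate constant is the quotient.\<close>
  define c where "c = \<kappa> / (2 * D)"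
  have c: "0 < c" using \<kappa> D by (simp add: c_def)
  define C where "C = 2 * D / c1"
  have C: "0 < C" using D H12(1) by (simp add: C_def)
  have "(norm (X t))\<^sup>2 \<le> C * exp (- (c * m \<xi> * \<rho> \<xi> * t)) * (norm (X 0))\<^sup>2"
    if S: "\<xi> \<in> S" and X: "flow_solution (A \<xi>) X" and t: "0 \<le> t" for \<xi> X t
  proof -
    define L where "L = (\<lambda>x. H x + (\<kappa> * m \<xi>) * \<Phi> \<xi> x)"
    define L' where "L' = (\<lambda>x. H' \<xi> x + (\<kappa> * m \<xi>) * \<Phi>' \<xi> x)"
    have lie: "lie_derivative (A \<xi>) L L'"
      unfolding L_def L'_def by (intro lie_derivative_add lie_derivative_cmult H \<Phi>(2) S)
    have small: "\<bar>\<kappa> * m \<xi> * \<Phi> \<xi> x\<bar> \<le> c1 / 2 * (norm x)\<^sup>2" for x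
    proof -
      have "\<bar>\<kappa> * m \<xi> * \<Phi> \<xi> x\<bar> = m \<xi> * (\<kappa> * \<bar>\<Phi> \<xi> x\<bar>)"
        using \<kappa> m[OF S] by (simp add: abs_mult)
      also have "\<dots> \<le> 1 * (\<kappa> * (K * (norm x)\<^sup>2))"
        using \<kappa> m[OF S] \<Phi>(3)[OF S, of x] by (intro mult_mono) auto
      also have "\<dots> = \<kappa> * K * (norm x)\<^sup>2" by simp
      also have "\<dots> \<le> c1 / 2 * (norm x)\<^sup>2" using \<kappa>K(1) by (intro mult_right_mono) auto
      finally show ?thesis .
    qed
    have lower: "c1 / 2 * (norm x)\<^sup>2 \<le> L x" for x
      using small[of x] H12(2)[of x] unfolding L_def by linarith
    have upper: "L x \<le> D * (norm x)\<^sup>2" for x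
    proof -
      have "0 \<le> c1 / 2 * (norm x)\<^sup>2" using H12(1) by simp
      then show ?thesis
        using small[of x] H12(3)[of x] unfolding L_def D_def distrib_right by linarith
    qed
    define \<mu> where "\<mu> = c * m \<xi> * \<rho> \<xi>"
    have \<mu>: "0 \<le> \<mu>" using c m[OF S] \<rho>(2)[OF S] by (simp add: \<mu>_def)
    have decr: "L' x \<le> - \<mu> * L x" for x
    proof -
      have "\<kappa> * m \<xi> * (\<Phi>' \<xi> x + T \<xi> x) \<le> \<kappa> * m \<xi> * (1/2 * T \<xi> x + K * N \<xi> x)"
        using \<Phi>(4)[OF S, of x] \<kappa> m[OF S] by (intro mult_left_mono) auto
      then have "\<kappa> * m \<xi> * \<Phi>' \<xi> x \<le> (\<kappa> * K) * (m \<xi> * N \<xi> x) - \<kappa> * m \<xi> / 2 * T \<xi> x"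
        by (simp add: algebra_simps)
      moreover have "(\<kappa> * K) * (m \<xi> * N \<xi> x) \<le> c3 * (m \<xi> * N \<xi> x)"
        using \<kappa>K(2) m[OF S] N[of \<xi> x] by (intro mult_right_mono) auto
      moreover have "\<kappa> * m \<xi> / 2 * (\<rho> \<xi> * (norm x)\<^sup>2) \<le> \<kappa> * m \<xi> / 2 * T \<xi> x"
        using \<rho>(1)[OF S, of x] \<kappa> m[OF S] by (intro mult_left_mono) auto
      moreover have "\<mu> * L x \<le> \<mu> * (D * (norm x)\<^sup>2)" using upper \<mu> by (intro mult_left_mono) auto
      moreover have "\<mu> * (D * (norm x)\<^sup>2) = \<kappa> * m \<xi> / 2 * (\<rho> \<xi> * (norm x)\<^sup>2)"
        using D by (simp add: \<mu>_def c_def)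
      ultimately show ?thesis using c3(2)[OF S, of x] unfolding L'_def by (simp add: mult.assoc)
    qed
    have deriv: "((\<lambda>t. L (X t)) has_real_derivative L' (X t)) (at t)" for t
      using lie X unfolding lie_derivative_def by blast
    \<comment> \<open>Gronwall's inequality in the form that exp(\<mu> t) times the functional
      decreases.\<close>
    have "exp (\<mu> * t) * L (X t) \<le> exp (\<mu> * 0) * L (X 0)"
    proof (rule DERIV_nonpos_imp_nonincreasing[OF t])
      fix s
      have "((\<lambda>t. exp (\<mu> * t) * L (X t)) has_real_derivative
          exp (\<mu> * s) * (\<mu> * L (X s) + L' (X s))) (at s)"
        by (auto intro!: derivative_eq_intros deriv simp: algebra_simps)
      moreover have "exp (\<mu> * s) * (\<mu> * L (X s) + L' (X s)) \<le> 0"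
        using decr[of "X s"] by (simp add: mult_le_0_iff)
      ultimately show "\<exists>y. ((\<lambda>t. exp (\<mu> * t) * L (X t)) has_real_derivative y) (at s) \<and> y \<le> 0"
        by blast
    qed
    then have "L (X t) \<le> exp (- (\<mu> * t)) * L (X 0)"
      by (simp add: exp_minus field_simps)
    also have "\<dots> \<le> exp (- (\<mu> * t)) * (D * (norm (X 0))\<^sup>2)" using upper by simp
    finally have "c1 / 2 * (norm (X t))\<^sup>2 \<le> exp (- (\<mu> * t)) * (D * (norm (X 0))\<^sup>2)"
      using lower[of "X t"] by simp
    then show ?thesis using H12(1) by (simp add: C_def \<mu>_def field_simps)
  qed
  then show ?thesis using C c by blast
qed

text \<open>A bound that holds for all large constants can be intersected with other such bounds, so
  one common constant arises without computing maxima. The nonnegative right-hand side is what lets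
  the constant grow.\<close>

lemma eventually_bounded_by:
  fixes lhs rhs :: "'a \<Rightarrow> 'b \<Rightarrow> real"
  assumes "\<And>i x. lhs i x \<le> c * rhs i x" "\<And>i x. 0 \<le> rhs i x"
  shows "\<forall>\<^sub>F C in at_top. \<forall>i x. lhs i x \<le> C * rhs i x"
  using eventually_ge_at_top[of c]
proof eventually_elim
  case (elim C)
  show ?case
  proof (intro allI)
    fix i x
    have "c * rhs i x \<le> C * rhs i x" using elim assms(2) by (rule mult_right_mono)
    then show "lhs i x \<le> C * rhs i x" using assms(1)[of i x] by simp
  qed
qed

lemma norm_minus_mono: "norm a \<le> A \<Longrightarrow> norm b \<le> B \<Longrightarrow> norm (a - b) \<le> A + B"
  for a b :: "'a::real_normed_vector"
  by (meson add_mono norm_triangle_ineq4 order_trans)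

section \<open>The beam system\<close>

locale beam =
  fixes k1 k2 k3 k4 k5 \<gamma> :: real and \<epsilon> :: nat
  assumes k: "0 < k1" "0 < k2" "0 < k3" "0 < k4" "0 < k5" and \<gamma>: "\<gamma> \<noteq> 0"
    and k23: "k2 \<noteq> k3" and \<epsilon>: "\<epsilon> = 0 \<or> \<epsilon> = 1"
begin

abbreviation A :: "real \<Rightarrow> complex^8^8"
  where "A \<equiv> beam_matrix k1 k2 k3 k4 k5 \<gamma> 1 0 0 \<epsilon>"

abbreviation s :: "real \<Rightarrow> complex" where "s \<xi> \<equiv> \<i> * complex_of_real \<xi>"

lemma A_nth:
  "(A \<xi> *v x) $ 1 = s \<xi> * x $ 2 + x $ 4 + x $ 6"
  "(A \<xi> *v x) $ 2 = k1 * s \<xi> * x $ 1 - \<gamma> * s \<xi> * x $ 8"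
  "(A \<xi> *v x) $ 3 = s \<xi> * x $ 4"
  "(A \<xi> *v x) $ 4 = k2 * s \<xi> * x $ 3 - k1 * x $ 1"
  "(A \<xi> *v x) $ 5 = s \<xi> * x $ 6"
  "(A \<xi> *v x) $ 6 = k3 * s \<xi> * x $ 5 - k1 * x $ 1"
  "(A \<xi> *v x) $ 7 = s \<xi> * x $ 8"
  "(A \<xi> *v x) $ 8 = k4 * s \<xi> * x $ 7 - \<gamma> * s \<xi> * x $ 2 - complex_of_real (k5 * \<xi> ^ (2 * \<epsilon>)) * x $ 8"
proof -
  note E = beam_matrix_mult[OF refl, of k1 k2 k3 k4 k5 \<gamma> 1 0 0 \<epsilon> \<xi> x]
  show "(A \<xi> *v x) $ 1 = s \<xi> * x $ 2 + x $ 4 + x $ 6"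
    using E(1) by (simp add: algebra_simps)
  show "(A \<xi> *v x) $ 2 = k1 * s \<xi> * x $ 1 - \<gamma> * s \<xi> * x $ 8"
    using E(2) by (simp add: algebra_simps eq_neg_iff_add_eq_0)
  show "(A \<xi> *v x) $ 3 = s \<xi> * x $ 4" using E(3) by simp
  show "(A \<xi> *v x) $ 4 = k2 * s \<xi> * x $ 3 - k1 * x $ 1"
    using E(4) by (simp add: algebra_simps)
  show "(A \<xi> *v x) $ 5 = s \<xi> * x $ 6" using E(5) by simp
  show "(A \<xi> *v x) $ 6 = k3 * s \<xi> * x $ 5 - k1 * x $ 1"
    using E(6) by (simp add: algebra_simps)
  show "(A \<xi> *v x) $ 7 = s \<xi> * x $ 8" using E(7) by simp
  \<comment> \<open>Here (-1)^\<epsilon> (i \<xi>)^(2\<epsilon>) = \<xi>^(2\<epsilon>) for both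
    values of \<epsilon>, so the two kinds of damping are treated alike, with a real nonnegative
    coefficient.\<close>
  have "(-1) ^ \<epsilon> * complex_of_real k5 * (s \<xi> ^ (2 * \<epsilon>) * x $ 8) =
      complex_of_real (k5 * \<xi> ^ (2 * \<epsilon>)) * x $ 8"
    using \<epsilon> by (auto simp: power_mult_distrib)
  then show "(A \<xi> *v x) $ 8 = k4 * s \<xi> * x $ 7 - \<gamma> * s \<xi> * x $ 2 - complex_of_real (k5 * \<xi> ^ (2 * \<epsilon>)) * x $ 8"
    using E(8) by (simp add: algebra_simps)
qed

text \<open>The weights make every coupling skew: as s is imaginary, the contributions of the pairs
  (v, u), (z, y), (\<phi>, \<theta>), (\<sigma>, \<eta>), (u, \<eta>) and of v with y and \<theta>
  cancel in the real part, and only the damping of \<eta> remains.\<close>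

definition energy :: "complex^8 \<Rightarrow> real" where
  "energy x = k1 * (norm (x $ 1))\<^sup>2 + (norm (x $ 2))\<^sup>2 + k2 * (norm (x $ 3))\<^sup>2 + (norm (x $ 4))\<^sup>2 +
    k3 * (norm (x $ 5))\<^sup>2 + (norm (x $ 6))\<^sup>2 + k4 * (norm (x $ 7))\<^sup>2 + (norm (x $ 8))\<^sup>2"

lemma linear_nth: "linear (\<lambda>x::complex^8. x $ i)"
  by (simp add: linear_iff)

lemma lie_derivative_energy:
  "lie_derivative (A \<xi>) energy (\<lambda>x. - (2 * k5) * \<xi> ^ (2 * \<epsilon>) * (norm (x $ 8))\<^sup>2)"
proof -
  have *: "lie_derivative (A \<xi>) (\<lambda>x. c * (norm (x $ i))\<^sup>2)
      (\<lambda>x. c * (x $ i \<bullet> (A \<xi> *v x) $ i + (A \<xi> *v x) $ i \<bullet> x $ i))" for c i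
    using lie_derivative_cmult[OF lie_derivative_inner[OF linear_nth linear_nth, of "A \<xi>" i i]]
    by (simp add: dot_square_norm)
  have **: "lie_derivative (A \<xi>) (\<lambda>x. (norm (x $ i))\<^sup>2)
      (\<lambda>x. (x $ i \<bullet> (A \<xi> *v x) $ i + (A \<xi> *v x) $ i \<bullet> x $ i))" for i
    using *[of 1 i] by simp
  have e: "energy = (\<lambda>x. k1 * (norm (x $ 1))\<^sup>2 + (norm (x $ 2))\<^sup>2 + k2 * (norm (x $ 3))\<^sup>2 + (norm (x $ 4))\<^sup>2 +
    k3 * (norm (x $ 5))\<^sup>2 + (norm (x $ 6))\<^sup>2 + k4 * (norm (x $ 7))\<^sup>2 + (norm (x $ 8))\<^sup>2)"
    by (simp add: fun_eq_iff energy_def)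
  have e': "(\<lambda>x. - (2 * k5) * \<xi> ^ (2 * \<epsilon>) * (norm (x $ 8))\<^sup>2) =
    (\<lambda>x. k1 * (x $ 1 \<bullet> (A \<xi> *v x) $ 1 + (A \<xi> *v x) $ 1 \<bullet> x $ 1) +
      (x $ 2 \<bullet> (A \<xi> *v x) $ 2 + (A \<xi> *v x) $ 2 \<bullet> x $ 2) +
      k2 * (x $ 3 \<bullet> (A \<xi> *v x) $ 3 + (A \<xi> *v x) $ 3 \<bullet> x $ 3) +
      (x $ 4 \<bullet> (A \<xi> *v x) $ 4 + (A \<xi> *v x) $ 4 \<bullet> x $ 4) +
      k3 * (x $ 5 \<bullet> (A \<xi> *v x) $ 5 + (A \<xi> *v x) $ 5 \<bullet> x $ 5) +
      (x $ 6 \<bullet> (A \<xi> *v x) $ 6 + (A \<xi> *v x) $ 6 \<bullet> x $ 6) +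
      k4 * (x $ 7 \<bullet> (A \<xi> *v x) $ 7 + (A \<xi> *v x) $ 7 \<bullet> x $ 7) +
      (x $ 8 \<bullet> (A \<xi> *v x) $ 8 + (A \<xi> *v x) $ 8 \<bullet> x $ 8))"
    unfolding A_nth cmod_power2
    by (simp add: fun_eq_iff inner_complex_def algebra_simps power2_eq_square)
  show ?thesis unfolding e e' by (intro lie_derivative_add * **)
qed

lemma norm_square_nth:
  "(norm x)\<^sup>2 = (norm (x $ 1))\<^sup>2 + (norm (x $ 2))\<^sup>2 + (norm (x $ 3))\<^sup>2 + (norm (x $ 4))\<^sup>2 +
    (norm (x $ 5))\<^sup>2 + (norm (x $ 6))\<^sup>2 + (norm (x $ 7))\<^sup>2 + (norm (x $ 8))\<^sup>2"
  for x :: "complex^8"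
  unfolding norm_vec_def L2_set_def sum_8 by simp

lemma energy_bounds:
  shows "min 1 (min k1 (min k2 (min k3 k4))) * (norm x)\<^sup>2 \<le> energy x"
    and "energy x \<le> max 1 (max k1 (max k2 (max k3 k4))) * (norm x)\<^sup>2"
proof -
  define m where "m = min 1 (min k1 (min k2 (min k3 k4)))"
  define M where "M = max 1 (max k1 (max k2 (max k3 k4)))"
  have m: "m \<le> 1" "m \<le> k1" "m \<le> k2" "m \<le> k3" "m \<le> k4" by (auto simp: m_def)
  have M: "1 \<le> M" "k1 \<le> M" "k2 \<le> M" "k3 \<le> M" "k4 \<le> M" by (auto simp: M_def)
  note le = mult_right_mono[OF _ zero_le_power2]
  have "m * (norm x)\<^sup>2 \<le> energy x"
    unfolding norm_square_nth energy_def distrib_left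
    using le[OF m(2), of "norm (x $ 1)"] le[OF m(1), of "norm (x $ 2)"] le[OF m(3), of "norm (x $ 3)"]
      le[OF m(1), of "norm (x $ 4)"] le[OF m(4), of "norm (x $ 5)"] le[OF m(1), of "norm (x $ 6)"]
      le[OF m(5), of "norm (x $ 7)"] le[OF m(1), of "norm (x $ 8)"] by linarith
  moreover have "energy x \<le> M * (norm x)\<^sup>2"
    unfolding norm_square_nth energy_def distrib_left
    using le[OF M(2), of "norm (x $ 1)"] le[OF M(1), of "norm (x $ 2)"] le[OF M(3), of "norm (x $ 3)"]
      le[OF M(1), of "norm (x $ 4)"] le[OF M(4), of "norm (x $ 5)"] le[OF M(1), of "norm (x $ 6)"]
      le[OF M(5), of "norm (x $ 7)"] le[OF M(1), of "norm (x $ 8)"] by linarith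
  ultimately show "min 1 (min k1 (min k2 (min k3 k4))) * (norm x)\<^sup>2 \<le> energy x"
    "energy x \<le> max 1 (max k1 (max k2 (max k3 k4))) * (norm x)\<^sup>2"
    unfolding m_def M_def by blast+
qed

text \<open>Each combination is read off from the derivative of its predecessor in the chain:
  \<eta>' contains s W, W' contains a multiple of s v, v' is Q, Q' contains s P, and P', R', T'
  contain s R, s T, s S.\<close>

definition W :: "complex^8 \<Rightarrow> complex" where "W x = k4 * x $ 7 - \<gamma> * x $ 2"
definition Q :: "real \<Rightarrow> complex^8 \<Rightarrow> complex" where "Q \<xi> x = s \<xi> * x $ 2 + x $ 4 + x $ 6"
definition P :: "complex^8 \<Rightarrow> complex" where "P x = k2 * x $ 3 + k3 * x $ 5"
definition R :: "complex^8 \<Rightarrow> complex" where "R x = k2 * x $ 4 + k3 * x $ 6"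
definition T :: "complex^8 \<Rightarrow> complex" where "T x = k2\<^sup>2 * x $ 3 + k3\<^sup>2 * x $ 5"
definition S :: "complex^8 \<Rightarrow> complex" where "S x = k2\<^sup>2 * x $ 4 + k3\<^sup>2 * x $ 6"

lemmas forms = W_def Q_def P_def R_def T_def S_def

lemma linear_forms: "linear W" "linear (Q \<xi>)" "linear P" "linear R" "linear T" "linear S"
  unfolding forms by (simp_all add: linear_iff algebra_simps)

text \<open>The chain closes at \<open>S\<close>: k2 and k3 are the roots of X^2 - (k2 + k3) X + k2
  k3, so the sum with weights k2^3 and k3^3 that arises in the derivative of \<open>S\<close> is a
  combination of \<open>T\<close> and \<open>P\<close>.\<close>

lemma forms_A:
  "(A \<xi> *v x) $ 8 = s \<xi> * W x + - complex_of_real (k5 * \<xi> ^ (2 * \<epsilon>)) * x $ 8"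
  "W (A \<xi> *v x) = - (\<gamma> * k1 * s \<xi>) * x $ 1 + (k4 + \<gamma>\<^sup>2) * s \<xi> * x $ 8"
  "(A \<xi> *v x) $ 1 = Q \<xi> x"
  "Q \<xi> (A \<xi> *v x) = s \<xi> * P x + ((k1 * (s \<xi>)\<^sup>2 - 2 * k1) * x $ 1 - \<gamma> * (s \<xi>)\<^sup>2 * x $ 8)"
  "P (A \<xi> *v x) = s \<xi> * R x"
  "R (A \<xi> *v x) = s \<xi> * T x + - (k1 * (k2 + k3)) * x $ 1"
  "T (A \<xi> *v x) = s \<xi> * S x"
  "S (A \<xi> *v x) = s \<xi> * ((k2 + k3) * T x - k2 * k3 * P x) - k1 * (k2\<^sup>2 + k3\<^sup>2) * x $ 1"
  unfolding forms A_nth by (simp_all add: algebra_simps power2_eq_square)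

lemma norm_s [simp]: "norm (s \<xi>) = \<bar>\<xi>\<bar>"
  by (simp add: norm_mult)

text \<open>Besides the combinations, the constant dominates the numerical coefficients of the
  chain; \<open>1 \<le> C\<close> allows lower powers of it to be absorbed in higher ones.\<close>

definition form_bound :: "real \<Rightarrow> bool" where
  "form_bound C \<longleftrightarrow> 1 \<le> C \<and> (\<forall>x. norm (W x) \<le> C * norm x) \<and> (\<forall>x. norm (P x) \<le> C * norm x) \<and>
    (\<forall>x. norm (R x) \<le> C * norm x) \<and> (\<forall>x. norm (T x) \<le> C * norm x) \<and> (\<forall>x. norm (S x) \<le> C * norm x) \<and>
    (\<forall>\<xi> x. norm (Q \<xi> x) \<le> C * ((\<bar>\<xi>\<bar> + 1) * norm x)) \<and>
    (\<forall>\<xi> x. norm (W (A \<xi> *v x)) \<le> C * (\<bar>\<xi>\<bar> * (norm (x $ 1) + norm (x $ 8)))) \<and>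
    (\<forall>\<xi> (x::complex^8). norm ((k1 * (s \<xi>)\<^sup>2 - 2 * k1) * x $ 1 - \<gamma> * (s \<xi>)\<^sup>2 * x $ 8) \<le>
      C * ((\<bar>\<xi>\<bar>\<^sup>2 + 1) * norm (x $ 1) + \<bar>\<xi>\<bar>\<^sup>2 * norm (x $ 8))) \<and>
    k1 * (k2 + k3) \<le> C \<and> k1 * (k2\<^sup>2 + k3\<^sup>2) \<le> C \<and> k2 + k3 \<le> C \<and> k2 * k3 \<le> C"

lemma form_boundD:
  assumes "form_bound C"
  shows "1 \<le> C" "norm (W x) \<le> C * norm x" "norm (P x) \<le> C * norm x" "norm (R x) \<le> C * norm x"
    "norm (T x) \<le> C * norm x" "norm (S x) \<le> C * norm x" "norm (Q \<xi> x) \<le> C * ((\<bar>\<xi>\<bar> + 1) * norm x)"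
    "norm (W (A \<xi> *v x)) \<le> C * (\<bar>\<xi>\<bar> * (norm (x $ 1) + norm (x $ 8)))"
    "norm ((k1 * (s \<xi>)\<^sup>2 - 2 * k1) * x $ 1 - \<gamma> * (s \<xi>)\<^sup>2 * x $ 8) \<le>
      C * ((\<bar>\<xi>\<bar>\<^sup>2 + 1) * norm (x $ 1) + \<bar>\<xi>\<bar>\<^sup>2 * norm (x $ 8))"
    "k1 * (k2 + k3) \<le> C" "k1 * (k2\<^sup>2 + k3\<^sup>2) \<le> C" "k2 + k3 \<le> C" "k2 * k3 \<le> C"
  using assms unfolding form_bound_def by blast+

lemma ex_form_bound: "\<exists>C. form_bound C"
proof -
  have comb: "norm (complex_of_real a * x $ i + complex_of_real b * x $ j) \<le> (\<bar>a\<bar> + \<bar>b\<bar>) * norm x"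
    for a b i j and x :: "complex^8"
    unfolding distrib_right using Finite_Cartesian_Product.norm_nth_le[of x]
    by (intro norm_triangle_mono) (auto simp: norm_mult intro!: mult_left_mono)
  \<comment> \<open>The unit index fills the first parameter of the generic bound when the quantity
    does not depend on \<xi>.\<close>
  have 1: "\<forall>\<^sub>F C in at_top. \<forall>(i::unit) x. norm (W x) \<le> C * norm x"
    by (rule eventually_bounded_by[where c = "\<bar>k4\<bar> + \<bar>-\<gamma>\<bar>"])
      (use comb[of k4 _ 7 "- \<gamma>" 2] in \<open>simp_all add: W_def\<close>)
  have 2: "\<forall>\<^sub>F C in at_top. \<forall>(i::unit) x. norm (P x) \<le> C * norm x"
    by (rule eventually_bounded_by[where c = "\<bar>k2\<bar> + \<bar>k3\<bar>"])
      (use comb[of k2 _ 3 k3 5] in \<open>simp_all add: P_def\<close>)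
  have 3: "\<forall>\<^sub>F C in at_top. \<forall>(i::unit) x. norm (R x) \<le> C * norm x"
    by (rule eventually_bounded_by[where c = "\<bar>k2\<bar> + \<bar>k3\<bar>"])
      (use comb[of k2 _ 4 k3 6] in \<open>simp_all add: R_def\<close>)
  have 4: "\<forall>\<^sub>F C in at_top. \<forall>(i::unit) x. norm (T x) \<le> C * norm x"
    by (rule eventually_bounded_by[where c = "\<bar>k2\<^sup>2\<bar> + \<bar>k3\<^sup>2\<bar>"])
      (use comb[of "k2\<^sup>2" _ 3 "k3\<^sup>2" 5] in \<open>simp_all add: T_def\<close>)
  have 5: "\<forall>\<^sub>F C in at_top. \<forall>(i::unit) x. norm (S x) \<le> C * norm x"
    by (rule eventually_bounded_by[where c = "\<bar>k2\<^sup>2\<bar> + \<bar>k3\<^sup>2\<bar>"])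
      (use comb[of "k2\<^sup>2" _ 4 "k3\<^sup>2" 6] in \<open>simp_all add: S_def\<close>)
  have 6: "\<forall>\<^sub>F C in at_top. \<forall>\<xi> x. norm (Q \<xi> x) \<le> C * ((\<bar>\<xi>\<bar> + 1) * norm x)"
  proof (rule eventually_bounded_by[where c = 2])
    fix \<xi> x
    have "norm (Q \<xi> x) \<le> \<bar>\<xi>\<bar> * norm x + norm x + norm x"
      unfolding Q_def using Finite_Cartesian_Product.norm_nth_le[of x]
      by (intro norm_triangle_mono) (auto simp: norm_mult intro!: mult_left_mono)
    also have "\<dots> \<le> 2 * ((\<bar>\<xi>\<bar> + 1) * norm x)" by (simp add: distrib_right)
    finally show "norm (Q \<xi> x) \<le> 2 * ((\<bar>\<xi>\<bar> + 1) * norm x)" .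
  qed simp
  have 7: "\<forall>\<^sub>F C in at_top. \<forall>\<xi> x. norm (W (A \<xi> *v x)) \<le> C * (\<bar>\<xi>\<bar> * (norm (x $ 1) + norm (x $ 8)))"
  proof (rule eventually_bounded_by[where c = "\<bar>\<gamma>\<bar> * k1 + (k4 + \<gamma>\<^sup>2)"])
    fix \<xi> x
    have "norm (W (A \<xi> *v x)) \<le> \<bar>\<gamma>\<bar> * k1 * (\<bar>\<xi>\<bar> * norm (x $ 1)) + (k4 + \<gamma>\<^sup>2) * (\<bar>\<xi>\<bar> * norm (x $ 8))"
      unfolding forms_A using k
      by (intro norm_triangle_mono) (simp_all add: norm_mult flip: of_real_add of_real_power)
    also have "\<dots> \<le> (\<bar>\<gamma>\<bar> * k1 + (k4 + \<gamma>\<^sup>2)) * (\<bar>\<xi>\<bar> * norm (x $ 1)) +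
        (\<bar>\<gamma>\<bar> * k1 + (k4 + \<gamma>\<^sup>2)) * (\<bar>\<xi>\<bar> * norm (x $ 8))"
      using k by (intro add_mono[OF mult_right_mono mult_right_mono]) auto
    finally show "norm (W (A \<xi> *v x)) \<le> (\<bar>\<gamma>\<bar> * k1 + (k4 + \<gamma>\<^sup>2)) * (\<bar>\<xi>\<bar> * (norm (x $ 1) + norm (x $ 8)))"
      by (simp add: distrib_left)
  qed simp
  have 8: "\<forall>\<^sub>F C in at_top. \<forall>\<xi> (x::complex^8). norm ((k1 * (s \<xi>)\<^sup>2 - 2 * k1) * x $ 1 - \<gamma> * (s \<xi>)\<^sup>2 * x $ 8) \<le>
      C * ((\<bar>\<xi>\<bar>\<^sup>2 + 1) * norm (x $ 1) + \<bar>\<xi>\<bar>\<^sup>2 * norm (x $ 8))"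
  proof (rule eventually_bounded_by[where c = "2 * k1 + \<bar>\<gamma>\<bar>"])
    fix \<xi> and x :: "complex^8"
    have c: "norm (complex_of_real k1 * (s \<xi>)\<^sup>2 - 2 * complex_of_real k1) \<le> 2 * k1 * (\<bar>\<xi>\<bar>\<^sup>2 + 1)"
    proof -
      have "norm (complex_of_real k1 * (s \<xi>)\<^sup>2 - 2 * complex_of_real k1) \<le> k1 * \<bar>\<xi>\<bar>\<^sup>2 + 2 * k1"
        by (intro norm_minus_mono) (use k in \<open>simp_all add: norm_mult norm_power\<close>)
      also have "\<dots> \<le> k1 * \<bar>\<xi>\<bar>\<^sup>2 + 2 * k1 + k1 * \<bar>\<xi>\<bar>\<^sup>2" using k by simp
      finally show ?thesis by (simp add: algebra_simps)
    qed
    have "norm ((k1 * (s \<xi>)\<^sup>2 - 2 * k1) * x $ 1 - \<gamma> * (s \<xi>)\<^sup>2 * x $ 8) \<le>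
        2 * k1 * (\<bar>\<xi>\<bar>\<^sup>2 + 1) * norm (x $ 1) + \<bar>\<gamma>\<bar> * \<bar>\<xi>\<bar>\<^sup>2 * norm (x $ 8)"
      by (intro norm_minus_mono)
        (use mult_right_mono[OF c, of "norm (x $ 1)"] in \<open>simp_all add: norm_mult norm_power\<close>)
    also have "\<dots> \<le> (2 * k1 + \<bar>\<gamma>\<bar>) * ((\<bar>\<xi>\<bar>\<^sup>2 + 1) * norm (x $ 1)) + (2 * k1 + \<bar>\<gamma>\<bar>) * (\<bar>\<xi>\<bar>\<^sup>2 * norm (x $ 8))"
      unfolding mult.assoc[symmetric] using k
      by (intro add_mono[OF mult_right_mono mult_right_mono] mult_right_mono) auto
    finally show "norm ((k1 * (s \<xi>)\<^sup>2 - 2 * k1) * x $ 1 - \<gamma> * (s \<xi>)\<^sup>2 * x $ 8) \<le>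
      (2 * k1 + \<bar>\<gamma>\<bar>) * ((\<bar>\<xi>\<bar>\<^sup>2 + 1) * norm (x $ 1) + \<bar>\<xi>\<bar>\<^sup>2 * norm (x $ 8))"
      by (simp add: distrib_left)
  qed simp
  have "eventually form_bound at_top"
    using 1 2 3 4 5 6 7 8 eventually_ge_at_top[of 1] eventually_ge_at_top[of "k1 * (k2 + k3)"]
      eventually_ge_at_top[of "k1 * (k2\<^sup>2 + k3\<^sup>2)"] eventually_ge_at_top[of "k2 + k3"]
      eventually_ge_at_top[of "k2 * k3"]
  proof eventually_elim
    case (elim C)
    then show ?case unfolding form_bound_def by simp
  qed
  then show ?thesis by (auto simp: eventually_at_top_linorder)
qed

end

section \<open>Dissipation at high frequencies\<close>

text \<open>Both the size of a multiplier and its cross term are estimated by replacing two factors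
  by upper bounds; what then remains in each chain step is a comparison of monomials in
  |\<xi>|.\<close>

lemma product_bound:
  fixes \<alpha> \<beta> g f G F :: real
  assumes "0 \<le> \<alpha>" "0 \<le> \<beta>" "0 \<le> g" "g \<le> G" "0 \<le> f" "f \<le> F" "\<alpha> * (\<beta> * G * F) \<le> M"
  shows "\<alpha> * (\<beta> * g * f) \<le> M"
proof -
  have "\<alpha> * (\<beta> * g * f) \<le> \<alpha> * (\<beta> * G * F)"
    using assms by (intro mult_left_mono mult_mono) auto
  then show ?thesis using assms by linarith
qed

lemma square_add_le: "(a + b)\<^sup>2 \<le> 2 * (a\<^sup>2 + b\<^sup>2)" for a b :: real
  using sum_squares_bound[of a b] by (simp add: power2_sum)

lemma square_add3_le: "(a + b + c)\<^sup>2 \<le> 3 * (a\<^sup>2 + b\<^sup>2 + c\<^sup>2)" for a b c :: real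
  using sum_squares_bound[of a b] sum_squares_bound[of a c] sum_squares_bound[of b c]
  by (simp add: power2_eq_square algebra_simps)

lemma norm_le_sum_nth:
  "norm x \<le> norm (x $ 1) + norm (x $ 2) + norm (x $ 3) + norm (x $ 4) + norm (x $ 5) + norm (x $ 6) +
    norm (x $ 7) + norm (x $ 8)" for x :: "complex^8"
proof -
  have "norm x \<le> (\<Sum>i\<in>UNIV. norm (x $ i))"
    unfolding norm_vec_def by (rule L2_set_le_sum) simp
  then show ?thesis by (simp add: sum_8)
qed

lemma square_sum8_le:
  "(a1 + a2 + a3 + a4 + a5 + a6 + a7 + a8)\<^sup>2 \<le>
    8 * (a1\<^sup>2 + a2\<^sup>2 + a3\<^sup>2 + a4\<^sup>2 + a5\<^sup>2 + a6\<^sup>2 + a7\<^sup>2 + a8\<^sup>2)" for a1 :: real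
  using square_add_le[of "(a1 + a2) + (a3 + a4)" "(a5 + a6) + (a7 + a8)"]
    square_add_le[of "a1 + a2" "a3 + a4"] square_add_le[of "a5 + a6" "a7 + a8"]
    square_add_le[of a1 a2] square_add_le[of a3 a4] square_add_le[of a5 a6] square_add_le[of a7 a8]
  by (simp add: add.assoc)

context beam
begin

definition recovery_bound :: "real \<Rightarrow> bool" where
  "recovery_bound K \<longleftrightarrow> 1 \<le> K \<and>
    (\<forall>x. norm (x $ 3) \<le> K * (norm (P x) + norm (T x))) \<and> (\<forall>x. norm (x $ 5) \<le> K * (norm (P x) + norm (T x))) \<and>
    (\<forall>x. norm (x $ 4) \<le> K * (norm (R x) + norm (S x))) \<and> (\<forall>x. norm (x $ 6) \<le> K * (norm (R x) + norm (S x))) \<and>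
    (\<forall>x. norm (x $ 4) \<le> K * (norm (R x) + norm (x $ 4 + x $ 6))) \<and>
    (\<forall>x. norm (x $ 6) \<le> K * (norm (R x) + norm (x $ 4 + x $ 6))) \<and>
    (\<forall>x. norm (x $ 7) \<le> K * (norm (W x) + norm (x $ 2)))"

lemma recovery_boundD:
  assumes "recovery_bound K"
  shows "1 \<le> K" "norm (x $ 3) \<le> K * (norm (P x) + norm (T x))" "norm (x $ 5) \<le> K * (norm (P x) + norm (T x))"
    "norm (x $ 4) \<le> K * (norm (R x) + norm (S x))" "norm (x $ 6) \<le> K * (norm (R x) + norm (S x))"
    "norm (x $ 4) \<le> K * (norm (R x) + norm (x $ 4 + x $ 6))"
    "norm (x $ 6) \<le> K * (norm (R x) + norm (x $ 4 + x $ 6))"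
    "norm (x $ 7) \<le> K * (norm (W x) + norm (x $ 2))"
  using assms unfolding recovery_bound_def by blast+

text \<open>Cramer's rule. The systems for (z, \<phi>) and (y, \<theta>) have determinant k2 k3 (k3
  - k2), and the one formed by \<open>R\<close> and y + \<theta> has determinant k2 - k3: this is
  where k2 \<noteq> k3 enters. For \<sigma> the divisor is k4.\<close>

lemma ex_recovery_bound: "\<exists>K. recovery_bound K"
proof -
  let ?k2 = "complex_of_real k2" and ?k3 = "complex_of_real k3"
  have nz: "?k2 \<noteq> 0" "?k3 \<noteq> 0" "?k2 - ?k3 \<noteq> 0" "?k3 - ?k2 \<noteq> 0" using k k23 by auto
  have ev: "\<forall>\<^sub>F K in at_top. \<forall>(i::unit) (x::complex^8). norm (f x) \<le> K * (norm (u x) + norm (w x))"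
    if e: "e \<noteq> 0" and eq: "\<And>x. e * f x = c * u x + d * w x" for f u w :: "complex^8 \<Rightarrow> complex" and c d e
  proof (rule eventually_bounded_by[where c = "(norm c + norm d) / norm e"])
    fix x
    have "norm e * norm (f x) \<le> norm c * norm (u x) + norm d * norm (w x)"
      unfolding norm_mult[symmetric] eq by (rule norm_triangle_ineq)
    also have "\<dots> \<le> (norm c + norm d) * norm (u x) + (norm c + norm d) * norm (w x)"
      by (intro add_mono mult_right_mono) auto
    finally show "norm (f x) \<le> (norm c + norm d) / norm e * (norm (u x) + norm (w x))"
      using e by (simp add: field_simps)
  qed auto
  have 1: "\<forall>\<^sub>F K in at_top. \<forall>(i::unit) x. norm (x $ 3) \<le> K * (norm (P x) + norm (T x))"
    by (rule ev[of "?k2 * (?k2 - ?k3)" _ "- ?k3" _ 1]) (use nz in simp, unfold P_def T_def of_real_power, algebra)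
  have 2: "\<forall>\<^sub>F K in at_top. \<forall>(i::unit) x. norm (x $ 5) \<le> K * (norm (P x) + norm (T x))"
    by (rule ev[of "?k3 * (?k3 - ?k2)" _ "- ?k2" _ 1]) (use nz in simp, unfold P_def T_def of_real_power, algebra)
  have 3: "\<forall>\<^sub>F K in at_top. \<forall>(i::unit) x. norm (x $ 4) \<le> K * (norm (R x) + norm (S x))"
    by (rule ev[of "?k2 * (?k2 - ?k3)" _ "- ?k3" _ 1]) (use nz in simp, unfold R_def S_def of_real_power, algebra)
  have 4: "\<forall>\<^sub>F K in at_top. \<forall>(i::unit) x. norm (x $ 6) \<le> K * (norm (R x) + norm (S x))"
    by (rule ev[of "?k3 * (?k3 - ?k2)" _ "- ?k2" _ 1]) (use nz in simp, unfold R_def S_def of_real_power, algebra)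
  have 5: "\<forall>\<^sub>F K in at_top. \<forall>(i::unit) (x::complex^8). norm (x $ 4) \<le> K * (norm (R x) + norm (x $ 4 + x $ 6))"
    by (rule ev[of "?k2 - ?k3" _ 1 _ "- ?k3"]) (use nz in simp, unfold R_def, algebra)
  have 6: "\<forall>\<^sub>F K in at_top. \<forall>(i::unit) (x::complex^8). norm (x $ 6) \<le> K * (norm (R x) + norm (x $ 4 + x $ 6))"
    by (rule ev[of "?k3 - ?k2" _ 1 _ "- ?k2"]) (use nz in simp, unfold R_def, algebra)
  have 7: "\<forall>\<^sub>F K in at_top. \<forall>(i::unit) x. norm (x $ 7) \<le> K * (norm (W x) + norm (x $ 2))"
    by (rule ev[of "complex_of_real k4" _ 1 _ "complex_of_real \<gamma>"]) (use k in simp, simp add: W_def)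
  have "eventually recovery_bound at_top"
    using 1 2 3 4 5 6 7 eventually_ge_at_top[of 1]
  proof eventually_elim
    case (elim K)
    then show ?case unfolding recovery_bound_def by simp
  qed
  then show ?thesis by (auto simp: eventually_at_top_linorder)
qed

text \<open>Up to the factor 2 k5 this is what the energy dissipates, with its power of \<xi>.
  Keeping that power matters for \<epsilon> = 1, where the damping term in the equation of \<eta>
  has size \<xi>^2 |\<eta>|.\<close>

definition Nh :: "real \<Rightarrow> complex^8 \<Rightarrow> real" where "Nh \<xi> x = (\<bar>\<xi>\<bar> ^ \<epsilon> * norm (x $ 8))\<^sup>2"

text \<open>A name for the reciprocal keeps division out of the estimates: with the relation
  \<open>inv_abs \<xi> * \<bar>\<xi>\<bar> = 1\<close> they become polynomial identities.\<close>

definition inv_abs :: "real \<Rightarrow> real" where "inv_abs \<xi> = inverse \<bar>\<xi>\<bar>"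

text \<open>The cross terms of the early steps involve v without weight and \<open>Q\<close> with a
  single reciprocal, which the last summand alone would not cover. That last summand yields the rate
  \<xi>^(-2).\<close>

definition Th :: "real \<Rightarrow> complex^8 \<Rightarrow> real" where
  "Th \<xi> x = (norm (W x))\<^sup>2 + (norm (x $ 1))\<^sup>2 + (inv_abs \<xi> * norm (Q \<xi> x))\<^sup>2 + (inv_abs \<xi> * norm x)\<^sup>2"

lemma norm_eta_le_Nh: "1 \<le> \<bar>\<xi>\<bar> \<Longrightarrow> (norm (x $ 8))\<^sup>2 \<le> Nh \<xi> x"
  unfolding Nh_def power_mult_distrib
  by (rule order_trans[OF _ mult_right_mono[of 1]]) auto

text \<open>The dissipation is passed on along the chain \<open>\<eta>\<close>, \<open>W\<close>, \<open>v\<close>, \<open>Q\<close>, \<open>P\<close>, \<open>R\<close>, \<open>T\<close>, \<open>S\<close>.\<close>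

lemma dissipated_high: "dissipated A {\<xi>. 1 \<le> \<bar>\<xi>\<bar>} Th Nh Th"
proof -
  obtain C where "form_bound C" using ex_form_bound by blast
  note C = form_boundD[OF this]
  let ?H = "{\<xi>::real. 1 \<le> \<bar>\<xi>\<bar>}"
  have N0: "0 \<le> Nh \<xi> x" and T0: "0 \<le> Th \<xi> x" for \<xi> x by (simp_all add: Nh_def Th_def)
  have TH: "(norm (W x))\<^sup>2 \<le> Th \<xi> x" "(norm (x $ 1))\<^sup>2 \<le> Th \<xi> x"
    "(inv_abs \<xi> * norm (Q \<xi> x))\<^sup>2 \<le> Th \<xi> x" "(inv_abs \<xi> * norm x)\<^sup>2 \<le> Th \<xi> x" for \<xi> x
    by (simp_all add: Th_def)
  have C0: "0 \<le> C" using C(1) by simp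
  have \<rho>: "inv_abs \<xi> * \<bar>\<xi>\<bar> = 1" "0 < inv_abs \<xi>" "inv_abs \<xi> \<le> 1" if "\<xi> \<in> ?H" for \<xi>
    using that by (auto simp: inv_abs_def inverse_le_1_iff)
  have p1: "p * X \<le> X" if "0 \<le> p" "p \<le> 1" "0 \<le> X" for p X :: real
    using that by (simp add: mult_left_le_one_le)
  note le = Finite_Cartesian_Product.norm_nth_le
  note eta = norm_eta_le_Nh
  have sqs: "0 \<le> (norm (W x))\<^sup>2" "0 \<le> (norm (x $ 1))\<^sup>2" "0 \<le> (inv_abs \<xi> * norm (Q \<xi> x))\<^sup>2"
    "0 \<le> (inv_abs \<xi> * norm (P x))\<^sup>2" "0 \<le> (inv_abs \<xi> * norm (R x))\<^sup>2" "0 \<le> (inv_abs \<xi> * norm (T x))\<^sup>2"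
    "0 \<le> Nh \<xi> x" "0 \<le> (inv_abs \<xi> * norm x)\<^sup>2" "(norm (x $ 8))\<^sup>2 \<le> Nh \<xi> x"
    "(2 * norm (x $ 1))\<^sup>2 = 4 * (norm (x $ 1))\<^sup>2"
    "(norm (W x))\<^sup>2 \<le> Th \<xi> x" "(norm (x $ 1))\<^sup>2 \<le> Th \<xi> x"
    "(inv_abs \<xi> * norm (Q \<xi> x))\<^sup>2 \<le> Th \<xi> x" "(inv_abs \<xi> * norm x)\<^sup>2 \<le> Th \<xi> x"
    if H: "\<xi> \<in> ?H" for \<xi> and x :: "complex^8"
    using N0 eta H TH by (simp_all add: power_mult_distrib)
  have Q2: "norm (Q \<xi> x) \<le> 2 * C * (\<bar>\<xi>\<bar> * norm x)" if "\<xi> \<in> ?H" for \<xi> x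
  proof -
    have "(\<bar>\<xi>\<bar> + 1) * norm x \<le> (2 * \<bar>\<xi>\<bar>) * norm x" using that by (intro mult_right_mono) auto
    then have "C * ((\<bar>\<xi>\<bar> + 1) * norm x) \<le> C * ((2 * \<bar>\<xi>\<bar>) * norm x)" using C0 by (rule mult_left_mono)
    then show ?thesis using C(7)[of \<xi> x] by (simp add: algebra_simps)
  qed
  let ?q1 = "\<lambda>\<xi> x. Nh \<xi> x + (norm (W x))\<^sup>2"
  let ?q2 = "\<lambda>\<xi> x. ?q1 \<xi> x + (norm (x $ 1))\<^sup>2"
  let ?q3 = "\<lambda>\<xi> x. ?q2 \<xi> x + (inv_abs \<xi> * norm (Q \<xi> x))\<^sup>2"
  let ?q4 = "\<lambda>\<xi> x. ?q3 \<xi> x + (inv_abs \<xi> * norm (P x))\<^sup>2"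
  let ?q5 = "\<lambda>\<xi> x. ?q4 \<xi> x + (inv_abs \<xi> * norm (R x))\<^sup>2"
  let ?q6 = "\<lambda>\<xi> x. ?q5 \<xi> x + (inv_abs \<xi> * norm (T x))\<^sup>2"
  let ?q7 = "\<lambda>\<xi> x. ?q6 \<xi> x + (inv_abs \<xi> * norm (S x))\<^sup>2"
  have 0: "dissipated A ?H Th Nh Nh" by (rule dissipated_observed[OF T0])
  have 1: "dissipated A ?H Th Nh ?q1"
  proof (rule dissipated_chain[OF 0, where \<alpha> = "\<lambda>\<xi>. (inv_abs \<xi>)\<^sup>2" and b = s and f = "\<lambda>_ x. x $ 8" and g = "\<lambda>_. W"
        and h = "\<lambda>\<xi> x. - complex_of_real (k5 * \<xi> ^ (2 * \<epsilon>)) * x $ 8" and L = 1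
        and ?M1.0 = C and ?M2.0 = "k5\<^sup>2" and ?M3.0 = 1 and ?M4.0 = "2 * C\<^sup>2"
        and a = "\<lambda>\<xi> x. norm (x $ 8)" and y = "\<lambda>\<xi> x. C * (norm (x $ 1) + norm (x $ 8))"])
    fix \<xi> and x :: "complex^8" assume H: "\<xi> \<in> ?H"
    note \<rho> = \<rho>[OF H]
    note sqs = sqs[OF H, of x]
    show "(inv_abs \<xi>)\<^sup>2 * (norm (s \<xi>) * norm (W x) * norm (x $ 8)) \<le> C * (norm x)\<^sup>2"
    proof (rule product_bound[OF _ _ _ C(2) _ le])
      have "(inv_abs \<xi>)\<^sup>2 * (norm (s \<xi>) * (C * norm x) * norm x) = inv_abs \<xi> * (C * (norm x)\<^sup>2)"
        unfolding norm_s using \<rho>(1) by algebra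
      also have "\<dots> \<le> C * (norm x)\<^sup>2" using \<rho> C0 by (intro p1) auto
      finally show "(inv_abs \<xi>)\<^sup>2 * (norm (s \<xi>) * (C * norm x) * norm x) \<le> C * (norm x)\<^sup>2" .
    qed auto
    show "(inv_abs \<xi>)\<^sup>2 * (norm (- complex_of_real (k5 * \<xi> ^ (2 * \<epsilon>)) * x $ 8))\<^sup>2 \<le> k5\<^sup>2 * Nh \<xi> x"
    proof -
      \<comment> \<open>For \<epsilon> = 1 one factor |\<xi>| of the damping sits in
        \<open>Nh\<close> and the other is cancelled by the weight; for \<epsilon> = 0 the weight is
        at most 1.\<close>
      have "norm (- complex_of_real (k5 * \<xi> ^ (2 * \<epsilon>)) * x $ 8) = \<bar>k5\<bar> * (\<bar>\<xi>\<bar> ^ \<epsilon>)\<^sup>2 * norm (x $ 8)"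
        unfolding norm_mult norm_minus_cancel norm_of_real abs_mult using \<epsilon> by auto
      note n = this
      have "(inv_abs \<xi>)\<^sup>2 * (norm (- complex_of_real (k5 * \<xi> ^ (2 * \<epsilon>)) * x $ 8))\<^sup>2 =
          (inv_abs \<xi> * \<bar>\<xi>\<bar> ^ \<epsilon>)\<^sup>2 * (\<bar>k5\<bar>\<^sup>2 * Nh \<xi> x)"
        unfolding Nh_def n by (simp only: power_mult_distrib power2_eq_square mult_ac)
      also have "\<dots> = (inv_abs \<xi> * \<bar>\<xi>\<bar> ^ \<epsilon>)\<^sup>2 * (k5\<^sup>2 * Nh \<xi> x)" by simp
      also have "\<dots> \<le> k5\<^sup>2 * Nh \<xi> x"
        using \<epsilon> \<rho> N0[of \<xi> x] by (intro p1) (auto simp: power_le_one)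
      finally show ?thesis .
    qed
    show "(norm (x $ 8))\<^sup>2 \<le> 1 * Nh \<xi> x" using eta[of \<xi> x] H by simp
    show "(C * (norm (x $ 1) + norm (x $ 8)))\<^sup>2 \<le> 2 * C\<^sup>2 * (Nh \<xi> x + Th \<xi> x)"
    proof -
      have "(norm (x $ 1) + norm (x $ 8))\<^sup>2 \<le> 2 * (Nh \<xi> x + Th \<xi> x)"
        using square_add_le[of "norm (x $ 1)" "norm (x $ 8)"] eta[of \<xi> x] H TH(2)[where \<xi> = \<xi> and x = x] by simp
      from mult_left_mono[OF this zero_le_power2[of C]] show ?thesis
        by (simp only: power_mult_distrib mult_ac)
    qed
    show "(inv_abs \<xi>)\<^sup>2 * (norm (s \<xi>) * norm (W (A \<xi> *v x)) * norm (x $ 8)) \<le>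
        norm (x $ 8) * (C * (norm (x $ 1) + norm (x $ 8)))"
    proof (rule product_bound[OF _ _ _ C(8) _ order_refl])
      have "(inv_abs \<xi>)\<^sup>2 * (norm (s \<xi>) * (C * (\<bar>\<xi>\<bar> * (norm (x $ 1) + norm (x $ 8)))) * norm (x $ 8)) =
          norm (x $ 8) * (C * (norm (x $ 1) + norm (x $ 8)))"
        unfolding norm_s using \<rho>(1) by algebra
      then show "(inv_abs \<xi>)\<^sup>2 * (norm (s \<xi>) * (C * (\<bar>\<xi>\<bar> * (norm (x $ 1) + norm (x $ 8)))) * norm (x $ 8)) \<le>
          norm (x $ 8) * (C * (norm (x $ 1) + norm (x $ 8)))" by (rule eq_refl)
    qed auto
    have E: "(inv_abs \<xi>)\<^sup>2 * (norm (s \<xi>) * norm (W x))\<^sup>2 = (norm (W x))\<^sup>2"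
      unfolding norm_s using \<rho>(1) by algebra
    show "(norm (W x))\<^sup>2 \<le> 1 * ((inv_abs \<xi>)\<^sup>2 * (norm (s \<xi>) * norm (W x))\<^sup>2)" by (simp only: E mult_1 order_refl)
  qed (use C0 N0 T0 in \<open>auto simp: forms_A linear_nth linear_forms\<close>)
  \<comment> \<open>The coefficient of v in the derivative of \<open>W\<close> is - \<gamma> k1 s,
    so \<gamma> \<noteq> 0 lets the dissipation pass. The derivative of v is exactly
    \<open>Q\<close>, which the total controls after one division by |\<xi>|.\<close>
  have 2: "dissipated A ?H Th Nh ?q2"
  proof (rule dissipated_chain[OF 1, where \<alpha> = "\<lambda>\<xi>. (inv_abs \<xi>)\<^sup>2" and b = "\<lambda>\<xi>. - (\<gamma> * k1 * s \<xi>)"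
        and f = "\<lambda>\<xi> x. W x" and g = "\<lambda>\<xi> x. x $ 1" and h = "\<lambda>\<xi> x. complex_of_real (k4 + \<gamma>\<^sup>2) * s \<xi> * x $ 8" and L = "1 / \<bar>\<gamma> * k1\<bar>\<^sup>2"
        and ?M1.0 = "\<bar>\<gamma> * k1\<bar> * C" and ?M2.0 = "(k4 + \<gamma>\<^sup>2)\<^sup>2" and ?M3.0 = "1" and ?M4.0 = "\<bar>\<gamma> * k1\<bar>\<^sup>2"
        and a = "\<lambda>\<xi> x. norm (W x)" and y = "\<lambda>\<xi> x. \<bar>\<gamma> * k1\<bar> * (inv_abs \<xi> * norm (Q \<xi> x))"])
    fix \<xi> and x :: "complex^8" assume H: "\<xi> \<in> ?H"
    note \<rho> = \<rho>[OF H]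
    note sqs = sqs[OF H, of x]
    have b: "norm (- (\<gamma> * k1 * s \<xi>)) = \<bar>\<gamma> * k1\<bar> * \<bar>\<xi>\<bar>" by (simp add: norm_mult norm_power abs_mult)
    show "(inv_abs \<xi>)\<^sup>2 * (norm (- (\<gamma> * k1 * s \<xi>)) * norm (x $ 1) * norm (W x)) \<le> \<bar>\<gamma> * k1\<bar> * C * (norm x)\<^sup>2"
      unfolding b
    proof (rule product_bound[OF _ _ _ le _ C(2)])
      have "(inv_abs \<xi>)\<^sup>2 * (\<bar>\<gamma> * k1\<bar> * \<bar>\<xi>\<bar> * (norm x) * (C * norm x)) = inv_abs \<xi> * (\<bar>\<gamma> * k1\<bar> * C * (norm x)\<^sup>2)"
        using \<rho>(1) by algebra
      also have "\<dots> \<le> \<bar>\<gamma> * k1\<bar> * C * (norm x)\<^sup>2"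
        using \<rho> C0 by (intro p1) (auto simp: power_le_one)
      finally show "(inv_abs \<xi>)\<^sup>2 * (\<bar>\<gamma> * k1\<bar> * \<bar>\<xi>\<bar> * (norm x) * (C * norm x)) \<le> \<bar>\<gamma> * k1\<bar> * C * (norm x)\<^sup>2" .
    qed auto
    show "(inv_abs \<xi>)\<^sup>2 * (norm (complex_of_real (k4 + \<gamma>\<^sup>2) * s \<xi> * x $ 8))\<^sup>2 \<le> (k4 + \<gamma>\<^sup>2)\<^sup>2 * (?q1 \<xi> x)"
      proof -
      have "norm (complex_of_real (k4 + \<gamma>\<^sup>2) * s \<xi> * x $ 8) = \<bar>k4 + \<gamma>\<^sup>2\<bar> * \<bar>\<xi>\<bar> * norm (x $ 8)"
        by (simp only: norm_mult norm_of_real norm_ii mult_1)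
      then have "(inv_abs \<xi>)\<^sup>2 * (norm (complex_of_real (k4 + \<gamma>\<^sup>2) * s \<xi> * x $ 8))\<^sup>2 = \<bar>k4 + \<gamma>\<^sup>2\<bar>\<^sup>2 * (norm (x $ 8))\<^sup>2"
        using \<rho>(1) by algebra
      also have "\<dots> \<le> \<bar>k4 + \<gamma>\<^sup>2\<bar>\<^sup>2 * (?q1 \<xi> x)"
        by (rule mult_left_mono) (use sqs in linarith, simp)
      finally show ?thesis by simp
    qed
    show "(norm (W x))\<^sup>2 \<le> 1 * (?q1 \<xi> x)"
      unfolding mult_1 using sqs by linarith
    show "(\<bar>\<gamma> * k1\<bar> * (inv_abs \<xi> * norm (Q \<xi> x)))\<^sup>2 \<le> \<bar>\<gamma> * k1\<bar>\<^sup>2 * (?q1 \<xi> x + Th \<xi> x)"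
      proof -
      have "(\<bar>\<gamma> * k1\<bar> * (inv_abs \<xi> * norm (Q \<xi> x)))\<^sup>2 = \<bar>\<gamma> * k1\<bar>\<^sup>2 * (inv_abs \<xi> * norm (Q \<xi> x))\<^sup>2" by algebra
      also have "\<dots> \<le> \<bar>\<gamma> * k1\<bar>\<^sup>2 * (?q1 \<xi> x + Th \<xi> x)" by (rule mult_left_mono) (use sqs in linarith, simp)
      finally show ?thesis .
    qed
    show "(inv_abs \<xi>)\<^sup>2 * (norm (- (\<gamma> * k1 * s \<xi>)) * norm ((A \<xi> *v x) $ 1) * norm (W x)) \<le> norm (W x) * (\<bar>\<gamma> * k1\<bar> * (inv_abs \<xi> * norm (Q \<xi> x)))"
      unfolding b
    proof (rule product_bound[OF _ _ _ eq_refl[OF arg_cong[OF forms_A(3), of norm]] _ order_refl])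
      show "(inv_abs \<xi>)\<^sup>2 * (\<bar>\<gamma> * k1\<bar> * \<bar>\<xi>\<bar> * (norm (Q \<xi> x)) * norm (W x)) \<le> norm (W x) * (\<bar>\<gamma> * k1\<bar> * (inv_abs \<xi> * norm (Q \<xi> x)))"
        by (rule eq_refl) (use \<rho>(1) in algebra)
    qed auto
    have "(norm (x $ 1))\<^sup>2 = 1 / \<bar>\<gamma> * k1\<bar>\<^sup>2 * ((inv_abs \<xi>)\<^sup>2 * (\<bar>\<gamma> * k1\<bar> * \<bar>\<xi>\<bar> * norm (x $ 1))\<^sup>2)"
    proof -
      have "(inv_abs \<xi>)\<^sup>2 * \<xi>\<^sup>2 = 1" by (metis \<rho>(1) power2_abs power_mult_distrib power_one)
      then show ?thesis using \<gamma> k by (simp add: power_mult_distrib field_simps)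
    qed
    then show "(norm (x $ 1))\<^sup>2 \<le> 1 / \<bar>\<gamma> * k1\<bar>\<^sup>2 * ((inv_abs \<xi>)\<^sup>2 * (norm (- (\<gamma> * k1 * s \<xi>)) * norm (x $ 1))\<^sup>2)"
      unfolding b by (rule eq_refl)
  qed (use C0 N0 T0 in \<open>auto simp: forms_A linear_nth linear_forms\<close>)
  have Q': "norm (Q \<xi> (A \<xi> *v x)) \<le> \<bar>\<xi>\<bar> * (C * norm x) + C * (2 * \<bar>\<xi>\<bar>\<^sup>2 * norm (x $ 1) + \<bar>\<xi>\<bar>\<^sup>2 * norm (x $ 8))"
    and Qr: "norm ((k1 * (s \<xi>)\<^sup>2 - 2 * k1) * x $ 1 - \<gamma> * (s \<xi>)\<^sup>2 * x $ 8) \<le> C * (2 * \<bar>\<xi>\<bar>\<^sup>2 * norm (x $ 1) + \<bar>\<xi>\<bar>\<^sup>2 * norm (x $ 8))"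
    if "\<xi> \<in> ?H" for \<xi> x
  proof -
    have "(\<bar>\<xi>\<bar>\<^sup>2 + 1) * norm (x $ 1) \<le> (2 * \<bar>\<xi>\<bar>\<^sup>2) * norm (x $ 1)"
      using that one_le_power[of "\<bar>\<xi>\<bar>" 2] by (intro mult_right_mono) auto
    then have "C * ((\<bar>\<xi>\<bar>\<^sup>2 + 1) * norm (x $ 1) + \<bar>\<xi>\<bar>\<^sup>2 * norm (x $ 8)) \<le> C * (2 * \<bar>\<xi>\<bar>\<^sup>2 * norm (x $ 1) + \<bar>\<xi>\<bar>\<^sup>2 * norm (x $ 8))"
      using C0 by (intro mult_left_mono) auto
    then show *: "norm ((k1 * (s \<xi>)\<^sup>2 - 2 * k1) * x $ 1 - \<gamma> * (s \<xi>)\<^sup>2 * x $ 8) \<le> C * (2 * \<bar>\<xi>\<bar>\<^sup>2 * norm (x $ 1) + \<bar>\<xi>\<bar>\<^sup>2 * norm (x $ 8))"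
      using C(9)[of \<xi> x] by linarith
    have "norm (s \<xi> * P x) \<le> \<bar>\<xi>\<bar> * (C * norm x)"
      unfolding norm_mult[of "s \<xi>" "P x"] norm_s by (intro mult_left_mono C(3)) auto
    then show "norm (Q \<xi> (A \<xi> *v x)) \<le> \<bar>\<xi>\<bar> * (C * norm x) + C * (2 * \<bar>\<xi>\<bar>\<^sup>2 * norm (x $ 1) + \<bar>\<xi>\<bar>\<^sup>2 * norm (x $ 8))"
      unfolding forms_A using * by (rule norm_triangle_mono)
  qed
  \<comment> \<open>The derivative of \<open>Q\<close> grows like \<xi>^2 |v|; the weight \<xi>^(-2)
    reduces it to the unweighted v contained in the total.\<close>
  have 3: "dissipated A ?H Th Nh ?q3"
  proof (rule dissipated_chain[OF 2, where \<alpha> = "\<lambda>\<xi>. (inv_abs \<xi>)\<^sup>2" and b = "\<lambda>\<xi>. 1"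
        and f = "\<lambda>\<xi> x. x $ 1" and g = "\<lambda>\<xi> x. Q \<xi> x" and h = "\<lambda>\<xi> x. 0" and L = "1"
        and ?M1.0 = "2 * C" and ?M2.0 = "0" and ?M3.0 = "1" and ?M4.0 = "12 * C\<^sup>2"
        and a = "\<lambda>\<xi> x. norm (x $ 1)" and y = "\<lambda>\<xi> x. C * (inv_abs \<xi> * norm x + 2 * norm (x $ 1) + norm (x $ 8))"])
    fix \<xi> and x :: "complex^8" assume H: "\<xi> \<in> ?H"
    note \<rho> = \<rho>[OF H]
    note sqs = sqs[OF H, of x]
    have b: "norm (1::complex) = 1" by (simp add: norm_mult norm_power abs_mult)
    show "(inv_abs \<xi>)\<^sup>2 * (norm (1::complex) * norm (Q \<xi> x) * norm (x $ 1)) \<le> 2 * C * (norm x)\<^sup>2"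
      unfolding b
    proof (rule product_bound[OF _ _ _ Q2[OF H] _ le])
      have "(inv_abs \<xi>)\<^sup>2 * (1 * (2 * C * (\<bar>\<xi>\<bar> * norm x)) * (norm x)) = inv_abs \<xi> * (2 * C * (norm x)\<^sup>2)"
        using \<rho>(1) by algebra
      also have "\<dots> \<le> 2 * C * (norm x)\<^sup>2"
        using \<rho> C0 by (intro p1) (auto simp: power_le_one)
      finally show "(inv_abs \<xi>)\<^sup>2 * (1 * (2 * C * (\<bar>\<xi>\<bar> * norm x)) * (norm x)) \<le> 2 * C * (norm x)\<^sup>2" .
    qed auto
    show "(inv_abs \<xi>)\<^sup>2 * (norm (0::complex))\<^sup>2 \<le> 0 * (?q2 \<xi> x)"
      by simp
    show "(norm (x $ 1))\<^sup>2 \<le> 1 * (?q2 \<xi> x)"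
      unfolding mult_1 using sqs by linarith
    show "(C * (inv_abs \<xi> * norm x + 2 * norm (x $ 1) + norm (x $ 8)))\<^sup>2 \<le> 12 * C\<^sup>2 * (?q2 \<xi> x + Th \<xi> x)"
      proof -
      have "(inv_abs \<xi> * norm x + 2 * norm (x $ 1) + norm (x $ 8))\<^sup>2 \<le> 12 * (?q2 \<xi> x + Th \<xi> x)"
        using square_add3_le[of "inv_abs \<xi> * norm x" "2 * norm (x $ 1)" "norm (x $ 8)"] sqs
        unfolding distrib_left by linarith
      from mult_left_mono[OF this zero_le_power2[of C]] show ?thesis
        by (simp only: power_mult_distrib mult_ac)
    qed
    show "(inv_abs \<xi>)\<^sup>2 * (norm (1::complex) * norm (Q \<xi> (A \<xi> *v x)) * norm (x $ 1)) \<le> norm (x $ 1) * (C * (inv_abs \<xi> * norm x + 2 * norm (x $ 1) + norm (x $ 8)))"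
      unfolding b
    proof (rule product_bound[OF _ _ _ Q'[OF H] _ order_refl])
      show "(inv_abs \<xi>)\<^sup>2 * (1 * (\<bar>\<xi>\<bar> * (C * norm x) + C * (2 * \<bar>\<xi>\<bar>\<^sup>2 * norm (x $ 1) + \<bar>\<xi>\<bar>\<^sup>2 * norm (x $ 8))) * norm (x $ 1)) \<le> norm (x $ 1) * (C * (inv_abs \<xi> * norm x + 2 * norm (x $ 1) + norm (x $ 8)))"
        by (rule eq_refl) (use \<rho>(1) in algebra)
    qed auto
    have "(inv_abs \<xi> * norm (Q \<xi> x))\<^sup>2 = 1 * ((inv_abs \<xi>)\<^sup>2 * (1 * norm (Q \<xi> x))\<^sup>2)"
      by (simp add: power_mult_distrib)
    then show "(inv_abs \<xi> * norm (Q \<xi> x))\<^sup>2 \<le> 1 * ((inv_abs \<xi>)\<^sup>2 * (norm (1::complex) * norm (Q \<xi> x))\<^sup>2)"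
      unfolding b by (rule eq_refl)
  qed (use C0 N0 T0 in \<open>auto simp: forms_A linear_nth linear_forms\<close>)
  have sbound: "norm (s \<xi> * z) \<le> \<bar>\<xi>\<bar> * (C * norm x)" if "norm z \<le> C * norm x" for \<xi> z and x :: "complex^8"
    unfolding norm_mult[of "s \<xi>" z] norm_s using that by (intro mult_left_mono) auto
  \<comment> \<open>The remainder in the derivative of \<open>Q\<close> contains \<xi>^2 v and
    \<xi>^2 \<eta>, so its square needs the weight \<xi>^(-4). One factor \<xi>^2 is regained from
    the coefficient s of \<open>P\<close>; the loss \<xi>^(-2) stays with all later combinations and
    is the source of the rate.\<close>
  have 4: "dissipated A ?H Th Nh ?q4"
  proof (rule dissipated_chain[OF 3, where \<alpha> = "\<lambda>\<xi>. (inv_abs \<xi>)^4" and b = "\<lambda>\<xi>. s \<xi>"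
        and f = "\<lambda>\<xi> x. Q \<xi> x" and g = "\<lambda>\<xi> x. P x" and h = "\<lambda>\<xi> x. (k1 * (s \<xi>)\<^sup>2 - 2 * k1) * x $ 1 - \<gamma> * (s \<xi>)\<^sup>2 * x $ 8" and L = "1"
        and ?M1.0 = "2 * C\<^sup>2" and ?M2.0 = "8 * C\<^sup>2" and ?M3.0 = "1" and ?M4.0 = "C\<^sup>2"
        and a = "\<lambda>\<xi> x. inv_abs \<xi> * norm (Q \<xi> x)" and y = "\<lambda>\<xi> x. C * (inv_abs \<xi> * norm x)"])
    fix \<xi> and x :: "complex^8" assume H: "\<xi> \<in> ?H"
    note \<rho> = \<rho>[OF H]
    note sqs = sqs[OF H, of x]
    have b: "norm (s \<xi>) = \<bar>\<xi>\<bar>" by (simp add: norm_mult norm_power abs_mult)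
    show "(inv_abs \<xi>)^4 * (norm (s \<xi>) * norm (P x) * norm (Q \<xi> x)) \<le> 2 * C\<^sup>2 * (norm x)\<^sup>2"
      unfolding b
    proof (rule product_bound[OF _ _ _ C(3) _ Q2[OF H]])
      have "(inv_abs \<xi>)^4 * (\<bar>\<xi>\<bar> * (C * norm x) * (2 * C * (\<bar>\<xi>\<bar> * norm x))) = (inv_abs \<xi>)\<^sup>2 * (2 * C\<^sup>2 * (norm x)\<^sup>2)"
        using \<rho>(1) by algebra
      also have "\<dots> \<le> 2 * C\<^sup>2 * (norm x)\<^sup>2"
        using \<rho> C0 by (intro p1) (auto simp: power_le_one)
      finally show "(inv_abs \<xi>)^4 * (\<bar>\<xi>\<bar> * (C * norm x) * (2 * C * (\<bar>\<xi>\<bar> * norm x))) \<le> 2 * C\<^sup>2 * (norm x)\<^sup>2" .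
    qed auto
    show "(inv_abs \<xi>)^4 * (norm ((k1 * (s \<xi>)\<^sup>2 - 2 * k1) * x $ 1 - \<gamma> * (s \<xi>)\<^sup>2 * x $ 8))\<^sup>2 \<le> 8 * C\<^sup>2 * (?q3 \<xi> x)"
      proof -
      have "(inv_abs \<xi>)^4 * (norm ((k1 * (s \<xi>)\<^sup>2 - 2 * k1) * x $ 1 - \<gamma> * (s \<xi>)\<^sup>2 * x $ 8))\<^sup>2 \<le> (inv_abs \<xi>)^4 * (C * (2 * \<bar>\<xi>\<bar>\<^sup>2 * norm (x $ 1) + \<bar>\<xi>\<bar>\<^sup>2 * norm (x $ 8)))\<^sup>2"
        using Qr[OF H] by (intro mult_left_mono power_mono) auto
      also have "\<dots> = C\<^sup>2 * (2 * norm (x $ 1) + norm (x $ 8))\<^sup>2" using \<rho>(1) by algebra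
      also have "\<dots> \<le> C\<^sup>2 * (8 * (?q3 \<xi> x))"
      proof (rule mult_left_mono)
        show "(2 * norm (x $ 1) + norm (x $ 8))\<^sup>2 \<le> 8 * (?q3 \<xi> x)"
          using square_add_le[of "2 * norm (x $ 1)" "norm (x $ 8)"] sqs unfolding distrib_left by linarith
      qed simp
     finally show ?thesis by (simp only: mult_ac)
    qed
    show "(inv_abs \<xi> * norm (Q \<xi> x))\<^sup>2 \<le> 1 * (?q3 \<xi> x)"
      unfolding mult_1 using sqs by linarith
    show "(C * (inv_abs \<xi> * norm x))\<^sup>2 \<le> C\<^sup>2 * (?q3 \<xi> x + Th \<xi> x)"
      proof -
      have "(C * (inv_abs \<xi> * norm x))\<^sup>2 = C\<^sup>2 * (inv_abs \<xi> * norm x)\<^sup>2" by algebra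
      also have "\<dots> \<le> C\<^sup>2 * (?q3 \<xi> x + Th \<xi> x)" by (rule mult_left_mono) (use sqs in linarith, use C0 in simp)
      finally show ?thesis .
    qed
    show "(inv_abs \<xi>)^4 * (norm (s \<xi>) * norm (P (A \<xi> *v x)) * norm (Q \<xi> x)) \<le> inv_abs \<xi> * norm (Q \<xi> x) * (C * (inv_abs \<xi> * norm x))"
      unfolding b
    proof (rule product_bound[OF _ _ _ eq_refl[OF arg_cong[OF forms_A(5), of norm], THEN order_trans, OF sbound[OF C(4)]] _ order_refl])
      show "(inv_abs \<xi>)^4 * (\<bar>\<xi>\<bar> * (\<bar>\<xi>\<bar> * (C * norm x)) * norm (Q \<xi> x)) \<le> inv_abs \<xi> * norm (Q \<xi> x) * (C * (inv_abs \<xi> * norm x))"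
        by (rule eq_refl) (use \<rho>(1) in algebra)
    qed auto
    have "(inv_abs \<xi> * norm (P x))\<^sup>2 = 1 * ((inv_abs \<xi>)^4 * (\<bar>\<xi>\<bar> * norm (P x))\<^sup>2)"
      using \<rho>(1) by algebra
    then show "(inv_abs \<xi> * norm (P x))\<^sup>2 \<le> 1 * ((inv_abs \<xi>)^4 * (norm (s \<xi>) * norm (P x))\<^sup>2)"
      unfolding b by (rule eq_refl)
  qed (use C0 N0 T0 in \<open>auto simp: forms_A linear_nth linear_forms\<close>)
  have R': "norm (R (A \<xi> *v x)) \<le> 2 * C * (\<bar>\<xi>\<bar> * norm x)" if "\<xi> \<in> ?H" for \<xi> x
  proof -
    have "norm (R (A \<xi> *v x)) \<le> \<bar>\<xi>\<bar> * (C * norm x) + C * norm x"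
      unfolding forms_A
    proof (rule norm_triangle_mono[OF sbound[OF C(5)]])
      show "norm (complex_of_real (- (k1 * (k2 + k3))) * x $ 1) \<le> C * norm x"
        unfolding norm_mult norm_of_real abs_minus_cancel
        using k C(10) C0 by (intro mult_mono le) auto
    qed
    moreover have "C * norm x \<le> \<bar>\<xi>\<bar> * (C * norm x)" using that C0 mult_right_mono[of 1 "\<bar>\<xi>\<bar>" "C * norm x"] by simp
    moreover have "2 * C * (\<bar>\<xi>\<bar> * norm x) = \<bar>\<xi>\<bar> * (C * norm x) + \<bar>\<xi>\<bar> * (C * norm x)" by algebra
    ultimately show ?thesis by linarith
  qed
  have 5: "dissipated A ?H Th Nh ?q5"
  proof (rule dissipated_chain[OF 4, where \<alpha> = "\<lambda>\<xi>. (inv_abs \<xi>)^4" and b = "\<lambda>\<xi>. s \<xi>"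
        and f = "\<lambda>\<xi> x. P x" and g = "\<lambda>\<xi> x. R x" and h = "\<lambda>\<xi> x. 0" and L = "1"
        and ?M1.0 = "C\<^sup>2" and ?M2.0 = "0" and ?M3.0 = "1" and ?M4.0 = "4 * C\<^sup>2"
        and a = "\<lambda>\<xi> x. inv_abs \<xi> * norm (P x)" and y = "\<lambda>\<xi> x. 2 * C * (inv_abs \<xi> * norm x)"])
    fix \<xi> and x :: "complex^8" assume H: "\<xi> \<in> ?H"
    note \<rho> = \<rho>[OF H]
    note sqs = sqs[OF H, of x]
    have b: "norm (s \<xi>) = \<bar>\<xi>\<bar>" by (simp add: norm_mult norm_power abs_mult)
    show "(inv_abs \<xi>)^4 * (norm (s \<xi>) * norm (R x) * norm (P x)) \<le> C\<^sup>2 * (norm x)\<^sup>2"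
      unfolding b
    proof (rule product_bound[OF _ _ _ C(4) _ C(3)])
      have "(inv_abs \<xi>)^4 * (\<bar>\<xi>\<bar> * (C * norm x) * (C * norm x)) = (inv_abs \<xi>)^3 * (C\<^sup>2 * (norm x)\<^sup>2)"
        using \<rho>(1) by algebra
      also have "\<dots> \<le> C\<^sup>2 * (norm x)\<^sup>2"
        using \<rho> C0 by (intro p1) (auto simp: power_le_one)
      finally show "(inv_abs \<xi>)^4 * (\<bar>\<xi>\<bar> * (C * norm x) * (C * norm x)) \<le> C\<^sup>2 * (norm x)\<^sup>2" .
    qed auto
    show "(inv_abs \<xi>)^4 * (norm (0::complex))\<^sup>2 \<le> 0 * (?q4 \<xi> x)"
      by simp
    show "(inv_abs \<xi> * norm (P x))\<^sup>2 \<le> 1 * (?q4 \<xi> x)"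
      unfolding mult_1 using sqs by linarith
    show "(2 * C * (inv_abs \<xi> * norm x))\<^sup>2 \<le> 4 * C\<^sup>2 * (?q4 \<xi> x + Th \<xi> x)"
      proof -
      have "(2 * C * (inv_abs \<xi> * norm x))\<^sup>2 = 4 * C\<^sup>2 * (inv_abs \<xi> * norm x)\<^sup>2" by algebra
      also have "\<dots> \<le> 4 * C\<^sup>2 * (?q4 \<xi> x + Th \<xi> x)" by (rule mult_left_mono) (use sqs in linarith, use C0 in simp)
      finally show ?thesis .
    qed
    show "(inv_abs \<xi>)^4 * (norm (s \<xi>) * norm (R (A \<xi> *v x)) * norm (P x)) \<le> inv_abs \<xi> * norm (P x) * (2 * C * (inv_abs \<xi> * norm x))"
      unfolding b
    proof (rule product_bound[OF _ _ _ R'[OF H] _ order_refl])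
      show "(inv_abs \<xi>)^4 * (\<bar>\<xi>\<bar> * (2 * C * (\<bar>\<xi>\<bar> * norm x)) * norm (P x)) \<le> inv_abs \<xi> * norm (P x) * (2 * C * (inv_abs \<xi> * norm x))"
        by (rule eq_refl) (use \<rho>(1) in algebra)
    qed auto
    have "(inv_abs \<xi> * norm (R x))\<^sup>2 = 1 * ((inv_abs \<xi>)^4 * (\<bar>\<xi>\<bar> * norm (R x))\<^sup>2)"
      using \<rho>(1) by algebra
    then show "(inv_abs \<xi> * norm (R x))\<^sup>2 \<le> 1 * ((inv_abs \<xi>)^4 * (norm (s \<xi>) * norm (R x))\<^sup>2)"
      unfolding b by (rule eq_refl)
  qed (use C0 N0 T0 in \<open>auto simp: forms_A linear_nth linear_forms\<close>)
  have 6: "dissipated A ?H Th Nh ?q6"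
  proof (rule dissipated_chain[OF 5, where \<alpha> = "\<lambda>\<xi>. (inv_abs \<xi>)^4" and b = "\<lambda>\<xi>. s \<xi>"
        and f = "\<lambda>\<xi> x. R x" and g = "\<lambda>\<xi> x. T x" and h = "\<lambda>\<xi> x. complex_of_real (- (k1 * (k2 + k3))) * x $ 1" and L = "1"
        and ?M1.0 = "C\<^sup>2" and ?M2.0 = "C\<^sup>2" and ?M3.0 = "1" and ?M4.0 = "C\<^sup>2"
        and a = "\<lambda>\<xi> x. inv_abs \<xi> * norm (R x)" and y = "\<lambda>\<xi> x. C * (inv_abs \<xi> * norm x)"])
    fix \<xi> and x :: "complex^8" assume H: "\<xi> \<in> ?H"
    note \<rho> = \<rho>[OF H]
    note sqs = sqs[OF H, of x]
    have b: "norm (s \<xi>) = \<bar>\<xi>\<bar>" by (simp add: norm_mult norm_power abs_mult)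
    show "(inv_abs \<xi>)^4 * (norm (s \<xi>) * norm (T x) * norm (R x)) \<le> C\<^sup>2 * (norm x)\<^sup>2"
      unfolding b
    proof (rule product_bound[OF _ _ _ C(5) _ C(4)])
      have "(inv_abs \<xi>)^4 * (\<bar>\<xi>\<bar> * (C * norm x) * (C * norm x)) = (inv_abs \<xi>)^3 * (C\<^sup>2 * (norm x)\<^sup>2)"
        using \<rho>(1) by algebra
      also have "\<dots> \<le> C\<^sup>2 * (norm x)\<^sup>2"
        using \<rho> C0 by (intro p1) (auto simp: power_le_one)
      finally show "(inv_abs \<xi>)^4 * (\<bar>\<xi>\<bar> * (C * norm x) * (C * norm x)) \<le> C\<^sup>2 * (norm x)\<^sup>2" .
    qed auto
    show "(inv_abs \<xi>)^4 * (norm (complex_of_real (- (k1 * (k2 + k3))) * x $ 1))\<^sup>2 \<le> C\<^sup>2 * (?q5 \<xi> x)"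
      proof -
      have "norm (complex_of_real (- (k1 * (k2 + k3))) * x $ 1) \<le> C * norm (x $ 1)"
        unfolding norm_mult norm_of_real abs_minus_cancel
        using k C(10) C0 by (intro mult_right_mono) auto
      then have "(inv_abs \<xi>)^4 * (norm (complex_of_real (- (k1 * (k2 + k3))) * x $ 1))\<^sup>2 \<le> 1 * (C * norm (x $ 1))\<^sup>2"
        using \<rho> by (intro mult_mono power_mono) (auto simp: power_le_one)
      also have "\<dots> = C\<^sup>2 * (norm (x $ 1))\<^sup>2" by algebra
      also have "\<dots> \<le> C\<^sup>2 * (?q5 \<xi> x)" by (rule mult_left_mono) (use sqs in linarith, simp)
      finally show ?thesis .
    qed
    show "(inv_abs \<xi> * norm (R x))\<^sup>2 \<le> 1 * (?q5 \<xi> x)"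
      unfolding mult_1 using sqs by linarith
    show "(C * (inv_abs \<xi> * norm x))\<^sup>2 \<le> C\<^sup>2 * (?q5 \<xi> x + Th \<xi> x)"
      proof -
      have "(C * (inv_abs \<xi> * norm x))\<^sup>2 = C\<^sup>2 * (inv_abs \<xi> * norm x)\<^sup>2" by algebra
      also have "\<dots> \<le> C\<^sup>2 * (?q5 \<xi> x + Th \<xi> x)" by (rule mult_left_mono) (use sqs in linarith, use C0 in simp)
      finally show ?thesis .
    qed
    show "(inv_abs \<xi>)^4 * (norm (s \<xi>) * norm (T (A \<xi> *v x)) * norm (R x)) \<le> inv_abs \<xi> * norm (R x) * (C * (inv_abs \<xi> * norm x))"
      unfolding b
    proof (rule product_bound[OF _ _ _ eq_refl[OF arg_cong[OF forms_A(7), of norm], THEN order_trans, OF sbound[OF C(6)]] _ order_refl])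
      show "(inv_abs \<xi>)^4 * (\<bar>\<xi>\<bar> * (\<bar>\<xi>\<bar> * (C * norm x)) * norm (R x)) \<le> inv_abs \<xi> * norm (R x) * (C * (inv_abs \<xi> * norm x))"
        by (rule eq_refl) (use \<rho>(1) in algebra)
    qed auto
    have "(inv_abs \<xi> * norm (T x))\<^sup>2 = 1 * ((inv_abs \<xi>)^4 * (\<bar>\<xi>\<bar> * norm (T x))\<^sup>2)"
      using \<rho>(1) by algebra
    then show "(inv_abs \<xi> * norm (T x))\<^sup>2 \<le> 1 * ((inv_abs \<xi>)^4 * (norm (s \<xi>) * norm (T x))\<^sup>2)"
      unfolding b by (rule eq_refl)
  qed (use C0 N0 T0 in \<open>auto simp: forms_A linear_nth linear_forms\<close>)
  have S': "norm (S (A \<xi> *v x)) \<le> 3 * C\<^sup>2 * (\<bar>\<xi>\<bar> * norm x)" if "\<xi> \<in> ?H" for \<xi> x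
  proof -
    have "norm (complex_of_real (k2 + k3) * T x - complex_of_real (k2 * k3) * P x) \<le> C * (C * norm x) + C * (C * norm x)"
      by (intro norm_minus_mono; unfold norm_mult norm_of_real; intro mult_mono C) (use k C C0 in auto)
    then have "norm (s \<xi> * (complex_of_real (k2 + k3) * T x - complex_of_real (k2 * k3) * P x)) \<le> \<bar>\<xi>\<bar> * (C * (C * norm x) + C * (C * norm x))"
      unfolding norm_mult[of "s \<xi>"] norm_s by (intro mult_left_mono) auto
    then have "norm (S (A \<xi> *v x)) \<le> \<bar>\<xi>\<bar> * (C * (C * norm x) + C * (C * norm x)) + C * norm x"
      unfolding forms_A
    proof (rule norm_minus_mono)
      show "norm (complex_of_real (k1 * (k2\<^sup>2 + k3\<^sup>2)) * x $ 1) \<le> C * norm x"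
        unfolding norm_mult norm_of_real using k C(11) C0 by (intro mult_mono le) auto
    qed
    moreover have "C * norm x \<le> \<bar>\<xi>\<bar> * (C * (C * norm x))"
    proof -
      have "1 * (C * norm x) \<le> C * (C * norm x)" by (rule mult_right_mono) (use C(1) in auto)
      moreover have "1 * (C * (C * norm x)) \<le> \<bar>\<xi>\<bar> * (C * (C * norm x))"
        by (rule mult_right_mono) (use that C0 in auto)
      ultimately show ?thesis by linarith
    qed
    ultimately have "norm (S (A \<xi> *v x)) \<le> 3 * (\<bar>\<xi>\<bar> * (C * (C * norm x)))" by (simp add: distrib_left)
    also have "\<dots> = 3 * C\<^sup>2 * (\<bar>\<xi>\<bar> * norm x)" by algebra
    finally show ?thesis .
  qed
  have 7: "dissipated A ?H Th Nh ?q7"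
  proof (rule dissipated_chain[OF 6, where \<alpha> = "\<lambda>\<xi>. (inv_abs \<xi>)^4" and b = "\<lambda>\<xi>. s \<xi>"
        and f = "\<lambda>\<xi> x. T x" and g = "\<lambda>\<xi> x. S x" and h = "\<lambda>\<xi> x. 0" and L = "1"
        and ?M1.0 = "C\<^sup>2" and ?M2.0 = "0" and ?M3.0 = "1" and ?M4.0 = "9 * C^4"
        and a = "\<lambda>\<xi> x. inv_abs \<xi> * norm (T x)" and y = "\<lambda>\<xi> x. 3 * C\<^sup>2 * (inv_abs \<xi> * norm x)"])
    fix \<xi> and x :: "complex^8" assume H: "\<xi> \<in> ?H"
    note \<rho> = \<rho>[OF H]
    note sqs = sqs[OF H, of x]
    have b: "norm (s \<xi>) = \<bar>\<xi>\<bar>" by (simp add: norm_mult norm_power abs_mult)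
    show "(inv_abs \<xi>)^4 * (norm (s \<xi>) * norm (S x) * norm (T x)) \<le> C\<^sup>2 * (norm x)\<^sup>2"
      unfolding b
    proof (rule product_bound[OF _ _ _ C(6) _ C(5)])
      have "(inv_abs \<xi>)^4 * (\<bar>\<xi>\<bar> * (C * norm x) * (C * norm x)) = (inv_abs \<xi>)^3 * (C\<^sup>2 * (norm x)\<^sup>2)"
        using \<rho>(1) by algebra
      also have "\<dots> \<le> C\<^sup>2 * (norm x)\<^sup>2"
        using \<rho> C0 by (intro p1) (auto simp: power_le_one)
      finally show "(inv_abs \<xi>)^4 * (\<bar>\<xi>\<bar> * (C * norm x) * (C * norm x)) \<le> C\<^sup>2 * (norm x)\<^sup>2" .
    qed auto
    show "(inv_abs \<xi>)^4 * (norm (0::complex))\<^sup>2 \<le> 0 * (?q6 \<xi> x)"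
      by simp
    show "(inv_abs \<xi> * norm (T x))\<^sup>2 \<le> 1 * (?q6 \<xi> x)"
      unfolding mult_1 using sqs by linarith
    show "(3 * C\<^sup>2 * (inv_abs \<xi> * norm x))\<^sup>2 \<le> 9 * C^4 * (?q6 \<xi> x + Th \<xi> x)"
      proof -
      have "(3 * C\<^sup>2 * (inv_abs \<xi> * norm x))\<^sup>2 = 9 * C^4 * (inv_abs \<xi> * norm x)\<^sup>2" by algebra
      also have "\<dots> \<le> 9 * C^4 * (?q6 \<xi> x + Th \<xi> x)" by (rule mult_left_mono) (use sqs in linarith, use C0 in simp)
      finally show ?thesis .
    qed
    show "(inv_abs \<xi>)^4 * (norm (s \<xi>) * norm (S (A \<xi> *v x)) * norm (T x)) \<le> inv_abs \<xi> * norm (T x) * (3 * C\<^sup>2 * (inv_abs \<xi> * norm x))"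
      unfolding b
    proof (rule product_bound[OF _ _ _ S'[OF H] _ order_refl])
      show "(inv_abs \<xi>)^4 * (\<bar>\<xi>\<bar> * (3 * C\<^sup>2 * (\<bar>\<xi>\<bar> * norm x)) * norm (T x)) \<le> inv_abs \<xi> * norm (T x) * (3 * C\<^sup>2 * (inv_abs \<xi> * norm x))"
        by (rule eq_refl) (use \<rho>(1) in algebra)
    qed auto
    have "(inv_abs \<xi> * norm (S x))\<^sup>2 = 1 * ((inv_abs \<xi>)^4 * (\<bar>\<xi>\<bar> * norm (S x))\<^sup>2)"
      using \<rho>(1) by algebra
    then show "(inv_abs \<xi> * norm (S x))\<^sup>2 \<le> 1 * ((inv_abs \<xi>)^4 * (norm (s \<xi>) * norm (S x))\<^sup>2)"
      unfolding b by (rule eq_refl)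
  qed (use C0 N0 T0 in \<open>auto simp: forms_A linear_nth linear_forms\<close>)
  obtain K where "recovery_bound K" using ex_recovery_bound by blast
  note K = recovery_boundD[OF this]
  \<comment> \<open>The unknowns are recovered in the order z, \<phi>, y, \<theta>, then u from
    \<open>Q\<close>, then \<sigma> from \<open>W\<close> and u. The factor 20 is generous: the
    count gives 3 + 8 K + 2 K^2 with K \<ge> 1.\<close>
  have rec: "inv_abs \<xi> * norm x \<le> 20 * K\<^sup>2 * (norm (x $ 8) + norm (W x) + norm (x $ 1) + inv_abs \<xi> * norm (Q \<xi> x) + inv_abs \<xi> * norm (P x) + inv_abs \<xi> * norm (R x) + inv_abs \<xi> * norm (T x) + inv_abs \<xi> * norm (S x))" if H: "\<xi> \<in> ?H" for \<xi> x
  proof -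
    let ?p = "inv_abs \<xi>" and ?v = "norm (x $ 1)" and ?n = "norm (x $ 8)" and ?W = "norm (W x)"
    let ?Q = "?p * norm (Q \<xi> x)" and ?P = "?p * norm (P x)" and ?R = "?p * norm (R x)"
      and ?T = "?p * norm (T x)" and ?S = "?p * norm (S x)"
    note p = \<rho>[OF H]
    have mp: "?p * X \<le> K * (?p * A + ?p * B)" if "X \<le> K * (A + B)" for X A B
      using mult_left_mono[OF that, of ?p] p(2) by (simp add: algebra_simps)
    have pos: "0 \<le> ?v" "0 \<le> ?n" "0 \<le> ?W" "0 \<le> ?Q" "0 \<le> ?P" "0 \<le> ?R" "0 \<le> ?T" "0 \<le> ?S"
      using p by simp_all
    define \<Sigma> where "\<Sigma> = ?n + ?W + ?v + ?Q + ?P + ?R + ?T + ?S"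
    have \<Sigma>: "0 \<le> \<Sigma>" "?n \<le> \<Sigma>" "?W \<le> \<Sigma>" "?v \<le> \<Sigma>" "?Q \<le> \<Sigma>" "?P + ?T \<le> \<Sigma>" "?R + ?S \<le> \<Sigma>"
      using pos unfolding \<Sigma>_def by linarith+
    have KS: "K * A \<le> K * \<Sigma>" if "A \<le> \<Sigma>" for A using that K(1) by (intro mult_left_mono) auto
    have 35: "?p * norm (x $ 3) \<le> K * \<Sigma>" "?p * norm (x $ 5) \<le> K * \<Sigma>"
      using mp[OF K(2)[of x]] mp[OF K(3)[of x]] KS[OF \<Sigma>(6)] by linarith+
    have 46: "?p * norm (x $ 4) \<le> K * \<Sigma>" "?p * norm (x $ 6) \<le> K * \<Sigma>"
      using mp[OF K(4)[of x]] mp[OF K(5)[of x]] KS[OF \<Sigma>(7)] by linarith+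
    have 2: "?p * norm (x $ 2) \<le> \<Sigma> + 2 * (K * \<Sigma>)"
    proof -
      have "s \<xi> * x $ 2 = Q \<xi> x - (x $ 4 + x $ 6)" by (simp add: Q_def)
      then have "\<bar>\<xi>\<bar> * norm (x $ 2) = norm (Q \<xi> x - (x $ 4 + x $ 6))"
        by (metis norm_mult norm_s)
      also have "\<dots> \<le> norm (Q \<xi> x) + (norm (x $ 4) + norm (x $ 6))"
        by (intro norm_minus_mono norm_triangle_ineq order_refl)
      finally have "?p * (\<bar>\<xi>\<bar> * norm (x $ 2)) \<le> ?p * (norm (Q \<xi> x) + (norm (x $ 4) + norm (x $ 6)))"
        using p(2) by (intro mult_left_mono) auto
      then have "norm (x $ 2) \<le> ?Q + (?p * norm (x $ 4) + ?p * norm (x $ 6))"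
        using p(1) by (simp add: distrib_left mult.assoc[symmetric])
      moreover have "?p * norm (x $ 2) \<le> norm (x $ 2)" using p by (intro p1) auto
      ultimately show ?thesis using 46 \<Sigma>(5) by linarith
    qed
    have 7: "?p * norm (x $ 7) \<le> K * (\<Sigma> + (\<Sigma> + 2 * (K * \<Sigma>)))"
    proof -
      have "?p * norm (x $ 7) \<le> K * (?p * norm (W x) + ?p * norm (x $ 2))" by (rule mp[OF K(8)])
      also have "\<dots> \<le> K * (\<Sigma> + (\<Sigma> + 2 * (K * \<Sigma>)))"
        using 2 \<Sigma>(3) p1[of ?p ?W] p K(1) by (intro mult_left_mono add_mono) auto
      finally show ?thesis .
    qed
    have 18: "?p * norm (x $ 1) \<le> \<Sigma>" "?p * norm (x $ 8) \<le> \<Sigma>"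
      using p1[of ?p ?v] p1[of ?p ?n] p \<Sigma> by auto
    have "?p * norm x \<le> ?p * (norm (x $ 1) + norm (x $ 2) + norm (x $ 3) + norm (x $ 4) + norm (x $ 5) + norm (x $ 6) +
        norm (x $ 7) + norm (x $ 8))"
      using norm_le_sum_nth[of x] p(2) by (intro mult_left_mono) auto
    also have "\<dots> \<le> \<Sigma> + (\<Sigma> + 2 * (K * \<Sigma>)) + K * \<Sigma> + K * \<Sigma> + K * \<Sigma> + K * \<Sigma> + K * (\<Sigma> + (\<Sigma> + 2 * (K * \<Sigma>))) + \<Sigma>"
      unfolding distrib_left[of ?p] using 18 2 35 46 7 by linarith
    also have "\<dots> = 3 * \<Sigma> + 8 * (K * \<Sigma>) + 2 * (K * (K * \<Sigma>))" by algebra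
    also have "\<dots> \<le> 20 * (K * (K * \<Sigma>))"
    proof -
      have "1 * \<Sigma> \<le> K * \<Sigma>" by (rule mult_right_mono) (use \<Sigma>(1) K(1) in auto)
      moreover have "1 * (K * \<Sigma>) \<le> K * (K * \<Sigma>)" by (rule mult_right_mono) (use \<Sigma>(1) K(1) in auto)
      ultimately show ?thesis using \<Sigma>(1) by linarith
    qed
    also have "\<dots> = 20 * K\<^sup>2 * \<Sigma>" by algebra
    finally show ?thesis by (simp add: \<Sigma>_def)
  qed
  show ?thesis
  \<comment> \<open>400 K^4 is the square of the recovery constant, and squaring a sum of eight
    terms costs a further 8. The summand 3 accounts for \<open>W\<close>, v and \<open>Q\<close> in
    the total.\<close>
  proof (rule dissipated_mono[OF 7, where M = "3 + 3200 * K^4"])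
    fix \<xi> x assume H: "\<xi> \<in> ?H"
    define q where "q = ?q3 \<xi> x +
      (inv_abs \<xi> * norm (P x))\<^sup>2 + (inv_abs \<xi> * norm (R x))\<^sup>2 + (inv_abs \<xi> * norm (T x))\<^sup>2 + (inv_abs \<xi> * norm (S x))\<^sup>2"
    have "0 \<le> inv_abs \<xi> * norm x" using \<rho>[OF H] by simp
    then have "(inv_abs \<xi> * norm x)\<^sup>2 \<le> (20 * K\<^sup>2 * (norm (x $ 8) + norm (W x) + norm (x $ 1) + inv_abs \<xi> * norm (Q \<xi> x) + inv_abs \<xi> * norm (P x) + inv_abs \<xi> * norm (R x) + inv_abs \<xi> * norm (T x) + inv_abs \<xi> * norm (S x)))\<^sup>2"
      using rec[OF H] by (rule power_mono[rotated])
    also have "\<dots> = 400 * K^4 * (norm (x $ 8) + norm (W x) + norm (x $ 1) + inv_abs \<xi> * norm (Q \<xi> x) + inv_abs \<xi> * norm (P x) + inv_abs \<xi> * norm (R x) + inv_abs \<xi> * norm (T x) + inv_abs \<xi> * norm (S x))\<^sup>2"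
      unfolding power_mult_distrib[of "20 * K\<^sup>2"] by simp
    also have "\<dots> \<le> 400 * K^4 * (8 * q)"
    proof (rule mult_left_mono)
      have "(norm (x $ 8))\<^sup>2 \<le> Nh \<xi> x" using eta H by simp
      then show "(norm (x $ 8) + norm (W x) + norm (x $ 1) + inv_abs \<xi> * norm (Q \<xi> x) + inv_abs \<xi> * norm (P x) + inv_abs \<xi> * norm (R x) + inv_abs \<xi> * norm (T x) + inv_abs \<xi> * norm (S x))\<^sup>2 \<le> 8 * q"
        by (intro order_trans[OF square_sum8_le]) (simp add: q_def)
    qed simp
    finally have "(inv_abs \<xi> * norm x)\<^sup>2 \<le> 3200 * K^4 * q" by simp
    moreover have "(norm (W x))\<^sup>2 \<le> q" "(norm (x $ 1))\<^sup>2 \<le> q" "(inv_abs \<xi> * norm (Q \<xi> x))\<^sup>2 \<le> q"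
      using N0[of \<xi> x] by (simp_all add: q_def)
    ultimately have "Th \<xi> x \<le> (3 + 3200 * K^4) * q" unfolding Th_def distrib_right by linarith
    then show "Th \<xi> x \<le> (3 + 3200 * K^4) * (?q3 \<xi> x +
      (inv_abs \<xi> * norm (P x))\<^sup>2 + (inv_abs \<xi> * norm (R x))\<^sup>2 + (inv_abs \<xi> * norm (T x))\<^sup>2 + (inv_abs \<xi> * norm (S x))\<^sup>2)"
      unfolding q_def .
  qed (simp add: add_pos_nonneg)
qed

end

section \<open>Dissipation at low frequencies\<close>

lemma square_scale: "c \<noteq> 0 \<Longrightarrow> (u * v)\<^sup>2 = 1 / c\<^sup>2 * (1 * (c * u * v)\<^sup>2)" for c u v :: real
  by (simp add: power_mult_distrib)

lemma linear_cmult: "linear f \<Longrightarrow> linear (\<lambda>x. c * f x)" for f :: "complex^8 \<Rightarrow> complex"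
  by (simp add: linear_iff distrib_left)

lemma linear_divide: "linear f \<Longrightarrow> linear (\<lambda>x. f x / c)" for f :: "complex^8 \<Rightarrow> complex"
  using linear_cmult[of f "inverse c"] by (simp add: field_simps)

context beam
begin

text \<open>The power |\<xi>|^(2\<epsilon>) of the damping is left out here and restored later as
  the factor \<open>m\<close> of \<open>dissipated_decay\<close>, so that one chain serves both
  values of \<epsilon>.\<close>

definition Nl :: "real \<Rightarrow> complex^8 \<Rightarrow> real" where "Nl \<xi> x = (norm (x $ 8))\<^sup>2"

definition Tl :: "real \<Rightarrow> complex^8 \<Rightarrow> real" where "Tl \<xi> x = (\<bar>\<xi>\<bar>\<^sup>2 * norm x)\<^sup>2"

text \<open>At low frequencies the terms of order zero in \<open>\<xi>\<close> dominate; the multiples of \<open>Q\<close>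
  subtracted here cancel the terms in \<open>x $ 1\<close> of lowest order in the derivatives of \<open>W\<close> and \<open>R\<close>.\<close>

definition Wl :: "real \<Rightarrow> complex^8 \<Rightarrow> complex" where "Wl \<xi> x = W x - (\<gamma> / 2) * (s \<xi> * Q \<xi> x)"
definition Rl :: "real \<Rightarrow> complex^8 \<Rightarrow> complex" where "Rl \<xi> x = R x - (k2 + k3) / 2 * Q \<xi> x"
definition Tl' :: "complex^8 \<Rightarrow> complex" where "Tl' x = T x - (k2 + k3) / 2 * P x"
text \<open>The derivative of \<open>pl\<close> is exactly - s^2 u, which makes u visible without
  dividing by \<xi>. The correction in \<open>ul\<close> removes the first-order term k1 s v from
  the derivative of u; what it adds to the derivative of \<open>pl\<close> is split off as the
  remainder s^3 Q / 2.\<close>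

definition pl :: "real \<Rightarrow> complex^8 \<Rightarrow> complex" where "pl \<xi> x = x $ 3 + x $ 5 - s \<xi> * x $ 1"
definition ul :: "real \<Rightarrow> complex^8 \<Rightarrow> complex" where "ul \<xi> x = x $ 2 + s \<xi> * Q \<xi> x / 2"

lemmas low_forms = Wl_def Rl_def Tl'_def pl_def ul_def

lemma linear_low: "linear (Wl \<xi>)" "linear (Rl \<xi>)" "linear Tl'" "linear (pl \<xi>)" "linear (ul \<xi>)"
  unfolding low_forms
  by (intro linear_compose_sub linear_compose_add linear_cmult linear_divide linear_forms linear_nth)+

text \<open>Powers of s are kept as nested products so that the domination rules below can strip one
  factor at a time.\<close>

definition hW :: "real \<Rightarrow> complex^8 \<Rightarrow> complex" where
  "hW \<xi> x = (k4 + \<gamma>\<^sup>2) * (s \<xi> * x $ 8) + (\<gamma>\<^sup>2 / 2) * (s \<xi> * (s \<xi> * (s \<xi> * x $ 8))) -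
    (\<gamma> / 2 * k1) * (s \<xi> * (s \<xi> * (s \<xi> * x $ 1)))"

definition hR :: "real \<Rightarrow> complex^8 \<Rightarrow> complex" where
  "hR \<xi> x = ((k2 + k3) / 2) * (s \<xi> * (s \<xi> * (\<gamma> * x $ 8 - k1 * x $ 1)))"

lemma forms_A_low:
  "Wl \<xi> (A \<xi> *v x) = - (\<gamma> / 2) * (s \<xi>)\<^sup>2 * P x + hW \<xi> x"
  "P (A \<xi> *v x) = s \<xi> * Rl \<xi> x + (k2 + k3) / 2 * (s \<xi> * Q \<xi> x)"
  "Rl \<xi> (A \<xi> *v x) = s \<xi> * Tl' x + hR \<xi> x"
  "Tl' (A \<xi> *v x) = s \<xi> * (S x - (k2 + k3) / 2 * R x)"
  "pl \<xi> (A \<xi> *v x) = - (s \<xi>)\<^sup>2 * ul \<xi> x + (s \<xi>) ^ 3 * Q \<xi> x / 2"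
  "ul \<xi> (A \<xi> *v x) = s \<xi> * (s \<xi> * P x) / 2 + (k1 / 2) * (s \<xi> * (s \<xi> * (s \<xi> * x $ 1))) -
    (\<gamma> * (s \<xi> * x $ 8) + (\<gamma> / 2) * (s \<xi> * (s \<xi> * (s \<xi> * x $ 8))))"
  unfolding low_forms hW_def hR_def forms_A A_nth
  by (simp_all add: Q_def R_def T_def algebra_simps power2_eq_square power3_eq_cube) (simp_all add: field_simps)

lemma norm_pow3_s [simp]: "norm ((s \<xi>) ^ 3) = \<bar>\<xi>\<bar> ^ 3" "norm ((s \<xi>)\<^sup>2) = \<bar>\<xi>\<bar>\<^sup>2"
  unfolding norm_power norm_s by simp_all

definition low_bound :: "real \<Rightarrow> bool" where
  "low_bound C \<longleftrightarrow> 1 \<le> C \<and> (\<forall>\<xi> x. \<bar>\<xi>\<bar> \<le> 1 \<longrightarrow>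
    norm (W x) \<le> C * norm x \<and> norm (P x) \<le> C * norm x \<and> norm (R x) \<le> C * norm x \<and>
    norm (Q \<xi> x) \<le> C * norm x \<and> norm (Wl \<xi> x) \<le> C * norm x \<and> norm (Rl \<xi> x) \<le> C * norm x \<and>
    norm (Tl' x) \<le> C * norm x \<and> norm (pl \<xi> x) \<le> C * norm x \<and> norm (ul \<xi> x) \<le> C * norm x \<and>
    norm (W (A \<xi> *v x)) \<le> C * (\<bar>\<xi>\<bar> * (norm (x $ 1) + norm (x $ 8))) \<and>
    norm (Q \<xi> (A \<xi> *v x)) \<le> C * norm x \<and>
    norm (hW \<xi> x) \<le> C * (\<bar>\<xi>\<bar>\<^sup>2 * norm (x $ 1) + norm (x $ 8)) \<and>
    norm (hR \<xi> x) \<le> C * ((norm (x $ 1) + norm (x $ 8)) * \<bar>\<xi>\<bar>\<^sup>2) \<and>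
    norm (Rl \<xi> (A \<xi> *v x)) \<le> C * (\<bar>\<xi>\<bar> * norm x) \<and>
    norm (Tl' (A \<xi> *v x)) \<le> C * (\<bar>\<xi>\<bar> * norm x) \<and>
    norm (ul \<xi> (A \<xi> *v x)) \<le> C * (\<bar>\<xi>\<bar>\<^sup>2 * norm (P x) + \<bar>\<xi>\<bar>\<^sup>2 * norm (x $ 1) + norm (x $ 8)))"

lemma low_boundD:
  assumes "low_bound C"
  shows "1 \<le> C" and "\<bar>\<xi>\<bar> \<le> 1 \<Longrightarrow> norm (W x) \<le> C * norm x" "\<bar>\<xi>\<bar> \<le> 1 \<Longrightarrow> norm (P x) \<le> C * norm x"
    "\<bar>\<xi>\<bar> \<le> 1 \<Longrightarrow> norm (R x) \<le> C * norm x"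
    "\<bar>\<xi>\<bar> \<le> 1 \<Longrightarrow> norm (Q \<xi> x) \<le> C * norm x" "\<bar>\<xi>\<bar> \<le> 1 \<Longrightarrow> norm (Wl \<xi> x) \<le> C * norm x"
    "\<bar>\<xi>\<bar> \<le> 1 \<Longrightarrow> norm (Rl \<xi> x) \<le> C * norm x"
    "\<bar>\<xi>\<bar> \<le> 1 \<Longrightarrow> norm (Tl' x) \<le> C * norm x" "\<bar>\<xi>\<bar> \<le> 1 \<Longrightarrow> norm (pl \<xi> x) \<le> C * norm x"
    "\<bar>\<xi>\<bar> \<le> 1 \<Longrightarrow> norm (ul \<xi> x) \<le> C * norm x"
    "\<bar>\<xi>\<bar> \<le> 1 \<Longrightarrow> norm (W (A \<xi> *v x)) \<le> C * (\<bar>\<xi>\<bar> * (norm (x $ 1) + norm (x $ 8)))"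
    "\<bar>\<xi>\<bar> \<le> 1 \<Longrightarrow> norm (Q \<xi> (A \<xi> *v x)) \<le> C * norm x"
    "\<bar>\<xi>\<bar> \<le> 1 \<Longrightarrow> norm (hW \<xi> x) \<le> C * (\<bar>\<xi>\<bar>\<^sup>2 * norm (x $ 1) + norm (x $ 8))"
    "\<bar>\<xi>\<bar> \<le> 1 \<Longrightarrow> norm (hR \<xi> x) \<le> C * ((norm (x $ 1) + norm (x $ 8)) * \<bar>\<xi>\<bar>\<^sup>2)"
    "\<bar>\<xi>\<bar> \<le> 1 \<Longrightarrow> norm (Rl \<xi> (A \<xi> *v x)) \<le> C * (\<bar>\<xi>\<bar> * norm x)"
    "\<bar>\<xi>\<bar> \<le> 1 \<Longrightarrow> norm (Tl' (A \<xi> *v x)) \<le> C * (\<bar>\<xi>\<bar> * norm x)"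
    "\<bar>\<xi>\<bar> \<le> 1 \<Longrightarrow> norm (ul \<xi> (A \<xi> *v x)) \<le> C * (\<bar>\<xi>\<bar>\<^sup>2 * norm (P x) + \<bar>\<xi>\<bar>\<^sup>2 * norm (x $ 1) + norm (x $ 8))"
  using assms unfolding low_bound_def by blast+

text \<open>Domination up to a constant, uniformly for |\<xi>| \<le> 1, in the manner of the
  O-notation. Its rules follow the syntax of an expression, so the bounds for the many linear
  combinations can be assembled mechanically.\<close>

definition low_dom :: "(real \<Rightarrow> complex^8 \<Rightarrow> complex) \<Rightarrow> (real \<Rightarrow> complex^8 \<Rightarrow> real) \<Rightarrow> bool" where
  "low_dom f g \<longleftrightarrow> (\<exists>c\<ge>0. \<forall>\<xi> x. \<bar>\<xi>\<bar> \<le> 1 \<longrightarrow> norm (f \<xi> x) \<le> c * g \<xi> x)"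

lemma low_domI: "0 \<le> c \<Longrightarrow> (\<And>\<xi> x. \<bar>\<xi>\<bar> \<le> 1 \<Longrightarrow> norm (f \<xi> x) \<le> c * g \<xi> x) \<Longrightarrow> low_dom f g"
  unfolding low_dom_def by blast

lemma low_dom_mono:
  assumes f: "low_dom f g" and g: "\<And>\<xi> x. \<bar>\<xi>\<bar> \<le> 1 \<Longrightarrow> g \<xi> x \<le> g' \<xi> x"
  shows "low_dom f g'"
proof -
  obtain c where c: "0 \<le> c" "\<And>\<xi> x. \<bar>\<xi>\<bar> \<le> 1 \<Longrightarrow> norm (f \<xi> x) \<le> c * g \<xi> x" using f unfolding low_dom_def by blast
  show ?thesis
    by (rule low_domI[OF c(1)]) (use c g in \<open>meson mult_left_mono order_trans\<close>)
qed

lemma low_dom_add: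
  assumes f: "low_dom f g" and f': "low_dom f' g"
  shows "low_dom (\<lambda>\<xi> x. f \<xi> x + f' \<xi> x) g"
proof -
  obtain c where c: "0 \<le> c" "\<And>\<xi> x. \<bar>\<xi>\<bar> \<le> 1 \<Longrightarrow> norm (f \<xi> x) \<le> c * g \<xi> x" using f unfolding low_dom_def by blast
  obtain d where d: "0 \<le> d" "\<And>\<xi> x. \<bar>\<xi>\<bar> \<le> 1 \<Longrightarrow> norm (f' \<xi> x) \<le> d * g \<xi> x" using f' unfolding low_dom_def by blast
  show ?thesis
    by (rule low_domI[of "c + d"]) (use c d in \<open>auto simp: distrib_right intro: norm_triangle_mono\<close>)
qed

lemma low_dom_cmult:
  assumes f: "low_dom f g"
  shows "low_dom (\<lambda>\<xi> x. a * f \<xi> x) g"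
proof -
  obtain c where c: "0 \<le> c" "\<And>\<xi> x. \<bar>\<xi>\<bar> \<le> 1 \<Longrightarrow> norm (f \<xi> x) \<le> c * g \<xi> x" using f unfolding low_dom_def by blast
  show ?thesis
    by (rule low_domI[of "norm a * c"]) (use c in \<open>auto simp: norm_mult mult.assoc intro: mult_left_mono\<close>)
qed

lemma low_dom_divide: "low_dom f g \<Longrightarrow> low_dom (\<lambda>\<xi> x. f \<xi> x / a) g"
  using low_dom_cmult[of f g "inverse a"] by (simp add: field_simps)

lemma low_dom_diff: "low_dom f g \<Longrightarrow> low_dom f' g \<Longrightarrow> low_dom (\<lambda>\<xi> x. f \<xi> x - f' \<xi> x) g"
  using low_dom_add[of f g "\<lambda>\<xi> x. - 1 * f' \<xi> x"] low_dom_cmult[of f' g "-1"] by simp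

lemma low_dom_s_gain:
  assumes f: "low_dom f g"
  shows "low_dom (\<lambda>\<xi> x. s \<xi> * f \<xi> x) (\<lambda>\<xi> x. \<bar>\<xi>\<bar> * g \<xi> x)"
proof -
  obtain c where c: "0 \<le> c" "\<And>\<xi> x. \<bar>\<xi>\<bar> \<le> 1 \<Longrightarrow> norm (f \<xi> x) \<le> c * g \<xi> x" using f unfolding low_dom_def by blast
  show ?thesis
  proof (rule low_domI[OF c(1)])
    fix \<xi> :: real and x :: "complex^8" assume "\<bar>\<xi>\<bar> \<le> 1"
    then have "\<bar>\<xi>\<bar> * norm (f \<xi> x) \<le> \<bar>\<xi>\<bar> * (c * g \<xi> x)" using c by (intro mult_left_mono) auto
    then show "norm (s \<xi> * f \<xi> x) \<le> c * (\<bar>\<xi>\<bar> * g \<xi> x)"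
      unfolding norm_mult[of "s \<xi>"] norm_s by (simp only: mult_ac)
  qed
qed

text \<open>The factor |\<xi>| \<le> 1 is dropped here, whereas \<open>low_dom_s_gain\<close> keeps
  it.\<close>

lemma low_dom_s:
  assumes f: "low_dom f g" and g: "\<And>\<xi> x. 0 \<le> g \<xi> x"
  shows "low_dom (\<lambda>\<xi> x. s \<xi> * f \<xi> x) g"
  by (rule low_dom_mono[OF low_dom_s_gain[OF f]]) (simp add: g mult_left_le_one_le)

lemma low_dom_nth: "low_dom (\<lambda>\<xi> x. x $ i) (\<lambda>\<xi> x. norm x)"
  by (rule low_domI[of 1]) (simp_all add: Finite_Cartesian_Product.norm_nth_le)

lemma low_dom_eventually:
  assumes f: "low_dom f g" and g: "\<And>\<xi> x. 0 \<le> g \<xi> x"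
  shows "\<forall>\<^sub>F C in at_top. \<forall>\<xi> x. \<bar>\<xi>\<bar> \<le> 1 \<longrightarrow> norm (f \<xi> x) \<le> C * g \<xi> x"
proof -
  obtain c where c: "0 \<le> c" "\<And>\<xi> x. \<bar>\<xi>\<bar> \<le> 1 \<Longrightarrow> norm (f \<xi> x) \<le> c * g \<xi> x" using f unfolding low_dom_def by blast
  show ?thesis
    using eventually_ge_at_top[of c]
    by eventually_elim (use c g in \<open>meson mult_right_mono order_trans\<close>)
qed

lemma ex_low_bound: "\<exists>C. low_bound C"
proof -
  let ?e = "\<lambda>(\<xi>::real) x::complex^8. norm x"
  note rules = low_dom_add low_dom_diff low_dom_divide low_dom_cmult low_dom_nth low_dom_s[OF _ norm_ge_zero]
  have e: "low_dom (\<lambda>_. W) ?e" "low_dom (\<lambda>_. P) ?e" "low_dom (\<lambda>_. R) ?e" "low_dom (\<lambda>_. T) ?e" "low_dom (\<lambda>_. S) ?e"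
    "low_dom Q ?e"
    unfolding forms by ((intro low_dom_add low_dom_diff low_dom_nth low_dom_s[OF _ norm_ge_zero]
      low_dom_cmult)+)
  have e': "low_dom Wl ?e" "low_dom Rl ?e" "low_dom (\<lambda>_. Tl') ?e" "low_dom pl ?e" "low_dom ul ?e"
    unfolding low_forms
    by (intro low_dom_add low_dom_diff low_dom_nth low_dom_divide low_dom_s[OF _ norm_ge_zero] low_dom_cmult e)+
  have 10: "low_dom (\<lambda>\<xi> x. W (A \<xi> *v x)) (\<lambda>\<xi> x. \<bar>\<xi>\<bar> * (norm (x $ 1) + norm (x $ 8)))"
    and 11: "low_dom (\<lambda>\<xi> x. Q \<xi> (A \<xi> *v x)) ?e"
  proof -
    obtain C where "form_bound C" using ex_form_bound by blast
    note C = form_boundD[OF this]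
    show "low_dom (\<lambda>\<xi> x. W (A \<xi> *v x)) (\<lambda>\<xi> x. \<bar>\<xi>\<bar> * (norm (x $ 1) + norm (x $ 8)))"
      by (rule low_domI[of C]) (use C(1,8) in auto)
    have "low_dom (\<lambda>\<xi> x. (k1 * (s \<xi>)\<^sup>2 - 2 * k1) * x $ 1 - \<gamma> * (s \<xi>)\<^sup>2 * x $ 8) ?e"
    proof (rule low_domI[of "3 * C"])
      fix \<xi> :: real and x :: "complex^8" assume "\<bar>\<xi>\<bar> \<le> 1"
      then have "\<bar>\<xi>\<bar>\<^sup>2 \<le> 1" by (intro power_le_one) auto
      then have "(\<bar>\<xi>\<bar>\<^sup>2 + 1) * norm (x $ 1) + \<bar>\<xi>\<bar>\<^sup>2 * norm (x $ 8) \<le> 2 * norm x + 1 * norm x"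
        by (intro add_mono mult_mono Finite_Cartesian_Product.norm_nth_le) auto
      from mult_left_mono[OF this, of C] C(1)
      have "C * ((\<bar>\<xi>\<bar>\<^sup>2 + 1) * norm (x $ 1) + \<bar>\<xi>\<bar>\<^sup>2 * norm (x $ 8)) \<le> 3 * C * norm x" by simp
      then show "norm ((k1 * (s \<xi>)\<^sup>2 - 2 * k1) * x $ 1 - \<gamma> * (s \<xi>)\<^sup>2 * x $ 8) \<le> 3 * C * norm x"
        using C(9)[of \<xi> x] by linarith
    qed (use C(1) in auto)
    then show "low_dom (\<lambda>\<xi> x. Q \<xi> (A \<xi> *v x)) ?e"
      unfolding forms_A by (intro low_dom_add low_dom_s[OF e(2)]) auto
  qed
  have self_le: "low_dom f g" if "\<And>\<xi> x. \<bar>\<xi>\<bar> \<le> 1 \<Longrightarrow> norm (f \<xi> x) \<le> g \<xi> x" for f g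
    by (rule low_domI[of 1]) (use that in auto)
  have r2: "norm (s \<xi> * (s \<xi> * z)) = \<bar>\<xi>\<bar>\<^sup>2 * norm z" for \<xi> z
    unfolding norm_mult norm_s[unfolded norm_mult] by (simp add: power2_eq_square)
  have 12: "low_dom hW (\<lambda>\<xi> x. \<bar>\<xi>\<bar>\<^sup>2 * norm (x $ 1) + norm (x $ 8))" (is "low_dom _ ?g")
  proof -
    have g: "0 \<le> ?g \<xi> x" for \<xi> x by simp
    have v: "low_dom (\<lambda>\<xi> x. s \<xi> * (s \<xi> * x $ 1)) ?g" by (rule self_le) (simp add: r2)
    have n: "low_dom (\<lambda>\<xi> x. x $ 8) ?g" by (rule self_le) simp
    note s = low_dom_s[where g = ?g, OF _ g]
    show ?thesis unfolding hW_def
      by (intro low_dom_add low_dom_diff low_dom_cmult s[OF v] s[OF s[OF s[OF n]]] s[OF n])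
  qed
  have inner: "low_dom (\<lambda>\<xi> x. \<gamma> * x $ 8 - k1 * x $ 1) (\<lambda>\<xi> x. norm (x $ 1) + norm (x $ 8))"
    by (intro low_dom_diff low_dom_cmult self_le) auto
  have 13: "low_dom hR (\<lambda>\<xi> x. (norm (x $ 1) + norm (x $ 8)) * \<bar>\<xi>\<bar>\<^sup>2)"
    unfolding hR_def
    by (rule low_dom_mono[OF low_dom_cmult[OF low_dom_s_gain[OF low_dom_s_gain[OF inner]]]])
      (simp add: power2_eq_square algebra_simps)
  have 14: "low_dom (\<lambda>\<xi> x. Rl \<xi> (A \<xi> *v x)) (\<lambda>\<xi> x. \<bar>\<xi>\<bar> * norm x)"
    unfolding forms_A_low hR_def
    by (intro low_dom_add low_dom_s_gain[OF e'(3)] low_dom_cmult low_dom_s_gain low_dom_s[OF _ norm_ge_zero]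
      low_dom_diff low_dom_nth)
  have 15: "low_dom (\<lambda>\<xi> x. Tl' (A \<xi> *v x)) (\<lambda>\<xi> x. \<bar>\<xi>\<bar> * norm x)"
    unfolding forms_A_low by (intro low_dom_s_gain low_dom_diff low_dom_cmult low_dom_divide e)
  have 16: "low_dom (\<lambda>\<xi> x. ul \<xi> (A \<xi> *v x)) (\<lambda>\<xi> x. \<bar>\<xi>\<bar>\<^sup>2 * norm (P x) + \<bar>\<xi>\<bar>\<^sup>2 * norm (x $ 1) + norm (x $ 8))"
    (is "low_dom _ ?g")
  proof -
    have g: "0 \<le> ?g \<xi> x" for \<xi> x by simp
    have v: "low_dom (\<lambda>\<xi> x. s \<xi> * (s \<xi> * x $ 1)) ?g" "low_dom (\<lambda>\<xi> x. s \<xi> * (s \<xi> * P x)) ?g"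
      by (rule self_le, simp add: r2)+
    have n: "low_dom (\<lambda>\<xi> x. x $ 8) ?g" by (rule self_le) simp
    note s = low_dom_s[where g = ?g, OF _ g]
    show ?thesis unfolding forms_A_low
      by (intro low_dom_add low_dom_diff low_dom_divide[OF v(2)] low_dom_cmult s[OF v(1)] s[OF s[OF s[OF n]]] s[OF n])
  qed
  have ev10: "\<forall>\<^sub>F C in at_top. \<forall>\<xi> x. \<bar>\<xi>\<bar> \<le> 1 \<longrightarrow> norm (W (A \<xi> *v x)) \<le> C * (\<bar>\<xi>\<bar> * (norm (x $ 1) + norm (x $ 8)))"
    by (rule low_dom_eventually[OF 10]) simp
  have ev12: "\<forall>\<^sub>F C in at_top. \<forall>\<xi> x. \<bar>\<xi>\<bar> \<le> 1 \<longrightarrow> norm (hW \<xi> x) \<le> C * (\<bar>\<xi>\<bar>\<^sup>2 * norm (x $ 1) + norm (x $ 8))"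
    by (rule low_dom_eventually[OF 12]) simp
  have ev13: "\<forall>\<^sub>F C in at_top. \<forall>\<xi> x. \<bar>\<xi>\<bar> \<le> 1 \<longrightarrow> norm (hR \<xi> x) \<le> C * ((norm (x $ 1) + norm (x $ 8)) * \<bar>\<xi>\<bar>\<^sup>2)"
    by (rule low_dom_eventually[OF 13]) simp
  have ev14: "\<forall>\<^sub>F C in at_top. \<forall>\<xi> x. \<bar>\<xi>\<bar> \<le> 1 \<longrightarrow> norm (Rl \<xi> (A \<xi> *v x)) \<le> C * (\<bar>\<xi>\<bar> * norm x)"
    by (rule low_dom_eventually[OF 14]) simp
  have ev15: "\<forall>\<^sub>F C in at_top. \<forall>\<xi> x. \<bar>\<xi>\<bar> \<le> 1 \<longrightarrow> norm (Tl' (A \<xi> *v x)) \<le> C * (\<bar>\<xi>\<bar> * norm x)"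
    by (rule low_dom_eventually[OF 15]) simp
  have ev16: "\<forall>\<^sub>F C in at_top. \<forall>\<xi> x. \<bar>\<xi>\<bar> \<le> 1 \<longrightarrow> norm (ul \<xi> (A \<xi> *v x)) \<le> C * (\<bar>\<xi>\<bar>\<^sup>2 * norm (P x) + \<bar>\<xi>\<bar>\<^sup>2 * norm (x $ 1) + norm (x $ 8))"
    by (rule low_dom_eventually[OF 16]) simp
  note ev = low_dom_eventually[OF _ norm_ge_zero]
  have "eventually low_bound at_top"
    using eventually_ge_at_top[of 1] ev[OF e(1)] ev[OF e(2)] ev[OF e(3)] ev[OF e(6)] ev[OF e'(1)] ev[OF e'(2)]
      ev[OF e'(3)] ev[OF e'(4)] ev[OF e'(5)] ev10 ev[OF 11] ev12 ev13 ev14 ev15 ev16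
  proof eventually_elim
    case (elim C)
    show ?case unfolding low_bound_def
      by (intro conjI allI impI elim(1)) (rule elim(2-)[rule_format], assumption)+
  qed
  then show ?thesis by (auto simp: eventually_at_top_linorder)
qed

text \<open>The chain is \<eta>, \<open>W\<close>, v, \<open>Q\<close>, \<open>P\<close>,
  \<open>Rl\<close>, \<open>Tl'\<close>, \<open>ul\<close>. The step to \<open>P\<close> starts from
  \<open>Wl\<close> instead of \<open>Q\<close>: the remainder - 2 k1 v in the derivative of
  \<open>Q\<close> would require the weight |\<xi>|^4 and leave only |\<xi>|^6 |P|^2, whereas the
  remainder for \<open>Wl\<close> is at most C (\<xi>^2 |v| + |\<eta>|) and gives |\<xi>|^4 |P|^2.
  \<open>Rl\<close> plays the same part on the way to \<open>Tl'\<close>.\<close>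

lemma dissipated_low: "dissipated A {\<xi>. 0 < \<bar>\<xi>\<bar> \<and> \<bar>\<xi>\<bar> \<le> 1} Tl Nl Tl"
proof -
  obtain C where "low_bound C" using ex_low_bound by blast
  note C = low_boundD[OF this]
  let ?L = "{\<xi>::real. 0 < \<bar>\<xi>\<bar> \<and> \<bar>\<xi>\<bar> \<le> 1}"
  have C0: "0 \<le> C" using C(1) by simp
  have N0: "0 \<le> Nl \<xi> x" and T0: "0 \<le> Tl \<xi> x" for \<xi> x by (simp_all add: Nl_def Tl_def)
  have r: "0 < \<bar>\<xi>\<bar>" "\<bar>\<xi>\<bar> \<le> 1" "\<bar>\<xi>\<bar>\<^sup>2 \<le> 1" "\<bar>\<xi>\<bar> ^ 3 \<le> 1" "\<bar>\<xi>\<bar> ^ 4 \<le> 1"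
    if "\<xi> \<in> ?L" for \<xi>
  proof -
    have "\<bar>\<xi>\<bar> ^ n \<le> 1" for n using that by (intro power_le_one) auto
    then show "\<bar>\<xi>\<bar>\<^sup>2 \<le> 1" "\<bar>\<xi>\<bar> ^ 3 \<le> 1" "\<bar>\<xi>\<bar> ^ 4 \<le> 1" by blast+
  qed (use that in auto)
  have p1: "p * X \<le> X" if "0 \<le> p" "p \<le> 1" "0 \<le> X" for p X :: real
    using that by (simp add: mult_left_le_one_le)
  note le = Finite_Cartesian_Product.norm_nth_le
  have sqs: "0 \<le> (\<bar>\<xi>\<bar> * norm (W x))\<^sup>2"
    "0 \<le> (\<bar>\<xi>\<bar>\<^sup>2 * norm (x $ 1))\<^sup>2"
    "0 \<le> (\<bar>\<xi>\<bar>\<^sup>2 * norm (Q \<xi> x))\<^sup>2"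
    "0 \<le> (\<bar>\<xi>\<bar>\<^sup>2 * norm (P x))\<^sup>2"
    "0 \<le> (\<bar>\<xi>\<bar>\<^sup>2 * norm (Rl \<xi> x))\<^sup>2"
    "0 \<le> (\<bar>\<xi>\<bar>\<^sup>2 * norm (Tl' x))\<^sup>2"
    "0 \<le> (\<bar>\<xi>\<bar>\<^sup>2 * norm (ul \<xi> x))\<^sup>2"
    "0 \<le> Nl \<xi> x" "(norm (x $ 8))\<^sup>2 = Nl \<xi> x" "(\<bar>\<xi>\<bar>\<^sup>2 * norm x)\<^sup>2 = Tl \<xi> x" "0 \<le> Tl \<xi> x" for \<xi> x
    by (simp_all add: Nl_def Tl_def)
  have W1: "norm (W (A \<xi> *v x)) \<le> C * (\<bar>\<xi>\<bar> * (norm x + norm (x $ 8)))" if "\<bar>\<xi>\<bar> \<le> 1" for \<xi> x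
    using C0 le[of x 1] by (intro order_trans[OF C(11)[OF that]] mult_left_mono add_right_mono) auto
  let ?q1 = "\<lambda>\<xi> x. Nl \<xi> x + (\<bar>\<xi>\<bar> * norm (W x))\<^sup>2"
  let ?q2 = "\<lambda>\<xi> x. ?q1 \<xi> x + (\<bar>\<xi>\<bar>\<^sup>2 * norm (x $ 1))\<^sup>2"
  let ?q3 = "\<lambda>\<xi> x. ?q2 \<xi> x + (\<bar>\<xi>\<bar>\<^sup>2 * norm (Q \<xi> x))\<^sup>2"
  let ?q4 = "\<lambda>\<xi> x. ?q3 \<xi> x + (\<bar>\<xi>\<bar>\<^sup>2 * norm (P x))\<^sup>2"
  let ?q5 = "\<lambda>\<xi> x. ?q4 \<xi> x + (\<bar>\<xi>\<bar>\<^sup>2 * norm (Rl \<xi> x))\<^sup>2"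
  let ?q6 = "\<lambda>\<xi> x. ?q5 \<xi> x + (\<bar>\<xi>\<bar>\<^sup>2 * norm (Tl' x))\<^sup>2"
  let ?q7 = "\<lambda>\<xi> x. ?q6 \<xi> x + (\<bar>\<xi>\<bar>\<^sup>2 * norm (ul \<xi> x))\<^sup>2"
  have 0: "dissipated A ?L Tl Nl Nl" by (rule dissipated_observed[OF T0])
  \<comment> \<open>The cross term contains |\<xi>| times the derivative of \<open>W\<close>, which
    brings a second factor |\<xi>|. The resulting \<xi>^2 |x| is what fixes the weight of the
    total.\<close>
  have 1: "dissipated A ?L Tl Nl ?q1"
  proof (rule dissipated_chain[OF 0, where \<alpha> = "\<lambda>\<xi>. 1" and b = "\<lambda>\<xi>. s \<xi>"
        and f = "\<lambda>\<xi> x. x $ 8" and g = "\<lambda>\<xi> x. W x" and h = "\<lambda>\<xi> x. - complex_of_real (k5 * \<xi> ^ (2 * \<epsilon>)) * x $ 8" and L = "1"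
        and ?M1.0 = "C" and ?M2.0 = "k5\<^sup>2" and ?M3.0 = "1" and ?M4.0 = "2 * C\<^sup>2"
        and a = "\<lambda>\<xi> x. norm (x $ 8)" and y = "\<lambda>\<xi> x. C * (\<bar>\<xi>\<bar>\<^sup>2 * norm x + \<bar>\<xi>\<bar>\<^sup>2 * norm (x $ 8))"])
    fix \<xi> and x :: "complex^8" assume H: "\<xi> \<in> ?L"
    note r = r[OF H] and sqs = sqs[where \<xi> = \<xi> and x = x]
    have b: "norm (s \<xi>) = \<bar>\<xi>\<bar>" by (simp add: norm_mult norm_power abs_mult power_abs)
    show "1 * (norm (s \<xi>) * norm (W x) * norm (x $ 8)) \<le> C * (norm x)\<^sup>2"
      unfolding b
    proof (rule product_bound[OF _ _ _ C(2)[OF r(2)] _ le])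
      have "1 * (\<bar>\<xi>\<bar> * (C * norm x) * (norm x)) = \<bar>\<xi>\<bar> * (C * (norm x)\<^sup>2)"
        by algebra
      also have "\<dots> \<le> C * (norm x)\<^sup>2"
        using r C0 by (intro p1) (auto simp: power_le_one)
      finally show "1 * (\<bar>\<xi>\<bar> * (C * norm x) * (norm x)) \<le> C * (norm x)\<^sup>2" .
    qed (use C0 in auto)
    show "1 * (norm (- complex_of_real (k5 * \<xi> ^ (2 * \<epsilon>)) * x $ 8))\<^sup>2 \<le> k5\<^sup>2 * (Nl \<xi> x)"
      proof -
      have "norm (- complex_of_real (k5 * \<xi> ^ (2 * \<epsilon>)) * x $ 8) = (\<bar>\<xi>\<bar> ^ (2 * \<epsilon>) * k5) * norm (x $ 8)"
        unfolding norm_mult norm_minus_cancel norm_of_real abs_mult using k \<epsilon> by auto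
      also have "\<dots> \<le> k5 * norm (x $ 8)" using k r \<epsilon> by (intro mult_right_mono p1) (auto simp: power_le_one)
      finally have "(norm (- complex_of_real (k5 * \<xi> ^ (2 * \<epsilon>)) * x $ 8))\<^sup>2 \<le> (k5 * norm (x $ 8))\<^sup>2" by (rule power_mono) simp
      then show ?thesis unfolding Nl_def power_mult_distrib mult_1 .
    qed
    show "(norm (x $ 8))\<^sup>2 \<le> 1 * (Nl \<xi> x)"
      unfolding mult_1 using sqs by linarith
    show "(C * (\<bar>\<xi>\<bar>\<^sup>2 * norm x + \<bar>\<xi>\<bar>\<^sup>2 * norm (x $ 8)))\<^sup>2 \<le> 2 * C\<^sup>2 * (Nl \<xi> x + Tl \<xi> x)"
      proof -
      have "(\<bar>\<xi>\<bar>\<^sup>2 * norm x + \<bar>\<xi>\<bar>\<^sup>2 * norm (x $ 8))\<^sup>2 \<le> 2 * (Nl \<xi> x + Tl \<xi> x)"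
      proof -
        have "(\<bar>\<xi>\<bar>\<^sup>2 * norm (x $ 8))\<^sup>2 \<le> (norm (x $ 8))\<^sup>2" using r by (intro power_mono p1) (auto simp: power_le_one)
        then show ?thesis using square_add_le[of "\<bar>\<xi>\<bar>\<^sup>2 * norm x" "\<bar>\<xi>\<bar>\<^sup>2 * norm (x $ 8)"] sqs unfolding distrib_left by linarith
      qed
      from mult_left_mono[OF this zero_le_power2[of C]] show ?thesis by (simp only: power_mult_distrib mult_ac)
    qed
    show "1 * (norm (s \<xi>) * norm (W (A \<xi> *v x)) * norm (x $ 8)) \<le> norm (x $ 8) * (C * (\<bar>\<xi>\<bar>\<^sup>2 * norm x + \<bar>\<xi>\<bar>\<^sup>2 * norm (x $ 8)))"
      unfolding b
      proof (rule product_bound[OF _ _ _ W1[OF r(2)] _ order_refl])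
      show "1 * (\<bar>\<xi>\<bar> * (C * (\<bar>\<xi>\<bar> * (norm x + norm (x $ 8)))) * (norm (x $ 8))) \<le> norm (x $ 8) * (C * (\<bar>\<xi>\<bar>\<^sup>2 * norm x + \<bar>\<xi>\<bar>\<^sup>2 * norm (x $ 8)))"
        by (rule eq_refl) algebra
    qed auto
    have "(\<bar>\<xi>\<bar> * norm (W x))\<^sup>2 = 1 * (1 * (\<bar>\<xi>\<bar> * norm (W x))\<^sup>2)"
      by simp
    then show "(\<bar>\<xi>\<bar> * norm (W x))\<^sup>2 \<le> 1 * (1 * (norm (s \<xi>) * norm (W x))\<^sup>2)"
      unfolding b by (rule eq_refl)
  qed (use C0 N0 T0 in \<open>auto simp: forms_A forms_A_low linear_nth linear_forms linear_low algebra_simps\<close>)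
  have 2: "dissipated A ?L Tl Nl ?q2"
  proof (rule dissipated_chain[OF 1, where \<alpha> = "\<lambda>\<xi>. \<bar>\<xi>\<bar>\<^sup>2" and b = "\<lambda>\<xi>. - (\<gamma> * k1 * s \<xi>)"
        and f = "\<lambda>\<xi> x. W x" and g = "\<lambda>\<xi> x. x $ 1" and h = "\<lambda>\<xi> x. complex_of_real (k4 + \<gamma>\<^sup>2) * s \<xi> * x $ 8" and L = "1 / \<bar>\<gamma> * k1\<bar>\<^sup>2"
        and ?M1.0 = "\<bar>\<gamma> * k1\<bar> * C" and ?M2.0 = "\<bar>k4 + \<gamma>\<^sup>2\<bar>\<^sup>2" and ?M3.0 = "1" and ?M4.0 = "(\<bar>\<gamma> * k1\<bar> * C)\<^sup>2"
        and a = "\<lambda>\<xi> x. \<bar>\<xi>\<bar> * norm (W x)" and y = "\<lambda>\<xi> x. \<bar>\<gamma> * k1\<bar> * C * (\<bar>\<xi>\<bar>\<^sup>2 * norm x)"])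
    fix \<xi> and x :: "complex^8" assume H: "\<xi> \<in> ?L"
    note r = r[OF H] and sqs = sqs[where \<xi> = \<xi> and x = x]
    have b: "norm (- (\<gamma> * k1 * s \<xi>)) = \<bar>\<gamma> * k1\<bar> * \<bar>\<xi>\<bar>" by (simp add: norm_mult norm_power abs_mult power_abs)
    show "\<bar>\<xi>\<bar>\<^sup>2 * (norm (- (\<gamma> * k1 * s \<xi>)) * norm (x $ 1) * norm (W x)) \<le> \<bar>\<gamma> * k1\<bar> * C * (norm x)\<^sup>2"
      unfolding b
    proof (rule product_bound[OF _ _ _ le _ C(2)[OF r(2)]])
      have "\<bar>\<xi>\<bar>\<^sup>2 * (\<bar>\<gamma> * k1\<bar> * \<bar>\<xi>\<bar> * (norm x) * (C * norm x)) = (\<bar>\<xi>\<bar>)^3 * (\<bar>\<gamma> * k1\<bar> * C * (norm x)\<^sup>2)"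
        by algebra
      also have "\<dots> \<le> \<bar>\<gamma> * k1\<bar> * C * (norm x)\<^sup>2"
        using r C0 by (intro p1) (auto simp: power_le_one)
      finally show "\<bar>\<xi>\<bar>\<^sup>2 * (\<bar>\<gamma> * k1\<bar> * \<bar>\<xi>\<bar> * (norm x) * (C * norm x)) \<le> \<bar>\<gamma> * k1\<bar> * C * (norm x)\<^sup>2" .
    qed (use C0 in auto)
    show "\<bar>\<xi>\<bar>\<^sup>2 * (norm (complex_of_real (k4 + \<gamma>\<^sup>2) * s \<xi> * x $ 8))\<^sup>2 \<le> \<bar>k4 + \<gamma>\<^sup>2\<bar>\<^sup>2 * (?q1 \<xi> x)"
      proof -
      have "norm (complex_of_real (k4 + \<gamma>\<^sup>2) * s \<xi> * x $ 8) = \<bar>k4 + \<gamma>\<^sup>2\<bar> * \<bar>\<xi>\<bar> * norm (x $ 8)"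
        by (simp only: norm_mult norm_of_real norm_ii mult_1)
      then have "\<bar>\<xi>\<bar>\<^sup>2 * (norm (complex_of_real (k4 + \<gamma>\<^sup>2) * s \<xi> * x $ 8))\<^sup>2 = (\<bar>\<xi>\<bar>)^4 * (\<bar>k4 + \<gamma>\<^sup>2\<bar>\<^sup>2 * (norm (x $ 8))\<^sup>2)"
        by algebra
      also have "\<dots> \<le> \<bar>k4 + \<gamma>\<^sup>2\<bar>\<^sup>2 * (norm (x $ 8))\<^sup>2" using r by (intro p1) (auto simp: power_le_one)
      also have "\<dots> \<le> \<bar>k4 + \<gamma>\<^sup>2\<bar>\<^sup>2 * (?q1 \<xi> x)"
        by (rule mult_left_mono) (use sqs in linarith, simp)
      finally show ?thesis .
    qed
    show "(\<bar>\<xi>\<bar> * norm (W x))\<^sup>2 \<le> 1 * (?q1 \<xi> x)"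
      unfolding mult_1 using sqs by linarith
    show "(\<bar>\<gamma> * k1\<bar> * C * (\<bar>\<xi>\<bar>\<^sup>2 * norm x))\<^sup>2 \<le> (\<bar>\<gamma> * k1\<bar> * C)\<^sup>2 * (?q1 \<xi> x + Tl \<xi> x)"
      proof -
      have "(\<bar>\<gamma> * k1\<bar> * C * (\<bar>\<xi>\<bar>\<^sup>2 * norm x))\<^sup>2 = (\<bar>\<gamma> * k1\<bar> * C)\<^sup>2 * (\<bar>\<xi>\<bar>\<^sup>2 * norm x)\<^sup>2" by algebra
      also have "\<dots> \<le> (\<bar>\<gamma> * k1\<bar> * C)\<^sup>2 * (?q1 \<xi> x + Tl \<xi> x)" by (rule mult_left_mono) (use sqs in linarith, use C0 in simp)
      finally show ?thesis .
    qed
    show "\<bar>\<xi>\<bar>\<^sup>2 * (norm (- (\<gamma> * k1 * s \<xi>)) * norm ((A \<xi> *v x) $ 1) * norm (W x)) \<le> \<bar>\<xi>\<bar> * norm (W x) * (\<bar>\<gamma> * k1\<bar> * C * (\<bar>\<xi>\<bar>\<^sup>2 * norm x))"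
      unfolding b
      proof (rule product_bound[OF _ _ _ eq_refl[OF arg_cong[OF forms_A(3), of norm], THEN order_trans, OF C(5)[OF r(2)]] _ order_refl])
      show "\<bar>\<xi>\<bar>\<^sup>2 * (\<bar>\<gamma> * k1\<bar> * \<bar>\<xi>\<bar> * (C * norm x) * (norm (W x))) \<le> \<bar>\<xi>\<bar> * norm (W x) * (\<bar>\<gamma> * k1\<bar> * C * (\<bar>\<xi>\<bar>\<^sup>2 * norm x))"
        by (rule eq_refl) algebra
    qed auto
    have "(\<bar>\<xi>\<bar>\<^sup>2 * norm (x $ 1))\<^sup>2 = 1 / \<bar>\<gamma> * k1\<bar>\<^sup>2 * (\<bar>\<xi>\<bar>\<^sup>2 * (\<bar>\<gamma> * k1\<bar> * \<bar>\<xi>\<bar> * norm (x $ 1))\<^sup>2)"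
      using \<gamma> k by (simp add: power_mult_distrib field_simps)
    then show "(\<bar>\<xi>\<bar>\<^sup>2 * norm (x $ 1))\<^sup>2 \<le> 1 / \<bar>\<gamma> * k1\<bar>\<^sup>2 * (\<bar>\<xi>\<bar>\<^sup>2 * (norm (- (\<gamma> * k1 * s \<xi>)) * norm (x $ 1))\<^sup>2)"
      unfolding b by (rule eq_refl)
  qed (use C0 N0 T0 in \<open>auto simp: forms_A forms_A_low linear_nth linear_forms linear_low algebra_simps\<close>)
  \<comment> \<open>The derivative of \<open>Q\<close> is of order zero here, so the weight
    |\<xi>|^4 is shared equally by the dissipated v and by x.\<close>
  have 3: "dissipated A ?L Tl Nl ?q3"
  proof (rule dissipated_chain[OF 2, where \<alpha> = "\<lambda>\<xi>. (\<bar>\<xi>\<bar>)^4" and b = "\<lambda>\<xi>. 1"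
        and f = "\<lambda>\<xi> x. x $ 1" and g = "\<lambda>\<xi> x. Q \<xi> x" and h = "\<lambda>\<xi> x. 0" and L = "1"
        and ?M1.0 = "C" and ?M2.0 = "0" and ?M3.0 = "1" and ?M4.0 = "C\<^sup>2"
        and a = "\<lambda>\<xi> x. \<bar>\<xi>\<bar>\<^sup>2 * norm (x $ 1)" and y = "\<lambda>\<xi> x. C * (\<bar>\<xi>\<bar>\<^sup>2 * norm x)"])
    fix \<xi> and x :: "complex^8" assume H: "\<xi> \<in> ?L"
    note r = r[OF H] and sqs = sqs[where \<xi> = \<xi> and x = x]
    have b: "norm (1::complex) = 1" by (simp add: norm_mult norm_power abs_mult power_abs)
    show "(\<bar>\<xi>\<bar>)^4 * (norm (1::complex) * norm (Q \<xi> x) * norm (x $ 1)) \<le> C * (norm x)\<^sup>2"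
      unfolding b
    proof (rule product_bound[OF _ _ _ C(5)[OF r(2)] _ le])
      have "(\<bar>\<xi>\<bar>)^4 * (1 * (C * norm x) * (norm x)) = (\<bar>\<xi>\<bar>)^4 * (C * (norm x)\<^sup>2)"
        by algebra
      also have "\<dots> \<le> C * (norm x)\<^sup>2"
        using r C0 by (intro p1) (auto simp: power_le_one)
      finally show "(\<bar>\<xi>\<bar>)^4 * (1 * (C * norm x) * (norm x)) \<le> C * (norm x)\<^sup>2" .
    qed (use C0 in auto)
    show "(\<bar>\<xi>\<bar>)^4 * (norm (0::complex))\<^sup>2 \<le> 0 * (?q2 \<xi> x)"
      by simp
    show "(\<bar>\<xi>\<bar>\<^sup>2 * norm (x $ 1))\<^sup>2 \<le> 1 * (?q2 \<xi> x)"
      unfolding mult_1 using sqs by linarith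
    show "(C * (\<bar>\<xi>\<bar>\<^sup>2 * norm x))\<^sup>2 \<le> C\<^sup>2 * (?q2 \<xi> x + Tl \<xi> x)"
      proof -
      have "(C * (\<bar>\<xi>\<bar>\<^sup>2 * norm x))\<^sup>2 = C\<^sup>2 * (\<bar>\<xi>\<bar>\<^sup>2 * norm x)\<^sup>2" by algebra
      also have "\<dots> \<le> C\<^sup>2 * (?q2 \<xi> x + Tl \<xi> x)" by (rule mult_left_mono) (use sqs in linarith, use C0 in simp)
      finally show ?thesis .
    qed
    show "(\<bar>\<xi>\<bar>)^4 * (norm (1::complex) * norm (Q \<xi> (A \<xi> *v x)) * norm (x $ 1)) \<le> \<bar>\<xi>\<bar>\<^sup>2 * norm (x $ 1) * (C * (\<bar>\<xi>\<bar>\<^sup>2 * norm x))"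
      unfolding b
      proof (rule product_bound[OF _ _ _ C(12)[OF r(2)] _ order_refl])
      show "(\<bar>\<xi>\<bar>)^4 * (1 * (C * norm x) * (norm (x $ 1))) \<le> \<bar>\<xi>\<bar>\<^sup>2 * norm (x $ 1) * (C * (\<bar>\<xi>\<bar>\<^sup>2 * norm x))"
        by (rule eq_refl) algebra
    qed auto
    have "(\<bar>\<xi>\<bar>\<^sup>2 * norm (Q \<xi> x))\<^sup>2 = 1 * ((\<bar>\<xi>\<bar>)^4 * (1 * norm (Q \<xi> x))\<^sup>2)"
      by algebra
    then show "(\<bar>\<xi>\<bar>\<^sup>2 * norm (Q \<xi> x))\<^sup>2 \<le> 1 * ((\<bar>\<xi>\<bar>)^4 * (norm (1::complex) * norm (Q \<xi> x))\<^sup>2)"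
      unfolding b by (rule eq_refl)
  qed (use C0 N0 T0 in \<open>auto simp: forms_A forms_A_low linear_nth linear_forms linear_low algebra_simps\<close>)
  have Wl: "norm (Wl \<xi> x) \<le> norm (W x) + \<bar>\<gamma> / 2\<bar> * \<bar>\<xi>\<bar> * norm (Q \<xi> x)" for \<xi> x
    unfolding Wl_def by (intro norm_minus_mono order_refl) (simp add: norm_mult)
  have sbound: "norm (s \<xi> * z) \<le> \<bar>\<xi>\<bar> * (C * norm x)" if "norm z \<le> C * norm x" for \<xi> z and x :: "complex^8"
    unfolding norm_mult[of "s \<xi>" z] norm_s using that by (intro mult_left_mono) auto
  \<comment> \<open>The factor \<open>a\<close> comes from the triangle inequality for
    \<open>Wl\<close>, both parts of which are already dissipated.\<close>
  have 4: "dissipated A ?L Tl Nl ?q4"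
  proof (rule dissipated_chain[OF 3, where \<alpha> = "\<lambda>\<xi>. 1" and b = "\<lambda>\<xi>. complex_of_real (- (\<gamma> / 2)) * (s \<xi>)\<^sup>2"
        and f = "\<lambda>\<xi> x. Wl \<xi> x" and g = "\<lambda>\<xi> x. P x" and h = "\<lambda>\<xi> x. hW \<xi> x" and L = "1 / \<bar>\<gamma> / 2\<bar>\<^sup>2"
        and ?M1.0 = "\<bar>\<gamma> / 2\<bar> * C\<^sup>2" and ?M2.0 = "2 * C\<^sup>2" and ?M3.0 = "2 * (1 + \<bar>\<gamma> / 2\<bar>\<^sup>2)" and ?M4.0 = "(\<bar>\<gamma> / 2\<bar> * C)\<^sup>2"
        and a = "\<lambda>\<xi> x. \<bar>\<xi>\<bar> * norm (W x) + \<bar>\<gamma> / 2\<bar> * (\<bar>\<xi>\<bar>\<^sup>2 * norm (Q \<xi> x))" and y = "\<lambda>\<xi> x. \<bar>\<gamma> / 2\<bar> * C * (\<bar>\<xi>\<bar>\<^sup>2 * norm x)"])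
    fix \<xi> and x :: "complex^8" assume H: "\<xi> \<in> ?L"
    note r = r[OF H] and sqs = sqs[where \<xi> = \<xi> and x = x]
    have b: "norm (complex_of_real (- (\<gamma> / 2)) * (s \<xi>)\<^sup>2) = \<bar>\<gamma> / 2\<bar> * \<bar>\<xi>\<bar>\<^sup>2" by (simp add: norm_mult norm_power abs_mult power_abs)
    show "1 * (norm (complex_of_real (- (\<gamma> / 2)) * (s \<xi>)\<^sup>2) * norm (P x) * norm (Wl \<xi> x)) \<le> \<bar>\<gamma> / 2\<bar> * C\<^sup>2 * (norm x)\<^sup>2"
      unfolding b
    proof (rule product_bound[OF _ _ _ C(3)[OF r(2)] _ C(6)[OF r(2)]])
      have "1 * (\<bar>\<gamma> / 2\<bar> * \<bar>\<xi>\<bar>\<^sup>2 * (C * norm x) * (C * norm x)) = \<bar>\<xi>\<bar>\<^sup>2 * (\<bar>\<gamma> / 2\<bar> * C\<^sup>2 * (norm x)\<^sup>2)"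
        by algebra
      also have "\<dots> \<le> \<bar>\<gamma> / 2\<bar> * C\<^sup>2 * (norm x)\<^sup>2"
        using r C0 by (intro p1) (auto simp: power_le_one)
      finally show "1 * (\<bar>\<gamma> / 2\<bar> * \<bar>\<xi>\<bar>\<^sup>2 * (C * norm x) * (C * norm x)) \<le> \<bar>\<gamma> / 2\<bar> * C\<^sup>2 * (norm x)\<^sup>2" .
    qed (use C0 in auto)
    show "1 * (norm (hW \<xi> x))\<^sup>2 \<le> 2 * C\<^sup>2 * (?q3 \<xi> x)"
      proof -
      have "1 * (norm (hW \<xi> x))\<^sup>2 \<le> (C * (\<bar>\<xi>\<bar>\<^sup>2 * norm (x $ 1) + norm (x $ 8)))\<^sup>2" unfolding mult_1 using C(13)[OF r(2)] by (intro power_mono) auto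
      also have "\<dots> = C\<^sup>2 * (\<bar>\<xi>\<bar>\<^sup>2 * norm (x $ 1) + norm (x $ 8))\<^sup>2" by algebra
      also have "\<dots> \<le> C\<^sup>2 * (2 * (?q3 \<xi> x))"
      proof (rule mult_left_mono)
        show "(\<bar>\<xi>\<bar>\<^sup>2 * norm (x $ 1) + norm (x $ 8))\<^sup>2 \<le> 2 * (?q3 \<xi> x)"
          using square_add_le[of "\<bar>\<xi>\<bar>\<^sup>2 * norm (x $ 1)" "norm (x $ 8)"] sqs unfolding distrib_left by linarith
      qed simp
      finally show ?thesis by (simp only: mult_ac)
    qed
    show "(\<bar>\<xi>\<bar> * norm (W x) + \<bar>\<gamma> / 2\<bar> * (\<bar>\<xi>\<bar>\<^sup>2 * norm (Q \<xi> x)))\<^sup>2 \<le> 2 * (1 + \<bar>\<gamma> / 2\<bar>\<^sup>2) * (?q3 \<xi> x)"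
      proof -
      have "(\<bar>\<xi>\<bar> * norm (W x) + \<bar>\<gamma> / 2\<bar> * (\<bar>\<xi>\<bar>\<^sup>2 * norm (Q \<xi> x)))\<^sup>2 \<le> 2 * ((\<bar>\<xi>\<bar> * norm (W x))\<^sup>2 + \<bar>\<gamma> / 2\<bar>\<^sup>2 * (\<bar>\<xi>\<bar>\<^sup>2 * norm (Q \<xi> x))\<^sup>2)"
        using square_add_le[of "\<bar>\<xi>\<bar> * norm (W x)" "\<bar>\<gamma> / 2\<bar> * (\<bar>\<xi>\<bar>\<^sup>2 * norm (Q \<xi> x))"] unfolding power_mult_distrib[of "\<bar>\<gamma> / 2\<bar>"] .
      also have "\<dots> \<le> 2 * (1 * (?q3 \<xi> x) + \<bar>\<gamma> / 2\<bar>\<^sup>2 * (?q3 \<xi> x))"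
      proof (rule mult_left_mono[OF add_mono])
        show "(\<bar>\<xi>\<bar> * norm (W x))\<^sup>2 \<le> 1 * (?q3 \<xi> x)" unfolding mult_1 using sqs by linarith
        show "\<bar>\<gamma> / 2\<bar>\<^sup>2 * (\<bar>\<xi>\<bar>\<^sup>2 * norm (Q \<xi> x))\<^sup>2 \<le> \<bar>\<gamma> / 2\<bar>\<^sup>2 * (?q3 \<xi> x)"
          by (rule mult_left_mono) (use sqs in linarith, simp)
      qed simp
      finally show ?thesis unfolding distrib_right[symmetric] by (simp only: mult_ac)
    qed
    show "(\<bar>\<gamma> / 2\<bar> * C * (\<bar>\<xi>\<bar>\<^sup>2 * norm x))\<^sup>2 \<le> (\<bar>\<gamma> / 2\<bar> * C)\<^sup>2 * (?q3 \<xi> x + Tl \<xi> x)"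
      proof -
      have "(\<bar>\<gamma> / 2\<bar> * C * (\<bar>\<xi>\<bar>\<^sup>2 * norm x))\<^sup>2 = (\<bar>\<gamma> / 2\<bar> * C)\<^sup>2 * (\<bar>\<xi>\<bar>\<^sup>2 * norm x)\<^sup>2" by algebra
      also have "\<dots> \<le> (\<bar>\<gamma> / 2\<bar> * C)\<^sup>2 * (?q3 \<xi> x + Tl \<xi> x)" by (rule mult_left_mono) (use sqs in linarith, use C0 in simp)
      finally show ?thesis .
    qed
    show "1 * (norm (complex_of_real (- (\<gamma> / 2)) * (s \<xi>)\<^sup>2) * norm (P (A \<xi> *v x)) * norm (Wl \<xi> x)) \<le> (\<bar>\<xi>\<bar> * norm (W x) + \<bar>\<gamma> / 2\<bar> * (\<bar>\<xi>\<bar>\<^sup>2 * norm (Q \<xi> x))) * (\<bar>\<gamma> / 2\<bar> * C * (\<bar>\<xi>\<bar>\<^sup>2 * norm x))"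
      unfolding b
      proof (rule product_bound[OF _ _ _ eq_refl[OF arg_cong[OF forms_A(5), of norm], THEN order_trans, OF sbound[OF C(4)[OF r(2)]]] _ Wl[of \<xi> x]])
      show "1 * (\<bar>\<gamma> / 2\<bar> * \<bar>\<xi>\<bar>\<^sup>2 * (\<bar>\<xi>\<bar> * (C * norm x)) * (norm (W x) + \<bar>\<gamma> / 2\<bar> * \<bar>\<xi>\<bar> * norm (Q \<xi> x))) \<le> (\<bar>\<xi>\<bar> * norm (W x) + \<bar>\<gamma> / 2\<bar> * (\<bar>\<xi>\<bar>\<^sup>2 * norm (Q \<xi> x))) * (\<bar>\<gamma> / 2\<bar> * C * (\<bar>\<xi>\<bar>\<^sup>2 * norm x))"
        by (rule eq_refl) algebra
    qed auto
    have "(\<bar>\<xi>\<bar>\<^sup>2 * norm (P x))\<^sup>2 = 1 / \<bar>\<gamma> / 2\<bar>\<^sup>2 * (1 * (\<bar>\<gamma> / 2\<bar> * \<bar>\<xi>\<bar>\<^sup>2 * norm (P x))\<^sup>2)"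
      using \<gamma> by (intro square_scale) simp
    then show "(\<bar>\<xi>\<bar>\<^sup>2 * norm (P x))\<^sup>2 \<le> 1 / \<bar>\<gamma> / 2\<bar>\<^sup>2 * (1 * (norm (complex_of_real (- (\<gamma> / 2)) * (s \<xi>)\<^sup>2) * norm (P x))\<^sup>2)"
      unfolding b by (rule eq_refl)
  qed (use C0 N0 T0 in \<open>auto simp: forms_A forms_A_low linear_nth linear_forms linear_low algebra_simps\<close>)
  have 5: "dissipated A ?L Tl Nl ?q5"
  proof (rule dissipated_chain[OF 4, where \<alpha> = "\<lambda>\<xi>. \<bar>\<xi>\<bar>\<^sup>2" and b = "\<lambda>\<xi>. s \<xi>"
        and f = "\<lambda>\<xi> x. P x" and g = "\<lambda>\<xi> x. Rl \<xi> x" and h = "\<lambda>\<xi> x. complex_of_real ((k2 + k3) / 2) * (s \<xi> * Q \<xi> x)" and L = "1"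
        and ?M1.0 = "C\<^sup>2" and ?M2.0 = "\<bar>(k2 + k3) / 2\<bar>\<^sup>2" and ?M3.0 = "1" and ?M4.0 = "C\<^sup>2"
        and a = "\<lambda>\<xi> x. \<bar>\<xi>\<bar>\<^sup>2 * norm (P x)" and y = "\<lambda>\<xi> x. C * (\<bar>\<xi>\<bar>\<^sup>2 * norm x)"])
    fix \<xi> and x :: "complex^8" assume H: "\<xi> \<in> ?L"
    note r = r[OF H] and sqs = sqs[where \<xi> = \<xi> and x = x]
    have b: "norm (s \<xi>) = \<bar>\<xi>\<bar>" by (simp add: norm_mult norm_power abs_mult power_abs)
    show "\<bar>\<xi>\<bar>\<^sup>2 * (norm (s \<xi>) * norm (Rl \<xi> x) * norm (P x)) \<le> C\<^sup>2 * (norm x)\<^sup>2"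
      unfolding b
    proof (rule product_bound[OF _ _ _ C(7)[OF r(2)] _ C(3)[OF r(2)]])
      have "\<bar>\<xi>\<bar>\<^sup>2 * (\<bar>\<xi>\<bar> * (C * norm x) * (C * norm x)) = (\<bar>\<xi>\<bar>)^3 * (C\<^sup>2 * (norm x)\<^sup>2)"
        by algebra
      also have "\<dots> \<le> C\<^sup>2 * (norm x)\<^sup>2"
        using r C0 by (intro p1) (auto simp: power_le_one)
      finally show "\<bar>\<xi>\<bar>\<^sup>2 * (\<bar>\<xi>\<bar> * (C * norm x) * (C * norm x)) \<le> C\<^sup>2 * (norm x)\<^sup>2" .
    qed (use C0 in auto)
    show "\<bar>\<xi>\<bar>\<^sup>2 * (norm (complex_of_real ((k2 + k3) / 2) * (s \<xi> * Q \<xi> x)))\<^sup>2 \<le> \<bar>(k2 + k3) / 2\<bar>\<^sup>2 * (?q4 \<xi> x)"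
      proof -
      have "norm (complex_of_real ((k2 + k3) / 2) * (s \<xi> * Q \<xi> x)) = \<bar>(k2 + k3) / 2\<bar> * (\<bar>\<xi>\<bar> * norm (Q \<xi> x))" by (simp only: norm_mult norm_of_real norm_ii mult_1)
      then have "\<bar>\<xi>\<bar>\<^sup>2 * (norm (complex_of_real ((k2 + k3) / 2) * (s \<xi> * Q \<xi> x)))\<^sup>2 = \<bar>(k2 + k3) / 2\<bar>\<^sup>2 * (\<bar>\<xi>\<bar>\<^sup>2 * norm (Q \<xi> x))\<^sup>2" by algebra
      also have "\<dots> \<le> \<bar>(k2 + k3) / 2\<bar>\<^sup>2 * (?q4 \<xi> x)" by (rule mult_left_mono) (use sqs in linarith, simp)
      finally show ?thesis .
    qed
    show "(\<bar>\<xi>\<bar>\<^sup>2 * norm (P x))\<^sup>2 \<le> 1 * (?q4 \<xi> x)"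
      unfolding mult_1 using sqs by linarith
    show "(C * (\<bar>\<xi>\<bar>\<^sup>2 * norm x))\<^sup>2 \<le> C\<^sup>2 * (?q4 \<xi> x + Tl \<xi> x)"
      proof -
      have "(C * (\<bar>\<xi>\<bar>\<^sup>2 * norm x))\<^sup>2 = C\<^sup>2 * (\<bar>\<xi>\<bar>\<^sup>2 * norm x)\<^sup>2" by algebra
      also have "\<dots> \<le> C\<^sup>2 * (?q4 \<xi> x + Tl \<xi> x)" by (rule mult_left_mono) (use sqs in linarith, use C0 in simp)
      finally show ?thesis .
    qed
    show "\<bar>\<xi>\<bar>\<^sup>2 * (norm (s \<xi>) * norm (Rl \<xi> (A \<xi> *v x)) * norm (P x)) \<le> \<bar>\<xi>\<bar>\<^sup>2 * norm (P x) * (C * (\<bar>\<xi>\<bar>\<^sup>2 * norm x))"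
      unfolding b
      proof (rule product_bound[OF _ _ _ C(15)[OF r(2)] _ order_refl])
      show "\<bar>\<xi>\<bar>\<^sup>2 * (\<bar>\<xi>\<bar> * (C * (\<bar>\<xi>\<bar> * norm x)) * (norm (P x))) \<le> \<bar>\<xi>\<bar>\<^sup>2 * norm (P x) * (C * (\<bar>\<xi>\<bar>\<^sup>2 * norm x))"
        by (rule eq_refl) algebra
    qed auto
    have "(\<bar>\<xi>\<bar>\<^sup>2 * norm (Rl \<xi> x))\<^sup>2 = 1 * (\<bar>\<xi>\<bar>\<^sup>2 * (\<bar>\<xi>\<bar> * norm (Rl \<xi> x))\<^sup>2)"
      by algebra
    then show "(\<bar>\<xi>\<bar>\<^sup>2 * norm (Rl \<xi> x))\<^sup>2 \<le> 1 * (\<bar>\<xi>\<bar>\<^sup>2 * (norm (s \<xi>) * norm (Rl \<xi> x))\<^sup>2)"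
      unfolding b by (rule eq_refl)
  next
    fix \<xi> x
    show "P (A \<xi> *v x) = s \<xi> * Rl \<xi> x + complex_of_real ((k2 + k3) / 2) * (s \<xi> * Q \<xi> x)"
      by (rule forms_A_low(2))
  qed (use C0 N0 T0 in \<open>auto simp: forms_A forms_A_low linear_nth linear_forms linear_low algebra_simps\<close>)
  have 6: "dissipated A ?L Tl Nl ?q6"
  proof (rule dissipated_chain[OF 5, where \<alpha> = "\<lambda>\<xi>. \<bar>\<xi>\<bar>\<^sup>2" and b = "\<lambda>\<xi>. s \<xi>"
        and f = "\<lambda>\<xi> x. Rl \<xi> x" and g = "\<lambda>\<xi> x. Tl' x" and h = "\<lambda>\<xi> x. hR \<xi> x" and L = "1"
        and ?M1.0 = "C\<^sup>2" and ?M2.0 = "2 * C\<^sup>2" and ?M3.0 = "1" and ?M4.0 = "C\<^sup>2"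
        and a = "\<lambda>\<xi> x. \<bar>\<xi>\<bar>\<^sup>2 * norm (Rl \<xi> x)" and y = "\<lambda>\<xi> x. C * (\<bar>\<xi>\<bar>\<^sup>2 * norm x)"])
    fix \<xi> and x :: "complex^8" assume H: "\<xi> \<in> ?L"
    note r = r[OF H] and sqs = sqs[where \<xi> = \<xi> and x = x]
    have b: "norm (s \<xi>) = \<bar>\<xi>\<bar>" by (simp add: norm_mult norm_power abs_mult power_abs)
    show "\<bar>\<xi>\<bar>\<^sup>2 * (norm (s \<xi>) * norm (Tl' x) * norm (Rl \<xi> x)) \<le> C\<^sup>2 * (norm x)\<^sup>2"
      unfolding b
    proof (rule product_bound[OF _ _ _ C(8)[OF r(2)] _ C(7)[OF r(2)]])
      have "\<bar>\<xi>\<bar>\<^sup>2 * (\<bar>\<xi>\<bar> * (C * norm x) * (C * norm x)) = (\<bar>\<xi>\<bar>)^3 * (C\<^sup>2 * (norm x)\<^sup>2)"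
        by algebra
      also have "\<dots> \<le> C\<^sup>2 * (norm x)\<^sup>2"
        using r C0 by (intro p1) (auto simp: power_le_one)
      finally show "\<bar>\<xi>\<bar>\<^sup>2 * (\<bar>\<xi>\<bar> * (C * norm x) * (C * norm x)) \<le> C\<^sup>2 * (norm x)\<^sup>2" .
    qed (use C0 in auto)
    show "\<bar>\<xi>\<bar>\<^sup>2 * (norm (hR \<xi> x))\<^sup>2 \<le> 2 * C\<^sup>2 * (?q5 \<xi> x)"
      proof -
      have "\<bar>\<xi>\<bar>\<^sup>2 * (norm (hR \<xi> x))\<^sup>2 \<le> 1 * (C * ((norm (x $ 1) + norm (x $ 8)) * \<bar>\<xi>\<bar>\<^sup>2))\<^sup>2"
        using C(14)[OF r(2)] r by (intro mult_mono power_mono) (auto simp: power_le_one)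
      also have "\<dots> = C\<^sup>2 * (\<bar>\<xi>\<bar>\<^sup>2 * norm (x $ 1) + \<bar>\<xi>\<bar>\<^sup>2 * norm (x $ 8))\<^sup>2" by algebra
      also have "\<dots> \<le> C\<^sup>2 * (2 * (?q5 \<xi> x))"
      proof (rule mult_left_mono)
        have "(\<bar>\<xi>\<bar>\<^sup>2 * norm (x $ 8))\<^sup>2 \<le> (norm (x $ 8))\<^sup>2" using r by (intro power_mono p1) (auto simp: power_le_one)
        then show "(\<bar>\<xi>\<bar>\<^sup>2 * norm (x $ 1) + \<bar>\<xi>\<bar>\<^sup>2 * norm (x $ 8))\<^sup>2 \<le> 2 * (?q5 \<xi> x)"
          using square_add_le[of "\<bar>\<xi>\<bar>\<^sup>2 * norm (x $ 1)" "\<bar>\<xi>\<bar>\<^sup>2 * norm (x $ 8)"] sqs unfolding distrib_left by linarith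
      qed simp
      finally show ?thesis by (simp only: mult_ac)
    qed
    show "(\<bar>\<xi>\<bar>\<^sup>2 * norm (Rl \<xi> x))\<^sup>2 \<le> 1 * (?q5 \<xi> x)"
      unfolding mult_1 using sqs by linarith
    show "(C * (\<bar>\<xi>\<bar>\<^sup>2 * norm x))\<^sup>2 \<le> C\<^sup>2 * (?q5 \<xi> x + Tl \<xi> x)"
      proof -
      have "(C * (\<bar>\<xi>\<bar>\<^sup>2 * norm x))\<^sup>2 = C\<^sup>2 * (\<bar>\<xi>\<bar>\<^sup>2 * norm x)\<^sup>2" by algebra
      also have "\<dots> \<le> C\<^sup>2 * (?q5 \<xi> x + Tl \<xi> x)" by (rule mult_left_mono) (use sqs in linarith, use C0 in simp)
      finally show ?thesis .
    qed
    show "\<bar>\<xi>\<bar>\<^sup>2 * (norm (s \<xi>) * norm (Tl' (A \<xi> *v x)) * norm (Rl \<xi> x)) \<le> \<bar>\<xi>\<bar>\<^sup>2 * norm (Rl \<xi> x) * (C * (\<bar>\<xi>\<bar>\<^sup>2 * norm x))"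
      unfolding b
      proof (rule product_bound[OF _ _ _ C(16)[OF r(2)] _ order_refl])
      show "\<bar>\<xi>\<bar>\<^sup>2 * (\<bar>\<xi>\<bar> * (C * (\<bar>\<xi>\<bar> * norm x)) * (norm (Rl \<xi> x))) \<le> \<bar>\<xi>\<bar>\<^sup>2 * norm (Rl \<xi> x) * (C * (\<bar>\<xi>\<bar>\<^sup>2 * norm x))"
        by (rule eq_refl) algebra
    qed auto
    have "(\<bar>\<xi>\<bar>\<^sup>2 * norm (Tl' x))\<^sup>2 = 1 * (\<bar>\<xi>\<bar>\<^sup>2 * (\<bar>\<xi>\<bar> * norm (Tl' x))\<^sup>2)"
      by algebra
    then show "(\<bar>\<xi>\<bar>\<^sup>2 * norm (Tl' x))\<^sup>2 \<le> 1 * (\<bar>\<xi>\<bar>\<^sup>2 * (norm (s \<xi>) * norm (Tl' x))\<^sup>2)"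
      unfolding b by (rule eq_refl)
  qed (use C0 N0 T0 in \<open>auto simp: forms_A forms_A_low linear_nth linear_forms linear_low algebra_simps\<close>)
  \<comment> \<open>The roles are reversed: the factor already dissipated is the derivative of
    \<open>ul\<close>, which involves only \<open>P\<close>, v and \<eta>, while \<open>pl\<close>
    itself is charged to the total. So \<open>pl\<close> can be used although it was never gained in
    the chain.\<close>
  have 7: "dissipated A ?L Tl Nl ?q7"
  proof (rule dissipated_chain[OF 6, where \<alpha> = "\<lambda>\<xi>. 1" and b = "\<lambda>\<xi>. - (s \<xi>)\<^sup>2"
        and f = "\<lambda>\<xi> x. pl \<xi> x" and g = "\<lambda>\<xi> x. ul \<xi> x" and h = "\<lambda>\<xi> x. (s \<xi>) ^ 3 * Q \<xi> x / 2" and L = "1"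
        and ?M1.0 = "C\<^sup>2" and ?M2.0 = "1" and ?M3.0 = "3" and ?M4.0 = "(C * C)\<^sup>2"
        and a = "\<lambda>\<xi> x. \<bar>\<xi>\<bar>\<^sup>2 * norm (P x) + \<bar>\<xi>\<bar>\<^sup>2 * norm (x $ 1) + norm (x $ 8)" and y = "\<lambda>\<xi> x. C * C * (\<bar>\<xi>\<bar>\<^sup>2 * norm x)"])
    fix \<xi> and x :: "complex^8" assume H: "\<xi> \<in> ?L"
    note r = r[OF H] and sqs = sqs[where \<xi> = \<xi> and x = x]
    have b: "norm (- (s \<xi>)\<^sup>2) = \<bar>\<xi>\<bar>\<^sup>2" by (simp add: norm_mult norm_power abs_mult power_abs)
    show "1 * (norm (- (s \<xi>)\<^sup>2) * norm (ul \<xi> x) * norm (pl \<xi> x)) \<le> C\<^sup>2 * (norm x)\<^sup>2"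
      unfolding b
    proof (rule product_bound[OF _ _ _ C(10)[OF r(2)] _ C(9)[OF r(2)]])
      have "1 * (\<bar>\<xi>\<bar>\<^sup>2 * (C * norm x) * (C * norm x)) = \<bar>\<xi>\<bar>\<^sup>2 * (C\<^sup>2 * (norm x)\<^sup>2)"
        by algebra
      also have "\<dots> \<le> C\<^sup>2 * (norm x)\<^sup>2"
        using r C0 by (intro p1) (auto simp: power_le_one)
      finally show "1 * (\<bar>\<xi>\<bar>\<^sup>2 * (C * norm x) * (C * norm x)) \<le> C\<^sup>2 * (norm x)\<^sup>2" .
    qed (use C0 in auto)
    show "1 * (norm ((s \<xi>) ^ 3 * Q \<xi> x / 2))\<^sup>2 \<le> 1 * (?q6 \<xi> x)"
      proof -
      have "norm ((s \<xi>) ^ 3 * Q \<xi> x / 2) = \<bar>\<xi>\<bar> ^ 3 * norm (Q \<xi> x) / 2" by (simp add: norm_mult norm_divide norm_power)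
      then have "1 * (norm ((s \<xi>) ^ 3 * Q \<xi> x / 2))\<^sup>2 = (\<bar>\<xi>\<bar>\<^sup>2 / 4) * (\<bar>\<xi>\<bar>\<^sup>2 * norm (Q \<xi> x))\<^sup>2" by (simp add: power2_eq_square power3_eq_cube)
      also have "\<dots> \<le> (\<bar>\<xi>\<bar>\<^sup>2 * norm (Q \<xi> x))\<^sup>2" using r by (intro p1) auto
      also have "\<dots> \<le> 1 * (?q6 \<xi> x)" unfolding mult_1 using sqs by linarith
      finally show ?thesis .
    qed
    show "(\<bar>\<xi>\<bar>\<^sup>2 * norm (P x) + \<bar>\<xi>\<bar>\<^sup>2 * norm (x $ 1) + norm (x $ 8))\<^sup>2 \<le> 3 * (?q6 \<xi> x)"
      using square_add3_le[of "\<bar>\<xi>\<bar>\<^sup>2 * norm (P x)" "\<bar>\<xi>\<bar>\<^sup>2 * norm (x $ 1)" "norm (x $ 8)"] sqs unfolding distrib_left by linarith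
    show "(C * C * (\<bar>\<xi>\<bar>\<^sup>2 * norm x))\<^sup>2 \<le> (C * C)\<^sup>2 * (?q6 \<xi> x + Tl \<xi> x)"
      proof -
      have "(C * C * (\<bar>\<xi>\<bar>\<^sup>2 * norm x))\<^sup>2 = (C * C)\<^sup>2 * (\<bar>\<xi>\<bar>\<^sup>2 * norm x)\<^sup>2" by algebra
      also have "\<dots> \<le> (C * C)\<^sup>2 * (?q6 \<xi> x + Tl \<xi> x)" by (rule mult_left_mono) (use sqs in linarith, use C0 in simp)
      finally show ?thesis .
    qed
    show "1 * (norm (- (s \<xi>)\<^sup>2) * norm (ul \<xi> (A \<xi> *v x)) * norm (pl \<xi> x)) \<le> (\<bar>\<xi>\<bar>\<^sup>2 * norm (P x) + \<bar>\<xi>\<bar>\<^sup>2 * norm (x $ 1) + norm (x $ 8)) * (C * C * (\<bar>\<xi>\<bar>\<^sup>2 * norm x))"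
      unfolding b
      proof (rule product_bound[OF _ _ _ C(17)[OF r(2)] _ C(9)[OF r(2)]])
      show "1 * (\<bar>\<xi>\<bar>\<^sup>2 * (C * (\<bar>\<xi>\<bar>\<^sup>2 * norm (P x) + \<bar>\<xi>\<bar>\<^sup>2 * norm (x $ 1) + norm (x $ 8))) * (C * norm x)) \<le> (\<bar>\<xi>\<bar>\<^sup>2 * norm (P x) + \<bar>\<xi>\<bar>\<^sup>2 * norm (x $ 1) + norm (x $ 8)) * (C * C * (\<bar>\<xi>\<bar>\<^sup>2 * norm x))"
        by (rule eq_refl) algebra
    qed auto
    have "(\<bar>\<xi>\<bar>\<^sup>2 * norm (ul \<xi> x))\<^sup>2 = 1 * (1 * (\<bar>\<xi>\<bar>\<^sup>2 * norm (ul \<xi> x))\<^sup>2)"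
      by algebra
    then show "(\<bar>\<xi>\<bar>\<^sup>2 * norm (ul \<xi> x))\<^sup>2 \<le> 1 * (1 * (norm (- (s \<xi>)\<^sup>2) * norm (ul \<xi> x))\<^sup>2)"
      unfolding b by (rule eq_refl)
  qed (use C0 N0 T0 in \<open>auto simp: forms_A forms_A_low linear_nth linear_forms linear_low algebra_simps\<close>)
  obtain K where "recovery_bound K" using ex_recovery_bound by blast
  note K = recovery_boundD[OF this]
  define m where "m = \<bar>(k2 + k3) / 2\<bar>"
  \<comment> \<open>The 3 counts v, u and \<eta>; the pair z, \<phi> contributes 2 K (1 + m), the
    pair y, \<theta> contributes 2 K (3 + m), and \<sigma> contributes 2 K.\<close>
  define M where "M = 3 + K * (10 + 4 * m)"
  have rec: "\<bar>\<xi>\<bar>\<^sup>2 * norm x \<le> M * (norm (x $ 8) + \<bar>\<xi>\<bar> * norm (W x) + \<bar>\<xi>\<bar>\<^sup>2 * norm (x $ 1) + \<bar>\<xi>\<bar>\<^sup>2 * norm (Q \<xi> x) + \<bar>\<xi>\<bar>\<^sup>2 * norm (P x) + \<bar>\<xi>\<bar>\<^sup>2 * norm (Rl \<xi> x) + \<bar>\<xi>\<bar>\<^sup>2 * norm (Tl' x) + \<bar>\<xi>\<bar>\<^sup>2 * norm (ul \<xi> x))" if H: "\<xi> \<in> ?L" for \<xi> x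
  proof -
    let ?p = "\<bar>\<xi>\<bar>\<^sup>2"
    note r = r[OF H]
    have p: "0 \<le> ?p" "?p \<le> 1" using r by simp_all
    have mp: "?p * X \<le> K * (?p * A + ?p * B)" if "X \<le> K * (A + B)" for X A B
      using mult_left_mono[OF that, of ?p] p by (simp add: algebra_simps)
    define \<Sigma> where "\<Sigma> = norm (x $ 8) + \<bar>\<xi>\<bar> * norm (W x) + \<bar>\<xi>\<bar>\<^sup>2 * norm (x $ 1) + \<bar>\<xi>\<bar>\<^sup>2 * norm (Q \<xi> x) + \<bar>\<xi>\<bar>\<^sup>2 * norm (P x) + \<bar>\<xi>\<bar>\<^sup>2 * norm (Rl \<xi> x) + \<bar>\<xi>\<bar>\<^sup>2 * norm (Tl' x) + \<bar>\<xi>\<bar>\<^sup>2 * norm (ul \<xi> x)"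
    have pos: "0 \<le> norm (x $ 8)" "0 \<le> \<bar>\<xi>\<bar> * norm (W x)" "0 \<le> \<bar>\<xi>\<bar>\<^sup>2 * norm (x $ 1)" "0 \<le> \<bar>\<xi>\<bar>\<^sup>2 * norm (Q \<xi> x)" "0 \<le> \<bar>\<xi>\<bar>\<^sup>2 * norm (P x)" "0 \<le> \<bar>\<xi>\<bar>\<^sup>2 * norm (Rl \<xi> x)" "0 \<le> \<bar>\<xi>\<bar>\<^sup>2 * norm (Tl' x)" "0 \<le> \<bar>\<xi>\<bar>\<^sup>2 * norm (ul \<xi> x)"
      using p by simp_all
    have m0: "0 \<le> m" by (simp add: m_def)
    have K0: "0 \<le> K" using K(1) by simp
    have \<Sigma>0: "0 \<le> \<Sigma>" using pos unfolding \<Sigma>_def by linarith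
    have T: "?p * norm (T x) \<le> \<bar>\<xi>\<bar>\<^sup>2 * norm (Tl' x) + m * (\<bar>\<xi>\<bar>\<^sup>2 * norm (P x))"
    proof -
      have "norm (T x) \<le> norm (Tl' x) + m * norm (P x)"
        using norm_triangle_ineq[of "Tl' x" "complex_of_real ((k2 + k3) / 2) * P x"]
        unfolding norm_mult norm_of_real m_def[symmetric] by (simp add: Tl'_def)
      from mult_left_mono[OF this p(1)] show ?thesis by (simp add: algebra_simps)
    qed
    have R: "?p * norm (R x) \<le> \<bar>\<xi>\<bar>\<^sup>2 * norm (Rl \<xi> x) + m * (\<bar>\<xi>\<bar>\<^sup>2 * norm (Q \<xi> x))"
    proof -
      have "norm (R x) \<le> norm (Rl \<xi> x) + m * norm (Q \<xi> x)"
        using norm_triangle_ineq[of "Rl \<xi> x" "complex_of_real ((k2 + k3) / 2) * Q \<xi> x"]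
        unfolding norm_mult norm_of_real m_def[symmetric] by (simp add: Rl_def)
      from mult_left_mono[OF this p(1)] show ?thesis by (simp add: algebra_simps)
    qed
    have sle: "norm (s \<xi> * z) \<le> norm z" for z
      unfolding norm_mult[of "s \<xi>"] norm_s using r by (simp add: mult_left_le_one_le)
    have u: "?p * norm (x $ 2) \<le> \<bar>\<xi>\<bar>\<^sup>2 * norm (ul \<xi> x) + \<bar>\<xi>\<bar>\<^sup>2 * norm (Q \<xi> x)"
    proof -
      have "norm (s \<xi> * Q \<xi> x / 2) \<le> norm (Q \<xi> x)"
        using sle[of "Q \<xi> x"] norm_ge_zero[of "Q \<xi> x"] unfolding norm_divide norm_numeral by linarith
      moreover have "x $ 2 = ul \<xi> x - s \<xi> * Q \<xi> x / 2" by (simp add: ul_def)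
      ultimately have "norm (x $ 2) \<le> norm (ul \<xi> x) + norm (Q \<xi> x)"
        by (metis norm_minus_mono order_refl)
      from mult_left_mono[OF this p(1)] show ?thesis by (simp add: algebra_simps)
    qed
    \<comment> \<open>\<open>S\<close> is not part of this chain, so y and \<theta> are recovered
      from \<open>R\<close> and from their sum, which \<open>Q\<close> and u determine.\<close>
    have yt: "?p * norm (x $ 4 + x $ 6) \<le> \<bar>\<xi>\<bar>\<^sup>2 * norm (Q \<xi> x) + ?p * norm (x $ 2)"
    proof -
      have "x $ 4 + x $ 6 = Q \<xi> x - s \<xi> * x $ 2" by (simp add: Q_def)
      then have "norm (x $ 4 + x $ 6) \<le> norm (Q \<xi> x) + norm (x $ 2)"
        by (metis norm_minus_mono order_refl sle)
      from mult_left_mono[OF this p(1)] show ?thesis by (simp add: algebra_simps)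
    qed
    have KS: "K * X \<le> K * Y" if "X \<le> Y" for X Y using that K0 by (rule mult_left_mono)
    have mS: "m * X \<le> m * \<Sigma>" if "X \<le> \<Sigma>" for X using that m0 by (rule mult_left_mono)
    have \<Sigma>: "norm (x $ 8) \<le> \<Sigma>" "\<bar>\<xi>\<bar> * norm (W x) \<le> \<Sigma>" "\<bar>\<xi>\<bar>\<^sup>2 * norm (x $ 1) \<le> \<Sigma>" "\<bar>\<xi>\<bar>\<^sup>2 * norm (Q \<xi> x) \<le> \<Sigma>" "\<bar>\<xi>\<bar>\<^sup>2 * norm (P x) \<le> \<Sigma>" "\<bar>\<xi>\<bar>\<^sup>2 * norm (Rl \<xi> x) \<le> \<Sigma>" "\<bar>\<xi>\<bar>\<^sup>2 * norm (Tl' x) \<le> \<Sigma>" "\<bar>\<xi>\<bar>\<^sup>2 * norm (ul \<xi> x) \<le> \<Sigma>"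
      "\<bar>\<xi>\<bar>\<^sup>2 * norm (ul \<xi> x) + \<bar>\<xi>\<bar>\<^sup>2 * norm (Q \<xi> x) \<le> \<Sigma>" "\<bar>\<xi>\<bar>\<^sup>2 * norm (P x) + \<bar>\<xi>\<bar>\<^sup>2 * norm (Tl' x) \<le> \<Sigma>"
      using pos unfolding \<Sigma>_def by linarith+
    have PT: "?p * norm (P x) + ?p * norm (T x) \<le> \<Sigma> + m * \<Sigma>"
      using T mS[OF \<Sigma>(5)] \<Sigma>(10) by linarith
    have RQ: "?p * norm (R x) + ?p * norm (x $ 4 + x $ 6) \<le> 3 * \<Sigma> + m * \<Sigma>"
      using R mS[OF \<Sigma>(4)] \<Sigma>(4,6,9) yt u by linarith
    have WU: "?p * norm (W x) + ?p * norm (x $ 2) \<le> 2 * \<Sigma>"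
    proof -
      have "?p * norm (W x) = \<bar>\<xi>\<bar> * (\<bar>\<xi>\<bar> * norm (W x))" by (simp only: power2_eq_square mult_ac)
      also have "\<dots> \<le> \<bar>\<xi>\<bar> * norm (W x)" using r by (intro p1) auto
      finally show ?thesis using \<Sigma>(2,9) u by linarith
    qed
    have 35: "?p * norm (x $ 3) \<le> K * (\<Sigma> + m * \<Sigma>)" "?p * norm (x $ 5) \<le> K * (\<Sigma> + m * \<Sigma>)"
      using mp[OF K(2)[of x]] mp[OF K(3)[of x]] KS[OF PT] by linarith+
    have 46: "?p * norm (x $ 4) \<le> K * (3 * \<Sigma> + m * \<Sigma>)" "?p * norm (x $ 6) \<le> K * (3 * \<Sigma> + m * \<Sigma>)"
      using mp[OF K(6)[of x]] mp[OF K(7)[of x]] KS[OF RQ] by linarith+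
    have 7: "?p * norm (x $ 7) \<le> K * (2 * \<Sigma>)"
      using mp[OF K(8)[of x]] KS[OF WU] by linarith
    have 8: "?p * norm (x $ 8) \<le> norm (x $ 8)" using p by (intro p1) auto
    have "?p * norm x \<le> ?p * (norm (x $ 1) + norm (x $ 2) + norm (x $ 3) + norm (x $ 4) + norm (x $ 5) + norm (x $ 6) +
        norm (x $ 7) + norm (x $ 8))"
      using norm_le_sum_nth[of x] p(1) by (intro mult_left_mono) auto
    also have "\<dots> \<le> \<Sigma> + \<Sigma> + K * (\<Sigma> + m * \<Sigma>) + K * (3 * \<Sigma> + m * \<Sigma>) + K * (\<Sigma> + m * \<Sigma>) + K * (3 * \<Sigma> + m * \<Sigma>) + K * (2 * \<Sigma>) + \<Sigma>"
      unfolding distrib_left[of ?p] using 35 46 7 8 u \<Sigma>(1,3,9) by linarith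
    also have "\<dots> = M * \<Sigma>" unfolding M_def by algebra
    finally show ?thesis by (simp add: \<Sigma>_def)
  qed
  have M0: "0 \<le> M" using K(1) by (simp add: M_def m_def)
  show ?thesis
  proof (rule dissipated_mono[OF 7, where M = "1 + 8 * M\<^sup>2"])
    fix \<xi> x assume H: "\<xi> \<in> ?L"
    have "Tl \<xi> x \<le> (M * (norm (x $ 8) + \<bar>\<xi>\<bar> * norm (W x) + \<bar>\<xi>\<bar>\<^sup>2 * norm (x $ 1) + \<bar>\<xi>\<bar>\<^sup>2 * norm (Q \<xi> x) + \<bar>\<xi>\<bar>\<^sup>2 * norm (P x) + \<bar>\<xi>\<bar>\<^sup>2 * norm (Rl \<xi> x) + \<bar>\<xi>\<bar>\<^sup>2 * norm (Tl' x) + \<bar>\<xi>\<bar>\<^sup>2 * norm (ul \<xi> x)))\<^sup>2"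
      unfolding Tl_def using rec[OF H] by (intro power_mono) auto
    also have "\<dots> = M\<^sup>2 * (norm (x $ 8) + \<bar>\<xi>\<bar> * norm (W x) + \<bar>\<xi>\<bar>\<^sup>2 * norm (x $ 1) + \<bar>\<xi>\<bar>\<^sup>2 * norm (Q \<xi> x) + \<bar>\<xi>\<bar>\<^sup>2 * norm (P x) + \<bar>\<xi>\<bar>\<^sup>2 * norm (Rl \<xi> x) + \<bar>\<xi>\<bar>\<^sup>2 * norm (Tl' x) + \<bar>\<xi>\<bar>\<^sup>2 * norm (ul \<xi> x))\<^sup>2" by (rule power_mult_distrib)
    also have "\<dots> \<le> M\<^sup>2 * (8 * (?q7 \<xi> x))"
    proof (rule mult_left_mono)
      show "(norm (x $ 8) + \<bar>\<xi>\<bar> * norm (W x) + \<bar>\<xi>\<bar>\<^sup>2 * norm (x $ 1) + \<bar>\<xi>\<bar>\<^sup>2 * norm (Q \<xi> x) + \<bar>\<xi>\<bar>\<^sup>2 * norm (P x) + \<bar>\<xi>\<bar>\<^sup>2 * norm (Rl \<xi> x) + \<bar>\<xi>\<bar>\<^sup>2 * norm (Tl' x) + \<bar>\<xi>\<bar>\<^sup>2 * norm (ul \<xi> x))\<^sup>2 \<le> 8 * (?q7 \<xi> x)"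
        by (rule order_trans[OF square_sum8_le]) (simp add: Nl_def)
    qed simp
    also have "\<dots> = 8 * M\<^sup>2 * (?q7 \<xi> x)" by (simp only: mult_ac)
    also have "\<dots> \<le> (1 + 8 * M\<^sup>2) * (?q7 \<xi> x)"
      using N0[of \<xi> x] by (intro mult_right_mono) auto
    finally show "Tl \<xi> x \<le> (1 + 8 * M\<^sup>2) * (?q7 \<xi> x)" .
  qed (simp add: add_pos_nonneg)
qed

end

section \<open>Decay of the propagator\<close>

lemma matrix_power_mult_vector: "(((**) A ^^ n) (mat 1)) *v x = (((*v) A) ^^ n) x"
  for A :: "complex^'n^'n"
  by (induction n) (simp_all add: matrix_vector_mul_assoc[symmetric])

lemma scaleR_matrix_mult: "(t *\<^sub>R A) ** (u *\<^sub>R B) = (t * u) *\<^sub>R (A ** B)" for A B :: "complex^'n^'n"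
  by (simp add: vec_eq_iff matrix_matrix_mult_def scaleR_sum_right mult_ac)

lemma matrix_power_scaleR:
  "((**) (t *\<^sub>R A) ^^ n) (mat 1) = t ^ n *\<^sub>R ((**) A ^^ n) (mat 1)" for A :: "complex^'n^'n"
  by (induction n) (simp_all add: scaleR_matrix_mult)

text \<open>An entry of the power is a coordinate of the n-th iterate applied to a basis vector, so
  the operator bound of \<open>A\<close> yields geometric growth.\<close>

lemma matrix_power_entry_bound:
  fixes A :: "complex^'n^'n"
  obtains K where "0 < K" "\<And>n i j. norm (((**) A ^^ n) (mat 1) $ i $ j) \<le> K ^ n"
proof -
  obtain K where K: "0 < K" "\<And>x. norm (A *v x) \<le> norm x * K"
    using bounded_linear.pos_bounded[of "(*v) A"] linear_conv_bounded_linear[of "(*v) A"]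
      matrix_vector_mul_linear[of A] by blast
  have pow: "norm (((*v) A ^^ n) x) \<le> K ^ n * norm x" for n x
  proof (induction n)
    case (Suc n)
    have "norm (A *v (((*v) A ^^ n) x)) \<le> norm (((*v) A ^^ n) x) * K" by (rule K)
    also have "\<dots> \<le> (K ^ n * norm x) * K" using Suc K(1) by (intro mult_right_mono) auto
    finally show ?case by (simp add: mult_ac)
  qed simp
  have "norm (((**) A ^^ n) (mat 1) $ i $ j) \<le> K ^ n" for n i j
  proof -
    have "((**) A ^^ n) (mat 1) $ i $ j = (((*v) A ^^ n) (axis j 1)) $ i"
      unfolding matrix_power_mult_vector[symmetric]
      by (simp add: matrix_vector_mult_def axis_def if_distrib[of "(*) _"] sum.delta cong: if_cong)
    then have "norm (((**) A ^^ n) (mat 1) $ i $ j) \<le> norm (((*v) A ^^ n) (axis j 1))"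
      by (simp add: Finite_Cartesian_Product.norm_nth_le)
    also have "\<dots> \<le> K ^ n * norm (axis j (1::complex) :: complex^'n)" by (rule pow)
    also have "norm (axis j (1::complex) :: complex^'n) = 1" by simp
    finally show ?thesis by simp
  qed
  then show thesis using K(1) that by blast
qed

text \<open>Entrywise the series is dominated by the exponential series of K |z|. Summability is
  stated for complex z so that the entries can be differentiated as complex power series.\<close>

lemma mat_exp_entry:
  fixes A :: "complex^'n^'n"
  shows "\<And>z. summable (\<lambda>n. (((**) A ^^ n) (mat 1) $ i $ j / fact n) * z ^ n)"
    and "mat_exp (t *\<^sub>R A) $ i $ j = (\<Sum>n. (((**) A ^^ n) (mat 1) $ i $ j / fact n) * of_real t ^ n)"
proof -
  obtain K where K: "0 < K" "\<And>n i j. norm (((**) A ^^ n) (mat 1) $ i $ j) \<le> K ^ n"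
    using matrix_power_entry_bound[of A] by blast
  have summ: "summable (\<lambda>n. (((**) A ^^ n) (mat 1) $ i $ j / fact n) * z ^ n)" for z i j
  proof (rule summable_comparison_test')
    show "summable (\<lambda>n. (K * norm z) ^ n / fact n)"
      using summable_exp[of "K * norm z"] by (simp add: field_simps)
    show "norm ((((**) A ^^ n) (mat 1) $ i $ j / fact n) * z ^ n) \<le> (K * norm z) ^ n / fact n" for n
      using K(2)[of n i j]
      by (simp add: norm_mult norm_divide norm_power power_mult_distrib divide_right_mono mult_right_mono)
  qed
  then show "\<And>z. summable (\<lambda>n. (((**) A ^^ n) (mat 1) $ i $ j / fact n) * z ^ n)" .
  define L where "L = (\<chi> i j. \<Sum>n. (((**) A ^^ n) (mat 1) $ i $ j / fact n) * of_real t ^ n)"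
  have "(\<lambda>n. (1 / fact n) *\<^sub>R ((**) (t *\<^sub>R A) ^^ n) (mat 1)) sums L"
    unfolding sums_def
  proof (intro vec_tendstoI)
    fix i j
    have "(\<lambda>n. (((**) A ^^ n) (mat 1) $ i $ j / fact n) * of_real t ^ n) sums (L $ i $ j)"
      unfolding L_def using summable_sums[OF summ] by simp
    then show "(\<lambda>N. (\<Sum>n<N. (1 / fact n) *\<^sub>R ((**) (t *\<^sub>R A) ^^ n) (mat 1)) $ i $ j) \<longlonglongrightarrow> L $ i $ j"
      unfolding sums_def matrix_power_scaleR sum_component vector_scaleR_component
      by (simp add: scaleR_conv_of_real field_simps)
  qed
  then show "mat_exp (t *\<^sub>R A) $ i $ j = (\<Sum>n. (((**) A ^^ n) (mat 1) $ i $ j / fact n) * of_real t ^ n)"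
    unfolding mat_exp_def using sums_unique[of _ L] by (simp add: L_def)
qed

lemma mat_exp_entry_derivative:
  fixes A :: "complex^'n^'n"
  shows "((\<lambda>t. mat_exp (t *\<^sub>R A) $ i $ j) has_vector_derivative (A ** mat_exp (t *\<^sub>R A)) $ i $ j) (at t)"
proof -
  define a where "a = (\<lambda>n. ((**) A ^^ n) (mat 1))"
  define c where "c = (\<lambda>i j n. a n $ i $ j / fact n)"
  have summ: "summable (\<lambda>n. c i j n * z ^ n)" for i j z
    unfolding c_def a_def by (rule mat_exp_entry)
  have E: "mat_exp (t *\<^sub>R A) $ i $ j = (\<Sum>n. c i j n * of_real t ^ n)" for t i j
    unfolding c_def a_def by (rule mat_exp_entry)
  \<comment> \<open>Differentiating shifts the coefficients by one, and (n + 1)/(n + 1)! = 1/n!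
    turns the shift into multiplication by \<open>A\<close> from the left.\<close>
  have "diffs (c i j) n = (\<Sum>k\<in>UNIV. A $ i $ k * c k j n)" for n
  proof -
    have "a (Suc n) $ i $ j = (\<Sum>k\<in>UNIV. A $ i $ k * a n $ k $ j)"
      by (simp add: a_def matrix_matrix_mult_def)
    then have "diffs (c i j) n = of_nat (Suc n) * ((\<Sum>k\<in>UNIV. A $ i $ k * a n $ k $ j) / (of_nat (Suc n) * fact n))"
      by (simp only: diffs_def c_def fact_Suc of_nat_mult of_nat_fact)
    also have "\<dots> = (\<Sum>k\<in>UNIV. A $ i $ k * a n $ k $ j) / fact n"
      by (simp del: of_nat_Suc)
    finally show ?thesis by (simp add: c_def sum_divide_distrib)
  qed
  then have "(\<Sum>n. diffs (c i j) n * of_real t ^ n) = (\<Sum>n. \<Sum>k\<in>UNIV. A $ i $ k * (c k j n * of_real t ^ n))"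
    by (simp add: sum_distrib_right mult.assoc)
  also have "\<dots> = (\<Sum>k\<in>UNIV. A $ i $ k * (\<Sum>n. c k j n * of_real t ^ n))"
    by (subst suminf_sum) (auto intro: summable_mult summ simp: suminf_mult[OF summ])
  also have "\<dots> = (A ** mat_exp (t *\<^sub>R A)) $ i $ j"
    by (simp add: matrix_matrix_mult_def E)
  finally have "((\<lambda>z. \<Sum>n. c i j n * z ^ n) has_field_derivative (A ** mat_exp (t *\<^sub>R A)) $ i $ j) (at (of_real t))"
    using termdiffs_strong_converges_everywhere[OF summ, of i j "of_real t"] by simp
  from has_vector_derivative_real_field[OF this] show ?thesis by (simp add: E)
qed

lemma vec_eq_sum_axis: "x = (\<Sum>i\<in>UNIV. axis i (x $ i))" for x :: "complex^'n"
  by (simp add: vec_eq_iff axis_def sum_component if_distrib cong: if_cong)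

lemma has_vector_derivative_vec:
  fixes X :: "real \<Rightarrow> complex^'n"
  assumes "\<And>i. ((\<lambda>t. X t $ i) has_vector_derivative D $ i) (at t)"
  shows "(X has_vector_derivative D) (at t)"
proof -
  have "((\<lambda>t. \<Sum>i\<in>UNIV. axis i (X t $ i)) has_vector_derivative (\<Sum>i\<in>UNIV. axis i (D $ i))) (at t)"
  proof (rule has_vector_derivative_sum)
    fix i :: 'n
    have "linear (axis i :: complex \<Rightarrow> complex^'n)"
      by (auto simp: linear_iff vec_eq_iff axis_def)
    from bounded_linear.has_vector_derivative[OF linear_conv_bounded_linear[THEN iffD1, OF this] assms]
    show "((\<lambda>t. axis i (X t $ i)) has_vector_derivative axis i (D $ i)) (at t)" .
  qed
  then show ?thesis by (simp flip: vec_eq_sum_axis)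
qed

lemma flow_solution_mat_exp: "flow_solution A (\<lambda>t. mat_exp (t *\<^sub>R A) *v x)" for A :: "complex^'n^'n"
  unfolding flow_solution_def
proof
  fix t
  show "((\<lambda>t. mat_exp (t *\<^sub>R A) *v x) has_vector_derivative A *v (mat_exp (t *\<^sub>R A) *v x)) (at t)"
  proof (rule has_vector_derivative_vec)
    fix i
    have "((\<lambda>t. \<Sum>j\<in>UNIV. mat_exp (t *\<^sub>R A) $ i $ j * x $ j) has_vector_derivative
        (\<Sum>j\<in>UNIV. (A ** mat_exp (t *\<^sub>R A)) $ i $ j * x $ j)) (at t)"
      by (intro has_vector_derivative_sum has_vector_derivative_mult_left mat_exp_entry_derivative)
    then show "((\<lambda>t. (mat_exp (t *\<^sub>R A) *v x) $ i) has_vector_derivative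
        (A *v (mat_exp (t *\<^sub>R A) *v x)) $ i) (at t)"
      unfolding matrix_vector_mul_assoc by (simp add: matrix_vector_mult_def)
  qed
qed

lemma mat_exp_0: "mat_exp (0 *\<^sub>R A) = mat 1" for A :: "complex^'n^'n"
proof -
  have "(\<Sum>n. (((**) A ^^ n) (mat 1) $ i $ j / fact n) * of_real 0 ^ n) = (mat 1 :: complex^'n^'n) $ i $ j" for i j
    by (subst suminf_finite[of "{0}"]) auto
  then show ?thesis using mat_exp_entry(2)[of 0 A] by (simp add: vec_eq_iff)
qed

section \<open>Exponential decay of the beam propagator\<close>

context beam
begin

definition rate :: "real \<Rightarrow> real" where
  "rate \<xi> = (if \<bar>\<xi>\<bar> \<le> 1 then \<bar>\<xi>\<bar> ^ (4 + 2 * \<epsilon>) else 1 / \<xi>\<^sup>2)"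

text \<open>For 0 < |\<xi>| \<le> 1 the weight |\<xi>|^(2\<epsilon>) of the energy loss is
  multiplied by the weight |\<xi>|^4 of the total; for |\<xi>| \<ge> 1 the first weight is 1. The
  larger factor and the smaller rate constant serve both regions. Frequency zero is a single point
  and hence negligible in the integrals to come.\<close>

lemma mat_exp_decay:
  "\<exists>C>0. \<exists>c>0. \<forall>\<xi> x t. \<xi> \<noteq> 0 \<longrightarrow> 0 \<le> t \<longrightarrow>
    (norm (mat_exp (t *\<^sub>R A \<xi>) *v x))\<^sup>2 \<le> C * exp (- (c * rate \<xi> * t)) * (norm x)\<^sup>2"
proof -
  define c1 where "c1 = min 1 (min k1 (min k2 (min k3 k4)))"
  define c2 where "c2 = max 1 (max k1 (max k2 (max k3 k4)))"
  have c1: "0 < c1" using k by (simp add: c1_def)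
  note E = lie_derivative_energy energy_bounds[folded c1_def c2_def]
  let ?L = "{\<xi>::real. 0 < \<bar>\<xi>\<bar> \<and> \<bar>\<xi>\<bar> \<le> 1}" and ?H = "{\<xi>::real. 1 \<le> \<bar>\<xi>\<bar>}"
  have "\<exists>C>0. \<exists>c>0. \<forall>\<xi>\<in>?L. \<forall>X. flow_solution (A \<xi>) X \<longrightarrow> (\<forall>t\<ge>0.
    (norm (X t))\<^sup>2 \<le> C * exp (- (c * \<bar>\<xi>\<bar> ^ (2 * \<epsilon>) * \<bar>\<xi>\<bar> ^ 4 * t)) * (norm (X 0))\<^sup>2)"
  proof (rule dissipated_decay[OF dissipated_low E(1) c1 E(2,3), where ?c3.0 = "2 * k5"
        and m = "\<lambda>\<xi>. \<bar>\<xi>\<bar> ^ (2 * \<epsilon>)" and \<rho> = "\<lambda>\<xi>. \<bar>\<xi>\<bar> ^ 4"])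
    show "- (2 * k5) * \<xi> ^ (2 * \<epsilon>) * (norm (x $ 8))\<^sup>2 \<le> - (2 * k5) * \<bar>\<xi>\<bar> ^ (2 * \<epsilon>) * Nl \<xi> x" for \<xi> x
      by (simp add: Nl_def power_even_abs)
    show "\<bar>\<xi>\<bar> ^ 4 * (norm x)\<^sup>2 \<le> Tl \<xi> x" for \<xi> x
      by (simp add: Tl_def power_mult_distrib)
    show "\<bar>\<xi>\<bar> ^ (2 * \<epsilon>) \<le> 1" if "\<xi> \<in> ?L" for \<xi> using that by (intro power_le_one) auto
  qed (use k in \<open>auto simp: Nl_def\<close>)
  then obtain C c where L: "0 < C" "0 < c" "\<And>\<xi> X t. \<xi> \<in> ?L \<Longrightarrow> flow_solution (A \<xi>) X \<Longrightarrow> 0 \<le> t \<Longrightarrow>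
    (norm (X t))\<^sup>2 \<le> C * exp (- (c * \<bar>\<xi>\<bar> ^ (2 * \<epsilon>) * \<bar>\<xi>\<bar> ^ 4 * t)) * (norm (X 0))\<^sup>2"
    by blast
  have "\<exists>C>0. \<exists>c>0. \<forall>\<xi>\<in>?H. \<forall>X. flow_solution (A \<xi>) X \<longrightarrow> (\<forall>t\<ge>0.
    (norm (X t))\<^sup>2 \<le> C * exp (- (c * 1 * (inv_abs \<xi>)\<^sup>2 * t)) * (norm (X 0))\<^sup>2)"
  proof (rule dissipated_decay[OF dissipated_high E(1) c1 E(2,3), where ?c3.0 = "2 * k5"
        and m = "\<lambda>\<xi>. 1" and \<rho> = "\<lambda>\<xi>. (inv_abs \<xi>)\<^sup>2"])
    show "- (2 * k5) * \<xi> ^ (2 * \<epsilon>) * (norm (x $ 8))\<^sup>2 \<le> - (2 * k5) * 1 * Nh \<xi> x" for \<xi> x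
      using \<epsilon> by (auto simp: Nh_def power_mult_distrib)
    show "(inv_abs \<xi>)\<^sup>2 * (norm x)\<^sup>2 \<le> Th \<xi> x" for \<xi> x
      by (simp add: Th_def power_mult_distrib)
  qed (use k in \<open>auto simp: Nh_def\<close>)
  then obtain C' c' where H: "0 < C'" "0 < c'" "\<And>\<xi> X t. \<xi> \<in> ?H \<Longrightarrow> flow_solution (A \<xi>) X \<Longrightarrow> 0 \<le> t \<Longrightarrow>
    (norm (X t))\<^sup>2 \<le> C' * exp (- (c' * 1 * (inv_abs \<xi>)\<^sup>2 * t)) * (norm (X 0))\<^sup>2"
    by blast
  have "(norm (mat_exp (t *\<^sub>R A \<xi>) *v x))\<^sup>2 \<le> max C C' * exp (- (min c c' * rate \<xi> * t)) * (norm x)\<^sup>2"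
    if "\<xi> \<noteq> 0" "0 \<le> t" for \<xi> x t
  proof -
    have weaken: "a * exp (- (d * rate \<xi> * t)) * (norm x)\<^sup>2 \<le> max C C' * exp (- (min c c' * rate \<xi> * t)) * (norm x)\<^sup>2"
      if "0 < a" "a \<le> max C C'" "min c c' \<le> d" for a d
    proof -
      have "0 \<le> rate \<xi>" by (simp add: rate_def)
      then have "min c c' * (rate \<xi> * t) \<le> d * (rate \<xi> * t)"
        using that \<open>0 \<le> t\<close> by (intro mult_right_mono) auto
      then show ?thesis using that L(1) by (intro mult_right_mono mult_mono) (auto simp: mult.assoc)
    qed
    note sol = flow_solution_mat_exp[of "A \<xi>" x]
    show ?thesis
    proof (cases "\<bar>\<xi>\<bar> \<le> 1")
      case True
      have "(norm (mat_exp (t *\<^sub>R A \<xi>) *v x))\<^sup>2 \<le> C * exp (- (c * rate \<xi> * t)) * (norm x)\<^sup>2"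
        using L(3)[OF _ sol \<open>0 \<le> t\<close>] True that
        by (simp only: mat_exp_0 matrix_vector_mul_lid)
          (simp add: rate_def power_add mult_ac)
      also have "\<dots> \<le> max C C' * exp (- (min c c' * rate \<xi> * t)) * (norm x)\<^sup>2"
        using L by (intro weaken) auto
      finally show ?thesis .
    next
      case False
      have "(norm (mat_exp (t *\<^sub>R A \<xi>) *v x))\<^sup>2 \<le> C' * exp (- (c' * rate \<xi> * t)) * (norm x)\<^sup>2"
        using H(3)[OF _ sol \<open>0 \<le> t\<close>] False that
        by (simp only: mat_exp_0 matrix_vector_mul_lid)
          (simp add: rate_def inv_abs_def field_simps)
      also have "\<dots> \<le> max C C' * exp (- (min c c' * rate \<xi> * t)) * (norm x)\<^sup>2"
        using H by (intro weaken) auto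
      finally show ?thesis .
    qed
  qed
  moreover have "0 < max C C'" "0 < min c c'" using L H by auto
  ultimately show ?thesis by blast
qed

end

section \<open>Test functions and weak derivatives\<close>

definition smooth :: "(real \<Rightarrow> real) \<Rightarrow> bool"
  where "smooth f \<longleftrightarrow> (\<forall>n x. (deriv ^^ n) f field_differentiable (at x))"

lemma test_function_iff: "test_function p \<longleftrightarrow> smooth p \<and> bounded {x. p x \<noteq> 0}"
  by (simp add: test_function_def smooth_def)

text \<open>A set of differentiable functions that is closed under \<open>deriv\<close> contains all
  iterated derivatives of its members. Smoothness is thus proved by exhibiting such a set, without
  formulas for higher derivatives.\<close>

lemma smooth_coinduct:
  assumes f: "f \<in> S" and diff: "\<And>g x. g \<in> S \<Longrightarrow> g field_differentiable (at x)"
    and deriv: "\<And>g. g \<in> S \<Longrightarrow> deriv g \<in> S"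
  shows "smooth f"
proof -
  have "(deriv ^^ n) f \<in> S" for n by (induction n) (auto intro: f deriv)
  then show ?thesis unfolding smooth_def using diff by blast
qed

lemma smooth_deriv: "smooth f \<Longrightarrow> smooth (deriv f)"
  unfolding smooth_def by (metis funpow_swap1 funpow.simps(2) comp_apply)

lemma smooth_DERIV: "smooth f \<Longrightarrow> (f has_real_derivative deriv f x) (at x)"
  unfolding smooth_def DERIV_deriv_iff_field_differentiable by (metis funpow_0)

lemma smooth_iterate_DERIV: "smooth f \<Longrightarrow> ((deriv ^^ n) f has_real_derivative (deriv ^^ Suc n) f x) (at x)"
  unfolding smooth_def by (simp add: DERIV_deriv_iff_field_differentiable)

text \<open>Here the invariant set is the range of the sequence; this form is used where the higher
  derivatives are explicit.\<close>

lemma smooth_sequence: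
  assumes "\<And>n x. (a n has_real_derivative a (Suc n) x) (at x)"
  shows "smooth (a 0)"
proof (rule smooth_coinduct[where S = "range a"])
  fix g assume "g \<in> range a"
  then obtain n where "g = a n" by blast
  then show "g field_differentiable (at x)" "deriv g \<in> range a" for x
    using assms[of n] by (auto simp: field_differentiable_def DERIV_imp_deriv[OF assms] intro!: ext)
qed simp

lemma smooth_affine:
  assumes "smooth f"
  shows "smooth (\<lambda>x. f (c * x + d))"
proof -
  define a where "a = (\<lambda>n x. c ^ n * (deriv ^^ n) f (c * x + d))"
  have "(a n has_real_derivative a (Suc n) x) (at x)" for n x
  proof -
    have "((\<lambda>x. (deriv ^^ n) f (c * x + d)) has_real_derivative (deriv ^^ Suc n) f (c * x + d) * c) (at x)"
      by (rule DERIV_chain2[OF smooth_iterate_DERIV[OF assms]]) (auto intro!: derivative_eq_intros)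
    then show ?thesis unfolding a_def by (auto intro!: derivative_eq_intros)
  qed
  from smooth_sequence[of a, OF this] show ?thesis by (simp add: a_def)
qed

text \<open>Leibniz's rule turns the derivative of a product into such a sum, so the set is
  invariant under differentiation and the binomial formula for higher derivatives is
  avoided.\<close>

inductive_set product_sums :: "(real \<Rightarrow> real) set" where
  product: "smooth f \<Longrightarrow> smooth g \<Longrightarrow> (\<lambda>x. f x * g x) \<in> product_sums"
| sum: "f \<in> product_sums \<Longrightarrow> g \<in> product_sums \<Longrightarrow> (\<lambda>x. f x + g x) \<in> product_sums"

lemma smooth_mult:
  assumes "smooth f" "smooth g"
  shows "smooth (\<lambda>x. f x * g x)"
proof (rule smooth_coinduct[where S = product_sums])
  have *: "(\<forall>x. h field_differentiable (at x)) \<and> deriv h \<in> product_sums" if "h \<in> product_sums" for h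
    using that
  proof induction
    case (product f g)
    have D: "((\<lambda>x. f x * g x) has_real_derivative f x * deriv g x + deriv f x * g x) (at x)" for x
      using DERIV_mult'[OF smooth_DERIV[OF product(1)] smooth_DERIV[OF product(2)]] .
    have "deriv (\<lambda>x. f x * g x) = (\<lambda>x. f x * deriv g x + deriv f x * g x)"
      using DERIV_imp_deriv[OF D] by blast
    moreover have "(\<lambda>x. f x * deriv g x + deriv f x * g x) \<in> product_sums"
      using product smooth_deriv by (intro product_sums.intros) auto
    ultimately show ?case using D unfolding field_differentiable_def by auto
  next
    case (sum f g)
    have "deriv (\<lambda>x. f x + g x) = (\<lambda>x. deriv f x + deriv g x)"
      using sum by auto
    then show ?case using sum by (auto intro!: product_sums.sum field_differentiable_add)
  qed
  show "h field_differentiable (at x)" "deriv h \<in> product_sums" if "h \<in> product_sums" for h x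
    using *[OF that] by blast+
qed (use assms in \<open>rule product_sums.product\<close>)

section \<open>Smooth cutoffs built from exp(-1/x)\<close>

definition flat :: "real poly \<Rightarrow> real \<Rightarrow> real"
  where "flat p x = (if 0 < x then poly p (1 / x) * exp (- (1 / x)) else 0)"

lemma poly_exp_tendsto_0: "((\<lambda>y. poly p y * exp (- y)) \<longlongrightarrow> (0::real)) at_top"
proof -
  have "((\<lambda>y. \<Sum>i\<le>degree p. coeff p i * (y ^ i / exp y)) \<longlongrightarrow> (\<Sum>i\<le>degree p. coeff p i * 0)) at_top"
    by (intro tendsto_sum tendsto_mult_left tendsto_power_div_exp_0)
  then show ?thesis by (simp add: poly_altdef exp_minus sum_divide_distrib field_simps)
qed

text \<open>With y = 1/x the derivative of p(y) exp(-y) in x is y^2 (p(y) - p'(y)) exp(-y), again of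
  the same kind, so the family is closed under differentiation. At the origin the right difference
  quotient is y p(y) exp(-y) with y tending to infinity.\<close>

lemma flat_derivative:
  "(flat p has_real_derivative flat ([:0, 0, 1:] * (p - pderiv p)) x) (at x)"
proof -
  consider "0 < x" | "x < 0" | "x = 0" by linarith
  then show ?thesis
  proof cases
    case 1
    have "((\<lambda>x. poly p (1 / x) * exp (- (1 / x))) has_real_derivative
        poly (pderiv p) (1 / x) * (- 1 / (x * x)) * exp (- (1 / x)) + poly p (1 / x) * (exp (- (1 / x)) * (1 / (x * x)))) (at x)"
      using 1 by (auto intro!: derivative_eq_intros DERIV_chain2[OF poly_DERIV] simp: field_simps)
    also have "poly (pderiv p) (1 / x) * (- 1 / (x * x)) * exp (- (1 / x)) + poly p (1 / x) * (exp (- (1 / x)) * (1 / (x * x))) =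
        flat ([:0, 0, 1:] * (p - pderiv p)) x"
      using 1 by (simp add: flat_def field_simps)
    finally show ?thesis
      by (rule has_field_derivative_transform_within_open[where S = "{0<..}"]) (use 1 in \<open>auto simp: flat_def\<close>)
  next
    case 2
    have "((\<lambda>x. 0) has_real_derivative 0) (at x)" by simp
    then have "(flat p has_real_derivative 0) (at x)"
      by (rule has_field_derivative_transform_within_open[where S = "{..<0}"]) (use 2 in \<open>auto simp: flat_def\<close>)
    then show ?thesis using 2 by (simp add: flat_def)
  next
    case 3
    have "((\<lambda>y. flat p y / y) \<longlongrightarrow> 0) (at_right 0)"
    proof (rule Lim_transform_eventually)
      show "((\<lambda>y. poly ([:0, 1:] * p) (inverse y) * exp (- inverse y)) \<longlongrightarrow> 0) (at_right 0)"
        by (rule filterlim_compose[OF poly_exp_tendsto_0 filterlim_inverse_at_top_right])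
      show "\<forall>\<^sub>F y in at_right 0. poly ([:0, 1:] * p) (inverse y) * exp (- inverse y) = flat p y / y"
        using eventually_at_right_less[of 0] by eventually_elim (simp add: flat_def field_simps)
    qed
    moreover have "((\<lambda>y. flat p y / y) \<longlongrightarrow> 0) (at_left 0)"
    proof (rule Lim_transform_eventually[OF tendsto_const])
      show "\<forall>\<^sub>F y in at_left 0. 0 = flat p y / y"
        using eventually_at_left_real[of "-1" 0] by (auto elim!: eventually_mono simp: flat_def)
    qed
    ultimately have "((\<lambda>y. flat p y / y) \<longlongrightarrow> 0) (at 0)"
      by (rule filterlim_split_at[rotated])
    then show ?thesis using 3 by (simp add: has_field_derivative_iff flat_def)
  qed
qed

lemma smooth_flat: "smooth (flat p)"
proof (rule smooth_coinduct[where S = "range flat"])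
  fix g assume "g \<in> range flat"
  then obtain p where p: "g = flat p" by blast
  have "deriv (flat p) = flat ([:0, 0, 1:] * (p - pderiv p))"
    using DERIV_imp_deriv[OF flat_derivative] by blast
  then show "g field_differentiable (at x)" "deriv g \<in> range flat" for x
    using flat_derivative[of p x] unfolding p field_differentiable_def by auto
qed simp

definition step :: "real \<Rightarrow> real" where "step x = (if 0 < x then exp (- (1 / x)) else 0)"

lemma smooth_step: "smooth step"
proof -
  have "step = flat 1" by (simp add: fun_eq_iff step_def flat_def)
  then show ?thesis by (metis smooth_flat)
qed

lemma step_bounds: "0 \<le> step x" "step x \<le> 1"
  by (auto simp: step_def)

lemma smooth_affine_step: "smooth (\<lambda>x. step (c * x + d))"
  by (rule smooth_affine[OF smooth_step])

text \<open>A bump supported in [-1, 1]. It is not normalised: its value at the origin is exp(-2),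
  and later it is divided out. The explicit factors 1 and - 1 match the shape of the lemmas on
  affine substitutions.\<close>

definition cutoff :: "real \<Rightarrow> real" where "cutoff x = step (1 * x + 1) * step (- 1 * x + 1)"

lemma test_function_deriv:
  assumes "test_function p"
  shows "test_function (deriv p)"
proof -
  have sm: "smooth p" and bd: "bounded {x. p x \<noteq> 0}" using assms by (auto simp: test_function_iff)
  from bd obtain R where R: "\<And>x. p x \<noteq> 0 \<Longrightarrow> \<bar>x\<bar> \<le> R" unfolding bounded_iff by auto
  have "deriv p x = 0" if "R < \<bar>x\<bar>" for x
  proof -
    have "((\<lambda>x. 0) has_real_derivative 0) (at x)" by simp
    then have "(p has_real_derivative 0) (at x)"
    proof (rule has_field_derivative_transform_within_open[where S = "{x. R < \<bar>x\<bar>}"])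
      show "open {x::real. R < \<bar>x\<bar>}" by (intro open_Collect_less continuous_intros)
      show "x \<in> {x. R < \<bar>x\<bar>}" using that by simp
      show "0 = p y" if "y \<in> {x. R < \<bar>x\<bar>}" for y using R[of y] that by auto
    qed
    then show ?thesis by (rule DERIV_imp_deriv)
  qed
  then have "bounded {x. deriv p x \<noteq> 0}" unfolding bounded_iff by (intro exI[of _ R]) force
  then show ?thesis using smooth_deriv[OF sm] by (simp add: test_function_iff)
qed

lemma test_function_mult:
  assumes "test_function p" "smooth f"
  shows "test_function (\<lambda>x. p x * f x)"
proof -
  have "{x. p x * f x \<noteq> 0} \<subseteq> {x. p x \<noteq> 0}" by auto
  then show ?thesis using assms smooth_mult unfolding test_function_iff by (auto intro: bounded_subset)
qed

lemma test_function_affine: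
  assumes "test_function p" "c \<noteq> 0"
  shows "test_function (\<lambda>x. p (c * x + d))"
proof -
  obtain R where R: "\<And>x. p x \<noteq> 0 \<Longrightarrow> \<bar>x\<bar> \<le> R"
    using assms unfolding test_function_iff bounded_iff by auto
  have "\<bar>x\<bar> \<le> (R + \<bar>d\<bar>) / \<bar>c\<bar>" if "p (c * x + d) \<noteq> 0" for x
  proof -
    have "\<bar>c\<bar> * \<bar>x\<bar> \<le> R + \<bar>d\<bar>" using R[OF that] unfolding abs_mult[symmetric] by linarith
    then show ?thesis using assms(2) by (simp add: field_simps)
  qed
  then have "bounded {x. p (c * x + d) \<noteq> 0}" unfolding bounded_iff by auto
  then show ?thesis using assms smooth_affine by (auto simp: test_function_iff)
qed

lemma test_function_step_product: "test_function (\<lambda>x. step (c * x + a) * step (- c * x + b))" if "0 < c"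
proof -
  have "\<bar>x\<bar> \<le> (\<bar>a\<bar> + \<bar>b\<bar>) / c" if "step (c * x + a) * step (- c * x + b) \<noteq> 0" for x
  proof -
    have "0 < c * x + a" "0 < - c * x + b" using that by (auto simp: step_def split: if_splits)
    then have "\<bar>c * x\<bar> \<le> \<bar>a\<bar> + \<bar>b\<bar>" by linarith
    then show ?thesis using \<open>0 < c\<close> by (simp add: abs_mult field_simps)
  qed
  then have "bounded {x. step (c * x + a) * step (- c * x + b) \<noteq> 0}" unfolding bounded_iff by auto
  then show ?thesis unfolding test_function_iff by (intro conjI smooth_mult smooth_affine_step)
qed

lemma test_function_cutoff: "test_function cutoff"
  using test_function_step_product[of 1 1 1] by (simp add: cutoff_def[abs_def])

lemma test_function_DERIV: "test_function p \<Longrightarrow> (p has_real_derivative deriv p x) (at x)"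
  by (simp add: test_function_iff smooth_DERIV)

lemma test_function_continuous: "test_function p \<Longrightarrow> continuous_on A p"
  by (meson DERIV_continuous continuous_at_imp_continuous_on test_function_DERIV)

lemma test_function_measurable: "test_function p \<Longrightarrow> p \<in> borel_measurable borel"
  by (simp add: borel_measurable_continuous_onI test_function_continuous)

lemma test_function_bounded:
  assumes "test_function p"
  obtains R B where "0 < R" "0 < B" "\<And>x. R < \<bar>x\<bar> \<Longrightarrow> p x = 0" "\<And>x. \<bar>p x\<bar> \<le> B"
    "\<And>x. \<bar>p x\<bar> \<le> B * indicator {-R..R} x"
proof -
  obtain R0 where R0: "\<And>x. p x \<noteq> 0 \<Longrightarrow> \<bar>x\<bar> \<le> R0"
    using assms unfolding test_function_iff bounded_iff by auto
  define R where "R = max R0 1"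
  have R: "0 < R" "\<And>x. R < \<bar>x\<bar> \<Longrightarrow> p x = 0" using R0 by (force simp: R_def)+
  have "bounded (p ` {-R..R})"
    by (intro compact_imp_bounded compact_continuous_image test_function_continuous assms) auto
  then obtain B0 where "\<forall>y\<in>p ` {-R..R}. norm y \<le> B0" unfolding bounded_iff by blast
  then have B0: "\<And>x. x \<in> {-R..R} \<Longrightarrow> \<bar>p x\<bar> \<le> B0" by simp
  define B where "B = max B0 1"
  have "\<bar>p x\<bar> \<le> B * indicator {-R..R} x" for x
    using B0[of x] R(2)[of x] by (cases "x \<in> {-R..R}") (auto simp: B_def le_max_iff_disj)
  moreover from this have "\<bar>p x\<bar> \<le> B" for x
    by (rule order_trans) (auto simp: B_def indicator_def)
  ultimately show thesis using R that[of R B] by (simp add: B_def)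
qed

lemma interval_indicator_integrable: "integrable lborel (\<lambda>x::real. B * indicator {-R..R} x :: real)"
  by (intro integrable_mult_right integrable_real_indicator) (auto simp: emeasure_lborel_Icc_eq)

lemma test_function_integrable:
  assumes p: "test_function p" and f: "f \<in> borel_measurable lborel" and Bf: "\<And>x. norm (f x) \<le> B"
  shows "integrable lborel (\<lambda>x. p x *\<^sub>R (f x :: 'a::euclidean_space))"
proof -
  obtain R C where RC: "\<And>x. \<bar>p x\<bar> \<le> C * indicator {-R..R} x" "0 < C" using test_function_bounded[OF p] by metis
  note [measurable] = test_function_measurable[OF p] f
  show ?thesis
  proof (rule Bochner_Integration.integrable_bound[OF interval_indicator_integrable[of "C * B" R]])
    show "AE x in lborel. norm (p x *\<^sub>R f x) \<le> norm (C * B * indicator {-R..R} x :: real)"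
    proof (rule AE_I2)
      fix x
      have "0 \<le> B" using order_trans[OF norm_ge_zero Bf] .
      have "norm (p x *\<^sub>R f x) \<le> (C * indicator {-R..R} x) * B"
        unfolding norm_scaleR using RC Bf[of x] by (intro mult_mono) auto
      then show "norm (p x *\<^sub>R f x) \<le> norm (C * B * indicator {-R..R} x :: real)"
        using \<open>0 \<le> B\<close> RC(2) by (simp add: mult_ac)
    qed
  qed measurable
qed

lemma test_function_times_locally_integrable:
  assumes p: "test_function p" and f: "locally_integrable (f :: real \<Rightarrow> 'a::euclidean_space)"
  shows "integrable lborel (\<lambda>x. p x *\<^sub>R f x)"
proof -
  obtain R C where RC: "\<And>x. \<bar>p x\<bar> \<le> C * indicator {-R..R} x" "0 < C" using test_function_bounded[OF p] by metis
  have [measurable]: "f \<in> borel_measurable lborel" using f by (simp add: locally_integrable_def)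
  note [measurable] = test_function_measurable[OF p]
  have "integrable lborel (\<lambda>x. C *\<^sub>R (indicator {-R..R} x *\<^sub>R f x))"
    using f unfolding locally_integrable_def set_integrable_def by (intro integrable_scaleR_right) blast
  then show ?thesis
  proof (rule Bochner_Integration.integrable_bound)
    show "AE x in lborel. norm (p x *\<^sub>R f x) \<le> norm (C *\<^sub>R (indicator {-R..R} x *\<^sub>R f x))"
    proof (rule AE_I2)
      fix x
      show "norm (p x *\<^sub>R f x) \<le> norm (C *\<^sub>R (indicator {-R..R} x *\<^sub>R f x))"
        using mult_right_mono[OF RC(1)[of x] norm_ge_zero[of "f x"]] RC(2) by (simp add: abs_mult)
    qed
  qed measurable
qed

section \<open>The fundamental lemma of the calculus of variations\<close>

lemma AE_zero_if_interval_integrals_zero: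
  fixes h :: "real \<Rightarrow> 'a::euclidean_space"
  assumes h: "locally_integrable h"
    and zero: "\<And>a b. a < b \<Longrightarrow> (LINT x:{a<..<b}|lborel. h x) = 0"
  shows "AE x in lborel. h x = 0"
proof -
  have [measurable]: "h \<in> borel_measurable lborel" using h by (simp add: locally_integrable_def)
  have "AE x in lborel. indicator {- real n<..<real n} x *\<^sub>R h x = 0" if n: "0 < n" for n
  proof -
    define g where "g = (\<lambda>x. indicator {- real n<..<real n} x *\<^sub>R h x)"
    have g: "integrable lborel g"
    proof -
      have "set_integrable lborel {- real n..real n} h" using h by (simp add: locally_integrable_def)
      then have "set_integrable lborel {- real n<..<real n} h" by (rule set_integrable_subset) auto
      then show ?thesis by (simp add: set_integrable_def g_def)
    qed
    have gs: "set_integrable lborel A g" if "A \<in> sets borel" for A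
      unfolding set_integrable_def by (rule integrable_mult_indicator) (use that g in auto)
    \<comment> \<open>Cutting \<open>h\<close> down to (-n, n) turns half lines into bounded
      intervals, so the hypothesis applies to all of them. Half lines are stable under intersection
      and generate the Borel sets, which allows the induction below.\<close>
    have half: "set_lebesgue_integral lborel {a<..} g = 0" for a
    proof (cases "a < real n")
      case True
      have "set_lebesgue_integral lborel {a<..} g = set_lebesgue_integral lborel {max a (- real n)<..<real n} h"
        unfolding set_lebesgue_integral_def g_def
        by (intro Bochner_Integration.integral_cong refl) (auto simp: indicator_def)
      also have "\<dots> = 0" using True n by (intro zero) auto
      finally show ?thesis .
    next
      case False
      then have "indicator {a<..} x *\<^sub>R g x = 0" for x by (auto simp: g_def indicator_def)
      then show ?thesis unfolding set_lebesgue_integral_def by (simp only: Bochner_Integration.integral_zero)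
    qed
    have total: "set_lebesgue_integral lborel UNIV g = 0"
    proof -
      have "set_lebesgue_integral lborel UNIV g = set_lebesgue_integral lborel {- real n<..} g"
        unfolding set_lebesgue_integral_def g_def
        by (intro Bochner_Integration.integral_cong refl) (auto simp: indicator_def)
      then show ?thesis by (simp add: half)
    qed
    have gen: "sets borel = sigma_sets UNIV (range (\<lambda>a::real. {a<..}))"
      by (subst borel_Ioi) (simp add: sets_measure_of)
    have "set_lebesgue_integral lborel A g = 0" if "A \<in> sets borel" for A
    proof -
      have "{a<..} \<inter> {b<..} = {max a b<..}" for a b :: real by auto
      then have "Int_stable (range (\<lambda>a::real. {a<..}))"
        unfolding Int_stable_def by auto
      moreover have "range (\<lambda>a::real. {a<..}) \<subseteq> Pow UNIV" by simp
      moreover have "A \<in> sigma_sets UNIV (range (\<lambda>a::real. {a<..}))" using that gen by simp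
      ultimately show ?thesis
      proof (induction rule: sigma_sets_induct_disjoint)
        case (basic A)
        then show ?case using half by auto
      next
        case empty
        then show ?case by (simp add: set_lebesgue_integral_def)
      next
        case (compl A)
        then have A: "A \<in> sets borel" using gen by simp
        have "set_lebesgue_integral lborel (A \<union> (UNIV - A)) g =
            set_lebesgue_integral lborel A g + set_lebesgue_integral lborel (UNIV - A) g"
          by (rule set_integral_Un) (use A gs in auto)
        then show ?case using compl total by simp
      next
        case (union A)
        then have A: "A i \<in> sets borel" for i using gen by auto
        have "(LINT x:(\<Union>i. A i)|lborel. g x) = (\<Sum>i. (LINT x:(A i)|lborel. g x))"
          by (rule lebesgue_integral_countable_add)
            (use A union gs in \<open>auto simp: disjoint_family_on_def\<close>)
        then show ?case using union by simp
      qed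
    qed
    then have zero: "set_lebesgue_integral lborel A g = 0" if "A \<in> sets borel" for A using that by blast
    \<comment> \<open>An integrable function whose integrals over all Borel sets vanish is zero
      almost everywhere; this is applied to each coordinate.\<close>
    have "AE x in lborel. g x \<bullet> b = 0" for b
    proof (rule density_unique_real[where f = "\<lambda>x. g x \<bullet> b" and f' = "\<lambda>_. 0"])
      fix A :: "real set" assume A: "A \<in> sets lborel"
      have "(LINT x|lborel. (indicator A x *\<^sub>R g x) \<bullet> b) = (LINT x|lborel. indicator A x *\<^sub>R g x) \<bullet> b"
        using gs[of A] A by (intro integral_inner_left) (simp add: set_integrable_def)
      then show "set_lebesgue_integral lborel A (\<lambda>x. g x \<bullet> b) = set_lebesgue_integral lborel A (\<lambda>_. 0)"
        using zero[of A] A by (simp add: set_lebesgue_integral_def)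
    qed (use g in auto)
    then have "AE x in lborel. \<forall>b\<in>Basis. g x \<bullet> b = 0"
      by (intro AE_finite_allI) auto
    then have "AE x in lborel. g x = 0"
      by eventually_elim (simp add: euclidean_all_zero_iff)
    then show ?thesis by (simp add: g_def)
  qed
  then have "AE x in lborel. \<forall>n>0. indicator {- real n<..<real n} x *\<^sub>R h x = 0"
    by (subst AE_all_countable) (auto simp: AE_all_countable)
  then show ?thesis
  proof eventually_elim
    case (elim x)
    obtain n where "\<bar>x\<bar> < real n" using reals_Archimedean2 by blast
    moreover from this have "0 < n" by (cases n) auto
    ultimately show ?case using elim[rule_format, of n] by (auto simp: indicator_def split: if_splits)
  qed
qed

lemma step_tendsto: "(\<lambda>n. step (real (Suc n) * y)) \<longlonglongrightarrow> indicator {0<..} y"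
proof (cases "0 < y")
  case True
  have "(\<lambda>n. exp (- (inverse (real (Suc n)) * inverse y))) \<longlonglongrightarrow> exp (- (0 * inverse y))"
    by (intro tendsto_intros LIMSEQ_inverse_real_of_nat)
  moreover have "0 < y + y * real n" for n using True by (simp add: add_pos_nonneg)
  ultimately show ?thesis using True by (simp add: step_def field_simps)
qed (simp add: step_def zero_less_mult_iff)

text \<open>The indicator of (a, b) is the pointwise limit of the test functions step(n (x - a))
  step(n (b - x)). They vanish off (a, b) and stay below 1, so \<open>h\<close> restricted to (a, b)
  is itself the integrable majorant.\<close>

lemma AE_zero_if_test_integrals_zero:
  fixes h :: "real \<Rightarrow> 'a::euclidean_space"
  assumes h: "locally_integrable h"
    and zero: "\<And>p. test_function p \<Longrightarrow> (LINT x|lborel. p x *\<^sub>R h x) = 0"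
  shows "AE x in lborel. h x = 0"
proof (rule AE_zero_if_interval_integrals_zero[OF h])
  fix a b :: real assume "a < b"
  have [measurable]: "h \<in> borel_measurable lborel" using h by (simp add: locally_integrable_def)
  define p where "p = (\<lambda>n x. step (real (Suc n) * x + - real (Suc n) * a) * step (- real (Suc n) * x + real (Suc n) * b))"
  have p: "test_function (p n)" for n
    unfolding p_def by (rule test_function_step_product) simp
  note [measurable] = test_function_measurable[OF p]
  have p_eq: "p n x = step (real (Suc n) * (x - a)) * step (real (Suc n) * (b - x))" for n x
    unfolding p_def by (simp add: algebra_simps)
  have supp: "p n x = 0" if "x \<notin> {a<..<b}" for n x
    using that unfolding p_eq by (auto simp: step_def zero_less_mult_iff)
  have "(\<lambda>n. LINT x|lborel. p n x *\<^sub>R h x) \<longlonglongrightarrow> (LINT x|lborel. indicator {a<..<b} x *\<^sub>R h x)"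
  proof (rule integral_dominated_convergence[where w = "\<lambda>x. norm (indicator {a<..<b} x *\<^sub>R h x)"])
    show "integrable lborel (\<lambda>x. norm (indicator {a<..<b} x *\<^sub>R h x))"
    proof -
      define R where "R = max \<bar>a\<bar> \<bar>b\<bar>"
      have "set_integrable lborel {- R..R} h" using h by (simp add: locally_integrable_def)
      then have "set_integrable lborel {a<..<b} h"
        by (rule set_integrable_subset) (auto simp: R_def)
      then show ?thesis unfolding set_integrable_def by (rule integrable_norm)
    qed
    show "AE x in lborel. (\<lambda>n. p n x *\<^sub>R h x) \<longlonglongrightarrow> indicator {a<..<b} x *\<^sub>R h x"
    proof (rule AE_I2)
      fix x
      have "(\<lambda>n. p n x) \<longlonglongrightarrow> indicator {0<..} (x - a) * indicator {0<..} (b - x)"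
        unfolding p_eq by (intro tendsto_mult step_tendsto)
      also have "indicator {0<..} (x - a) * indicator {0<..} (b - x) = (indicator {a<..<b} x :: real)"
        by (auto simp: indicator_def)
      finally show "(\<lambda>n. p n x *\<^sub>R h x) \<longlonglongrightarrow> indicator {a<..<b} x *\<^sub>R h x"
        by (rule tendsto_scaleR[OF _ tendsto_const])
    qed
    show "AE x in lborel. norm (p n x *\<^sub>R h x) \<le> norm (indicator {a<..<b} x *\<^sub>R h x)" for n
    proof (rule AE_I2)
      fix x
      have "\<bar>p n x\<bar> \<le> indicator {a<..<b} x"
        using supp[of x n] unfolding p_eq
        by (cases "x \<in> {a<..<b}") (auto simp: abs_mult step_bounds intro!: mult_le_one)
      then show "norm (p n x *\<^sub>R h x) \<le> norm (indicator {a<..<b} x *\<^sub>R h x)"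
        by (simp add: mult_right_mono)
    qed
  qed measurable
  then have "(\<lambda>n. 0) \<longlonglongrightarrow> (LINT x|lborel. indicator {a<..<b} x *\<^sub>R h x)" using zero[OF p] by simp
  then show "(LINT x:{a<..<b}|lborel. h x) = 0"
    unfolding set_lebesgue_integral_def using LIMSEQ_unique[OF tendsto_const] by metis
qed

lemma locally_integrable_diff:
  "locally_integrable f \<Longrightarrow> locally_integrable g \<Longrightarrow> locally_integrable (\<lambda>x. f x - g x)"
  by (auto simp: locally_integrable_def set_integral_diff)

lemma has_weak_deriv_unique:
  fixes f :: "real \<Rightarrow> 'a::euclidean_space"
  assumes "has_weak_deriv k f g" "has_weak_deriv k f g'"
  shows "AE x in lborel. g x = g' x"
proof -
  have l: "locally_integrable g" "locally_integrable g'"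
    using assms by (auto simp: has_weak_deriv_def)
  have "AE x in lborel. g x - g' x = 0"
  proof (rule AE_zero_if_test_integrals_zero[OF locally_integrable_diff[OF l]])
    fix p assume p: "test_function p"
    have "(-1) ^ k *\<^sub>R (LINT x|lborel. p x *\<^sub>R g x) = (-1) ^ k *\<^sub>R (LINT x|lborel. p x *\<^sub>R g' x)"
      using assms p unfolding has_weak_deriv_def by metis
    then show "(LINT x|lborel. p x *\<^sub>R (g x - g' x)) = 0"
      using test_function_times_locally_integrable[OF p l(1)] test_function_times_locally_integrable[OF p l(2)]
      by (simp add: scaleR_diff_right)
  qed
  then show ?thesis by simp
qed

lemma L2_locally_integrable:
  fixes f :: "real \<Rightarrow> 'a::euclidean_space"
  assumes f: "f \<in> L2"
  shows "locally_integrable f"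
  unfolding locally_integrable_def
proof (intro conjI allI)
  show [measurable]: "f \<in> borel_measurable lborel" using f by (simp add: L2_def)
  fix R
  have "integrable lborel (\<lambda>x. 1 * indicator {-R..R} x + (norm (f x))\<^sup>2)"
    using f by (intro Bochner_Integration.integrable_add interval_indicator_integrable) (simp add: L2_def)
  then show "set_integrable lborel {-R..R} f"
    unfolding set_integrable_def
  proof (rule Bochner_Integration.integrable_bound)
    show "AE x in lborel. norm (indicator {-R..R} x *\<^sub>R f x) \<le> norm (1 * indicator {-R..R} x + (norm (f x))\<^sup>2)"
    proof (rule AE_I2)
      fix x
      have "norm (f x) \<le> 1 + (norm (f x))\<^sup>2"
        using sum_squares_bound[of "norm (f x)" 1] norm_ge_zero[of "f x"]
        unfolding mult_1_right one_power2 by (smt (verit) zero_le_power2)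
      then show "norm (indicator {-R..R} x *\<^sub>R f x) \<le> norm (1 * indicator {-R..R} x + (norm (f x))\<^sup>2)"
        by (auto simp: indicator_def)
    qed
  qed measurable
qed

lemma L2_norm_cong_AE:
  fixes f g :: "real \<Rightarrow> 'a::euclidean_space"
  assumes "AE x in lborel. f x = g x" "f \<in> borel_measurable lborel" "g \<in> borel_measurable lborel"
  shows "L2_norm f = L2_norm g"
proof -
  have "(LINT x|lborel. (norm (f x))\<^sup>2) = (LINT x|lborel. (norm (g x))\<^sup>2)"
    using assms by (intro integral_cong_AE) auto
  then show ?thesis by (simp add: L2_norm_def)
qed

text \<open>This removes the choice operator: in norms the selected representative may be replaced
  by any weak derivative at hand, since two of them agree almost everywhere.\<close>

lemma L2_norm_weak_deriv:
  assumes "has_weak_deriv k f g"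
  shows "L2_norm (weak_deriv k f) = L2_norm g"
proof -
  have "has_weak_deriv k f (weak_deriv k f)"
    unfolding weak_deriv_def by (rule someI[where P = "has_weak_deriv k f", OF assms])
  then show ?thesis using has_weak_deriv_unique[OF _ assms] assms
    by (intro L2_norm_cong_AE) (auto simp: has_weak_deriv_def locally_integrable_def)
qed

section \<open>The Fourier transform of integrable functions\<close>

text \<open>The scalar transform without normalising factor, in agreement with the integrals in
  \<open>has_fourier\<close>; the factors 2 pi below come from this convention. Vector-valued
  functions are treated through their components.\<close>

definition ft :: "(real \<Rightarrow> complex) \<Rightarrow> real \<Rightarrow> complex"
  where "ft f \<xi> = (LINT x|lborel. cis (- (x * \<xi>)) * f x)"

lemma cis_measurable [measurable]: "cis \<in> borel_measurable borel"
  by (intro borel_measurable_continuous_onI continuous_intros)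

lemma cnj_measurable [measurable]: "cnj \<in> borel_measurable borel"
  by (intro borel_measurable_continuous_onI continuous_intros)

lemma integrable_norm_mult:
  fixes f g :: "real \<Rightarrow> complex"
  assumes "integrable lborel f" "g \<in> borel_measurable lborel" "\<And>x. norm (g x) \<le> B"
  shows "integrable lborel (\<lambda>x. g x * f x)"
proof (rule Bochner_Integration.integrable_bound[where f = "\<lambda>x. B *\<^sub>R f x"])
  note [measurable] = assms(2) borel_measurable_integrable[OF assms(1)]
  show "(\<lambda>x. g x * f x) \<in> borel_measurable lborel" by measurable
  show "AE x in lborel. norm (g x * f x) \<le> norm (B *\<^sub>R f x)"
  proof (rule AE_I2)
    fix x
    have "norm (g x) \<le> \<bar>B\<bar>" using assms(3)[of x] by linarith
    then show "norm (g x * f x) \<le> norm (B *\<^sub>R f x)" by (simp add: norm_mult mult_right_mono)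
  qed
qed (use assms(1) in simp)

lemma ft_integrable:
  assumes "integrable lborel f"
  shows "integrable lborel (\<lambda>x. cis (- (x * \<xi>)) * f x)"
  by (rule integrable_norm_mult[OF assms, of _ 1]) auto

lemma norm_ft_le: "integrable lborel f \<Longrightarrow> norm (ft f \<xi>) \<le> (LINT x|lborel. norm (f x))"
  unfolding ft_def by (rule order_trans[OF integral_norm_bound]) (simp add: norm_mult)

lemma ft_measurable [measurable]:
  assumes [measurable]: "f \<in> borel_measurable borel"
  shows "ft f \<in> borel_measurable borel"
  unfolding ft_def[abs_def] by measurable

text \<open>Fubini's theorem, the kernel being symmetric in x and \<xi>.\<close>

lemma ft_multiplication:
  assumes f: "integrable lborel f" and g: "integrable lborel g"
  shows "(LINT \<xi>|lborel. ft f \<xi> * g \<xi>) = (LINT x|lborel. f x * ft g x)"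
proof -
  note [measurable] = borel_measurable_integrable[OF f] borel_measurable_integrable[OF g]
  have "integrable (lborel \<Otimes>\<^sub>M lborel) (\<lambda>(x, \<xi>). cis (- (x * \<xi>)) * f x * g \<xi>)"
  proof (rule lborel_pair.Fubini_integrable)
    show "(\<lambda>(x, \<xi>). cis (- (x * \<xi>)) * f x * g \<xi>) \<in> borel_measurable (lborel \<Otimes>\<^sub>M lborel)" by measurable
    show "integrable lborel (\<lambda>x. LINT \<xi>|lborel. norm (case (x, \<xi>) of (x, \<xi>) \<Rightarrow> cis (- (x * \<xi>)) * f x * g \<xi>))"
      using f g by (simp add: norm_mult)
    show "AE x in lborel. integrable lborel (\<lambda>\<xi>. case (x, \<xi>) of (x, \<xi>) \<Rightarrow> cis (- (x * \<xi>)) * f x * g \<xi>)"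
    proof (rule AE_I2)
      fix x
      have "integrable lborel (\<lambda>\<xi>. (cis (- (x * \<xi>)) * f x) * g \<xi>)"
        by (rule integrable_norm_mult[OF g, of _ "norm (f x)"]) (simp_all add: norm_mult)
      then show "integrable lborel (\<lambda>\<xi>. case (x, \<xi>) of (x, \<xi>) \<Rightarrow> cis (- (x * \<xi>)) * f x * g \<xi>)" by simp
    qed
  qed
  from lborel_pair.Fubini_integral[OF this]
  have "(LINT \<xi>|lborel. LINT x|lborel. cis (- (x * \<xi>)) * f x * g \<xi>) = (LINT x|lborel. LINT \<xi>|lborel. cis (- (x * \<xi>)) * f x * g \<xi>)" .
  moreover have e1: "(LINT x|lborel. cis (- (x * \<xi>)) * f x * g \<xi>) = ft f \<xi> * g \<xi>" for \<xi>
    by (simp add: ft_def)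
  moreover have e2: "(LINT \<xi>|lborel. cis (- (x * \<xi>)) * f x * g \<xi>) = f x * ft g x" for x
  proof -
    have "(LINT \<xi>|lborel. cis (- (x * \<xi>)) * f x * g \<xi>) = (LINT \<xi>|lborel. f x * (cis (- (\<xi> * x)) * g \<xi>))"
      by (simp add: mult_ac)
    then show ?thesis by (simp add: ft_def)
  qed
  ultimately show ?thesis by (simp only:)
qed

section \<open>Gaussian regularisation, Bessel's inequality and inversion\<close>

definition gauss :: "real \<Rightarrow> real \<Rightarrow> real" where "gauss n \<xi> = exp (- (\<xi> / n)\<^sup>2 / 2)"

lemma gauss_eq: "0 < n \<Longrightarrow> gauss n \<xi> = sqrt (2 * pi) * n * normal_density 0 n \<xi>"
  by (simp add: gauss_def normal_density_def real_sqrt_mult power_divide field_simps)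

lemma gauss_bounds: "0 \<le> gauss n \<xi>" "gauss n \<xi> \<le> 1"
  by (simp_all add: gauss_def)

lemma gauss_measurable [measurable]: "gauss n \<in> borel_measurable borel"
  unfolding gauss_def[abs_def] by measurable

lemma gauss_integrable: "0 < n \<Longrightarrow> integrable lborel (gauss n)"
proof -
  assume n: "0 < n"
  then have "gauss n = (\<lambda>\<xi>. sqrt (2 * pi) * n * normal_density 0 n \<xi>)" by (simp add: fun_eq_iff gauss_eq)
  then show ?thesis using n by (simp add: integrable_normal_density)
qed

lemma gauss_tendsto: "(\<lambda>n. gauss (real (Suc n)) \<xi>) \<longlonglongrightarrow> 1"
proof -
  have "(\<lambda>n. exp (- (\<xi> * inverse (real (Suc n)))\<^sup>2 / 2)) \<longlonglongrightarrow> exp (- (\<xi> * 0)\<^sup>2 / 2)"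
    by (intro tendsto_intros LIMSEQ_inverse_real_of_nat) simp_all
  then show ?thesis unfolding gauss_def divide_inverse[of \<xi>] by (simp only: mult_zero_right power_zero_numeral minus_zero div_0 exp_zero)
qed

lemma normal_density_scale:
  assumes n: "0 < n"
  shows "normal_density 0 (1 / n) x = n * std_normal_density (n * x)"
proof -
  have "sqrt (2 * pi * (1 / n)\<^sup>2) = sqrt (2 * pi) / n"
    unfolding real_sqrt_mult[of "2 * pi" "(1 / n)\<^sup>2"] real_sqrt_abs using n by simp
  moreover have "- (x - 0)\<^sup>2 / (2 * (1 / n)\<^sup>2) = - (n * x)\<^sup>2 / 2"
    using n by (simp add: power_divide power_mult_distrib)
  ultimately show ?thesis
    unfolding std_normal_density_def unfolding normal_density_def by simp
qed

text \<open>The characteristic function of the standard normal distribution provides the transform.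
  Rescaling by n turns it into 2 pi times the density with standard deviation 1/n, an approximate
  identity as n grows.\<close>

lemma ft_gauss:
  assumes n: "0 < n"
  shows "ft (\<lambda>\<xi>. of_real (gauss n \<xi>)) x = of_real (2 * pi * normal_density 0 (1 / n) x)"
proof -
  have "char std_normal_distribution (- (n * x)) = of_real (exp (- (n * x)\<^sup>2 / 2))"
    by (simp add: char_std_normal_distribution)
  then have C: "(LINT u|lborel. std_normal_density u *\<^sub>R cis (- (n * x) * u)) = of_real (exp (- (n * x)\<^sup>2 / 2))"
    unfolding char_def by (subst (asm) integral_density) (simp_all add: cis_conv_exp mult_ac)
  have "ft (\<lambda>\<xi>. of_real (gauss n \<xi>)) x = n *\<^sub>R (LINT u|lborel. cis (- ((0 + n * u) * x)) * of_real (gauss n (0 + n * u)))"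
    unfolding ft_def using n by (subst lborel_integral_real_affine[where c = n and t = 0]) simp_all
  also have "(LINT u|lborel. cis (- ((0 + n * u) * x)) * of_real (gauss n (0 + n * u))) =
      (LINT u|lborel. sqrt (2 * pi) *\<^sub>R (std_normal_density u *\<^sub>R cis (- (n * x) * u)))"
    using n by (intro Bochner_Integration.integral_cong refl)
      (simp add: gauss_def std_normal_density_def scaleR_conv_of_real mult_ac)
  also have "\<dots> = sqrt (2 * pi) *\<^sub>R of_real (exp (- (n * x)\<^sup>2 / 2))"
    by (simp only: integral_scaleR_right C)
  also have "n *\<^sub>R \<dots> = of_real (2 * pi * normal_density 0 (1 / n) x)"
  proof -
    have q: "sqrt (2 * pi) * sqrt (2 * pi) = 2 * pi" by simp
    have "q * q * (n * (1 / q * e)) = n * (q * e)" if "q \<noteq> 0" for q e :: real using that by simp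
    from this[of "sqrt (2 * pi)", unfolded q]
    have "2 * pi * normal_density 0 (1 / n) x = n * (sqrt (2 * pi) * exp (- (n * x)\<^sup>2 / 2))"
      unfolding normal_density_scale[OF n] std_normal_density_def by simp
    then show ?thesis by (simp only: scaleR_conv_of_real of_real_mult)
  qed
  finally show ?thesis .
qed

lemma ft_modulated_gauss:
  assumes n: "0 < n"
  shows "ft (\<lambda>\<xi>. cis (- (\<xi> * x)) * of_real (gauss n \<xi>)) y = of_real (2 * pi * normal_density 0 (1 / n) (x + y))"
proof -
  have "ft (\<lambda>\<xi>. cis (- (\<xi> * x)) * of_real (gauss n \<xi>)) y = ft (\<lambda>\<xi>. of_real (gauss n \<xi>)) (x + y)"
    unfolding ft_def mult.assoc[symmetric] cis_mult by (simp add: algebra_simps)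
  then show ?thesis by (simp only: ft_gauss[OF n])
qed

lemma integrable_modulated_gauss: "0 < n \<Longrightarrow> integrable lborel (\<lambda>\<xi>. cis (- (\<xi> * x)) * complex_of_real (gauss n \<xi>))"
  by (rule ft_integrable) (intro integrable_of_real gauss_integrable)

text \<open>Covers non-integrable functions as well: their integral has the default value 0.\<close>

lemma norm_integral_le_nn_integral: "ennreal (norm (integral\<^sup>L M f)) \<le> (\<integral>\<^sup>+x. ennreal (norm (f x)) \<partial>M)"
  for f :: "'a \<Rightarrow> 'b::{banach, second_countable_topology}"
  by (cases "integrable M f") (simp_all add: integral_norm_bound_ennreal not_integrable_integral_eq)

lemma nn_integral_normal_density_shift:
  assumes "0 < s"
  shows "(\<integral>\<^sup>+y. ennreal (normal_density 0 s (x + y)) \<partial>lborel) = 1"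
    "(\<integral>\<^sup>+y. ennreal (normal_density 0 s (y + x)) \<partial>lborel) = 1"
proof -
  have "(\<integral>\<^sup>+y. ennreal (normal_density 0 s y) \<partial>lborel) = 1"
    using assms by (subst nn_integral_eq_integral) (simp_all add: integrable_normal_density integral_normal_density)
  then show "(\<integral>\<^sup>+y. ennreal (normal_density 0 s (x + y)) \<partial>lborel) = 1"
    by (subst (asm) nn_integral_real_affine[where c = 1 and t = x]) simp_all
  then show "(\<integral>\<^sup>+y. ennreal (normal_density 0 s (y + x)) \<partial>lborel) = 1"
    by (simp add: add.commute)
qed

lemma cnj_ft: "cnj (ft f \<xi>) = ft (\<lambda>y. cnj (f (- y))) \<xi>"
proof -
  have "cnj (ft f \<xi>) = (LINT x|lborel. cis (x * \<xi>) * cnj (f x))"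
    unfolding ft_def by (simp add: cis_cnj flip: Bochner_Integration.integral_cnj)
  also have "\<dots> = (LINT x|lborel. cis (- (x * \<xi>)) * cnj (f (- x)))"
    by (subst lborel_integral_real_affine[where c = "-1" and t = 0]) simp_all
  finally show ?thesis by (simp add: ft_def)
qed

lemma integrable_reflect:
  "integrable lborel f \<Longrightarrow> integrable lborel (\<lambda>x. f (- x))" for f :: "real \<Rightarrow> 'a::{banach, second_countable_topology}"
  using lborel_integrable_real_affine[of f "-1" 0] by simp

text \<open>The multiplication formula rewrites the weighted integral of |ft f|^2 as a double
  integral of f(x) f'(y) against 2 pi K(x + y), where f'(y) is the conjugate of f(-y) and K is a
  normal density. Since K has mass 1 in each variable and 2 |f(x)| |f'(y)| \<le> |f(x)|^2 +
  |f'(y)|^2, each half contributes pi times the integral of |f|^2.\<close>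

lemma bessel_gauss:
  assumes f: "integrable lborel f" and n: "0 < n"
  shows "(\<integral>\<^sup>+\<xi>. ennreal ((norm (ft f \<xi>))\<^sup>2 * gauss n \<xi>) \<partial>lborel) \<le> ennreal (2 * pi) * (\<integral>\<^sup>+x. ennreal ((norm (f x))\<^sup>2) \<partial>lborel)"
proof -
  note [measurable] = borel_measurable_integrable[OF f]
  let ?K = "normal_density 0 (1 / n)"
  define f' where "f' = (\<lambda>y. cnj (f (- y)))"
  have f': "integrable lborel f'"
    unfolding f'_def using integrable_reflect[OF f] by simp
  note [measurable] = borel_measurable_integrable[OF f']
  have bound: "norm (ft f \<xi>) \<le> (LINT x|lborel. norm (f x))" for \<xi> by (rule norm_ft_le[OF f])
  have int1: "integrable lborel (\<lambda>\<xi>. cnj (ft f \<xi>) * complex_of_real (gauss n \<xi>))"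
  proof (rule integrable_norm_mult[where B = "LINT x|lborel. norm (f x)"])
    show "(\<lambda>\<xi>. cnj (ft f \<xi>)) \<in> borel_measurable lborel" by measurable
  qed (use bound gauss_integrable[OF n] in simp_all)
  have real: "of_real ((norm (ft f \<xi>))\<^sup>2 * gauss n \<xi>) = ft f \<xi> * (cnj (ft f \<xi>) * complex_of_real (gauss n \<xi>))" for \<xi>
    by (simp add: complex_norm_square mult.assoc[symmetric] del: of_real_power)
  have int2: "integrable lborel (\<lambda>\<xi>. (norm (ft f \<xi>))\<^sup>2 * gauss n \<xi>)"
  proof -
    have "integrable lborel (\<lambda>\<xi>. ft f \<xi> * (cnj (ft f \<xi>) * complex_of_real (gauss n \<xi>)))"
      by (rule integrable_norm_mult[OF int1 _ bound]) simp
    then have "integrable lborel (\<lambda>\<xi>. complex_of_real ((norm (ft f \<xi>))\<^sup>2 * gauss n \<xi>))" unfolding real .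
    then show ?thesis by (simp only: complex_of_real_integrable_eq)
  qed
  have "(\<integral>\<^sup>+\<xi>. ennreal ((norm (ft f \<xi>))\<^sup>2 * gauss n \<xi>) \<partial>lborel) = ennreal (LINT \<xi>|lborel. (norm (ft f \<xi>))\<^sup>2 * gauss n \<xi>)"
    using int2 by (intro nn_integral_eq_integral) (auto simp: gauss_bounds)
  also have "(LINT \<xi>|lborel. (norm (ft f \<xi>))\<^sup>2 * gauss n \<xi>) =
      norm (LINT \<xi>|lborel. ft f \<xi> * (cnj (ft f \<xi>) * complex_of_real (gauss n \<xi>)))"
    unfolding real[symmetric] integral_complex_of_real norm_of_real
    by (intro abs_of_nonneg[symmetric] integral_nonneg_AE) (simp add: gauss_bounds)
  also have "(LINT \<xi>|lborel. ft f \<xi> * (cnj (ft f \<xi>) * complex_of_real (gauss n \<xi>))) =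
      (LINT x|lborel. f x * ft (\<lambda>\<xi>. cnj (ft f \<xi>) * complex_of_real (gauss n \<xi>)) x)"
    by (rule ft_multiplication[OF f int1])
  also have "\<dots> = (LINT x|lborel. LINT y|lborel. f x * (f' y * of_real (2 * pi * ?K (x + y))))"
  proof (intro Bochner_Integration.integral_cong refl)
    fix x
    have "ft (\<lambda>\<xi>. cnj (ft f \<xi>) * complex_of_real (gauss n \<xi>)) x =
        (LINT \<xi>|lborel. ft f' \<xi> * (cis (- (\<xi> * x)) * complex_of_real (gauss n \<xi>)))"
      unfolding cnj_ft f'_def[symmetric] by (subst ft_def) (simp only: mult_ac)
    also have "\<dots> = (LINT y|lborel. f' y * of_real (2 * pi * ?K (x + y)))"
      by (subst ft_multiplication[OF f' integrable_modulated_gauss[OF n]]) (simp only: ft_modulated_gauss[OF n])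
    finally show "f x * ft (\<lambda>\<xi>. cnj (ft f \<xi>) * complex_of_real (gauss n \<xi>)) x =
        (LINT y|lborel. f x * (f' y * of_real (2 * pi * ?K (x + y))))"
      by simp
  qed
  also have "ennreal (norm \<dots>) \<le> (\<integral>\<^sup>+x. \<integral>\<^sup>+y. ennreal (norm (f x * (f' y * of_real (2 * pi * ?K (x + y))))) \<partial>lborel \<partial>lborel)"
    by (rule order_trans[OF norm_integral_le_nn_integral]) (intro nn_integral_mono norm_integral_le_nn_integral)
  also have "\<dots> \<le> (\<integral>\<^sup>+x. \<integral>\<^sup>+y. ennreal pi * (ennreal ((norm (f x))\<^sup>2) * ennreal (?K (x + y))) +
      ennreal pi * (ennreal ((norm (f' y))\<^sup>2) * ennreal (?K (x + y))) \<partial>lborel \<partial>lborel)"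
  proof (intro nn_integral_mono)
    fix x y
    have "norm (f x * (f' y * of_real (2 * pi * ?K (x + y)))) = pi * ?K (x + y) * (2 * norm (f x) * norm (f' y))"
      unfolding norm_mult norm_of_real by simp
    also have "\<dots> \<le> pi * ?K (x + y) * ((norm (f x))\<^sup>2 + (norm (f' y))\<^sup>2)"
      by (intro mult_left_mono sum_squares_bound) simp
    also have "\<dots> = pi * ((norm (f x))\<^sup>2 * ?K (x + y)) + pi * ((norm (f' y))\<^sup>2 * ?K (x + y))"
      by (simp add: algebra_simps)
    finally show "ennreal (norm (f x * (f' y * of_real (2 * pi * ?K (x + y))))) \<le>
        ennreal pi * (ennreal ((norm (f x))\<^sup>2) * ennreal (?K (x + y))) +
        ennreal pi * (ennreal ((norm (f' y))\<^sup>2) * ennreal (?K (x + y)))"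
      by (simp flip: ennreal_mult ennreal_plus add: ennreal_leI)
  qed
  also have "\<dots> = ennreal pi * (\<integral>\<^sup>+x. ennreal ((norm (f x))\<^sup>2) \<partial>lborel) +
      (\<integral>\<^sup>+x. \<integral>\<^sup>+y. ennreal pi * (ennreal ((norm (f' y))\<^sup>2) * ennreal (?K (x + y))) \<partial>lborel \<partial>lborel)"
    using n by (simp add: nn_integral_add nn_integral_cmult nn_integral_normal_density_shift)
  also have "(\<integral>\<^sup>+x. \<integral>\<^sup>+y. ennreal pi * (ennreal ((norm (f' y))\<^sup>2) * ennreal (?K (x + y))) \<partial>lborel \<partial>lborel) =
      (\<integral>\<^sup>+y. \<integral>\<^sup>+x. ennreal pi * (ennreal ((norm (f' y))\<^sup>2) * ennreal (?K (x + y))) \<partial>lborel \<partial>lborel)"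
    by (rule lborel_pair.Fubini'[symmetric]) measurable
  also have "\<dots> = ennreal pi * (\<integral>\<^sup>+y. ennreal ((norm (f' y))\<^sup>2) \<partial>lborel)"
    using n by (simp add: nn_integral_cmult nn_integral_normal_density_shift)
  also have "(\<integral>\<^sup>+y. ennreal ((norm (f' y))\<^sup>2) \<partial>lborel) = (\<integral>\<^sup>+y. ennreal ((norm (f y))\<^sup>2) \<partial>lborel)"
    by (subst (2) nn_integral_real_affine[where c = "-1" and t = 0]) (simp_all add: f'_def)
  finally show ?thesis
    by (simp add: ennreal_mult' distrib_right[symmetric] ennreal_plus[symmetric] del: ennreal_plus)
qed

text \<open>The bound with the Gaussian weight is independent of n, and Fatou's lemma preserves it
  as the weight tends to 1.\<close>

theorem bessel:
  assumes f: "integrable lborel f"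
  shows "(\<integral>\<^sup>+\<xi>. ennreal ((norm (ft f \<xi>))\<^sup>2) \<partial>lborel) \<le> ennreal (2 * pi) * (\<integral>\<^sup>+x. ennreal ((norm (f x))\<^sup>2) \<partial>lborel)"
proof -
  note [measurable] = borel_measurable_integrable[OF f]
  have "(\<integral>\<^sup>+\<xi>. ennreal ((norm (ft f \<xi>))\<^sup>2) \<partial>lborel) =
      (\<integral>\<^sup>+\<xi>. liminf (\<lambda>n. ennreal ((norm (ft f \<xi>))\<^sup>2 * gauss (real (Suc n)) \<xi>)) \<partial>lborel)"
  proof (intro nn_integral_cong)
    fix \<xi>
    have "(\<lambda>n. ennreal ((norm (ft f \<xi>))\<^sup>2 * gauss (real (Suc n)) \<xi>)) \<longlonglongrightarrow> ennreal ((norm (ft f \<xi>))\<^sup>2 * 1)"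
      by (intro tendsto_ennrealI tendsto_mult_left gauss_tendsto)
    then show "ennreal ((norm (ft f \<xi>))\<^sup>2) = liminf (\<lambda>n. ennreal ((norm (ft f \<xi>))\<^sup>2 * gauss (real (Suc n)) \<xi>))"
      by (simp add: lim_imp_Liminf)
  qed
  also have "\<dots> \<le> liminf (\<lambda>n. \<integral>\<^sup>+\<xi>. ennreal ((norm (ft f \<xi>))\<^sup>2 * gauss (real (Suc n)) \<xi>) \<partial>lborel)"
    by (rule nn_integral_liminf) measurable
  also have "\<dots> \<le> liminf (\<lambda>n. ennreal (2 * pi) * (\<integral>\<^sup>+x. ennreal ((norm (f x))\<^sup>2) \<partial>lborel))"
    by (intro Liminf_mono always_eventually allI bessel_gauss f) simp
  also have "\<dots> = ennreal (2 * pi) * (\<integral>\<^sup>+x. ennreal ((norm (f x))\<^sup>2) \<partial>lborel)"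
    by (simp add: Liminf_const)
  finally show ?thesis .
qed

text \<open>A Gaussian is inserted in the inversion integral. On one side it tends to 1 under the
  integrable majorant |ft p|; on the other the multiplication formula produces an average of
  \<open>p\<close> around x with a normal density of width 1/n, which tends to p(x) because
  \<open>p\<close> is continuous and bounded.\<close>

lemma ft_inversion:
  fixes p :: "real \<Rightarrow> complex"
  assumes p: "integrable lborel p" and ftp: "integrable lborel (ft p)"
    and cont: "continuous_on UNIV p" and bdd: "\<And>x. norm (p x) \<le> B"
  shows "(LINT \<xi>|lborel. cis (x * \<xi>) * ft p \<xi>) = 2 * pi * p x"
proof -
  note [measurable] = borel_measurable_integrable[OF p]
  define a where "a = (\<lambda>n. LINT \<xi>|lborel. ft p \<xi> * (cis (- (\<xi> * (- x))) * complex_of_real (gauss (real (Suc n)) \<xi>)))"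
  have "a \<longlonglongrightarrow> (LINT \<xi>|lborel. ft p \<xi> * cis (x * \<xi>))"
    unfolding a_def
  proof (rule integral_dominated_convergence[where w = "\<lambda>\<xi>. norm (ft p \<xi>)"])
    show "AE \<xi> in lborel. (\<lambda>n. ft p \<xi> * (cis (- (\<xi> * (- x))) * complex_of_real (gauss (real (Suc n)) \<xi>))) \<longlonglongrightarrow> ft p \<xi> * cis (x * \<xi>)"
    proof (rule AE_I2)
      fix \<xi>
      have "(\<lambda>n. ft p \<xi> * (cis (- (\<xi> * (- x))) * complex_of_real (gauss (real (Suc n)) \<xi>))) \<longlonglongrightarrow> ft p \<xi> * (cis (- (\<xi> * (- x))) * complex_of_real 1)"
        by (intro tendsto_intros gauss_tendsto)
      then show "(\<lambda>n. ft p \<xi> * (cis (- (\<xi> * (- x))) * complex_of_real (gauss (real (Suc n)) \<xi>))) \<longlonglongrightarrow> ft p \<xi> * cis (x * \<xi>)"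
        by (simp add: mult.commute)
    qed
    show "AE \<xi> in lborel. norm (ft p \<xi> * (cis (- (\<xi> * (- x))) * complex_of_real (gauss (real (Suc n)) \<xi>))) \<le> norm (ft p \<xi>)" for n
      by (rule AE_I2) (simp add: norm_mult gauss_bounds mult_left_le)
  qed (use ftp in simp_all)
  moreover have "a \<longlonglongrightarrow> (LINT u|lborel. p x * of_real (2 * pi * std_normal_density u))"
  proof -
    have a_eq: "a n = (LINT u|lborel. p (x + inverse (real (Suc n)) * u) * of_real (2 * pi * std_normal_density u))" for n
    proof -
      let ?n = "real (Suc n)"
      have n: "0 < ?n" by simp
      have "a n = (LINT y|lborel. p y * of_real (2 * pi * normal_density 0 (1 / ?n) (- x + y)))"
        unfolding a_def by (subst ft_multiplication[OF p integrable_modulated_gauss[OF n]]) (simp only: ft_modulated_gauss[OF n])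
      \<comment> \<open>The substitution y = x + u/n makes the density independent of n, so that
        dominated convergence applies.\<close>
      also have "\<dots> = inverse ?n *\<^sub>R (LINT u|lborel. p (x + inverse ?n * u) *
          of_real (2 * pi * normal_density 0 (1 / ?n) (- x + (x + inverse ?n * u))))"
        by (subst lborel_integral_real_affine[where c = "inverse ?n" and t = x]) simp_all
      also have "\<dots> = (LINT u|lborel. inverse ?n *\<^sub>R (p (x + inverse ?n * u) *
          of_real (2 * pi * normal_density 0 (1 / ?n) (- x + (x + inverse ?n * u)))))"
        by simp
      also have "\<dots> = (LINT u|lborel. p (x + inverse ?n * u) * of_real (2 * pi * std_normal_density u))"
      proof (intro Bochner_Integration.integral_cong refl)
        fix u
        have "normal_density 0 (1 / ?n) (- x + (x + inverse ?n * u)) = ?n * std_normal_density u"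
          unfolding normal_density_scale[OF n] by (simp del: of_nat_Suc add: mult.assoc[symmetric])
        then show "inverse ?n *\<^sub>R (p (x + inverse ?n * u) *
          of_real (2 * pi * normal_density 0 (1 / ?n) (- x + (x + inverse ?n * u)))) =
          p (x + inverse ?n * u) * of_real (2 * pi * std_normal_density u)"
          by (simp add: scaleR_conv_of_real del: of_nat_Suc)
      qed
      finally show ?thesis .
    qed
    have lim: "(\<lambda>n. LINT u|lborel. p (x + inverse (real (Suc n)) * u) * of_real (2 * pi * std_normal_density u)) \<longlonglongrightarrow>
        (LINT u|lborel. p x * of_real (2 * pi * std_normal_density u))"
    proof (rule integral_dominated_convergence[where w = "\<lambda>u. B * (2 * pi * std_normal_density u)"])
      show "AE u in lborel. (\<lambda>n. p (x + inverse (real (Suc n)) * u) * of_real (2 * pi * std_normal_density u)) \<longlonglongrightarrow>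
          p x * of_real (2 * pi * std_normal_density u)"
      proof (rule AE_I2)
        fix u
        have "(\<lambda>n. x + inverse (real (Suc n)) * u) \<longlonglongrightarrow> x + 0 * u"
          by (intro tendsto_intros LIMSEQ_inverse_real_of_nat)
        then have "(\<lambda>n. p (x + inverse (real (Suc n)) * u)) \<longlonglongrightarrow> p x"
          by (intro continuous_on_tendsto_compose[OF cont]) auto
        then show "(\<lambda>n. p (x + inverse (real (Suc n)) * u) * of_real (2 * pi * std_normal_density u)) \<longlonglongrightarrow>
          p x * of_real (2 * pi * std_normal_density u)"
          by (intro tendsto_intros)
      qed
      show "AE u in lborel. norm (p (x + inverse (real (Suc n)) * u) * of_real (2 * pi * std_normal_density u)) \<le>
          B * (2 * pi * std_normal_density u)" for n
        unfolding norm_mult norm_of_real using order_trans[OF norm_ge_zero bdd]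
        by (intro AE_I2 mult_mono bdd) auto
      have [measurable]: "p \<in> borel_measurable borel" using p by simp
      show "(\<lambda>u. p x * complex_of_real (2 * pi * std_normal_density u)) \<in> borel_measurable lborel"
        by measurable
      show "(\<lambda>u. p (x + inverse (real (Suc n)) * u) * complex_of_real (2 * pi * std_normal_density u)) \<in> borel_measurable lborel" for n
        by measurable
      show "integrable lborel (\<lambda>u. B * (2 * pi * std_normal_density u))"
        by (simp add: integrable_normal_density)
    qed
    show ?thesis using lim unfolding a_eq[symmetric] .
  qed
  ultimately have "(LINT \<xi>|lborel. ft p \<xi> * cis (x * \<xi>)) = (LINT u|lborel. p x * of_real (2 * pi * std_normal_density u))"
    by (rule LIMSEQ_unique)
  also have "\<dots> = 2 * pi * p x"
    using integral_normal_density[of 1 0] by (simp add: integral_complex_of_real)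
  finally show ?thesis by (simp add: mult.commute)
qed

section \<open>The Fourier transform on square integrable functions\<close>

lemma L2_iff:
  fixes f :: "real \<Rightarrow> 'a::euclidean_space"
  shows "f \<in> L2 \<longleftrightarrow> f \<in> borel_measurable borel \<and> (\<integral>\<^sup>+x. ennreal ((norm (f x))\<^sup>2) \<partial>lborel) < \<infinity>"
proof -
  have "integrable lborel (\<lambda>x. (norm (f x))\<^sup>2) \<longleftrightarrow> (\<integral>\<^sup>+x. ennreal ((norm (f x))\<^sup>2) \<partial>lborel) < \<infinity>"
    if [measurable]: "f \<in> borel_measurable borel"
    by (subst integrable_iff_bounded) simp
  then show ?thesis by (auto simp: L2_def)
qed

lemma nn_integral_norm_square:
  fixes f :: "real \<Rightarrow> 'a::euclidean_space"
  assumes "f \<in> L2"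
  shows "(\<integral>\<^sup>+x. ennreal ((norm (f x))\<^sup>2) \<partial>lborel) = ennreal ((L2_norm f)\<^sup>2)"
proof -
  have "(\<integral>\<^sup>+x. ennreal ((norm (f x))\<^sup>2) \<partial>lborel) = ennreal (LINT x|lborel. (norm (f x))\<^sup>2)"
    using assms by (intro nn_integral_eq_integral) (auto simp: L2_def)
  then show ?thesis by (simp add: L2_norm_def)
qed

lemma L2_bound:
  fixes f :: "real \<Rightarrow> 'a::euclidean_space" and g :: "real \<Rightarrow> 'b::euclidean_space"
  assumes f: "f \<in> L2" and g: "g \<in> borel_measurable borel" and le: "\<And>x. norm (g x) \<le> C * norm (f x)"
  shows "g \<in> L2"
  unfolding L2_iff
proof
  have [measurable]: "f \<in> borel_measurable borel" using f by (simp add: L2_iff)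
  have "(\<integral>\<^sup>+x. ennreal ((norm (g x))\<^sup>2) \<partial>lborel) \<le> (\<integral>\<^sup>+x. ennreal (C\<^sup>2) * ennreal ((norm (f x))\<^sup>2) \<partial>lborel)"
  proof (intro nn_integral_mono)
    fix x
    have "(norm (g x))\<^sup>2 \<le> (C * norm (f x))\<^sup>2" by (intro power_mono le) simp
    then show "ennreal ((norm (g x))\<^sup>2) \<le> ennreal (C\<^sup>2) * ennreal ((norm (f x))\<^sup>2)"
      by (simp add: power_mult_distrib flip: ennreal_mult)
  qed
  also have "\<dots> = ennreal (C\<^sup>2) * (\<integral>\<^sup>+x. ennreal ((norm (f x))\<^sup>2) \<partial>lborel)"
    by (rule nn_integral_cmult) measurable
  also have "\<dots> < \<infinity>" using f by (simp add: L2_iff ennreal_mult_less_top)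
  finally show "(\<integral>\<^sup>+x. ennreal ((norm (g x))\<^sup>2) \<partial>lborel) < \<infinity>" .
qed (rule g)

lemma L2_add:
  fixes f g :: "real \<Rightarrow> 'a::euclidean_space"
  assumes "f \<in> L2" "g \<in> L2"
  shows "(\<lambda>x. f x + g x) \<in> L2"
proof -
  have [measurable]: "f \<in> borel_measurable borel" "g \<in> borel_measurable borel" using assms by (auto simp: L2_iff)
  have "integrable lborel (\<lambda>x. 2 * ((norm (f x))\<^sup>2 + (norm (g x))\<^sup>2))"
    using assms by (intro integrable_mult_right Bochner_Integration.integrable_add) (auto simp: L2_def)
  then have "integrable lborel (\<lambda>x. (norm (f x + g x))\<^sup>2)"
  proof (rule Bochner_Integration.integrable_bound)
    show "AE x in lborel. norm ((norm (f x + g x))\<^sup>2) \<le> norm (2 * ((norm (f x))\<^sup>2 + (norm (g x))\<^sup>2))"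
    proof (rule AE_I2)
      fix x
      have "(norm (f x + g x))\<^sup>2 \<le> (norm (f x) + norm (g x))\<^sup>2" by (intro power_mono norm_triangle_ineq) simp
      also have "\<dots> \<le> 2 * ((norm (f x))\<^sup>2 + (norm (g x))\<^sup>2)"
        using sum_squares_bound[of "norm (f x)" "norm (g x)"] by (simp add: power2_sum)
      finally show "norm ((norm (f x + g x))\<^sup>2) \<le> norm (2 * ((norm (f x))\<^sup>2 + (norm (g x))\<^sup>2))" by simp
    qed
  qed measurable
  then show ?thesis by (simp add: L2_def)
qed

lemma L2_scaleR: "f \<in> L2 \<Longrightarrow> (\<lambda>x. c *\<^sub>R f x) \<in> L2" for f :: "real \<Rightarrow> 'a::euclidean_space"
  by (rule L2_bound[where f = f and C = "\<bar>c\<bar>"]) (auto simp: L2_iff)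

lemma L2_diff: "f \<in> L2 \<Longrightarrow> g \<in> L2 \<Longrightarrow> (\<lambda>x. f x - g x) \<in> L2" for f g :: "real \<Rightarrow> 'a::euclidean_space"
  using L2_add[of f "\<lambda>x. (-1) *\<^sub>R g x"] L2_scaleR[of g "-1"] by simp

lemma L2_mult_integrable:
  fixes f g :: "real \<Rightarrow> complex"
  assumes "f \<in> L2" "g \<in> L2"
  shows "integrable lborel (\<lambda>x. f x * g x)"
proof -
  have [measurable]: "f \<in> borel_measurable borel" "g \<in> borel_measurable borel" using assms by (auto simp: L2_iff)
  have "integrable lborel (\<lambda>x. (norm (f x))\<^sup>2 + (norm (g x))\<^sup>2)"
    using assms by (intro Bochner_Integration.integrable_add) (auto simp: L2_def)
  then show ?thesis
  proof (rule Bochner_Integration.integrable_bound)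
    show "AE x in lborel. norm (f x * g x) \<le> norm ((norm (f x))\<^sup>2 + (norm (g x))\<^sup>2)"
    proof (rule AE_I2)
      fix x
      have "norm (f x) * norm (g x) \<le> (norm (f x))\<^sup>2 + (norm (g x))\<^sup>2"
        using sum_squares_bound[of "norm (f x)" "norm (g x)"] mult_nonneg_nonneg[OF norm_ge_zero norm_ge_zero, of "f x" "g x"]
        by linarith
      then show "norm (f x * g x) \<le> norm ((norm (f x))\<^sup>2 + (norm (g x))\<^sup>2)" by (simp add: norm_mult)
    qed
  qed measurable
qed

lemma Cauchy_Schwarz_integral:
  fixes f g :: "real \<Rightarrow> complex"
  assumes [measurable]: "f \<in> borel_measurable borel" "g \<in> borel_measurable borel"
  shows "ennreal ((norm (LINT x|lborel. f x * g x))\<^sup>2) \<le>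
    (\<integral>\<^sup>+x. ennreal ((norm (f x))\<^sup>2) \<partial>lborel) * (\<integral>\<^sup>+x. ennreal ((norm (g x))\<^sup>2) \<partial>lborel)"
proof -
  have "ennreal ((norm (LINT x|lborel. f x * g x))\<^sup>2) = (ennreal (norm (LINT x|lborel. f x * g x)))\<^sup>2"
    by (simp add: ennreal_power)
  also have "\<dots> \<le> (\<integral>\<^sup>+x. ennreal (norm (f x * g x)) \<partial>lborel)\<^sup>2"
    by (intro power_mono norm_integral_le_nn_integral) simp
  also have "(\<integral>\<^sup>+x. ennreal (norm (f x * g x)) \<partial>lborel) = (\<integral>\<^sup>+x. ennreal (norm (f x)) * ennreal (norm (g x)) \<partial>lborel)"
    by (simp add: norm_mult ennreal_mult)
  also have "\<dots>\<^sup>2 \<le> (\<integral>\<^sup>+x. (ennreal (norm (f x)))\<^sup>2 \<partial>lborel) * (\<integral>\<^sup>+x. (ennreal (norm (g x)))\<^sup>2 \<partial>lborel)"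
    by (rule Cauchy_Schwarz_nn_integral) measurable
  finally show ?thesis by (simp add: ennreal_power)
qed

lemma tendsto_integral_mult_L2:
  fixes d :: "'i \<Rightarrow> real \<Rightarrow> complex"
  assumes d: "\<And>n. d n \<in> borel_measurable borel" and q: "q \<in> L2"
    and lim: "((\<lambda>n. \<integral>\<^sup>+x. ennreal ((norm (d n x))\<^sup>2) \<partial>lborel) \<longlongrightarrow> 0) F"
  shows "((\<lambda>n. LINT x|lborel. d n x * q x) \<longlongrightarrow> 0) F"
proof -
  let ?q = "\<integral>\<^sup>+x. ennreal ((norm (q x))\<^sup>2) \<partial>lborel"
  have q': "q \<in> borel_measurable borel" "?q < top" using q by (auto simp: L2_iff)
  have "((\<lambda>n. ?q * (\<integral>\<^sup>+x. ennreal ((norm (d n x))\<^sup>2) \<partial>lborel)) \<longlongrightarrow> ?q * 0) F"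
    by (rule ennreal_tendsto_cmult[OF q'(2) lim])
  then have lim0: "((\<lambda>n. ?q * (\<integral>\<^sup>+x. ennreal ((norm (d n x))\<^sup>2) \<partial>lborel)) \<longlongrightarrow> ennreal 0) F"
    by simp
  have "((\<lambda>n. ennreal ((norm (LINT x|lborel. d n x * q x))\<^sup>2)) \<longlongrightarrow> ennreal 0) F"
  proof (rule tendsto_sandwich[OF _ _ tendsto_const lim0])
    show "\<forall>\<^sub>F n in F. ennreal ((norm (LINT x|lborel. d n x * q x))\<^sup>2) \<le> ?q * (\<integral>\<^sup>+x. ennreal ((norm (d n x))\<^sup>2) \<partial>lborel)"
      using Cauchy_Schwarz_integral[OF d q'(1)] by (intro always_eventually allI) (simp add: mult.commute)
  qed simp
  then have "((\<lambda>n. (norm (LINT x|lborel. d n x * q x))\<^sup>2) \<longlongrightarrow> 0) F"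
    by (rule tendsto_ennrealD) auto
  then have "((\<lambda>n. sqrt ((norm (LINT x|lborel. d n x * q x))\<^sup>2)) \<longlongrightarrow> sqrt 0) F"
    by (rule tendsto_real_sqrt)
  then show ?thesis by (simp add: tendsto_norm_zero_iff)
qed

text \<open>Test functions are taken in L1 and L2 at once: then \<open>ft q\<close> is a convergent
  integral and lies in L2 by Bessel's inequality, so that both sides of the formula converge
  absolutely.\<close>

definition fourier_pair :: "(real \<Rightarrow> complex) \<Rightarrow> (real \<Rightarrow> complex) \<Rightarrow> bool"
  where "fourier_pair f F \<longleftrightarrow> f \<in> L2 \<and> F \<in> L2 \<and>
    (\<forall>q. integrable lborel q \<longrightarrow> q \<in> L2 \<longrightarrow> (LINT \<xi>|lborel. F \<xi> * q \<xi>) = (LINT x|lborel. f x * ft q x))"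

lemma ft_L2:
  assumes "integrable lborel q" "q \<in> L2"
  shows "ft q \<in> L2"
  unfolding L2_iff
proof
  show "ft q \<in> borel_measurable borel" using assms by (simp add: L2_iff ft_measurable)
  have "(\<integral>\<^sup>+x. ennreal ((norm (ft q x))\<^sup>2) \<partial>lborel) \<le> ennreal (2 * pi) * (\<integral>\<^sup>+x. ennreal ((norm (q x))\<^sup>2) \<partial>lborel)"
    by (rule bessel[OF assms(1)])
  also have "\<dots> < \<infinity>" using assms(2) by (simp add: L2_iff ennreal_mult_less_top)
  finally show "(\<integral>\<^sup>+x. ennreal ((norm (ft q x))\<^sup>2) \<partial>lborel) < \<infinity>" .
qed

text \<open>All uses of the definition go through approximation: it suffices that truncations converge on
  both sides.\<close>

lemma fourier_pair_limit:
  assumes f: "f \<in> L2" and F: "F \<in> L2" and ne: "\<not> trivial_limit \<F>"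
    and fn: "\<And>n. integrable lborel (fn n)"
    and lim_f: "((\<lambda>n. \<integral>\<^sup>+x. ennreal ((norm (f x - fn n x))\<^sup>2) \<partial>lborel) \<longlongrightarrow> 0) \<F>"
    and lim_F: "((\<lambda>n. \<integral>\<^sup>+\<xi>. ennreal ((norm (F \<xi> - ft (fn n) \<xi>))\<^sup>2) \<partial>lborel) \<longlongrightarrow> 0) \<F>"
    and fn2: "\<And>n. fn n \<in> L2"
  shows "fourier_pair f F"
  unfolding fourier_pair_def
proof (intro conjI allI impI f F)
  fix q :: "real \<Rightarrow> complex" assume q: "integrable lborel q" "q \<in> L2"
  have [measurable]: "f \<in> borel_measurable borel" "F \<in> borel_measurable borel" "fn n \<in> borel_measurable borel" for n
    using f F fn2[of n] by (auto simp: L2_iff)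
  have "((\<lambda>n. LINT \<xi>|lborel. (F \<xi> - ft (fn n) \<xi>) * q \<xi>) \<longlongrightarrow> 0) \<F>"
    by (rule tendsto_integral_mult_L2[OF _ q(2) lim_F]) measurable
  moreover have "((\<lambda>n. LINT x|lborel. (f x - fn n x) * ft q x) \<longlongrightarrow> 0) \<F>"
    by (rule tendsto_integral_mult_L2[OF _ ft_L2[OF q] lim_f]) measurable
  ultimately have "((\<lambda>n. (LINT \<xi>|lborel. (F \<xi> - ft (fn n) \<xi>) * q \<xi>) - (LINT x|lborel. (f x - fn n x) * ft q x)) \<longlongrightarrow> 0 - 0) \<F>"
    by (rule tendsto_diff)
  \<comment> \<open>The multiplication formula for \<open>fn n\<close> cancels the approximations.
    The difference is therefore constant in n, and as it tends to 0 it vanishes.\<close>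
  moreover have "(LINT \<xi>|lborel. (F \<xi> - ft (fn n) \<xi>) * q \<xi>) - (LINT x|lborel. (f x - fn n x) * ft q x) =
      (LINT \<xi>|lborel. F \<xi> * q \<xi>) - (LINT x|lborel. f x * ft q x)" for n
  proof -
    have "(LINT \<xi>|lborel. (F \<xi> - ft (fn n) \<xi>) * q \<xi>) = (LINT \<xi>|lborel. F \<xi> * q \<xi>) - (LINT \<xi>|lborel. ft (fn n) \<xi> * q \<xi>)"
      unfolding left_diff_distrib
      by (intro Bochner_Integration.integral_diff L2_mult_integrable F q ft_L2 fn fn2)
    moreover have "(LINT x|lborel. (f x - fn n x) * ft q x) = (LINT x|lborel. f x * ft q x) - (LINT x|lborel. fn n x * ft q x)"
      unfolding left_diff_distrib
      by (intro Bochner_Integration.integral_diff L2_mult_integrable f q ft_L2 fn fn2)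
    ultimately show ?thesis using ft_multiplication[OF fn q(1), of n] by simp
  qed
  ultimately show "(LINT \<xi>|lborel. F \<xi> * q \<xi>) = (LINT x|lborel. f x * ft q x)"
    by (simp add: tendsto_const_iff[OF ne])
qed

section \<open>Truncation, completeness and existence of the transform\<close>

definition truncate :: "(real \<Rightarrow> 'a) \<Rightarrow> real \<Rightarrow> real \<Rightarrow> 'a::euclidean_space"
  where "truncate f R x = indicator {-R..R} x *\<^sub>R f x"

lemma truncate_measurable [measurable]:
  "f \<in> borel_measurable borel \<Longrightarrow> truncate f R \<in> borel_measurable borel"
  unfolding truncate_def[abs_def] by measurable

lemma truncate_L2: "f \<in> L2 \<Longrightarrow> truncate f R \<in> L2"
  by (rule L2_bound[where f = f and C = 1]) (auto simp: L2_iff truncate_def indicator_def)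

lemma truncate_integrable: "f \<in> L2 \<Longrightarrow> integrable lborel (truncate f R)"
  using L2_locally_integrable[of f] unfolding locally_integrable_def set_integrable_def truncate_def[abs_def] by blast

lemma truncate_tendsto:
  assumes f: "f \<in> L2"
  shows "((\<lambda>R. \<integral>\<^sup>+x. ennreal ((norm (f x - truncate f R x))\<^sup>2) \<partial>lborel) \<longlongrightarrow> 0) at_top"
proof -
  have [measurable]: "f \<in> borel_measurable borel" using f by (simp add: L2_iff)
  have i: "integrable lborel (\<lambda>x. (norm (f x))\<^sup>2)" using f by (simp add: L2_def)
  have "((\<lambda>R. LINT x|lborel. (norm (f x - truncate f R x))\<^sup>2) \<longlongrightarrow> integral\<^sup>L lborel (\<lambda>x::real. 0::real)) at_top"
  proof (rule integral_dominated_convergence_at_top[where w = "\<lambda>x. (norm (f x))\<^sup>2"])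
    show "\<forall>\<^sub>F R in at_top. AE x in lborel. norm ((norm (f x - truncate f R x))\<^sup>2) \<le> (norm (f x))\<^sup>2"
      by (intro always_eventually allI AE_I2) (auto simp: truncate_def indicator_def)
    show "AE x in lborel. ((\<lambda>R. (norm (f x - truncate f R x))\<^sup>2) \<longlongrightarrow> 0) at_top"
    proof (rule AE_I2)
      fix x
      have "\<forall>\<^sub>F R in at_top. 0 = (norm (f x - truncate f R x))\<^sup>2"
        using eventually_ge_at_top[of "\<bar>x\<bar>"] by eventually_elim (auto simp: truncate_def indicator_def)
      then show "((\<lambda>R. (norm (f x - truncate f R x))\<^sup>2) \<longlongrightarrow> 0) at_top"
        by (rule Lim_transform_eventually[OF tendsto_const])
    qed
  qed (use i in \<open>simp_all\<close>)
  then have "((\<lambda>R. ennreal (LINT x|lborel. (norm (f x - truncate f R x))\<^sup>2)) \<longlongrightarrow> ennreal 0) at_top"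
    by (intro tendsto_ennrealI) simp
  moreover have "ennreal (LINT x|lborel. (norm (f x - truncate f R x))\<^sup>2) = (\<integral>\<^sup>+x. ennreal ((norm (f x - truncate f R x))\<^sup>2) \<partial>lborel)" for R
    using L2_diff[OF f truncate_L2[OF f]] by (subst nn_integral_eq_integral) (auto simp: L2_def)
  ultimately show ?thesis by simp
qed

text \<open>The sum of 2^m |d m x|^2 over m is integrable, hence finite almost everywhere; there the
  increments decay like 2^(-m/2) and are summable. The rate 1/8 leaves room for the weight 2^m.
  Fatou's lemma transfers the rate to the limit.\<close>

lemma L2_complete:
  fixes u :: "nat \<Rightarrow> real \<Rightarrow> complex"
  assumes u: "\<And>n. u n \<in> borel_measurable borel" and C: "0 \<le> C"
    and cauchy: "\<And>m n. m \<le> n \<Longrightarrow> (\<integral>\<^sup>+x. ennreal ((norm (u n x - u m x))\<^sup>2) \<partial>lborel) \<le> ennreal (C * (1/8) ^ m)"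
  obtains G where "G \<in> borel_measurable borel" "AE x in lborel. (\<lambda>n. u n x) \<longlonglongrightarrow> G x"
    "\<And>m. (\<integral>\<^sup>+x. ennreal ((norm (G x - u m x))\<^sup>2) \<partial>lborel) \<le> ennreal (C * (1/8) ^ m)"
proof -
  note [measurable] = u
  define d where "d = (\<lambda>m x. u (Suc m) x - u m x)"
  have [measurable]: "d m \<in> borel_measurable borel" for m unfolding d_def by measurable
  have "(\<integral>\<^sup>+x. (\<Sum>m. ennreal (2 ^ m * (norm (d m x))\<^sup>2)) \<partial>lborel) = (\<Sum>m. \<integral>\<^sup>+x. ennreal (2 ^ m * (norm (d m x))\<^sup>2) \<partial>lborel)"
    by (rule nn_integral_suminf) measurable
  also have "\<dots> \<le> (\<Sum>m. ennreal (C * (1/4) ^ m))"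
  proof (intro suminf_le)
    fix m
    have "(\<integral>\<^sup>+x. ennreal (2 ^ m * (norm (d m x))\<^sup>2) \<partial>lborel) = (\<integral>\<^sup>+x. ennreal (2 ^ m) * ennreal ((norm (d m x))\<^sup>2) \<partial>lborel)"
      by (simp add: ennreal_mult)
    also have "\<dots> = ennreal (2 ^ m) * (\<integral>\<^sup>+x. ennreal ((norm (d m x))\<^sup>2) \<partial>lborel)"
      by (rule nn_integral_cmult) measurable
    also have "\<dots> \<le> ennreal (2 ^ m) * ennreal (C * (1/8) ^ m)"
      unfolding d_def by (intro mult_left_mono cauchy) auto
    also have "\<dots> = ennreal (2 ^ m * (C * (1/8) ^ m))" using C by (simp add: ennreal_mult)
    also have "2 ^ m * (C * (1/8) ^ m) = C * (2 * (1/8)) ^ m" by (simp only: power_mult_distrib mult_ac)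
    finally show "(\<integral>\<^sup>+x. ennreal (2 ^ m * (norm (d m x))\<^sup>2) \<partial>lborel) \<le> ennreal (C * (1/4) ^ m)" by simp
  qed auto
  also have "\<dots> < \<infinity>"
  proof -
    have "summable (\<lambda>m. C * (1/4) ^ m)" by (intro summable_mult summable_geometric) simp
    then show ?thesis using C by (subst suminf_ennreal2) auto
  qed
  finally have fin: "(\<integral>\<^sup>+x. (\<Sum>m. ennreal (2 ^ m * (norm (d m x))\<^sup>2)) \<partial>lborel) \<noteq> \<infinity>" by (rule less_imp_neq)
  have "(\<lambda>x. \<Sum>m. ennreal (2 ^ m * (norm (d m x))\<^sup>2)) \<in> borel_measurable lborel"
    by measurable
  then have "AE x in lborel. (\<Sum>m. ennreal (2 ^ m * (norm (d m x))\<^sup>2)) \<noteq> \<infinity>"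
    using fin by (rule nn_integral_PInf_AE)
  then have conv: "AE x in lborel. convergent (\<lambda>n. u n x)"
  proof (rule eventually_mono)
    fix x assume elim: "(\<Sum>m. ennreal (2 ^ m * (norm (d m x))\<^sup>2)) \<noteq> \<infinity>"
    define e where "e = (\<lambda>m. ennreal (2 ^ m * (norm (d m x))\<^sup>2))"
    have "sum e {m} \<le> suminf e" for m by (rule sum_le_suminf) auto
    then have le: "e m \<le> suminf e" for m by simp
    have "suminf e < top" using elim unfolding e_def by (simp only: infinity_ennreal_def less_top)
    then have e: "enn2real (e m) \<le> enn2real (suminf e)" for m by (intro enn2real_mono le)
    define B where "B = enn2real (suminf e)"
    have B: "2 ^ m * (norm (d m x))\<^sup>2 \<le> B" for m using e[of m] unfolding B_def by (simp add: e_def)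
    have "summable (\<lambda>m. d m x)"
    proof (rule summable_comparison_test')
      show "summable (\<lambda>m. sqrt B * (1 / sqrt 2) ^ m)" by (intro summable_mult summable_geometric) simp
      show "norm (d m x) \<le> sqrt B * (1 / sqrt 2) ^ m" for m
      proof -
        have "sqrt (2 ^ m * (norm (d m x))\<^sup>2) \<le> sqrt B" using B by simp
        then have "sqrt 2 ^ m * norm (d m x) \<le> sqrt B" by (simp add: real_sqrt_mult real_sqrt_power)
        then show ?thesis by (simp add: power_divide field_simps)
      qed
    qed
    then have "(\<lambda>n. \<Sum>m<n. d m x) \<longlonglongrightarrow> (\<Sum>m. d m x)" by (rule summable_LIMSEQ)
    moreover have "(\<Sum>m<n. d m x) = u n x - u 0 x" for n
      unfolding d_def by (rule sum_lessThan_telescope)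
    ultimately have "(\<lambda>n. u n x - u 0 x + u 0 x) \<longlonglongrightarrow> (\<Sum>m. d m x) + u 0 x" by (intro tendsto_add) auto
    then show "convergent (\<lambda>n. u n x)" by (auto simp: convergent_def)
  qed
  define G where "G = (\<lambda>x. lim (\<lambda>n. u n x))"
  have G [measurable]: "G \<in> borel_measurable borel" unfolding G_def by measurable
  have lim: "AE x in lborel. (\<lambda>n. u n x) \<longlonglongrightarrow> G x"
    using conv by eventually_elim (simp add: G_def convergent_LIMSEQ_iff)
  have "(\<integral>\<^sup>+x. ennreal ((norm (G x - u m x))\<^sup>2) \<partial>lborel) \<le> ennreal (C * (1/8) ^ m)" for m
  proof -
    have "(\<integral>\<^sup>+x. ennreal ((norm (G x - u m x))\<^sup>2) \<partial>lborel) = (\<integral>\<^sup>+x. liminf (\<lambda>n. ennreal ((norm (u n x - u m x))\<^sup>2)) \<partial>lborel)"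
    proof (intro nn_integral_cong_AE)
      show "AE x in lborel. ennreal ((norm (G x - u m x))\<^sup>2) = liminf (\<lambda>n. ennreal ((norm (u n x - u m x))\<^sup>2))"
        using lim
      proof eventually_elim
        case (elim x)
        then have "(\<lambda>n. ennreal ((norm (u n x - u m x))\<^sup>2)) \<longlonglongrightarrow> ennreal ((norm (G x - u m x))\<^sup>2)"
          by (intro tendsto_ennrealI tendsto_power tendsto_norm tendsto_diff tendsto_const)
        from lim_imp_Liminf[OF trivial_limit_sequentially this] show ?case by simp
      qed
    qed
    also have "\<dots> \<le> liminf (\<lambda>n. \<integral>\<^sup>+x. ennreal ((norm (u n x - u m x))\<^sup>2) \<partial>lborel)"
      by (rule nn_integral_liminf) measurable
    also have "\<dots> \<le> liminf (\<lambda>n. ennreal (C * (1/8) ^ m))"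
    proof (rule Liminf_mono)
      show "\<forall>\<^sub>F n in sequentially. (\<integral>\<^sup>+x. ennreal ((norm (u n x - u m x))\<^sup>2) \<partial>lborel) \<le> ennreal (C * (1/8) ^ m)"
        using eventually_ge_at_top[of m] by eventually_elim (rule cauchy)
    qed
    also have "\<dots> = ennreal (C * (1/8) ^ m)" by (simp add: Liminf_const)
    finally show ?thesis .
  qed
  with G lim show thesis by (rule that)
qed

text \<open>Along suitable radii the squared norm cut off by truncation is at most (1/8)^m. Bessel's
  inequality for integrable functions makes the transforms of the truncations a fast Cauchy
  sequence, and Fatou's lemma passes the bound on to the limit.\<close>

theorem fourier_pair_exists:
  assumes f: "f \<in> L2"
  obtains G where "fourier_pair f G"
    "(\<integral>\<^sup>+\<xi>. ennreal ((norm (G \<xi>))\<^sup>2) \<partial>lborel) \<le> ennreal (2 * pi) * (\<integral>\<^sup>+x. ennreal ((norm (f x))\<^sup>2) \<partial>lborel)"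
proof -
  have fm [measurable]: "f \<in> borel_measurable borel" using f by (simp add: L2_iff)
  have "\<forall>\<^sub>F R in at_top. (\<integral>\<^sup>+x. ennreal ((norm (f x - truncate f R x))\<^sup>2) \<partial>lborel) < ennreal ((1/8) ^ m)" for m :: nat
    by (rule order_tendstoD(2)[OF truncate_tendsto[OF f]]) simp
  then have "\<exists>r. \<forall>R\<ge>r. (\<integral>\<^sup>+x. ennreal ((norm (f x - truncate f R x))\<^sup>2) \<partial>lborel) < ennreal ((1/8) ^ m)" for m :: nat
    unfolding eventually_at_top_linorder .
  then obtain r where r: "\<And>m R. r m \<le> R \<Longrightarrow> (\<integral>\<^sup>+x. ennreal ((norm (f x - truncate f R x))\<^sup>2) \<partial>lborel) < ennreal ((1/8) ^ m)"
    by metis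
  \<comment> \<open>Summing the absolute values makes the radii increasing while keeping them above
    \<open>r m\<close>.\<close>
  define R where "R = (\<lambda>m. \<Sum>k\<le>m. \<bar>r k\<bar>)"
  have R_mono: "R m \<le> R n" if "m \<le> n" for m n
    unfolding R_def using that by (intro sum_mono2) auto
  have "r m \<le> R m" for m
    unfolding R_def using member_le_sum[of m "{..m}" "\<lambda>k. \<bar>r k\<bar>"] by simp
  then have close: "(\<integral>\<^sup>+x. ennreal ((norm (f x - truncate f (R m) x))\<^sup>2) \<partial>lborel) \<le> ennreal ((1/8) ^ m)" for m
    using r less_imp_le by blast
  define u where "u = (\<lambda>m. ft (truncate f (R m)))"
  note ti = truncate_integrable[OF f] and t2 = truncate_L2[OF f]
  have u [measurable]: "u m \<in> borel_measurable borel" for m unfolding u_def by measurable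
  have cauchy: "(\<integral>\<^sup>+x. ennreal ((norm (u n x - u m x))\<^sup>2) \<partial>lborel) \<le> ennreal (2 * pi * (1/8) ^ m)" if "m \<le> n" for m n
  proof -
    let ?d = "\<lambda>x. truncate f (R n) x - truncate f (R m) x"
    have "u n x - u m x = ft ?d x" for x
      unfolding u_def ft_def right_diff_distrib
      by (rule Bochner_Integration.integral_diff[symmetric]) (intro ft_integrable ti)+
    then have "(\<integral>\<^sup>+x. ennreal ((norm (u n x - u m x))\<^sup>2) \<partial>lborel) \<le> ennreal (2 * pi) * (\<integral>\<^sup>+x. ennreal ((norm (?d x))\<^sup>2) \<partial>lborel)"
      using bessel[of ?d] ti by simp
    also have "(\<integral>\<^sup>+x. ennreal ((norm (?d x))\<^sup>2) \<partial>lborel) \<le> (\<integral>\<^sup>+x. ennreal ((norm (f x - truncate f (R m) x))\<^sup>2) \<partial>lborel)"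
      using R_mono[OF that] by (intro nn_integral_mono ennreal_leI power_mono) (auto simp: truncate_def indicator_def)
    also have "\<dots> \<le> ennreal ((1/8) ^ m)" by (rule close)
    finally show ?thesis by (simp add: ennreal_mult mult_left_mono)
  qed
  obtain G where G: "G \<in> borel_measurable borel" "AE x in lborel. (\<lambda>n. u n x) \<longlonglongrightarrow> G x"
    "\<And>m. (\<integral>\<^sup>+x. ennreal ((norm (G x - u m x))\<^sup>2) \<partial>lborel) \<le> ennreal (2 * pi * (1/8) ^ m)"
    by (rule L2_complete[OF u _ cauchy]) auto
  have bound: "(\<integral>\<^sup>+\<xi>. ennreal ((norm (G \<xi>))\<^sup>2) \<partial>lborel) \<le> ennreal (2 * pi) * (\<integral>\<^sup>+x. ennreal ((norm (f x))\<^sup>2) \<partial>lborel)"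
  proof -
    have "(\<integral>\<^sup>+\<xi>. ennreal ((norm (G \<xi>))\<^sup>2) \<partial>lborel) = (\<integral>\<^sup>+\<xi>. liminf (\<lambda>n. ennreal ((norm (u n \<xi>))\<^sup>2)) \<partial>lborel)"
    proof (intro nn_integral_cong_AE)
      show "AE x in lborel. ennreal ((norm (G x))\<^sup>2) = liminf (\<lambda>n. ennreal ((norm (u n x))\<^sup>2))"
        using G(2)
      proof eventually_elim
        case (elim x)
        then have "(\<lambda>n. ennreal ((norm (u n x))\<^sup>2)) \<longlonglongrightarrow> ennreal ((norm (G x))\<^sup>2)"
          by (intro tendsto_intros tendsto_ennrealI)
        from lim_imp_Liminf[OF trivial_limit_sequentially this] show ?case by simp
      qed
    qed
    also have "\<dots> \<le> liminf (\<lambda>n. \<integral>\<^sup>+\<xi>. ennreal ((norm (u n \<xi>))\<^sup>2) \<partial>lborel)"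
      by (rule nn_integral_liminf) measurable
    also have "\<dots> \<le> liminf (\<lambda>n. ennreal (2 * pi) * (\<integral>\<^sup>+x. ennreal ((norm (f x))\<^sup>2) \<partial>lborel))"
    proof (intro Liminf_mono always_eventually allI)
      fix n
      have "(\<integral>\<^sup>+\<xi>. ennreal ((norm (u n \<xi>))\<^sup>2) \<partial>lborel) \<le> ennreal (2 * pi) * (\<integral>\<^sup>+x. ennreal ((norm (truncate f (R n) x))\<^sup>2) \<partial>lborel)"
        unfolding u_def by (rule bessel[OF ti])
      also have "\<dots> \<le> ennreal (2 * pi) * (\<integral>\<^sup>+x. ennreal ((norm (f x))\<^sup>2) \<partial>lborel)"
        by (intro mult_left_mono nn_integral_mono ennreal_leI power_mono) (auto simp: truncate_def indicator_def)
      finally show "(\<integral>\<^sup>+\<xi>. ennreal ((norm (u n \<xi>))\<^sup>2) \<partial>lborel) \<le> ennreal (2 * pi) * (\<integral>\<^sup>+x. ennreal ((norm (f x))\<^sup>2) \<partial>lborel)" .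
    qed
    also have "\<dots> = ennreal (2 * pi) * (\<integral>\<^sup>+x. ennreal ((norm (f x))\<^sup>2) \<partial>lborel)" by (simp add: Liminf_const)
    finally show ?thesis .
  qed
  have G2: "G \<in> L2"
    using bound f G(1) by (auto simp: L2_iff ennreal_mult_less_top intro: le_less_trans)
  have geo: "(\<lambda>m. ennreal (C * (1/8) ^ m)) \<longlonglongrightarrow> 0" for C
  proof -
    have "(\<lambda>m. C * (1/8) ^ m) \<longlonglongrightarrow> C * 0" by (intro tendsto_mult_left LIMSEQ_realpow_zero) auto
    then have "(\<lambda>m. ennreal (C * (1/8) ^ m)) \<longlonglongrightarrow> ennreal 0" by (intro tendsto_ennrealI) simp
    then show ?thesis by simp
  qed
  have "fourier_pair f G"
  proof (rule fourier_pair_limit[OF f G2, where fn = "\<lambda>m. truncate f (R m)" and \<F> = sequentially])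
    show "(\<lambda>n. \<integral>\<^sup>+x. ennreal ((norm (f x - truncate f (R n) x))\<^sup>2) \<partial>lborel) \<longlonglongrightarrow> 0"
      by (rule tendsto_sandwich[OF _ _ tendsto_const geo[of 1]]) (use close in auto)
    show "(\<lambda>n. \<integral>\<^sup>+x. ennreal ((norm (G x - ft (truncate f (R n)) x))\<^sup>2) \<partial>lborel) \<longlonglongrightarrow> 0"
      by (rule tendsto_sandwich[OF _ _ tendsto_const geo[of "2 * pi"]]) (use G(3) in \<open>auto simp: u_def\<close>)
  qed (use ti t2 in auto)
  then show thesis using bound by (rule that)
qed

section \<open>Weak derivatives and the Fourier transform\<close>

lemma test_function_L2:
  assumes p: "test_function p"
  shows "(\<lambda>x. complex_of_real (p x)) \<in> L2" and "integrable lborel (\<lambda>x. complex_of_real (p x))"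
proof -
  have "integrable lborel (\<lambda>x. p x *\<^sub>R (1 :: complex))"
    by (rule test_function_integrable[OF p, where B = 1]) auto
  then show "integrable lborel (\<lambda>x. complex_of_real (p x))" by (simp add: scaleR_conv_of_real)
  obtain R B where "\<And>x. \<bar>p x\<bar> \<le> B" using test_function_bounded[OF p] by metis
  then have "integrable lborel (\<lambda>x. p x *\<^sub>R p x)"
    by (intro test_function_integrable[OF p, where B = B]) (use test_function_measurable[OF p] in auto)
  then show "(\<lambda>x. complex_of_real (p x)) \<in> L2"
    using test_function_measurable[OF p] by (simp add: L2_def power2_eq_square)
qed

lemma AE_eq_if_test_integrals_eq:
  assumes F: "locally_integrable (F :: real \<Rightarrow> complex)" and G: "locally_integrable G"
    and eq: "\<And>p. test_function p \<Longrightarrow> (LINT \<xi>|lborel. F \<xi> * of_real (p \<xi>)) = (LINT \<xi>|lborel. G \<xi> * of_real (p \<xi>))"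
  shows "AE \<xi> in lborel. F \<xi> = G \<xi>"
proof -
  have "AE \<xi> in lborel. F \<xi> - G \<xi> = 0"
  proof (rule AE_zero_if_test_integrals_zero[OF locally_integrable_diff[OF F G]])
    fix p :: "real \<Rightarrow> real" assume p: "test_function p"
    have "(LINT x|lborel. p x *\<^sub>R (F x - G x)) = (LINT x|lborel. p x *\<^sub>R F x) - (LINT x|lborel. p x *\<^sub>R G x)"
      unfolding scaleR_diff_right
      by (intro Bochner_Integration.integral_diff test_function_times_locally_integrable p F G)
    also have "\<dots> = 0" using eq[OF p] by (simp add: scaleR_conv_of_real mult.commute)
    finally show "(LINT x|lborel. p x *\<^sub>R (F x - G x)) = 0" .
  qed
  then show ?thesis by simp
qed

lemma fourier_pairD: "fourier_pair f F \<Longrightarrow> integrable lborel q \<Longrightarrow> q \<in> L2 \<Longrightarrow>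
    (LINT \<xi>|lborel. F \<xi> * q \<xi>) = (LINT x|lborel. f x * ft q x)"
  by (simp add: fourier_pair_def)

text \<open>Testing identifies \<open>F\<close> almost everywhere with the convergent integral
  \<open>ft f\<close>, to which the trivial bound applies.\<close>

lemma fourier_pair_L1:
  assumes f: "fourier_pair f F" and i: "integrable lborel f"
  shows "AE \<xi> in lborel. norm (F \<xi>) \<le> (LINT x|lborel. norm (f x))"
proof -
  have fL: "f \<in> L2" using f by (simp add: fourier_pair_def)
  have "AE \<xi> in lborel. F \<xi> = ft f \<xi>"
  proof (rule AE_eq_if_test_integrals_eq)
    show "locally_integrable F" using f by (auto simp: fourier_pair_def intro: L2_locally_integrable)
    show "locally_integrable (ft f)" by (intro L2_locally_integrable ft_L2 i fL)
    show "(LINT \<xi>|lborel. F \<xi> * of_real (p \<xi>)) = (LINT \<xi>|lborel. ft f \<xi> * of_real (p \<xi>))" if "test_function p" for p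
      using fourier_pairD[OF f] ft_multiplication[OF i] test_function_L2[OF that] by simp
  qed
  then show ?thesis by eventually_elim (simp add: norm_ft_le[OF i])
qed

lemma norm_cis_diff_le: "norm (cis a - cis b) \<le> \<bar>a - b\<bar>"
proof -
  have "cis a - cis b = cis b * (cis (a - b) - 1)" by (simp add: right_diff_distrib cis_mult)
  then have "norm (cis a - cis b) = norm (cis (a - b) - 1)" by (simp add: norm_mult)
  then show ?thesis using iexp_approx1[of "a - b" 0] by (simp add: cis_conv_exp)
qed

text \<open>Differentiation under the integral: the difference quotient of the exponentials is at
  most |x| in modulus, so |x h(x)| is an integrable majorant. The variable is real and the values
  are complex; stated as a limit of quotients, the result splits into real derivatives of the real
  and the imaginary part.\<close>

lemma ft_quotient_tendsto:
  assumes h: "integrable lborel h" and xh: "integrable lborel (\<lambda>x. of_real x * h x)"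
  shows "((\<lambda>y. (ft h y - ft h \<xi>) / of_real (y - \<xi>)) \<longlongrightarrow> ft (\<lambda>x. - \<i> * of_real x * h x) \<xi>) (at \<xi>)"
  unfolding tendsto_at_iff_sequentially comp_def
proof (intro allI impI)
  fix Y :: "nat \<Rightarrow> real" assume Y: "\<forall>i. Y i \<in> UNIV - {\<xi>}" "Y \<longlonglongrightarrow> \<xi>"
  note [measurable] = borel_measurable_integrable[OF h]
  let ?s = "\<lambda>i x. (cis (- (x * Y i)) - cis (- (x * \<xi>))) / of_real (Y i - \<xi>) * h x"
  have "(\<lambda>i. LINT x|lborel. ?s i x) \<longlonglongrightarrow> (LINT x|lborel. cis (- (x * \<xi>)) * (- \<i> * of_real x * h x))"
  proof (rule integral_dominated_convergence[where w = "\<lambda>x. norm (of_real x * h x)"])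
    show "AE x in lborel. (\<lambda>i. ?s i x) \<longlonglongrightarrow> cis (- (x * \<xi>)) * (- \<i> * of_real x * h x)"
    proof (rule AE_I2)
      fix x
      have "((\<lambda>z. exp (- \<i> * of_real x * z)) has_field_derivative (- \<i> * of_real x) * exp (- \<i> * of_real x * of_real \<xi>)) (at (of_real \<xi>))"
        by (auto intro!: derivative_eq_intros)
      then have lim: "((\<lambda>z. (exp (- \<i> * of_real x * z) - exp (- \<i> * of_real x * of_real \<xi>)) / (z - of_real \<xi>)) \<longlongrightarrow>
          (- \<i> * of_real x) * exp (- \<i> * of_real x * of_real \<xi>)) (at (complex_of_real \<xi>))"
        unfolding has_field_derivative_iff .
      have Yc: "\<forall>i. complex_of_real (Y i) \<in> UNIV - {of_real \<xi>}" "(\<lambda>i. complex_of_real (Y i)) \<longlonglongrightarrow> of_real \<xi>"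
        using Y by (auto intro: tendsto_of_real)
      have "(\<lambda>i. (exp (- \<i> * of_real x * of_real (Y i)) - exp (- \<i> * of_real x * of_real \<xi>)) / (of_real (Y i) - of_real \<xi>)) \<longlonglongrightarrow>
          (- \<i> * of_real x) * exp (- \<i> * of_real x * of_real \<xi>)"
        by (rule lim[unfolded tendsto_at_iff_sequentially comp_def, THEN spec[where x = "\<lambda>i. complex_of_real (Y i)"], THEN mp, THEN mp, OF Yc])
      moreover have "exp (- \<i> * of_real x * of_real r) = cis (- (x * r))" for r
        by (simp add: cis_conv_exp mult_ac)
      ultimately have "(\<lambda>i. (cis (- (x * Y i)) - cis (- (x * \<xi>))) / of_real (Y i - \<xi>)) \<longlonglongrightarrow> (- \<i> * of_real x) * cis (- (x * \<xi>))"
        by simp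
      then have "(\<lambda>i. ?s i x) \<longlonglongrightarrow> (- \<i> * of_real x) * cis (- (x * \<xi>)) * h x"
        by (intro tendsto_mult_right)
      then show "(\<lambda>i. ?s i x) \<longlonglongrightarrow> cis (- (x * \<xi>)) * (- \<i> * of_real x * h x)"
        by (simp only: mult_ac)
    qed
    show "AE x in lborel. norm (?s i x) \<le> norm (of_real x * h x)" for i
    proof (rule AE_I2)
      fix x
      have "norm (cis (- (x * Y i)) - cis (- (x * \<xi>))) \<le> \<bar>x\<bar> * \<bar>Y i - \<xi>\<bar>"
        using norm_cis_diff_le[of "- (x * Y i)" "- (x * \<xi>)"]
        by (simp add: abs_mult[symmetric] algebra_simps abs_minus_commute)
      then have "norm ((cis (- (x * Y i)) - cis (- (x * \<xi>))) / of_real (Y i - \<xi>)) \<le> \<bar>x\<bar>"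
        using Y(1) unfolding norm_divide norm_of_real by (simp add: divide_le_eq)
      then show "norm (?s i x) \<le> norm (of_real x * h x)"
        unfolding norm_mult norm_of_real by (rule mult_right_mono) simp
    qed
    show "integrable lborel (\<lambda>x. norm (of_real x * h x))" by (rule integrable_norm[OF xh])
    show "(\<lambda>x. cis (- (x * \<xi>)) * (- \<i> * of_real x * h x)) \<in> borel_measurable lborel" by measurable
    show "?s i \<in> borel_measurable lborel" for i by measurable
  qed
  moreover have "(ft h (Y i) - ft h \<xi>) / of_real (Y i - \<xi>) = (LINT x|lborel. ?s i x)" for i
  proof -
    have "ft h (Y i) - ft h \<xi> = (LINT x|lborel. cis (- (x * Y i)) * h x - cis (- (x * \<xi>)) * h x)"
      unfolding ft_def by (rule Bochner_Integration.integral_diff[symmetric]) (intro ft_integrable h)+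
    then have "(ft h (Y i) - ft h \<xi>) / of_real (Y i - \<xi>) =
        (LINT x|lborel. (cis (- (x * Y i)) * h x - cis (- (x * \<xi>)) * h x) / of_real (Y i - \<xi>))"
      by simp
    then show ?thesis by (simp add: algebra_simps diff_divide_distrib)
  qed
  ultimately show "(\<lambda>i. (ft h (Y i) - ft h \<xi>) / of_real (Y i - \<xi>)) \<longlonglongrightarrow> ft (\<lambda>x. - \<i> * of_real x * h x) \<xi>"
    by (simp only: ft_def[of "\<lambda>x. - \<i> * of_real x * h x"])
qed

lemma ft_DERIV:
  assumes "integrable lborel h" "integrable lborel (\<lambda>x. of_real x * h x)"
  shows "((\<lambda>y. Re (ft h y)) has_real_derivative Re (ft (\<lambda>x. - \<i> * of_real x * h x) \<xi>)) (at \<xi>)"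
    and "((\<lambda>y. Im (ft h y)) has_real_derivative Im (ft (\<lambda>x. - \<i> * of_real x * h x) \<xi>)) (at \<xi>)"
  using tendsto_Re[OF ft_quotient_tendsto[OF assms]] tendsto_Im[OF ft_quotient_tendsto[OF assms]]
  unfolding has_field_derivative_iff by (simp_all only: Re_divide_of_real Im_divide_of_real minus_complex.simps)

lemma smooth_power: "smooth (\<lambda>x. x ^ n)"
proof -
  have id: "smooth (\<lambda>x. x)"
    using smooth_sequence[of "\<lambda>n x. case n of 0 \<Rightarrow> x | Suc 0 \<Rightarrow> 1 | _ \<Rightarrow> 0"]
    by (simp add: split: nat.split)
  have one: "smooth (\<lambda>x. 1)"
    using smooth_sequence[of "\<lambda>n x. case n of 0 \<Rightarrow> 1 | _ \<Rightarrow> 0"] by (simp split: nat.split)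
  show ?thesis by (induction n) (simp_all add: id one smooth_mult)
qed

text \<open>The n-th derivative is the transform of (- i x)^n q(x), integrable because of the
  compact support. Real and imaginary parts are separated because smoothness is defined for real
  functions.\<close>

lemma ft_test_smooth:
  assumes q: "test_function q"
  shows "smooth (\<lambda>\<xi>. Re (ft (\<lambda>x. of_real (q x)) \<xi>))" "smooth (\<lambda>\<xi>. Im (ft (\<lambda>x. of_real (q x)) \<xi>))"
    and "deriv (\<lambda>\<xi>. Re (ft (\<lambda>x. of_real (q x)) \<xi>)) \<xi> = Re (ft (\<lambda>x. - \<i> * of_real x * of_real (q x)) \<xi>)"
    and "deriv (\<lambda>\<xi>. Im (ft (\<lambda>x. of_real (q x)) \<xi>)) \<xi> = Im (ft (\<lambda>x. - \<i> * of_real x * of_real (q x)) \<xi>)"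
proof -
  let ?h = "\<lambda>n x. (- \<i> * of_real x) ^ n * complex_of_real (q x)"
  have i: "integrable lborel (?h n)" for n
  proof -
    have "integrable lborel (\<lambda>x. complex_of_real (q x * x ^ n))"
      by (rule test_function_L2(2)[OF test_function_mult[OF q smooth_power]])
    then have "integrable lborel (\<lambda>x. (- \<i>) ^ n * complex_of_real (q x * x ^ n))"
      by (rule integrable_mult_right)
    moreover have "(\<lambda>x. (- \<i>) ^ n * complex_of_real (q x * x ^ n)) = ?h n"
      unfolding power_mult_distrib of_real_mult of_real_power by (simp only: mult_ac)
    ultimately show ?thesis by (simp only:)
  qed
  have xi: "integrable lborel (\<lambda>x. of_real x * ?h n x)" for n
  proof -
    have "integrable lborel (\<lambda>x. \<i> * ?h (Suc n) x)" by (rule integrable_mult_right[OF i])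
    moreover have "(\<lambda>x. \<i> * ?h (Suc n) x) = (\<lambda>x. of_real x * ?h n x)"
    proof
      fix x
      have "\<i> * ?h (Suc n) x = (\<i> * (- \<i>)) * (of_real x * ?h n x)" unfolding power_Suc by (simp only: mult_ac)
      then show "\<i> * ?h (Suc n) x = of_real x * ?h n x" by simp
    qed
    ultimately show ?thesis by (simp only:)
  qed
  have S: "(\<lambda>x. - \<i> * of_real x * ?h n x) = ?h (Suc n)" for n
    by (simp add: fun_eq_iff mult_ac)
  note D = ft_DERIV[OF i xi, unfolded S]
  show "smooth (\<lambda>\<xi>. Re (ft (\<lambda>x. of_real (q x)) \<xi>))" "smooth (\<lambda>\<xi>. Im (ft (\<lambda>x. of_real (q x)) \<xi>))"
    using smooth_sequence[of "\<lambda>n \<xi>. Re (ft (?h n) \<xi>)", OF D(1)] smooth_sequence[of "\<lambda>n \<xi>. Im (ft (?h n) \<xi>)", OF D(2)]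
    by simp_all
  show "deriv (\<lambda>\<xi>. Re (ft (\<lambda>x. of_real (q x)) \<xi>)) \<xi> = Re (ft (\<lambda>x. - \<i> * of_real x * of_real (q x)) \<xi>)"
    "deriv (\<lambda>\<xi>. Im (ft (\<lambda>x. of_real (q x)) \<xi>)) \<xi> = Im (ft (\<lambda>x. - \<i> * of_real x * of_real (q x)) \<xi>)"
    using DERIV_imp_deriv[OF D(1)[of 0]] DERIV_imp_deriv[OF D(2)[of 0]] by simp_all
qed

lemma L2_of_real_bound:
  assumes "h \<in> L2" "p \<in> borel_measurable borel" "\<And>x. \<bar>p x\<bar> \<le> norm (h x :: complex)"
  shows "(\<lambda>x. complex_of_real (p x)) \<in> L2"
  by (rule L2_bound[OF assms(1), where C = 1]) (use assms in auto)

text \<open>The transform of a test function is smooth but in general not compactly supported, so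
  integration by parts must be extended to smooth functions that are square integrable together with
  their derivative. Multiplying by \<open>cutoff\<close> at r x with r tending to 0 leaves the
  factor \<open>cutoff 0\<close> in the limit; the derivative of the cutoff carries an additional r
  and disappears.\<close>

lemma weak_deriv_smooth_L2:
  assumes wd: "has_weak_deriv 1 f g" and f: "f \<in> L2" and g: "(g :: real \<Rightarrow> complex) \<in> L2"
    and \<phi>: "smooth \<phi>" and \<phi>L: "(\<lambda>x. complex_of_real (\<phi> x)) \<in> L2" "(\<lambda>x. complex_of_real (deriv \<phi> x)) \<in> L2"
  shows "(LINT x|lborel. of_real (deriv \<phi> x) * f x) = - (LINT x|lborel. of_real (\<phi> x) * g x)"
proof -
  obtain B where B: "\<And>x. \<bar>cutoff x\<bar> \<le> B" using test_function_bounded[OF test_function_cutoff] by metis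
  obtain D where D: "\<And>x. \<bar>deriv cutoff x\<bar> \<le> D"
    using test_function_bounded[OF test_function_deriv[OF test_function_cutoff]] by metis
  have BD0: "0 \<le> B" "0 \<le> D" using order_trans[OF abs_ge_zero B] order_trans[OF abs_ge_zero D] by auto
  have [measurable]: "f \<in> borel_measurable borel" "g \<in> borel_measurable borel"
    "(\<lambda>x. complex_of_real (\<phi> x)) \<in> borel_measurable borel" "(\<lambda>x. complex_of_real (deriv \<phi> x)) \<in> borel_measurable borel"
    "cutoff \<in> borel_measurable borel" "deriv cutoff \<in> borel_measurable borel"
    using f g \<phi>L by (auto simp: L2_iff intro!: test_function_measurable test_function_deriv test_function_cutoff)
  define r where "r = (\<lambda>n. 1 / real (Suc n))"
  have r: "0 < r n" "r n \<le> 1" for n by (auto simp: r_def)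
  have r0: "r \<longlonglongrightarrow> 0" unfolding r_def by (rule LIMSEQ_Suc[OF lim_1_over_n])
  let ?p = "\<lambda>n x. cutoff (r n * x + 0) * \<phi> x"
  let ?u = "\<lambda>n x. complex_of_real (cutoff (r n * x)) * (of_real (\<phi> x) * g x)"
  let ?w = "\<lambda>n x. of_real (deriv cutoff (r n * x) * r n) * (of_real (\<phi> x) * f x) + complex_of_real (cutoff (r n * x)) * (of_real (deriv \<phi> x) * f x)"
  have p: "test_function (?p n)" for n
    using r[of n] by (intro test_function_mult test_function_affine test_function_cutoff \<phi>) auto
  have dp: "deriv (?p n) x = deriv cutoff (r n * x) * r n * \<phi> x + cutoff (r n * x) * deriv \<phi> x" for n x
  proof -
    have "((\<lambda>x. cutoff (r n * x + 0)) has_real_derivative deriv cutoff (r n * x + 0) * r n) (at x)"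
      by (rule DERIV_chain2[OF test_function_DERIV[OF test_function_cutoff]]) (auto intro!: derivative_eq_intros)
    from DERIV_mult[OF this smooth_DERIV[OF \<phi>]] show ?thesis
      by (intro DERIV_imp_deriv) (simp add: algebra_simps)
  qed
  have eq: "(LINT x|lborel. ?w n x) = - (LINT x|lborel. ?u n x)" for n
  proof -
    have "(LINT x|lborel. deriv (?p n) x *\<^sub>R f x) = - (LINT x|lborel. ?p n x *\<^sub>R g x)"
      using wd p[of n] unfolding has_weak_deriv_def by auto
    then show ?thesis unfolding dp by (simp add: scaleR_conv_of_real algebra_simps)
  qed
  have cut: "(\<lambda>n. complex_of_real (cutoff (r n * x))) \<longlonglongrightarrow> of_real (cutoff 0)" for x
  proof -
    have "(\<lambda>n. r n * x) \<longlonglongrightarrow> 0" using tendsto_mult_left_zero[OF r0] .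
    moreover have "isCont cutoff 0" by (rule DERIV_isCont[OF test_function_DERIV[OF test_function_cutoff]])
    ultimately show ?thesis by (intro tendsto_of_real isCont_tendsto_compose[of 0 cutoff])
  qed
  have dcut: "(\<lambda>n. complex_of_real (deriv cutoff (r n * x) * r n)) \<longlonglongrightarrow> of_real 0" for x
  proof -
    have "norm (deriv cutoff (r n * x) * r n) \<le> D * r n" for n
      using mult_right_mono[OF D[of "r n * x"], of "r n"] r(1)[of n] by (simp add: abs_mult)
    then have "\<forall>\<^sub>F n in sequentially. norm (deriv cutoff (r n * x) * r n) \<le> D * r n" by simp
    from tendsto_of_real[OF Lim_null_comparison[OF this tendsto_mult_right_zero[OF r0]]] show ?thesis .
  qed
  have i: "integrable lborel (\<lambda>x. of_real (\<phi> x) * g x)" "integrable lborel (\<lambda>x. of_real (\<phi> x) * f x)"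
    "integrable lborel (\<lambda>x. of_real (deriv \<phi> x) * f x)"
    by (intro L2_mult_integrable f g \<phi>L)+
  have u: "(\<lambda>n. LINT x|lborel. ?u n x) \<longlonglongrightarrow> (LINT x|lborel. of_real (cutoff 0) * (of_real (\<phi> x) * g x))"
  proof (rule integral_dominated_convergence[where w = "\<lambda>x. B * norm (of_real (\<phi> x) * g x)"])
    show "integrable lborel (\<lambda>x. B * norm (of_real (\<phi> x) * g x))" using i by auto
    show "AE x in lborel. (\<lambda>n. ?u n x) \<longlonglongrightarrow> of_real (cutoff 0) * (of_real (\<phi> x) * g x)"
      by (intro AE_I2 tendsto_mult_right cut)
    show "AE x in lborel. norm (?u n x) \<le> B * norm (of_real (\<phi> x) * g x)" for n
      unfolding norm_mult[of "of_real (cutoff _)"] norm_of_real by (intro AE_I2 mult_right_mono B) simp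
  qed measurable
  have w: "(\<lambda>n. LINT x|lborel. ?w n x) \<longlonglongrightarrow> (LINT x|lborel. of_real 0 * (of_real (\<phi> x) * f x) + of_real (cutoff 0) * (of_real (deriv \<phi> x) * f x))"
  proof (rule integral_dominated_convergence[where w = "\<lambda>x. D * norm (of_real (\<phi> x) * f x) + B * norm (of_real (deriv \<phi> x) * f x)"])
    show "integrable lborel (\<lambda>x. D * norm (of_real (\<phi> x) * f x) + B * norm (of_real (deriv \<phi> x) * f x))"
      using i by auto
    show "AE x in lborel. (\<lambda>n. ?w n x) \<longlonglongrightarrow> of_real 0 * (of_real (\<phi> x) * f x) + of_real (cutoff 0) * (of_real (deriv \<phi> x) * f x)"
      by (intro AE_I2 tendsto_add tendsto_mult_right cut dcut)
    show "AE x in lborel. norm (?w n x) \<le> D * norm (of_real (\<phi> x) * f x) + B * norm (of_real (deriv \<phi> x) * f x)" for n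
    proof (intro AE_I2 order_trans[OF norm_triangle_ineq] add_mono)
      fix x
      have "\<bar>deriv cutoff (r n * x) * r n\<bar> \<le> D * 1"
        unfolding abs_mult using D r[of n] BD0 by (intro mult_mono) auto
      then show "norm (of_real (deriv cutoff (r n * x) * r n) * (of_real (\<phi> x) * f x)) \<le> D * norm (of_real (\<phi> x) * f x)"
        unfolding norm_mult[of "of_real (_ * r n)"] norm_of_real by (intro mult_right_mono) auto
      show "norm (complex_of_real (cutoff (r n * x)) * (of_real (deriv \<phi> x) * f x)) \<le> B * norm (of_real (deriv \<phi> x) * f x)"
        unfolding norm_mult[of "of_real (cutoff _)"] norm_of_real by (intro mult_right_mono B) simp
    qed
  qed measurable
  have "(LINT x|lborel. of_real 0 * (of_real (\<phi> x) * f x) + of_real (cutoff 0) * (of_real (deriv \<phi> x) * f x))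
      = - (LINT x|lborel. of_real (cutoff 0) * (of_real (\<phi> x) * g x))"
    by (rule LIMSEQ_unique[OF w[unfolded eq] tendsto_minus[OF u]])
  then have "of_real (cutoff 0) * (LINT x|lborel. of_real (deriv \<phi> x) * f x) = of_real (cutoff 0) * - (LINT x|lborel. of_real (\<phi> x) * g x)"
    by simp
  \<comment> \<open>The value is exp(-2), so the unnormalised factor can be cancelled.\<close>
  moreover have "complex_of_real (cutoff 0) \<noteq> 0" by (simp add: cutoff_def step_def)
  ultimately show ?thesis by (metis mult_left_cancel)
qed

text \<open>Tested with q, the claim becomes integration by parts against \<open>ft q\<close>, whose
  derivative is the transform of - i x q(x). Weak derivatives are tested with real functions, hence
  the splitting of \<open>ft q\<close> into real and imaginary part.\<close>

theorem fourier_pair_weak_deriv: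
  assumes wd: "has_weak_deriv 1 f g" and F: "fourier_pair f F" and G: "fourier_pair g G"
  shows "AE \<xi> in lborel. G \<xi> = \<i> * of_real \<xi> * F \<xi>"
proof (rule AE_eq_if_test_integrals_eq)
  have L: "f \<in> L2" "g \<in> L2" "F \<in> L2" "G \<in> L2" using F G by (auto simp: fourier_pair_def)
  show "locally_integrable G" by (rule L2_locally_integrable[OF L(4)])
  have Fm [measurable]: "F \<in> borel_measurable borel" using L by (simp add: L2_iff)
  show "locally_integrable (\<lambda>\<xi>. \<i> * of_real \<xi> * F \<xi>)"
    unfolding locally_integrable_def
  proof (intro conjI allI)
    fix R :: real
    have "integrable lborel (truncate F R)" by (rule truncate_integrable[OF L(3)])
    then have "integrable lborel (\<lambda>x. \<bar>R\<bar> *\<^sub>R truncate F R x)" by (rule integrable_scaleR_right)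
    then show "set_integrable lborel {- R..R} (\<lambda>\<xi>. \<i> * of_real \<xi> * F \<xi>)"
      unfolding set_integrable_def
      by (rule Bochner_Integration.integrable_bound)
        (auto simp: truncate_def norm_mult indicator_def abs_le_iff intro!: AE_I2 mult_right_mono)
  qed measurable
  fix q :: "real \<Rightarrow> real" assume q: "test_function q"
  let ?q = "\<lambda>x. complex_of_real (q x)" and ?q1 = "\<lambda>x. - \<i> * of_real x * complex_of_real (q x)"
  note [measurable] = test_function_measurable[OF q]
  have "test_function (\<lambda>x. q x * x ^ 1)" by (rule test_function_mult[OF q smooth_power])
  note xq = test_function_L2[OF this]
  have q1: "integrable lborel ?q1"
    using integrable_mult_right[OF xq(2), of "- \<i>"] by (simp add: mult_ac)
  have q1L: "?q1 \<in> L2"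
    by (rule L2_bound[OF xq(1), where C = 1]) (auto simp: norm_mult)
  note q0 = test_function_L2[OF q]
  let ?P = "ft ?q" and ?P1 = "ft ?q1"
  have PL: "?P \<in> L2" "?P1 \<in> L2" by (intro ft_L2 q0 q1 q1L)+
  have [measurable]: "?P \<in> borel_measurable borel" "?P1 \<in> borel_measurable borel" using PL by (auto simp: L2_iff)
  have "(\<lambda>x. complex_of_real (Re (?P x))) \<in> L2" "(\<lambda>x. complex_of_real (Im (?P x))) \<in> L2"
    "(\<lambda>x. complex_of_real (Re (?P1 x))) \<in> L2" "(\<lambda>x. complex_of_real (Im (?P1 x))) \<in> L2"
    by (rule L2_of_real_bound[OF PL(1)] L2_of_real_bound[OF PL(2)]; simp add: abs_Re_le_cmod abs_Im_le_cmod)+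
  note RI = this
  have re: "(LINT x|lborel. of_real (Re (?P1 x)) * f x) = - (LINT x|lborel. of_real (Re (?P x)) * g x)"
    using weak_deriv_smooth_L2[OF wd L(1,2) ft_test_smooth(1)[OF q]] RI unfolding ft_test_smooth(3)[OF q] by simp
  have im: "(LINT x|lborel. of_real (Im (?P1 x)) * f x) = - (LINT x|lborel. of_real (Im (?P x)) * g x)"
    using weak_deriv_smooth_L2[OF wd L(1,2) ft_test_smooth(2)[OF q]] RI unfolding ft_test_smooth(4)[OF q] by simp
  have split: "(LINT x|lborel. h x * H x) = (LINT x|lborel. of_real (Re (H x)) * h x) + \<i> * (LINT x|lborel. of_real (Im (H x)) * h x)"
    if "h \<in> L2" "(\<lambda>x. complex_of_real (Re (H x))) \<in> L2" "(\<lambda>x. complex_of_real (Im (H x))) \<in> L2" for h H :: "real \<Rightarrow> complex"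
  proof -
    have "(LINT x|lborel. h x * H x) = (LINT x|lborel. of_real (Re (H x)) * h x + \<i> * (of_real (Im (H x)) * h x))"
      by (intro Bochner_Integration.integral_cong refl) (subst complex_eq[of "H _"], simp add: algebra_simps)
    also have "\<dots> = (LINT x|lborel. of_real (Re (H x)) * h x) + \<i> * (LINT x|lborel. of_real (Im (H x)) * h x)"
      using that by (subst Bochner_Integration.integral_add) (simp_all add: L2_mult_integrable)
    finally show ?thesis .
  qed
  have "(LINT \<xi>|lborel. G \<xi> * ?q \<xi>) = (LINT x|lborel. g x * ?P x)"
    by (rule fourier_pairD[OF G q0(2,1)])
  also have "\<dots> = - (LINT x|lborel. f x * ?P1 x)"
    unfolding split[OF L(2) RI(1,2)] split[OF L(1) RI(3,4)] re im by simp
  also have "(LINT x|lborel. f x * ?P1 x) = (LINT \<xi>|lborel. F \<xi> * ?q1 \<xi>)"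
    by (rule fourier_pairD[OF F q1 q1L, symmetric])
  also have "- \<dots> = (LINT \<xi>|lborel. - (F \<xi> * ?q1 \<xi>))" by simp
  also have "\<dots> = (LINT \<xi>|lborel. \<i> * of_real \<xi> * F \<xi> * ?q \<xi>)"
    by (intro Bochner_Integration.integral_cong refl) simp
  finally show "(LINT \<xi>|lborel. G \<xi> * ?q \<xi>) = (LINT \<xi>|lborel. \<i> * of_real \<xi> * F \<xi> * ?q \<xi>)" .
qed

lemma fourier_pair_unique:
  assumes "fourier_pair f F" "fourier_pair f G"
  shows "AE \<xi> in lborel. F \<xi> = G \<xi>"
proof (rule AE_eq_if_test_integrals_eq)
  show "locally_integrable F" "locally_integrable G"
    using assms by (auto simp: fourier_pair_def intro: L2_locally_integrable)
  show "(LINT \<xi>|lborel. F \<xi> * of_real (p \<xi>)) = (LINT \<xi>|lborel. G \<xi> * of_real (p \<xi>))" if "test_function p" for p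
    using fourier_pairD[OF assms(1)] fourier_pairD[OF assms(2)] test_function_L2[OF that] by simp
qed

text \<open>The inequality is known for the transform constructed from truncations; uniqueness
  extends it to every pair.\<close>

lemma fourier_pair_bessel:
  assumes F: "fourier_pair f F"
  shows "(\<integral>\<^sup>+\<xi>. ennreal ((norm (F \<xi>))\<^sup>2) \<partial>lborel) \<le> ennreal (2 * pi) * (\<integral>\<^sup>+x. ennreal ((norm (f x))\<^sup>2) \<partial>lborel)"
proof -
  have "f \<in> L2" using F by (simp add: fourier_pair_def)
  then obtain G where G: "fourier_pair f G"
    and le: "(\<integral>\<^sup>+\<xi>. ennreal ((norm (G \<xi>))\<^sup>2) \<partial>lborel) \<le> ennreal (2 * pi) * (\<integral>\<^sup>+x. ennreal ((norm (f x))\<^sup>2) \<partial>lborel)"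
    using fourier_pair_exists by blast
  have "AE \<xi> in lborel. F \<xi> = G \<xi>" by (rule fourier_pair_unique[OF F G])
  then have "AE \<xi> in lborel. ennreal ((norm (F \<xi>))\<^sup>2) = ennreal ((norm (G \<xi>))\<^sup>2)"
    by eventually_elim simp
  from nn_integral_cong_AE[OF this] le show ?thesis by simp
qed

text \<open>The derivative of a test function is a test function, so the identity of order k may be
  applied to \<open>deriv p\<close> and compared with the one of order k + 1.\<close>

lemma has_weak_deriv_Suc:
  fixes f :: "real \<Rightarrow> 'a::euclidean_space"
  assumes g: "has_weak_deriv k f g" and h: "has_weak_deriv (Suc k) f h"
  shows "has_weak_deriv 1 g h"
  unfolding has_weak_deriv_def
proof (intro conjI allI impI)
  show "locally_integrable g" "locally_integrable h" using g h by (auto simp: has_weak_deriv_def)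
  fix p assume p: "test_function p"
  have "(-1) ^ k *\<^sub>R (LINT x|lborel. deriv p x *\<^sub>R g x) = (LINT x|lborel. (deriv ^^ k) (deriv p) x *\<^sub>R f x)"
    using g test_function_deriv[OF p] by (simp add: has_weak_deriv_def)
  also have "(deriv ^^ k) (deriv p) = (deriv ^^ Suc k) p" by (simp add: funpow_swap1)
  also have "(LINT x|lborel. (deriv ^^ Suc k) p x *\<^sub>R f x) = (-1) ^ Suc k *\<^sub>R (LINT x|lborel. p x *\<^sub>R h x)"
    using h p unfolding has_weak_deriv_def by blast
  finally have "(-1) ^ k *\<^sub>R (LINT x|lborel. deriv p x *\<^sub>R g x) = (-1) ^ k *\<^sub>R ((-1) *\<^sub>R (LINT x|lborel. p x *\<^sub>R h x))"
    by simp
  then have "(LINT x|lborel. deriv p x *\<^sub>R g x) = (-1) *\<^sub>R (LINT x|lborel. p x *\<^sub>R h x)"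
    unfolding scaleR_cancel_left by simp
  then show "(LINT x|lborel. (deriv ^^ 1) p x *\<^sub>R g x) = (- 1) ^ 1 *\<^sub>R (LINT x|lborel. p x *\<^sub>R h x)"
    by simp
qed

text \<open>Each step transforms one further weak derivative and multiplies by i \<xi>. The
  hypothesis asks for all intermediate derivatives in L2, as the Sobolev space provides
  them.\<close>

lemma fourier_pair_weak_deriv_iterated:
  assumes F: "fourier_pair f F" and wd: "\<And>k. k \<le> n \<Longrightarrow> \<exists>g\<in>L2. has_weak_deriv k f g"
  shows "k \<le> n \<Longrightarrow> \<exists>g G. has_weak_deriv k f g \<and> fourier_pair g G \<and> (AE \<xi> in lborel. G \<xi> = (\<i> * of_real \<xi>) ^ k * F \<xi>)"
proof (induction k)
  case 0
  have "f \<in> L2" using F by (simp add: fourier_pair_def)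
  then have "has_weak_deriv 0 f f" by (simp add: has_weak_deriv_def L2_locally_integrable)
  with F show ?case by auto
next
  case (Suc k)
  then obtain g G where g: "has_weak_deriv k f g" "fourier_pair g G" and G: "AE \<xi> in lborel. G \<xi> = (\<i> * of_real \<xi>) ^ k * F \<xi>"
    by auto
  obtain h where h: "h \<in> L2" "has_weak_deriv (Suc k) f h" using wd[OF Suc.prems] by blast
  obtain H where H: "fourier_pair h H" using fourier_pair_exists[OF h(1)] by blast
  have "AE \<xi> in lborel. H \<xi> = (\<i> * of_real \<xi>) ^ Suc k * F \<xi>"
    using fourier_pair_weak_deriv[OF has_weak_deriv_Suc[OF g(1) h(2)] g(2) H] G by eventually_elim simp
  with h H show ?case by blast
qed

lemma fourier_pair_weighted_bessel:
  assumes F: "fourier_pair f F" and wd: "\<And>k. k \<le> n \<Longrightarrow> \<exists>g\<in>L2. has_weak_deriv k f g" and g: "has_weak_deriv n f g"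
  shows "(\<integral>\<^sup>+\<xi>. ennreal (\<xi> ^ (2 * n) * (norm (F \<xi>))\<^sup>2) \<partial>lborel) \<le> ennreal (2 * pi) * (\<integral>\<^sup>+x. ennreal ((norm (g x))\<^sup>2) \<partial>lborel)"
proof -
  obtain h H where h: "has_weak_deriv n f h" "fourier_pair h H" and H: "AE \<xi> in lborel. H \<xi> = (\<i> * of_real \<xi>) ^ n * F \<xi>"
    using fourier_pair_weak_deriv_iterated[OF F wd order_refl] by blast
  have "AE \<xi> in lborel. ennreal (\<xi> ^ (2 * n) * (norm (F \<xi>))\<^sup>2) = ennreal ((norm (H \<xi>))\<^sup>2)"
    using H
  proof eventually_elim
    case (elim \<xi>)
    have "(norm (H \<xi>))\<^sup>2 = (\<bar>\<xi>\<bar> ^ n)\<^sup>2 * (norm (F \<xi>))\<^sup>2" unfolding elim by (simp add: norm_mult norm_power power_mult_distrib)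
    also have "(\<bar>\<xi>\<bar> ^ n)\<^sup>2 = \<xi> ^ (2 * n)" by (simp add: power_mult[symmetric] power_even_abs mult.commute)
    finally show ?case by simp
  qed
  then have "(\<integral>\<^sup>+\<xi>. ennreal (\<xi> ^ (2 * n) * (norm (F \<xi>))\<^sup>2) \<partial>lborel) = (\<integral>\<^sup>+\<xi>. ennreal ((norm (H \<xi>))\<^sup>2) \<partial>lborel)"
    by (rule nn_integral_cong_AE)
  also have "\<dots> \<le> ennreal (2 * pi) * (\<integral>\<^sup>+x. ennreal ((norm (h x))\<^sup>2) \<partial>lborel)"
    by (rule fourier_pair_bessel[OF h(2)])
  also have "(\<integral>\<^sup>+x. ennreal ((norm (h x))\<^sup>2) \<partial>lborel) = (\<integral>\<^sup>+x. ennreal ((norm (g x))\<^sup>2) \<partial>lborel)"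
  proof (rule nn_integral_cong_AE)
    show "AE x in lborel. ennreal ((norm (h x))\<^sup>2) = ennreal ((norm (g x))\<^sup>2)"
      using has_weak_deriv_unique[OF h(1) g] by eventually_elim simp
  qed
  finally show ?thesis .
qed

section \<open>Transforms of test functions and reconstruction of weak derivatives\<close>

lemma integral_deriv_compact_support:
  fixes h :: "real \<Rightarrow> complex"
  assumes D: "\<And>x. (h has_vector_derivative h' x) (at x)" and cont: "continuous_on UNIV h'"
    and supp: "\<And>x. R \<le> \<bar>x\<bar> \<Longrightarrow> h x = 0" and supp': "\<And>x. R < \<bar>x\<bar> \<Longrightarrow> h' x = 0" and R: "0 \<le> R"
  shows "(LINT x|lborel. h' x) = 0"
proof -
  have "(LINT x|lborel. indicator {- R..R} x *\<^sub>R h' x) = h R - h (- R)"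
    using R by (intro integral_FTC_Icc has_vector_derivative_at_within[OF D] continuous_on_subset[OF cont]) auto
  also have "(\<lambda>x. indicator {- R..R} x *\<^sub>R h' x) = h'" using supp' by (auto simp: fun_eq_iff indicator_def abs_if)
  finally show ?thesis using supp[of R] supp[of "- R"] R by simp
qed

lemma test_function_iterate: "test_function p \<Longrightarrow> test_function ((deriv ^^ k) p)"
  by (induction k) (auto simp: test_function_deriv)

lemma ft_deriv_test_function:
  assumes p: "test_function p"
  shows "ft (\<lambda>x. of_real (deriv p x)) \<xi> = \<i> * of_real \<xi> * ft (\<lambda>x. of_real (p x)) \<xi>"
proof -
  have dp: "test_function (deriv p)" by (rule test_function_deriv[OF p])
  obtain R1 B1 where R1: "\<And>x. R1 < \<bar>x\<bar> \<Longrightarrow> p x = 0" "0 < R1" using test_function_bounded[OF p] by metis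
  obtain R2 B2 where R2: "\<And>x. R2 < \<bar>x\<bar> \<Longrightarrow> deriv p x = 0" using test_function_bounded[OF dp] by metis
  let ?h' = "\<lambda>x. cis (- (x * \<xi>)) * of_real (deriv p x) - \<i> * of_real \<xi> * (cis (- (x * \<xi>)) * of_real (p x))"
  have "(LINT x|lborel. ?h' x) = 0"
  \<comment> \<open>The added 1 matters at the end points: \<open>p\<close> is only known to vanish
    strictly beyond \<open>R1\<close>, while the boundary values must be 0.\<close>
  proof (rule integral_deriv_compact_support[where h = "\<lambda>x. cis (- (x * \<xi>)) * of_real (p x)" and R = "max R1 R2 + 1"])
    fix x
    have "((\<lambda>z. exp (- \<i> * of_real \<xi> * z)) has_field_derivative (- \<i> * of_real \<xi>) * exp (- \<i> * of_real \<xi> * of_real x)) (at (of_real x))"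
      by (auto intro!: derivative_eq_intros)
    from has_vector_derivative_real_field[OF this]
    have c: "((\<lambda>x. cis (- (x * \<xi>))) has_vector_derivative - \<i> * of_real \<xi> * cis (- (x * \<xi>))) (at x)"
      by (simp add: cis_conv_exp mult_ac)
    have "((\<lambda>x. complex_of_real (p x)) has_vector_derivative of_real (deriv p x)) (at x)"
      by (intro has_vector_derivative_of_real) (use test_function_DERIV[OF p] in \<open>simp add: has_real_derivative_iff_has_vector_derivative\<close>)
    from has_vector_derivative_mult[OF c this]
    show "((\<lambda>x. cis (- (x * \<xi>)) * of_real (p x)) has_vector_derivative ?h' x) (at x)"
      by (simp add: algebra_simps)
  next
    show "continuous_on UNIV ?h'"
      unfolding cis_conv_exp by (intro continuous_intros test_function_continuous p dp)
    show "cis (- (x * \<xi>)) * of_real (p x) = 0" if "max R1 R2 + 1 \<le> \<bar>x\<bar>" for x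
      using R1(1)[of x] that by simp
    show "?h' x = 0" if "max R1 R2 + 1 < \<bar>x\<bar>" for x
      using R1(1)[of x] R2[of x] that by simp
    show "0 \<le> max R1 R2 + 1" using R1(2) by simp
  qed
  moreover have "(LINT x|lborel. ?h' x) = ft (\<lambda>x. of_real (deriv p x)) \<xi> - \<i> * of_real \<xi> * ft (\<lambda>x. of_real (p x)) \<xi>"
    unfolding ft_def
    by (subst Bochner_Integration.integral_diff) (auto intro!: integrable_mult_right ft_integrable test_function_L2 p dp)
  ultimately show ?thesis by simp
qed

lemma ft_iterated_deriv_test_function:
  assumes p: "test_function p"
  shows "ft (\<lambda>x. of_real ((deriv ^^ k) p x)) \<xi> = (\<i> * of_real \<xi>) ^ k * ft (\<lambda>x. of_real (p x)) \<xi>"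
  by (induction k) (simp_all add: ft_deriv_test_function[OF test_function_iterate[OF p]])

text \<open>Two derivatives suffice: the transform and \<xi>^2 times the transform are both bounded,
  so a multiple of 1/(1 + \<xi>^2) is a majorant.\<close>

lemma ft_test_function_integrable:
  assumes p: "test_function p"
  shows "integrable lborel (ft (\<lambda>x. of_real (p x)))"
proof -
  let ?P = "\<lambda>x. complex_of_real (p x)" and ?P2 = "\<lambda>x. complex_of_real ((deriv ^^ 2) p x)"
  note [measurable] = test_function_measurable[OF p]
  have i: "integrable lborel ?P" "integrable lborel ?P2"
    by (intro test_function_L2 test_function_iterate p)+
  define C where "C = (LINT x|lborel. norm (?P x)) + (LINT x|lborel. norm (?P2 x))"
  have "integrable lborel (\<lambda>\<xi>::real. C * inverse (1 + \<xi>\<^sup>2))"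
    using integrable_inverse_1_plus_square by (intro integrable_mult_right) (simp add: set_integrable_def)
  then show ?thesis
  proof (rule Bochner_Integration.integrable_bound)
    show "AE \<xi> in lborel. norm (ft ?P \<xi>) \<le> norm (C * inverse (1 + \<xi>\<^sup>2))"
    proof (rule AE_I2)
      fix \<xi>
      have "norm (ft ?P2 \<xi>) = \<xi>\<^sup>2 * norm (ft ?P \<xi>)"
        unfolding ft_iterated_deriv_test_function[OF p] by (simp add: norm_mult norm_power)
      then have "(1 + \<xi>\<^sup>2) * norm (ft ?P \<xi>) \<le> C"
        using norm_ft_le[OF i(1), of \<xi>] norm_ft_le[OF i(2), of \<xi>] unfolding C_def by (simp add: algebra_simps)
      moreover have pos: "0 < 1 + \<xi>\<^sup>2" by (rule add_pos_nonneg) auto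
      ultimately have "norm (ft ?P \<xi>) \<le> C * inverse (1 + \<xi>\<^sup>2)" by (simp add: field_simps)
      then show "norm (ft ?P \<xi>) \<le> norm (C * inverse (1 + \<xi>\<^sup>2))" by simp
    qed
  qed measurable
qed

lemma integral_reflect: "(LINT x|lborel. h (- x)) = (LINT x|lborel. h x)" for h :: "real \<Rightarrow> complex"
  by (subst lborel_integral_real_affine[where c = "-1" and t = 0 and f = h]) simp_all

lemma nn_integral_reflect: "h \<in> borel_measurable borel \<Longrightarrow> (\<integral>\<^sup>+x. h (- x) \<partial>lborel) = (\<integral>\<^sup>+x. h x \<partial>lborel)" for h :: "real \<Rightarrow> ennreal"
  by (subst nn_integral_real_affine[where c = "-1" and t = 0 and f = h]) simp_all

lemma L2_reflect: "h \<in> L2 \<Longrightarrow> (\<lambda>x. h (- x)) \<in> L2" for h :: "real \<Rightarrow> complex"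
  unfolding L2_def using integrable_reflect[of "\<lambda>x. (norm (h x))\<^sup>2"] by auto

text \<open>Every test function is thus the transform of some function in L1 and L2. This is what
  allows the multiplication formula, which speaks of \<open>ft q\<close>, to be evaluated at an
  arbitrary test function.\<close>

lemma test_function_ft_inverse:
  assumes p: "test_function p"
  defines "q \<equiv> (\<lambda>\<xi>. ft (\<lambda>x. of_real (p x)) (- \<xi>) / of_real (2 * pi))"
  shows "integrable lborel q" "q \<in> L2" "ft q x = of_real (p x)"
proof -
  let ?P = "\<lambda>x. complex_of_real (p x)"
  note i = ft_test_function_integrable[OF p]
  show "integrable lborel q"
    unfolding q_def by (intro integrable_divide integrable_reflect i)
  have "ft ?P \<in> L2" by (intro ft_L2 test_function_L2 p)
  from L2_scaleR[OF L2_reflect[OF this], of "1 / (2 * pi)"]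
  show "q \<in> L2" by (simp add: q_def scaleR_conv_of_real)
  obtain R B where B: "\<And>x. \<bar>p x\<bar> \<le> B" using test_function_bounded[OF p] by metis
  have "ft q x = (LINT \<xi>|lborel. cis (- (\<xi> * x)) * q \<xi>)" by (rule ft_def)
  also have "\<dots> = (LINT \<xi>|lborel. cis (x * - \<xi>) * ft ?P (- \<xi>) / of_real (2 * pi))"
    unfolding q_def by (intro Bochner_Integration.integral_cong refl) (simp add: mult.commute)
  also have "\<dots> = (LINT \<xi>|lborel. cis (x * \<xi>) * ft ?P \<xi> / of_real (2 * pi))"
    by (rule integral_reflect)
  also have "\<dots> = (LINT \<xi>|lborel. cis (x * \<xi>) * ft ?P \<xi>) / of_real (2 * pi)" by (rule integral_divide_zero)
  also have "(LINT \<xi>|lborel. cis (x * \<xi>) * ft ?P \<xi>) = complex_of_real (2 * pi) * of_real (p x)"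
    by (rule ft_inversion[OF test_function_L2(2)[OF p] i, where B = B])
      (auto intro!: continuous_intros test_function_continuous p B)
  finally show "ft q x = of_real (p x)" by simp
qed

text \<open>The candidate is the inverse transform of (i \<xi>)^k F, written as the reflected
  forward transform divided by 2 pi. For the verification the k-th derivative of the test function
  is represented as a transform, so that its k factors i \<xi> can be moved to \<open>F\<close>; the
  reflection produces the sign (-1)^k.\<close>

theorem weak_deriv_of_fourier_pair:
  assumes F: "fourier_pair f F" and H: "(\<lambda>\<xi>. (\<i> * of_real \<xi>) ^ k * F \<xi>) \<in> L2"
  obtains g where "g \<in> L2" "has_weak_deriv k f g"
    "(\<integral>\<^sup>+x. ennreal ((norm (g x))\<^sup>2) \<partial>lborel) \<le> (\<integral>\<^sup>+\<xi>. ennreal (\<xi> ^ (2 * k) * (norm (F \<xi>))\<^sup>2) \<partial>lborel)"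
proof -
  define H where "H = (\<lambda>\<xi>. (\<i> * of_real \<xi>) ^ k * F \<xi>)"
  have HL: "H \<in> L2" using assms(2) by (simp add: H_def)
  obtain G where G: "fourier_pair H G"
    and le: "(\<integral>\<^sup>+\<xi>. ennreal ((norm (G \<xi>))\<^sup>2) \<partial>lborel) \<le> ennreal (2 * pi) * (\<integral>\<^sup>+x. ennreal ((norm (H x))\<^sup>2) \<partial>lborel)"
    using fourier_pair_exists[OF HL] by blast
  have GL: "G \<in> L2" and fL: "f \<in> L2" using G F by (auto simp: fourier_pair_def)
  have [measurable]: "G \<in> borel_measurable borel" using GL by (simp add: L2_iff)
  define g where "g = (\<lambda>x. (1 / (2 * pi)) *\<^sub>R G (- x))"
  have gL: "g \<in> L2" unfolding g_def by (intro L2_scaleR L2_reflect GL)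
  have "has_weak_deriv k f g"
    unfolding has_weak_deriv_def
  proof (intro conjI allI impI)
    show "locally_integrable f" "locally_integrable g" by (intro L2_locally_integrable fL gL)+
    fix p assume p: "test_function p"
    let ?P = "\<lambda>x. complex_of_real (p x)" and ?Pk = "\<lambda>x. complex_of_real ((deriv ^^ k) p x)"
    note q = test_function_ft_inverse[OF test_function_iterate[OF p, of k]]
    have Q: "test_function (\<lambda>x. p (- 1 * x + 0))" by (rule test_function_affine[OF p]) simp
    have "(LINT x|lborel. (deriv ^^ k) p x *\<^sub>R f x) = (LINT x|lborel. f x * ft (\<lambda>\<xi>. ft ?Pk (- \<xi>) / of_real (2 * pi)) x)"
      unfolding q(3) by (simp add: scaleR_conv_of_real mult.commute)
    also have "\<dots> = (LINT \<xi>|lborel. F \<xi> * (ft ?Pk (- \<xi>) / of_real (2 * pi)))"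
      by (rule fourier_pairD[OF F q(1,2), symmetric])
    also have "\<dots> = (LINT \<xi>|lborel. ((-1) ^ k / of_real (2 * pi)) * (H \<xi> * ft (\<lambda>x. of_real (p (- x))) \<xi>))"
    proof (intro Bochner_Integration.integral_cong refl)
      fix \<xi>
      have "ft (\<lambda>x. complex_of_real (p (- x))) \<xi> = ft ?P (- \<xi>)"
        unfolding ft_def using integral_reflect[of "\<lambda>x. cis (- (x * - \<xi>)) * ?P x"] by simp
      moreover have "(\<i> * of_real (- \<xi>)) ^ k = (-1) ^ k * (\<i> * of_real \<xi>) ^ k"
        unfolding power_mult_distrib[symmetric] by simp
      ultimately show "F \<xi> * (ft ?Pk (- \<xi>) / of_real (2 * pi)) = ((-1) ^ k / of_real (2 * pi)) * (H \<xi> * ft (\<lambda>x. of_real (p (- x))) \<xi>)"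
        unfolding ft_iterated_deriv_test_function[OF p] H_def by simp
    qed
    also have "\<dots> = ((-1) ^ k / of_real (2 * pi)) * (LINT \<xi>|lborel. H \<xi> * ft (\<lambda>x. of_real (p (- x))) \<xi>)" by simp
    also have "(LINT \<xi>|lborel. H \<xi> * ft (\<lambda>x. of_real (p (- x))) \<xi>) = (LINT x|lborel. G x * of_real (p (- x)))"
      using fourier_pairD[OF G test_function_L2(2,1)[OF Q]] by simp
    also have "\<dots> = (LINT x|lborel. G (- x) * of_real (p x))"
      using integral_reflect[of "\<lambda>x. G (- x) * of_real (p x)"] by simp
    also have "((-1) ^ k / of_real (2 * pi)) * \<dots> = (-1) ^ k *\<^sub>R (LINT x|lborel. p x *\<^sub>R g x)"
      unfolding g_def by (simp add: scaleR_conv_of_real mult_ac flip: Bochner_Integration.integral_mult_right_zero)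
    finally show "(LINT x|lborel. (deriv ^^ k) p x *\<^sub>R f x) = (-1) ^ k *\<^sub>R (LINT x|lborel. p x *\<^sub>R g x)" .
  qed
  moreover have "(\<integral>\<^sup>+x. ennreal ((norm (g x))\<^sup>2) \<partial>lborel) \<le> (\<integral>\<^sup>+\<xi>. ennreal (\<xi> ^ (2 * k) * (norm (F \<xi>))\<^sup>2) \<partial>lborel)"
  proof -
    have "(\<integral>\<^sup>+x. ennreal ((norm (g x))\<^sup>2) \<partial>lborel) = (\<integral>\<^sup>+x. ennreal ((1 / (2 * pi))\<^sup>2) * ennreal ((norm (G (- x)))\<^sup>2) \<partial>lborel)"
      by (simp add: g_def power_mult_distrib power_divide flip: ennreal_mult)
    also have "\<dots> = ennreal ((1 / (2 * pi))\<^sup>2) * (\<integral>\<^sup>+x. ennreal ((norm (G (- x)))\<^sup>2) \<partial>lborel)"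
      by (rule nn_integral_cmult) measurable
    also have "(\<integral>\<^sup>+x. ennreal ((norm (G (- x)))\<^sup>2) \<partial>lborel) = (\<integral>\<^sup>+x. ennreal ((norm (G x))\<^sup>2) \<partial>lborel)"
      by (rule nn_integral_reflect) measurable
    also have "ennreal ((1 / (2 * pi))\<^sup>2) * \<dots> \<le> ennreal ((1 / (2 * pi))\<^sup>2) * (ennreal (2 * pi) * (\<integral>\<^sup>+x. ennreal ((norm (H x))\<^sup>2) \<partial>lborel))"
      by (intro mult_left_mono le) simp
    also have "\<dots> = ennreal ((1 / (2 * pi))\<^sup>2 * (2 * pi)) * (\<integral>\<^sup>+x. ennreal ((norm (H x))\<^sup>2) \<partial>lborel)"
      by (simp add: ennreal_mult mult.assoc)
    \<comment> \<open>The constants multiply to 1/(2 pi), which is estimated by 1: the decay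
      statement tolerates any constant.\<close>
    also have "\<dots> \<le> 1 * (\<integral>\<^sup>+x. ennreal ((norm (H x))\<^sup>2) \<partial>lborel)"
    proof (rule mult_right_mono)
      have "(1 / (2 * pi))\<^sup>2 * (2 * pi) = 1 / (2 * pi)" by (simp add: power2_eq_square)
      also have "\<dots> \<le> 1" using pi_gt3 by simp
      finally show "ennreal ((1 / (2 * pi))\<^sup>2 * (2 * pi)) \<le> 1" by simp
    qed simp
    also have "\<dots> = (\<integral>\<^sup>+\<xi>. ennreal (\<xi> ^ (2 * k) * (norm (F \<xi>))\<^sup>2) \<partial>lborel)"
    proof -
      have "(norm (H \<xi>))\<^sup>2 = \<xi> ^ (2 * k) * (norm (F \<xi>))\<^sup>2" for \<xi>
      proof -
        have "(norm (H \<xi>))\<^sup>2 = (\<bar>\<xi>\<bar> ^ k)\<^sup>2 * (norm (F \<xi>))\<^sup>2" unfolding H_def by (simp add: norm_mult norm_power power_mult_distrib)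
        also have "(\<bar>\<xi>\<bar> ^ k)\<^sup>2 = \<xi> ^ (2 * k)" by (simp add: power_mult[symmetric] power_even_abs mult.commute)
        finally show ?thesis .
      qed
      then show ?thesis by simp
    qed
    finally show ?thesis .
  qed
  ultimately show thesis using gL that by blast
qed

section \<open>Vector-valued functions\<close>

lemma norm_square_vec: "(norm x)\<^sup>2 = (\<Sum>i\<in>UNIV. (norm (x $ i))\<^sup>2)" for x :: "complex^'n"
  by (simp add: norm_vec_def L2_set_def sum_nonneg)

lemma vec_nth_measurable: "f \<in> borel_measurable borel \<Longrightarrow> (\<lambda>x. f x $ i) \<in> borel_measurable borel"
  for f :: "real \<Rightarrow> complex^'n"
  by (rule borel_measurable_continuous_on[where f = "\<lambda>v. v $ i"]) (intro continuous_intros)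

lemma vec_lambda_measurable:
  fixes g :: "'n::finite \<Rightarrow> real \<Rightarrow> complex"
  assumes [measurable]: "\<And>i. g i \<in> borel_measurable borel"
  shows "(\<lambda>x. \<chi> i. g i x) \<in> borel_measurable borel"
proof (subst borel_measurable_euclidean_space, rule ballI)
  fix b :: "complex^'n" assume "b \<in> Basis"
  show "(\<lambda>x. (\<chi> i. g i x) \<bullet> b) \<in> borel_measurable borel"
    unfolding inner_vec_def vec_lambda_beta by measurable
qed

text \<open>The weight is carried along because the reduction to components serves both plain L2
  norms and integrals with powers of \<xi>.\<close>

lemma nn_integral_norm_square_vec:
  fixes f :: "real \<Rightarrow> complex^'n"
  assumes "f \<in> borel_measurable borel" "w \<in> borel_measurable borel" "\<And>x. 0 \<le> w x"
  shows "(\<integral>\<^sup>+x. ennreal (w x * (norm (f x))\<^sup>2) \<partial>lborel) = (\<Sum>i\<in>UNIV. \<integral>\<^sup>+x. ennreal (w x * (norm (f x $ i))\<^sup>2) \<partial>lborel)"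
proof -
  note [measurable] = vec_nth_measurable[OF assms(1)] assms(2)
  have "(\<integral>\<^sup>+x. ennreal (w x * (norm (f x))\<^sup>2) \<partial>lborel) = (\<integral>\<^sup>+x. (\<Sum>i\<in>UNIV. ennreal (w x * (norm (f x $ i))\<^sup>2)) \<partial>lborel)"
    unfolding norm_square_vec sum_distrib_left using assms(3) by (simp add: sum_ennreal)
  also have "\<dots> = (\<Sum>i\<in>UNIV. \<integral>\<^sup>+x. ennreal (w x * (norm (f x $ i))\<^sup>2) \<partial>lborel)"
    by (rule nn_integral_sum) measurable
  finally show ?thesis .
qed

lemma L2_nth: "f \<in> L2 \<Longrightarrow> (\<lambda>x. f x $ i) \<in> L2" for f :: "real \<Rightarrow> complex^'n"
  by (rule L2_bound[where f = f and C = 1]) (auto simp: L2_iff Finite_Cartesian_Product.norm_nth_le intro: vec_nth_measurable)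

lemma L2_vec_lambda:
  fixes g :: "'n::finite \<Rightarrow> real \<Rightarrow> complex"
  assumes g: "\<And>i. g i \<in> L2"
  shows "(\<lambda>x. \<chi> i. g i x) \<in> L2"
proof -
  have m: "(\<lambda>x. \<chi> i. g i x) \<in> borel_measurable borel" using g by (intro vec_lambda_measurable) (simp add: L2_iff)
  show ?thesis
    using m g nn_integral_norm_square_vec[OF m, of "\<lambda>_. 1"] by (simp add: L2_iff)
qed

lemma integral_nth: "integrable lborel f \<Longrightarrow> (LINT x|lborel. f x) $ i = (LINT x|lborel. f x $ i)"
  for f :: "real \<Rightarrow> complex^'n"
  by (rule integral_bounded_linear[OF bounded_linear_vec_nth, symmetric])

lemma has_weak_deriv_nth:
  fixes f :: "real \<Rightarrow> complex^'n"
  assumes wd: "has_weak_deriv k f g" and f: "f \<in> L2" and g: "g \<in> L2"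
  shows "has_weak_deriv k (\<lambda>x. f x $ i) (\<lambda>x. g x $ i)"
  unfolding has_weak_deriv_def
proof (intro conjI allI impI)
  show "locally_integrable (\<lambda>x. f x $ i)" "locally_integrable (\<lambda>x. g x $ i)"
    by (intro L2_locally_integrable L2_nth f g)+
  fix p assume p: "test_function p"
  have "(LINT x|lborel. (deriv ^^ k) p x *\<^sub>R f x) $ i = ((-1) ^ k *\<^sub>R (LINT x|lborel. p x *\<^sub>R g x)) $ i"
    using wd p by (simp add: has_weak_deriv_def)
  moreover have "integrable lborel (\<lambda>x. (deriv ^^ k) p x *\<^sub>R f x)" "integrable lborel (\<lambda>x. p x *\<^sub>R g x)"
    by (intro test_function_times_locally_integrable test_function_iterate p L2_locally_integrable f g)+
  ultimately show "(LINT x|lborel. (deriv ^^ k) p x *\<^sub>R f x $ i) = (-1) ^ k *\<^sub>R (LINT x|lborel. p x *\<^sub>R g x $ i)"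
    by (simp add: integral_nth)
qed

lemma has_weak_deriv_vec_lambda:
  fixes f :: "real \<Rightarrow> complex^'n"
  assumes wd: "\<And>i. has_weak_deriv k (\<lambda>x. f x $ i) (g i)" and f: "f \<in> L2" and g: "\<And>i. g i \<in> L2"
  shows "has_weak_deriv k f (\<lambda>x. \<chi> i. g i x)"
  unfolding has_weak_deriv_def
proof (intro conjI allI impI)
  show lf: "locally_integrable f" and lg: "locally_integrable (\<lambda>x. \<chi> i. g i x)"
    by (intro L2_locally_integrable L2_vec_lambda f g)+
  fix p assume p: "test_function p"
  show "(LINT x|lborel. (deriv ^^ k) p x *\<^sub>R f x) = (-1) ^ k *\<^sub>R (LINT x|lborel. p x *\<^sub>R (\<chi> i. g i x))"
    using wd p unfolding vec_eq_iff
    by (simp add: integral_nth test_function_times_locally_integrable test_function_iterate has_weak_deriv_def lf lg)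
qed

text \<open>Component by component, the integrals in \<open>has_fourier\<close> are transforms of
  truncations, and a component is bounded by the full norm; so the approximation criterion for pairs
  applies.\<close>

lemma has_fourier_nth:
  fixes f :: "real \<Rightarrow> complex^'n"
  assumes "has_fourier f F"
  shows "fourier_pair (\<lambda>x. f x $ i) (\<lambda>\<xi>. F \<xi> $ i)"
proof (rule fourier_pair_limit)
  have f: "f \<in> L2" and F: "F \<in> L2" using assms by (auto simp: has_fourier_def)
  show "(\<lambda>x. f x $ i) \<in> L2" "(\<lambda>\<xi>. F \<xi> $ i) \<in> L2" by (intro L2_nth f F)+
  show "at_top \<noteq> (bot :: real filter)" by simp
  show "integrable lborel (truncate (\<lambda>x. f x $ i) R)" "truncate (\<lambda>x. f x $ i) R \<in> L2" for R
    by (intro truncate_integrable truncate_L2 L2_nth f)+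
  show "((\<lambda>R. \<integral>\<^sup>+x. ennreal ((norm (f x $ i - truncate (\<lambda>x. f x $ i) R x))\<^sup>2) \<partial>lborel) \<longlongrightarrow> 0) at_top"
    by (intro truncate_tendsto L2_nth f)
  let ?I = "\<lambda>R \<xi>. LINT x:{-R..R}|lborel. cis (- (x * \<xi>)) *s f x"
  have nth: "ft (truncate (\<lambda>x. f x $ i) R) \<xi> = ?I R \<xi> $ i" for R \<xi>
  proof -
    have [measurable]: "(\<lambda>x. f x $ i) \<in> borel_measurable borel" for i using f by (intro vec_nth_measurable) (simp add: L2_iff)
    have "integrable lborel (\<lambda>x. indicator {-R..R} x *\<^sub>R (cis (- (x * \<xi>)) *s f x))"
    proof (rule Bochner_Integration.integrable_bound[OF truncate_integrable[OF f, of R]])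
      have "(\<lambda>x. \<chi> i. indicator {-R..R} x *\<^sub>R (cis (- (x * \<xi>)) * f x $ i)) \<in> borel_measurable borel"
        by (intro vec_lambda_measurable) measurable
      also have "(\<lambda>x. \<chi> i. indicator {-R..R} x *\<^sub>R (cis (- (x * \<xi>)) * f x $ i)) = (\<lambda>x. indicator {-R..R} x *\<^sub>R (cis (- (x * \<xi>)) *s f x))"
        by (simp add: fun_eq_iff vec_eq_iff)
      finally show "(\<lambda>x. indicator {-R..R} x *\<^sub>R (cis (- (x * \<xi>)) *s f x)) \<in> borel_measurable lborel" by simp
      have "norm (cis a *s v) = norm v" for a and v :: "complex^'n"
        by (simp add: norm_vec_def norm_mult)
      then show "AE x in lborel. norm (indicator {-R..R} x *\<^sub>R (cis (- (x * \<xi>)) *s f x)) \<le> norm (truncate f R x)"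
        by (simp add: truncate_def)
    qed
    from integral_nth[OF this, of i] show ?thesis
      unfolding ft_def set_lebesgue_integral_def truncate_def by (simp add: mult_ac)
  qed
  have "((\<lambda>R. \<integral>\<^sup>+\<xi>. ennreal ((norm (F \<xi> - ?I R \<xi>))\<^sup>2) \<partial>lborel) \<longlongrightarrow> 0) at_top"
    using assms by (simp add: has_fourier_def)
  then show "((\<lambda>R. \<integral>\<^sup>+\<xi>. ennreal ((norm (F \<xi> $ i - ft (truncate (\<lambda>x. f x $ i) R) \<xi>))\<^sup>2) \<partial>lborel) \<longlongrightarrow> 0) at_top"
  proof (rule tendsto_sandwich[OF _ _ tendsto_const, rotated 2])
    show "\<forall>\<^sub>F R in at_top. (\<integral>\<^sup>+\<xi>. ennreal ((norm (F \<xi> $ i - ft (truncate (\<lambda>x. f x $ i) R) \<xi>))\<^sup>2) \<partial>lborel)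
        \<le> (\<integral>\<^sup>+\<xi>. ennreal ((norm (F \<xi> - ?I R \<xi>))\<^sup>2) \<partial>lborel)"
    proof (intro always_eventually allI nn_integral_mono ennreal_leI power_mono norm_ge_zero)
      fix R \<xi>
      show "norm (F \<xi> $ i - ft (truncate (\<lambda>x. f x $ i) R) \<xi>) \<le> norm (F \<xi> - ?I R \<xi>)"
        unfolding nth using Finite_Cartesian_Product.norm_nth_le[of "F \<xi> - ?I R \<xi>" i] by simp
    qed
  qed simp
qed

lemma fourier_weighted_le:
  fixes f :: "real \<Rightarrow> complex^'n"
  assumes f: "f \<in> sobolev_H N" and n: "n \<le> N" and F: "has_fourier f F"
  shows "(\<integral>\<^sup>+\<xi>. ennreal (\<xi> ^ (2 * n) * (norm (F \<xi>))\<^sup>2) \<partial>lborel) \<le> ennreal (2 * pi * (L2_norm (weak_deriv n f))\<^sup>2)"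
proof -
  have fL: "f \<in> L2" and FL: "F \<in> L2" using F by (auto simp: has_fourier_def)
  obtain g where g: "g \<in> L2" "has_weak_deriv n f g" using f n by (auto simp: sobolev_H_def)
  have wd: "\<exists>h\<in>L2. has_weak_deriv k (\<lambda>x. f x $ i) h" if "k \<le> n" for k i
  proof -
    have "k \<le> N" using n that by simp
    then obtain h where h: "h \<in> L2" "has_weak_deriv k f h" using f by (auto simp: sobolev_H_def)
    then show ?thesis using L2_nth[OF h(1)] has_weak_deriv_nth[OF h(2) fL h(1)] by blast
  qed
  have "(\<integral>\<^sup>+\<xi>. ennreal (\<xi> ^ (2 * n) * (norm (F \<xi>))\<^sup>2) \<partial>lborel) = (\<Sum>i\<in>UNIV. \<integral>\<^sup>+\<xi>. ennreal (\<xi> ^ (2 * n) * (norm (F \<xi> $ i))\<^sup>2) \<partial>lborel)"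
    using FL by (intro nn_integral_norm_square_vec) (auto simp: L2_iff)
  also have "\<dots> \<le> (\<Sum>i\<in>UNIV. ennreal (2 * pi) * (\<integral>\<^sup>+x. ennreal ((norm (g x $ i))\<^sup>2) \<partial>lborel))"
    by (intro sum_mono fourier_pair_weighted_bessel[OF has_fourier_nth[OF F] wd has_weak_deriv_nth[OF g(2) fL g(1)]])
  also have "\<dots> = ennreal (2 * pi) * (\<integral>\<^sup>+x. ennreal ((norm (g x))\<^sup>2) \<partial>lborel)"
    using nn_integral_norm_square_vec[of g "\<lambda>_. 1"] g(1) by (simp add: L2_iff sum_distrib_left)
  also have "\<dots> = ennreal (2 * pi * (L2_norm (weak_deriv n f))\<^sup>2)"
    unfolding nn_integral_norm_square[OF g(1)] L2_norm_weak_deriv[OF g(2)] by (simp add: ennreal_mult)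
  finally show ?thesis .
qed

text \<open>Each component is bounded by the L1 norm of the whole vector function; summing the
  squares costs the dimension.\<close>

lemma fourier_L1_bound:
  fixes f :: "real \<Rightarrow> complex^'n"
  assumes f: "f \<in> L1" and F: "has_fourier f F"
  shows "AE \<xi> in lborel. (norm (F \<xi>))\<^sup>2 \<le> CARD('n) * (L1_norm f)\<^sup>2"
proof -
  have fi: "integrable lborel f" using f by (simp add: L1_def)
  have i: "integrable lborel (\<lambda>x. f x $ i)" for i
    by (rule integrable_bounded_linear[OF bounded_linear_vec_nth fi])
  have "AE \<xi> in lborel. \<forall>i\<in>UNIV. norm (F \<xi> $ i) \<le> L1_norm f"
  proof (rule AE_finite_allI)
    fix i
    have "(LINT x|lborel. norm (f x $ i)) \<le> L1_norm f"
      unfolding L1_norm_def by (intro integral_mono integrable_norm i fi Finite_Cartesian_Product.norm_nth_le)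
    then show "AE \<xi> in lborel. norm (F \<xi> $ i) \<le> L1_norm f"
      using fourier_pair_L1[OF has_fourier_nth[OF F] i, of i] by (auto elim: eventually_mono)
  qed simp
  then show ?thesis
  proof (rule eventually_mono)
    fix \<xi> assume "\<forall>i\<in>UNIV. norm (F \<xi> $ i) \<le> L1_norm f"
    then have "(\<Sum>i\<in>UNIV. (norm (F \<xi> $ i))\<^sup>2) \<le> (\<Sum>i\<in>(UNIV :: 'n set). (L1_norm f)\<^sup>2)"
      by (intro sum_mono power_mono) auto
    then show "(norm (F \<xi>))\<^sup>2 \<le> CARD('n) * (L1_norm f)\<^sup>2" by (simp add: norm_square_vec)
  qed
qed

text \<open>As \<xi>^(2k) \<le> 1 + \<xi>^(2j) for k \<le> j, the weighted bound of order j and the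
  square integrability of \<open>F\<close> yield all weak derivatives up to order j, which
  membership in the Sobolev space demands. They are constructed for the components and
  reassembled.\<close>

lemma sobolev_of_fourier_weighted:
  fixes f :: "real \<Rightarrow> complex^'n"
  assumes F: "has_fourier f F" and B: "0 \<le> B"
    and le: "(\<integral>\<^sup>+\<xi>. ennreal (\<xi> ^ (2 * j) * (norm (F \<xi>))\<^sup>2) \<partial>lborel) \<le> ennreal (B\<^sup>2)"
  shows "f \<in> sobolev_H j" and "L2_norm (weak_deriv j f) \<le> B"
proof -
  have fL: "f \<in> L2" and FL: "F \<in> L2" using F by (auto simp: has_fourier_def)
  have Fm [measurable]: "F \<in> borel_measurable borel" using FL by (simp add: L2_iff)
  note [measurable] = vec_nth_measurable[OF Fm]
  have wd: "\<exists>g\<in>L2. has_weak_deriv k f g \<and> (\<integral>\<^sup>+x. ennreal ((norm (g x))\<^sup>2) \<partial>lborel) \<le> (\<integral>\<^sup>+\<xi>. ennreal (\<xi> ^ (2 * k) * (norm (F \<xi>))\<^sup>2) \<partial>lborel)"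
    if k: "k \<le> j" for k
  proof -
    have pw: "\<xi> ^ (2 * k) \<le> 1 + \<xi> ^ (2 * j)" for \<xi> :: real
    proof (cases "\<bar>\<xi>\<bar> \<le> 1")
      case True
      then have "\<bar>\<xi>\<bar> ^ (2 * k) \<le> 1" by (intro power_le_one) auto
      then have "\<xi> ^ (2 * k) \<le> 1" by (simp add: power_even_abs)
      moreover have "0 \<le> \<xi> ^ (2 * j)" by (rule zero_le_even_power) simp
      ultimately show ?thesis by linarith
    next
      case False
      then have "\<bar>\<xi>\<bar> ^ (2 * k) \<le> \<bar>\<xi>\<bar> ^ (2 * j)" using k by (intro power_increasing) auto
      then show ?thesis by (simp add: power_even_abs)
    qed
    have H: "(\<lambda>\<xi>. (\<i> * of_real \<xi>) ^ k * F \<xi> $ i) \<in> L2" for i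
      unfolding L2_iff
    proof
      show "(\<lambda>\<xi>. (\<i> * of_real \<xi>) ^ k * F \<xi> $ i) \<in> borel_measurable borel" by measurable
      have "(\<integral>\<^sup>+\<xi>. ennreal ((norm ((\<i> * of_real \<xi>) ^ k * F \<xi> $ i))\<^sup>2) \<partial>lborel)
          \<le> (\<integral>\<^sup>+\<xi>. ennreal ((norm (F \<xi>))\<^sup>2) + ennreal (\<xi> ^ (2 * j) * (norm (F \<xi>))\<^sup>2) \<partial>lborel)"
      proof (rule nn_integral_mono)
        fix \<xi>
        have "(norm ((\<i> * of_real \<xi>) ^ k * F \<xi> $ i))\<^sup>2 = (\<bar>\<xi>\<bar> ^ k)\<^sup>2 * (norm (F \<xi> $ i))\<^sup>2"
          by (simp add: norm_mult norm_power power_mult_distrib)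
        also have "(\<bar>\<xi>\<bar> ^ k)\<^sup>2 = \<xi> ^ (2 * k)" by (simp add: power_mult[symmetric] power_even_abs mult.commute)
        also have "\<xi> ^ (2 * k) * (norm (F \<xi> $ i))\<^sup>2 \<le> (1 + \<xi> ^ (2 * j)) * (norm (F \<xi>))\<^sup>2"
          by (intro mult_mono pw power_mono Finite_Cartesian_Product.norm_nth_le) auto
        finally show "ennreal ((norm ((\<i> * of_real \<xi>) ^ k * F \<xi> $ i))\<^sup>2) \<le> ennreal ((norm (F \<xi>))\<^sup>2) + ennreal (\<xi> ^ (2 * j) * (norm (F \<xi>))\<^sup>2)"
          by (simp add: distrib_right flip: ennreal_plus)
      qed
      also have "\<dots> = (\<integral>\<^sup>+\<xi>. ennreal ((norm (F \<xi>))\<^sup>2) \<partial>lborel) + (\<integral>\<^sup>+\<xi>. ennreal (\<xi> ^ (2 * j) * (norm (F \<xi>))\<^sup>2) \<partial>lborel)"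
        by (rule nn_integral_add) measurable
      also have "\<dots> < \<infinity>" using FL le_less_trans[OF le ennreal_less_top] by (simp add: L2_iff)
      finally show "(\<integral>\<^sup>+\<xi>. ennreal ((norm ((\<i> * of_real \<xi>) ^ k * F \<xi> $ i))\<^sup>2) \<partial>lborel) < \<infinity>" .
    qed
    let ?P = "\<lambda>i g. g \<in> L2 \<and> has_weak_deriv k (\<lambda>x. f x $ i) g \<and>
        (\<integral>\<^sup>+x. ennreal ((norm (g x))\<^sup>2) \<partial>lborel) \<le> (\<integral>\<^sup>+\<xi>. ennreal (\<xi> ^ (2 * k) * (norm (F \<xi> $ i))\<^sup>2) \<partial>lborel)"
    have "\<exists>g. ?P i g" for i
      by (rule weak_deriv_of_fourier_pair[OF has_fourier_nth[OF F, of i] H]) blast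
    then have "\<forall>i. \<exists>g. ?P i g" by blast
    from choice[OF this] obtain g where "\<forall>i. ?P i (g i)" ..
    then have g: "\<And>i. g i \<in> L2" "\<And>i. has_weak_deriv k (\<lambda>x. f x $ i) (g i)"
      "\<And>i. (\<integral>\<^sup>+x. ennreal ((norm (g i x))\<^sup>2) \<partial>lborel) \<le> (\<integral>\<^sup>+\<xi>. ennreal (\<xi> ^ (2 * k) * (norm (F \<xi> $ i))\<^sup>2) \<partial>lborel)"
      by blast+
    have gL: "(\<lambda>x. \<chi> i. g i x) \<in> L2" by (rule L2_vec_lambda[OF g(1)])
    have "(\<integral>\<^sup>+x. ennreal ((norm (\<chi> i. g i x))\<^sup>2) \<partial>lborel) = (\<Sum>i\<in>UNIV. \<integral>\<^sup>+x. ennreal ((norm (g i x))\<^sup>2) \<partial>lborel)"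
      using nn_integral_norm_square_vec[of "\<lambda>x. \<chi> i. g i x" "\<lambda>_. 1"] gL by (simp add: L2_iff)
    also have "\<dots> \<le> (\<Sum>i\<in>UNIV. \<integral>\<^sup>+\<xi>. ennreal (\<xi> ^ (2 * k) * (norm (F \<xi> $ i))\<^sup>2) \<partial>lborel)"
      by (intro sum_mono g(3))
    also have "\<dots> = (\<integral>\<^sup>+\<xi>. ennreal (\<xi> ^ (2 * k) * (norm (F \<xi>))\<^sup>2) \<partial>lborel)"
      by (intro nn_integral_norm_square_vec[symmetric] Fm) auto
    finally show ?thesis using gL has_weak_deriv_vec_lambda[OF g(2) fL g(1)] by blast
  qed
  then show "f \<in> sobolev_H j" using fL by (auto simp: sobolev_H_def)
  obtain g where g: "g \<in> L2" "has_weak_deriv j f g"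
    and gle: "(\<integral>\<^sup>+x. ennreal ((norm (g x))\<^sup>2) \<partial>lborel) \<le> (\<integral>\<^sup>+\<xi>. ennreal (\<xi> ^ (2 * j) * (norm (F \<xi>))\<^sup>2) \<partial>lborel)"
    using wd[OF order_refl] by blast
  have "ennreal ((L2_norm g)\<^sup>2) \<le> ennreal (B\<^sup>2)"
    using order_trans[OF gle le] unfolding nn_integral_norm_square[OF g(1)] .
  then have "(L2_norm g)\<^sup>2 \<le> B\<^sup>2" by (simp add: ennreal_le_iff)
  then show "L2_norm (weak_deriv j f) \<le> B"
    unfolding L2_norm_weak_deriv[OF g(2)] using B by (rule power2_le_imp_le)
qed

section \<open>Decay of the solution\<close>

lemma power_exp_bound:
  fixes c y :: real
  assumes c: "0 < c" and y: "0 \<le> y"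
  shows "y ^ l * exp (- (c * y)) \<le> fact l / c ^ l"
proof -
  \<comment> \<open>A single term of the exponential series is at most the whole series.\<close>
  have "sum (\<lambda>n. (c * y) ^ n /\<^sub>R fact n) {l} \<le> exp (c * y)"
    unfolding exp_def by (rule sum_le_suminf[OF summable_exp_generic]) (use c y in auto)
  then have "c ^ l * y ^ l \<le> fact l * exp (c * y)"
    by (simp add: power_mult_distrib divide_inverse_commute[symmetric] field_simps)
  then show ?thesis using c by (simp add: exp_minus field_simps)
qed

lemma integrable_inverse_1_plus_square_line: "integrable lborel (\<lambda>\<xi>::real. inverse (1 + \<xi>\<^sup>2))"
  using integrable_inverse_1_plus_square by (simp add: set_integrable_def)

lemma moment_exp_power_finite:
  fixes c :: real
  assumes c: "0 < c" and m: "0 < m"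
  shows "(\<integral>\<^sup>+w. ennreal (w ^ (2 * j) * exp (- (c * \<bar>w\<bar> ^ m))) \<partial>lborel) < \<infinity>"
proof -
  \<comment> \<open>The first summand covers |w| \<le> 1. The second covers |w| > 1, where 1 + w^2
    \<le> 2 w^2 raises the exponent to 2j + 2 and |w|^m is replaced by |w|.\<close>
  define K where "K = 2 + 2 * (fact (2 * j + 2) / c ^ (2 * j + 2))"
  have K: "2 \<le> K" "2 * (fact (2 * j + 2) / c ^ (2 * j + 2)) \<le> K" using c by (auto simp: K_def)
  have "w ^ (2 * j) * exp (- (c * \<bar>w\<bar> ^ m)) \<le> K * inverse (1 + w\<^sup>2)" for w :: real
  proof -
    have e: "w ^ (2 * j) = \<bar>w\<bar> ^ (2 * j)" "w\<^sup>2 = \<bar>w\<bar>\<^sup>2" by (simp_all add: power_even_abs)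
    have "(1 + \<bar>w\<bar>\<^sup>2) * (\<bar>w\<bar> ^ (2 * j) * exp (- (c * \<bar>w\<bar> ^ m))) \<le> K"
    proof (cases "\<bar>w\<bar> \<le> 1")
      case True
      have "(1 + \<bar>w\<bar>\<^sup>2) * (\<bar>w\<bar> ^ (2 * j) * exp (- (c * \<bar>w\<bar> ^ m))) \<le> 2 * (1 * 1)"
      proof (intro mult_mono)
        show "1 + \<bar>w\<bar>\<^sup>2 \<le> 2" using power_le_one[of "\<bar>w\<bar>" 2] True by simp
        show "\<bar>w\<bar> ^ (2 * j) \<le> 1" using True by (intro power_le_one) auto
        show "exp (- (c * \<bar>w\<bar> ^ m)) \<le> 1" using c by simp
      qed auto
      then show ?thesis using K by simp
    next
      case False
      then have w: "1 \<le> \<bar>w\<bar>" by simp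
      have "(1 + \<bar>w\<bar>\<^sup>2) * (\<bar>w\<bar> ^ (2 * j) * exp (- (c * \<bar>w\<bar> ^ m))) \<le> (2 * \<bar>w\<bar>\<^sup>2) * (\<bar>w\<bar> ^ (2 * j) * exp (- (c * \<bar>w\<bar>)))"
      proof (intro mult_mono order_refl)
        show "1 + \<bar>w\<bar>\<^sup>2 \<le> 2 * \<bar>w\<bar>\<^sup>2" using one_le_power[OF w, of 2] by simp
        have "\<bar>w\<bar> ^ 1 \<le> \<bar>w\<bar> ^ m" using m w by (intro power_increasing) auto
        then show "exp (- (c * \<bar>w\<bar> ^ m)) \<le> exp (- (c * \<bar>w\<bar>))" using c by simp
      qed auto
      also have "\<dots> = 2 * (\<bar>w\<bar> ^ (2 * j + 2) * exp (- (c * \<bar>w\<bar>)))"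
        unfolding power_add by (simp only: mult_ac)
      also have "\<dots> \<le> 2 * (fact (2 * j + 2) / c ^ (2 * j + 2))"
        by (intro mult_left_mono power_exp_bound c) auto
      finally show ?thesis using K by linarith
    qed
    moreover have "0 < 1 + \<bar>w\<bar>\<^sup>2" by (rule add_pos_nonneg) auto
    ultimately show ?thesis unfolding e by (simp add: field_simps)
  qed
  then have "(\<integral>\<^sup>+w. ennreal (w ^ (2 * j) * exp (- (c * \<bar>w\<bar> ^ m))) \<partial>lborel) \<le> (\<integral>\<^sup>+w. ennreal (K * inverse (1 + w\<^sup>2)) \<partial>lborel)"
    by (intro nn_integral_mono ennreal_leI)
  also have "\<dots> < \<infinity>"
  proof -
    have "integrable lborel (\<lambda>w::real. K * inverse (1 + w\<^sup>2))"
      by (intro integrable_mult_right integrable_inverse_1_plus_square_line)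
    from nn_integral_eq_integral[OF this] show ?thesis using K by simp
  qed
  finally show ?thesis .
qed

text \<open>The substitution \<xi> = r w with r^m (1 + t) = 1 removes t from the exponential, and
  the factor r^(2j + 1) is the power of 1 + t. Working with 1 + t in place of t keeps the identity
  meaningful at t = 0.\<close>

lemma low_frequency_integral:
  fixes c t :: real
  assumes m: "0 < m" and t: "0 \<le> t"
  shows "(\<integral>\<^sup>+\<xi>. ennreal (\<xi> ^ (2 * j) * exp (- (c * \<bar>\<xi>\<bar> ^ m * (1 + t)))) \<partial>lborel) =
    ennreal ((1 + t) powr (- (2 * real j + 1) / m)) * (\<integral>\<^sup>+w. ennreal (w ^ (2 * j) * exp (- (c * \<bar>w\<bar> ^ m))) \<partial>lborel)"
proof -
  define r where "r = (1 + t) powr (- 1 / m)"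
  have r: "0 < r" using t by (simp add: r_def)
  have rm: "r ^ m * (1 + t) = 1"
  proof -
    have "r ^ m = (1 + t) powr (- 1)" using r m unfolding r_def by (simp add: powr_powr flip: powr_realpow)
    then show ?thesis using t by (simp add: powr_minus)
  qed
  have rj: "r * r ^ (2 * j) = (1 + t) powr (- (2 * real j + 1) / m)"
  proof -
    have "r * r ^ (2 * j) = r powr (1 + 2 * real j)" using r by (simp add: powr_add flip: powr_realpow)
    also have "\<dots> = (1 + t) powr ((- 1 / m) * (1 + 2 * real j))" unfolding r_def by (simp add: powr_powr)
    also have "(- 1 / m) * (1 + 2 * real j) = - (2 * real j + 1) / m" by (simp add: divide_inverse algebra_simps)
    finally show ?thesis .
  qed
  have "(\<integral>\<^sup>+\<xi>. ennreal (\<xi> ^ (2 * j) * exp (- (c * \<bar>\<xi>\<bar> ^ m * (1 + t)))) \<partial>lborel) =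
      ennreal \<bar>r\<bar> * (\<integral>\<^sup>+w. ennreal ((0 + r * w) ^ (2 * j) * exp (- (c * \<bar>0 + r * w\<bar> ^ m * (1 + t)))) \<partial>lborel)"
    by (rule nn_integral_real_affine) (use r in auto)
  also have "(\<lambda>w. ennreal ((0 + r * w) ^ (2 * j) * exp (- (c * \<bar>0 + r * w\<bar> ^ m * (1 + t))))) =
      (\<lambda>w. ennreal (r ^ (2 * j)) * ennreal (w ^ (2 * j) * exp (- (c * \<bar>w\<bar> ^ m))))"
  proof
    fix w
    have "c * \<bar>0 + r * w\<bar> ^ m * (1 + t) = c * \<bar>w\<bar> ^ m * (r ^ m * (1 + t))"
      using r by (simp add: abs_mult power_mult_distrib mult_ac)
    then have "(0 + r * w) ^ (2 * j) * exp (- (c * \<bar>0 + r * w\<bar> ^ m * (1 + t))) = r ^ (2 * j) * (w ^ (2 * j) * exp (- (c * \<bar>w\<bar> ^ m)))"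
      unfolding rm by (simp add: power_mult_distrib)
    then show "ennreal ((0 + r * w) ^ (2 * j) * exp (- (c * \<bar>0 + r * w\<bar> ^ m * (1 + t)))) = ennreal (r ^ (2 * j)) * ennreal (w ^ (2 * j) * exp (- (c * \<bar>w\<bar> ^ m)))"
      using r by (simp add: ennreal_mult)
  qed
  also have "(\<integral>\<^sup>+w. ennreal (r ^ (2 * j)) * ennreal (w ^ (2 * j) * exp (- (c * \<bar>w\<bar> ^ m))) \<partial>lborel) =
      ennreal (r ^ (2 * j)) * (\<integral>\<^sup>+w. ennreal (w ^ (2 * j) * exp (- (c * \<bar>w\<bar> ^ m))) \<partial>lborel)"
    by (rule nn_integral_cmult) measurable
  also have "ennreal \<bar>r\<bar> * \<dots> = ennreal (r * r ^ (2 * j)) * (\<integral>\<^sup>+w. ennreal (w ^ (2 * j) * exp (- (c * \<bar>w\<bar> ^ m))) \<partial>lborel)"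
    using r by (simp add: ennreal_mult mult.assoc)
  finally show ?thesis unfolding rj .
qed

text \<open>The bound y^l exp(-c y) \<le> l!/c^l is used with y = (1 + t)/\<xi>^2. Passing from t to
  1 + t costs exp(c/\<xi>^2), which is at most exp c.\<close>

lemma high_frequency_bound:
  fixes c t \<xi> :: real
  assumes c: "0 < c" and t: "0 \<le> t" and \<xi>: "1 < \<bar>\<xi>\<bar>"
  shows "exp (- (c * (1 / \<xi>\<^sup>2) * t)) \<le> exp c * (fact l / c ^ l) * (1 + t) powr (- real l) * \<xi> ^ (2 * l)"
proof -
  have x2: "1 < \<xi>\<^sup>2" using one_less_power[OF \<xi>, of 2] by simp
  define y where "y = (1 + t) / \<xi>\<^sup>2"
  have y: "0 < y" unfolding y_def using t x2 by (intro divide_pos_pos) linarith+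
  have cy: "c * y = c * (1 / \<xi>\<^sup>2) + c * (1 / \<xi>\<^sup>2) * t"
    unfolding y_def by (simp add: add_divide_distrib distrib_left)
  have yl: "y ^ l = (1 + t) ^ l / \<xi> ^ (2 * l)" by (simp add: y_def power_divide power_mult)
  have p: "(1 + t) powr (- real l) = 1 / (1 + t) ^ l"
    using t by (simp add: powr_minus powr_realpow inverse_eq_divide)
  have "exp (- (c * (1 / \<xi>\<^sup>2) * t)) = exp (c * (1 / \<xi>\<^sup>2)) * exp (- (c * y))"
    unfolding exp_add[symmetric] cy by simp
  also have "\<dots> \<le> exp c * (fact l / c ^ l / y ^ l)"
  proof (intro mult_mono)
    show "exp (c * (1 / \<xi>\<^sup>2)) \<le> exp c" 
    proof -
      have "1 / \<xi>\<^sup>2 \<le> 1" using x2 by (subst divide_le_eq_1_pos) linarith+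
      then have "c * (1 / \<xi>\<^sup>2) \<le> c * 1" using c by (intro mult_left_mono) auto
      then show ?thesis by simp
    qed
    have "y ^ l * exp (- (c * y)) \<le> fact l / c ^ l" using c y by (intro power_exp_bound) auto
    then show "exp (- (c * y)) \<le> fact l / c ^ l / y ^ l"
      unfolding pos_le_divide_eq[OF zero_less_power[OF y]] by (simp only: mult.commute)
  qed auto
  also have "\<dots> = exp c * (fact l / c ^ l) * (1 + t) powr (- real l) * \<xi> ^ (2 * l)"
    unfolding yl p by simp
  finally show ?thesis .
qed

text \<open>Split at |\<xi>| = 1: low frequencies use the bound of the transform by the L1 norm,
  high ones trade the factor \<xi>^(2l) for (1 + t)^(-l), paid by the derivative of order j + l. The
  constant is obtained before the data are fixed. Sobolev membership belongs to the conclusion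
  because \<open>weak_deriv\<close> is meaningful only where a weak derivative exists.\<close>

theorem decay_estimate:
  fixes M :: "real \<Rightarrow> complex^'n^'n" and C c :: real
  assumes m: "0 < m" and C: "0 < C" and c: "0 < c" and N: "j + l \<le> N"
    and decay: "\<And>\<xi> x t. \<xi> \<noteq> 0 \<Longrightarrow> 0 \<le> t \<Longrightarrow>
      (norm (mat_exp (t *\<^sub>R M \<xi>) *v x))\<^sup>2 \<le> C * exp (- (c * (if \<bar>\<xi>\<bar> \<le> 1 then \<bar>\<xi>\<bar> ^ m else 1 / \<xi>\<^sup>2) * t)) * (norm x)\<^sup>2"
  obtains c0 where "0 < c0" "\<And>U0 U t. U0 \<in> sobolev_H N \<inter> L1 \<Longrightarrow> solves_cauchy M U0 U \<Longrightarrow> 0 \<le> t \<Longrightarrow>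
    (\<lambda>x. U x t) \<in> sobolev_H j \<and>
    L2_norm (weak_deriv j (\<lambda>x. U x t)) \<le> c0 * (1 + t) powr (- (2 * real j + 1) / (2 * m)) * L1_norm U0
      + c0 * (1 + t) powr (- real l / 2) * L2_norm (weak_deriv (j + l) U0)"
proof -
  let ?J = "\<integral>\<^sup>+w. ennreal (w ^ (2 * j) * exp (- (c * \<bar>w\<bar> ^ m))) \<partial>lborel"
  obtain J where J: "0 \<le> J" "?J = ennreal J"
    using moment_exp_power_finite[OF c m, of j] by (cases ?J) auto
  define a where "a = C * CARD('n) * exp c * J"
  define b where "b = C * (exp c * (fact l / c ^ l)) * (2 * pi)"
  \<comment> \<open>Being at least 1, this constant has a square that dominates \<open>a\<close> and
    \<open>b\<close>; the square is what is needed, as the estimate is proved for squared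
    norms.\<close>
  define c0 where "c0 = 1 + a + b"
  have ab: "0 \<le> a" "0 \<le> b" using C c J(1) by (auto simp: a_def b_def)
  have c0: "a \<le> c0\<^sup>2" "b \<le> c0\<^sup>2" "0 < c0"
  proof -
    have "1 \<le> c0" "a \<le> c0" "b \<le> c0" using ab by (auto simp: c0_def)
    moreover from this have "c0 \<le> c0\<^sup>2" by (simp add: power2_eq_square)
    ultimately show "a \<le> c0\<^sup>2" "b \<le> c0\<^sup>2" "0 < c0" by linarith+
  qed
  have "(\<lambda>x. U x t) \<in> sobolev_H j \<and>
    L2_norm (weak_deriv j (\<lambda>x. U x t)) \<le> c0 * (1 + t) powr (- (2 * real j + 1) / (2 * m)) * L1_norm U0
      + c0 * (1 + t) powr (- real l / 2) * L2_norm (weak_deriv (j + l) U0)"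
    if U0: "U0 \<in> sobolev_H N \<inter> L1" and U: "solves_cauchy M U0 U" and t: "0 \<le> t" for U0 U t
  proof -
    obtain F0 where F0: "has_fourier U0 F0" and Ft: "has_fourier (\<lambda>x. U x t) (\<lambda>\<xi>. mat_exp (t *\<^sub>R M \<xi>) *v F0 \<xi>)"
      using U t unfolding solves_cauchy_def by blast
    have [measurable]: "F0 \<in> borel_measurable borel" using F0 by (simp add: has_fourier_def L2_iff)
    let ?L = "L1_norm U0" and ?M = "L2_norm (weak_deriv (j + l) U0)"
    have L: "0 \<le> ?L" by (simp add: L1_norm_def)
    have M: "0 \<le> ?M" by (simp add: L2_norm_def)
    define \<alpha> where "\<alpha> = (1 + t) powr (- (2 * real j + 1) / (2 * m))"
    define \<beta> where "\<beta> = (1 + t) powr (- real l / 2)"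
    have \<alpha>: "\<alpha>\<^sup>2 = (1 + t) powr (- (2 * real j + 1) / m)"
      using m t unfolding \<alpha>_def power2_eq_square powr_add[symmetric] by (intro arg_cong2[where f = "(powr)"]) (auto simp: field_simps)
    have \<beta>: "\<beta>\<^sup>2 = (1 + t) powr (- real l)"
      unfolding \<beta>_def power2_eq_square powr_add[symmetric] by simp
    have \<alpha>\<beta>: "0 \<le> \<alpha>" "0 \<le> \<beta>" by (auto simp: \<alpha>_def \<beta>_def)
    define a' where "a' = C * CARD('n) * exp c * ?L\<^sup>2"
    define b' where "b' = C * (exp c * (fact l / c ^ l)) * \<beta>\<^sup>2"
    have ab': "0 \<le> a'" "0 \<le> b'" using C c by (auto simp: a'_def b'_def)
    define low where "low = (\<lambda>\<xi>. \<xi> ^ (2 * j) * exp (- (c * \<bar>\<xi>\<bar> ^ m * (1 + t))))"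
    define high where "high = (\<lambda>\<xi>. \<xi> ^ (2 * (j + l)) * (norm (F0 \<xi>))\<^sup>2)"
    have low0: "0 \<le> low \<xi>" and high0: "0 \<le> high \<xi>" for \<xi> by (auto simp: low_def high_def intro!: mult_nonneg_nonneg zero_le_even_power)
    have [measurable]: "low \<in> borel_measurable borel" "high \<in> borel_measurable borel"
      unfolding low_def high_def by measurable
    have "AE \<xi> in lborel. \<xi> \<noteq> (0::real)" by (rule AE_lborel_singleton)
    moreover have "AE \<xi> in lborel. (norm (F0 \<xi>))\<^sup>2 \<le> CARD('n) * ?L\<^sup>2"
      using U0 by (intro fourier_L1_bound F0) auto
    ultimately have pointwise: "AE \<xi> in lborel. ennreal (\<xi> ^ (2 * j) * (norm (mat_exp (t *\<^sub>R M \<xi>) *v F0 \<xi>))\<^sup>2) \<le> ennreal a' * ennreal (low \<xi>) + ennreal b' * ennreal (high \<xi>)"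
    proof eventually_elim
      case (elim \<xi>)
      have x0: "0 \<le> \<xi> ^ (2 * j)" by (rule zero_le_even_power) simp
      have "\<xi> ^ (2 * j) * (norm (mat_exp (t *\<^sub>R M \<xi>) *v F0 \<xi>))\<^sup>2 \<le> a' * low \<xi> + b' * high \<xi>"
      proof (cases "\<bar>\<xi>\<bar> \<le> 1")
        case True
        have "\<bar>\<xi>\<bar> ^ m \<le> 1" using True by (intro power_le_one) auto
        then have "c * \<bar>\<xi>\<bar> ^ m \<le> c * 1" using c by (intro mult_left_mono) auto
        \<comment> \<open>As |\<xi>|^m \<le> 1 here, passing from t to 1 + t costs at most exp
          c.\<close>
        then have ex: "exp (- (c * \<bar>\<xi>\<bar> ^ m * t)) \<le> exp c * exp (- (c * \<bar>\<xi>\<bar> ^ m * (1 + t)))"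
          unfolding exp_add[symmetric] by (simp add: distrib_left)
        have "(norm (mat_exp (t *\<^sub>R M \<xi>) *v F0 \<xi>))\<^sup>2 \<le> C * exp (- (c * \<bar>\<xi>\<bar> ^ m * t)) * (norm (F0 \<xi>))\<^sup>2"
          using decay[OF elim(1) t, of "F0 \<xi>"] True by simp
        also have "\<dots> \<le> C * (exp c * exp (- (c * \<bar>\<xi>\<bar> ^ m * (1 + t)))) * (CARD('n) * ?L\<^sup>2)"
          using C by (intro mult_mono ex elim(2)) auto
        finally have "\<xi> ^ (2 * j) * (norm (mat_exp (t *\<^sub>R M \<xi>) *v F0 \<xi>))\<^sup>2 \<le> \<xi> ^ (2 * j) * \<dots>"
          by (intro mult_left_mono x0)
        also have "\<dots> = a' * low \<xi>" unfolding a'_def low_def by (simp only: mult_ac)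
        finally show ?thesis using mult_nonneg_nonneg[OF ab'(2) high0[of \<xi>]] by linarith
      next
        case False
        have "(norm (mat_exp (t *\<^sub>R M \<xi>) *v F0 \<xi>))\<^sup>2 \<le> C * exp (- (c * (1 / \<xi>\<^sup>2) * t)) * (norm (F0 \<xi>))\<^sup>2"
          using decay[OF elim(1) t, of "F0 \<xi>"] False by simp
        also have "\<dots> \<le> C * (exp c * (fact l / c ^ l) * \<beta>\<^sup>2 * \<xi> ^ (2 * l)) * (norm (F0 \<xi>))\<^sup>2"
          unfolding \<beta> using C c t False by (intro mult_right_mono mult_left_mono high_frequency_bound) auto
        finally have "\<xi> ^ (2 * j) * (norm (mat_exp (t *\<^sub>R M \<xi>) *v F0 \<xi>))\<^sup>2 \<le> \<xi> ^ (2 * j) * \<dots>"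
          by (intro mult_left_mono x0)
        also have "\<dots> = b' * high \<xi>" unfolding b'_def high_def distrib_left power_add by (simp only: mult_ac)
        finally show ?thesis using mult_nonneg_nonneg[OF ab'(1) low0[of \<xi>]] by linarith
      qed
      then have "ennreal (\<xi> ^ (2 * j) * (norm (mat_exp (t *\<^sub>R M \<xi>) *v F0 \<xi>))\<^sup>2) \<le> ennreal (a' * low \<xi> + b' * high \<xi>)"
        by (rule ennreal_leI)
      also have "\<dots> = ennreal a' * ennreal (low \<xi>) + ennreal b' * ennreal (high \<xi>)"
        using ab' low0[of \<xi>] high0[of \<xi>] by (simp add: ennreal_mult)
      finally show ?case .
    qed
    define B where "B = c0 * \<alpha> * ?L + c0 * \<beta> * ?M"
    have "(\<integral>\<^sup>+\<xi>. ennreal (\<xi> ^ (2 * j) * (norm (mat_exp (t *\<^sub>R M \<xi>) *v F0 \<xi>))\<^sup>2) \<partial>lborel)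
        \<le> (\<integral>\<^sup>+\<xi>. ennreal a' * ennreal (low \<xi>) + ennreal b' * ennreal (high \<xi>) \<partial>lborel)"
      by (rule nn_integral_mono_AE[OF pointwise])
    also have "\<dots> = (\<integral>\<^sup>+\<xi>. ennreal a' * ennreal (low \<xi>) \<partial>lborel) + (\<integral>\<^sup>+\<xi>. ennreal b' * ennreal (high \<xi>) \<partial>lborel)"
      by (rule nn_integral_add) measurable
    also have "(\<integral>\<^sup>+\<xi>. ennreal a' * ennreal (low \<xi>) \<partial>lborel) = ennreal a' * (\<integral>\<^sup>+\<xi>. ennreal (low \<xi>) \<partial>lborel)"
      by (rule nn_integral_cmult) measurable
    also have "(\<integral>\<^sup>+\<xi>. ennreal (low \<xi>) \<partial>lborel) = ennreal (\<alpha>\<^sup>2) * ennreal J"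
      unfolding low_def low_frequency_integral[OF m t] \<alpha> J(2) ..
    also have "(\<integral>\<^sup>+\<xi>. ennreal b' * ennreal (high \<xi>) \<partial>lborel) = ennreal b' * (\<integral>\<^sup>+\<xi>. ennreal (high \<xi>) \<partial>lborel)"
      by (rule nn_integral_cmult) measurable
    also have "ennreal a' * (ennreal (\<alpha>\<^sup>2) * ennreal J) + \<dots> \<le> ennreal a' * (ennreal (\<alpha>\<^sup>2) * ennreal J) + ennreal b' * ennreal (2 * pi * ?M\<^sup>2)"
      unfolding high_def using U0 by (intro add_left_mono mult_left_mono fourier_weighted_le[OF _ N F0]) auto
    also have "\<dots> = ennreal (a' * (\<alpha>\<^sup>2 * J) + b' * (2 * pi * ?M\<^sup>2))"
      using ab' J(1) by (simp add: ennreal_mult)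
    also have "\<dots> \<le> ennreal (B\<^sup>2)"
    proof (rule ennreal_leI)
      have "a' * (\<alpha>\<^sup>2 * J) = a * (\<alpha> * ?L)\<^sup>2" unfolding a'_def a_def power_mult_distrib by (simp only: mult_ac)
      also have "\<dots> \<le> c0\<^sup>2 * (\<alpha> * ?L)\<^sup>2" by (intro mult_right_mono c0) auto
      also have "\<dots> = (c0 * \<alpha> * ?L)\<^sup>2" unfolding power_mult_distrib by (simp only: mult_ac)
      finally have 1: "a' * (\<alpha>\<^sup>2 * J) \<le> (c0 * \<alpha> * ?L)\<^sup>2" .
      have "b' * (2 * pi * ?M\<^sup>2) = b * (\<beta> * ?M)\<^sup>2" unfolding b'_def b_def power_mult_distrib by (simp only: mult_ac)
      also have "\<dots> \<le> c0\<^sup>2 * (\<beta> * ?M)\<^sup>2" by (intro mult_right_mono c0) auto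
      also have "\<dots> = (c0 * \<beta> * ?M)\<^sup>2" unfolding power_mult_distrib by (simp only: mult_ac)
      finally have 2: "b' * (2 * pi * ?M\<^sup>2) \<le> (c0 * \<beta> * ?M)\<^sup>2" .
      \<comment> \<open>The mixed term is nonnegative, so the sum of the two squares is at most the
        square of the sum; this converts the bound for the squared norm into a sum of two
        norms.\<close>
      have "0 \<le> 2 * (c0 * \<alpha> * ?L) * (c0 * \<beta> * ?M)" using c0 \<alpha>\<beta> L M by simp
      with 1 2 show "a' * (\<alpha>\<^sup>2 * J) + b' * (2 * pi * ?M\<^sup>2) \<le> B\<^sup>2" unfolding B_def power2_sum by linarith
    qed
    finally have "(\<integral>\<^sup>+\<xi>. ennreal (\<xi> ^ (2 * j) * (norm (mat_exp (t *\<^sub>R M \<xi>) *v F0 \<xi>))\<^sup>2) \<partial>lborel) \<le> ennreal (B\<^sup>2)" .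
    moreover have "0 \<le> B" using c0 \<alpha>\<beta> L M by (simp add: B_def)
    ultimately show ?thesis
      using sobolev_of_fourier_weighted[OF Ft] unfolding B_def \<alpha>_def \<beta>_def by blast
  qed
  with c0(3) show thesis by (rule that)
qed

theorem theorem4p2:
  fixes k1 k2 k3 k4 k5 \<gamma> \<tau>1 \<tau>2 \<tau>3 :: real and \<epsilon>0 N l j :: nat
  assumes "k1 > 0" "k2 > 0" "k3 > 0" "k4 > 0" "k5 > 0" "\<gamma> \<noteq> 0"
    and "\<epsilon>0 \<in> {0, 1}"
    and "(\<tau>1, \<tau>2, \<tau>3) = (1, 0, 0)"
    and "k3 - k2 \<noteq> 0"
    and "0 < N" "0 < l" "l \<le> N" "j \<in> {0..N - l}"
  shows "\<exists>c0>0. \<forall>(U0 :: real \<Rightarrow> complex^8) U.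
    U0 \<in> sobolev_H N \<inter> L1 \<longrightarrow>
    solves_cauchy (beam_matrix k1 k2 k3 k4 k5 \<gamma> \<tau>1 \<tau>2 \<tau>3 \<epsilon>0) U0 U \<longrightarrow>
    (\<forall>t\<ge>0. (\<lambda>x. U x t) \<in> sobolev_H j) \<and>
    (\<epsilon>0 = 1 \<longrightarrow> (\<forall>t\<ge>0.
      L2_norm (weak_deriv j (\<lambda>x. U x t))
        \<le> c0 * (1 + t) powr (- 1 / 12 - real j / 6) * L1_norm U0
          + c0 * (1 + t) powr (- real l / 2) * L2_norm (weak_deriv (j + l) U0))) \<and>
    (\<epsilon>0 = 0 \<longrightarrow> (\<forall>t\<ge>0.
      L2_norm (weak_deriv j (\<lambda>x. U x t))
        \<le> c0 * (1 + t) powr (- 1 / 8 - real j / 4) * L1_norm U0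
          + c0 * (1 + t) powr (- real l / 2) * L2_norm (weak_deriv (j + l) U0)))"
proof -
  have \<tau>: "\<tau>1 = 1" "\<tau>2 = 0" "\<tau>3 = 0" and \<epsilon>: "\<epsilon>0 = 0 \<or> \<epsilon>0 = 1" and N: "j + l \<le> N"
    using assms by auto
  interpret beam k1 k2 k3 k4 k5 \<gamma> \<epsilon>0
    by unfold_locales (use assms \<epsilon> in auto)
  let ?A = "beam_matrix k1 k2 k3 k4 k5 \<gamma> 1 0 0 \<epsilon>0"
  obtain C c where C: "0 < C" "0 < c" and decay: "\<And>\<xi> x t. \<xi> \<noteq> 0 \<Longrightarrow> 0 \<le> t \<Longrightarrow>
      (norm (mat_exp (t *\<^sub>R ?A \<xi>) *v x))\<^sup>2 \<le> C * exp (- (c * rate \<xi> * t)) * (norm x)\<^sup>2"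
    using mat_exp_decay by blast
  obtain c0 where c0: "0 < c0" "\<And>U0 U t. U0 \<in> sobolev_H N \<inter> L1 \<Longrightarrow> solves_cauchy ?A U0 U \<Longrightarrow> 0 \<le> t \<Longrightarrow>
    (\<lambda>x. U x t) \<in> sobolev_H j \<and>
    L2_norm (weak_deriv j (\<lambda>x. U x t)) \<le> c0 * (1 + t) powr (- (2 * real j + 1) / (2 * real (4 + 2 * \<epsilon>0))) * L1_norm U0
      + c0 * (1 + t) powr (- real l / 2) * L2_norm (weak_deriv (j + l) U0)"
    by (rule decay_estimate[where m = "4 + 2 * \<epsilon>0", OF _ C N decay[unfolded rate_def]]) auto
  \<comment> \<open>The general exponent (2j + 1)/(2m) is evaluated at m = 6 and m = 4.\<close>
  have e1: "- (2 * real j + 1) / (2 * real (4 + 2 * 1)) = - 1 / 12 - real j / 6"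
    and e0: "- (2 * real j + 1) / (2 * real (4 + 2 * 0)) = - 1 / 8 - real j / 4"
    by (simp_all add: field_simps)
  show ?thesis
  proof (intro exI[of _ c0] conjI allI impI c0(1))
    fix U0 :: "real \<Rightarrow> complex^8" and U :: "real \<Rightarrow> real \<Rightarrow> complex^8" and t :: real
    assume U: "U0 \<in> sobolev_H N \<inter> L1" "solves_cauchy (beam_matrix k1 k2 k3 k4 k5 \<gamma> \<tau>1 \<tau>2 \<tau>3 \<epsilon>0) U0 U" and t: "0 \<le> t"
    note est = c0(2)[OF U[unfolded \<tau>] t]
    show "(\<lambda>x. U x t) \<in> sobolev_H j" using est by (rule conjunct1)
    show "L2_norm (weak_deriv j (\<lambda>x. U x t)) \<le> c0 * (1 + t) powr (- 1 / 12 - real j / 6) * L1_norm U0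
        + c0 * (1 + t) powr (- real l / 2) * L2_norm (weak_deriv (j + l) U0)" if "\<epsilon>0 = 1"
      using est unfolding that e1 by (rule conjunct2)
    show "L2_norm (weak_deriv j (\<lambda>x. U x t)) \<le> c0 * (1 + t) powr (- 1 / 8 - real j / 4) * L1_norm U0
        + c0 * (1 + t) powr (- real l / 2) * L2_norm (weak_deriv (j + l) U0)" if "\<epsilon>0 = 0"
      using est unfolding that e0 by (rule conjunct2)
  qed
qed

end
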